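(* Let $T$ be a monad on the category of sets, let $I$ be a small category, let $A: I\to \mathfrak{Alg}(T)$ be a diagram of $T$-algebras and let $M$ be an $A$-module. Then there exists a spectral sequence $$E_2^{p,q}=H^p_{BW}(I,\mathcal H^q(A,M))\Rightarrow H^{p+q}_{\mathbb G_I}(A,M),$$ where $\mathcal H^q(A,M)$ is the natural system on $I$ whose value on a morphism $\alpha:i\to j$ is $H^q_{\mathbb G}(A(i),\alpha^*M(j))$.
   Context: **Modules and derivations.** For an object $X$ of a category $\mathfrak C$ with limits, an $X$-module is an abelian group object in the slice category $\mathfrak C/X$. For $f:X\to Y$ and a $Y$-module $N$, $f^*N$ denotes the $X$-module obtained by pullback along $f$. For an object $Z\to X$ of $\mathfrak C/X$ and an $X$-module $N$, $\mathrm{Der}(Z,N):=\mathrm{Hom}_{\mathfrak C/X}(Z,N)$, an abelian group. Here $\mathfrak C=\mathfrak{Alg}(T)$, the category of $T$-algebras, or $\mathfrak C=\mathfrak{Alg}(T)^I$, the category of functors $I\to\mathfrak{Alg}(T)$. An $A$-module $M$ is thus an abelian group object in $\mathfrak{Alg}(T)^I/A$; each $M(j)$ is an $A(j)$-module, and for $\alpha:i\to j$ the $A(i)$-module $\alpha^*M(j)$ is the pullback of $M(j)$ along $A(\alpha)$. **Comonad cohomology.** For a comonad $\mathbb G=(G,\varepsilon,\delta)$ on $\mathfrak C$, an object $X$ and an $X$-module $N$, $H^n_{\mathbb G}(X,N)$ is the $n$-th cohomology of the cochain complex $\mathrm{Der}(G(X),N)\to\mathrm{Der}(G^2(X),N)\to\cdots$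 (with $\mathrm{Der}(G^{n+1}X,N)$ in degree $n\ge0$) whose coboundary is the alternating sum of the maps induced by the face maps $G^i\varepsilon G^{n-i}$ of the comonad resolution of $X$. **The two comonads.** $\mathbb G$ is the comonad on $\mathfrak{Alg}(T)$ given by the free/forgetful adjunction between $\mathfrak{Sets}$ and $\mathfrak{Alg}(T)$. Let $I_0$ be the category with the same objects as $I$ and only identity morphisms. $\mathbb G_I$ is the comonad on $\mathfrak{Alg}(T)^I$ given by the forgetful functor $\mathfrak{Alg}(T)^I\to\mathfrak{Sets}^{I_0}$ and its left adjoint (left Kan extension along $I_0\subset I$ followed by the free $T$-algebra functor objectwise). **Baues–Wirsching cohomology.** The category of factorizations $\mathcal FI$ has as objects the morphisms of $I$; a morphism $f\to g$ is a pair $(\alpha,\beta)$ of morphisms of $I$ with $g=\alpha f\beta$. A natural system on $I$ is a functor $D:\mathcal FI\to\mathfrak{Ab}$; write $\alpha_*:D(f)\to D(\alpha f)$ and $\beta^*:D(f)\to D(f\beta)$ for the induced maps. $H^*_{BW}(I,D)$ is the cohomology of the complex $C^n_{BW}(I,D)=\prod_{i_n\xrightarrow{\alpha_n}\cdots\xrightarrow{\alpha_1}i_0}D(\alpha_1\cdots\alpha_n)$ (for $n=0$: $\prod_iD(\mathrm{id}_i)$) with $(df)(\alpha_1,\dots,\alpha_{n+1})=(\alpha_1)_*f(\alpha_2,\dots,\alpha_{n+1})+\sum_{j=1}^n(-1)^jf(\alpha_1,\dots,\alpha_j\alpha_{j+1},\dots,\alpha_{n+1})+(-1)^{n+1}(\alpha_{n+1})^*f(\alpha_1,\dots,\alpha_n)$.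 The natural system structure on $\mathcal H^q(A,M)$ is induced by the maps $M(\beta):M(j)\to M(j')$ and $A(\gamma):A(i')\to A(i)$ for $\beta:j\to j'$, $\gamma:i'\to i$. *)

theory Defs
  imports "HOL-Algebra.FiniteProduct" "HOL-Algebra.Product_Groups"
begin

section \<open>Categories, functors, natural transformations\<close>

record ('o, 'm) cat =
  Obj :: "'o set"
  Arr :: "'m set"
  Dom :: "'m \<Rightarrow> 'o"
  Cod :: "'m \<Rightarrow> 'o"
  Idn :: "'o \<Rightarrow> 'm"
  Cmp :: "'m \<Rightarrow> 'm \<Rightarrow> 'm"  (infixl "\<bullet>\<index>" 70)

definition Hom :: "('o, 'm) cat \<Rightarrow> 'o \<Rightarrow> 'o \<Rightarrow> 'm set" where
  "Hom C x y = {f \<in> Arr C. Dom C f = x \<and> Cod C f = y}"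

definition is_category :: "('o, 'm) cat \<Rightarrow> bool" where
  "is_category C \<longleftrightarrow>
     (\<forall>f \<in> Arr C. Dom C f \<in> Obj C \<and> Cod C f \<in> Obj C) \<and>
     (\<forall>x \<in> Obj C. Idn C x \<in> Hom C x x) \<and>
     (\<forall>f \<in> Arr C. \<forall>g \<in> Arr C. Cod C f = Dom C g \<longrightarrow>
        g \<bullet>\<^bsub>C\<^esub> f \<in> Hom C (Dom C f) (Cod C g)) \<and>
     (\<forall>f \<in> Arr C. f \<bullet>\<^bsub>C\<^esub> Idn C (Dom C f) = f \<and> Idn C (Cod C f) \<bullet>\<^bsub>C\<^esub> f = f) \<and>
     (\<forall>f \<in> Arr C. \<forall>g \<in> Arr C. \<forall>h \<in> Arr C. Cod C f = Dom C g \<and> Cod C g = Dom C h \<longrightarrow>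
        (h \<bullet>\<^bsub>C\<^esub> g) \<bullet>\<^bsub>C\<^esub> f = h \<bullet>\<^bsub>C\<^esub> (g \<bullet>\<^bsub>C\<^esub> f))"

record ('o, 'm, 'p, 'n) fctr =
  fob :: "'o \<Rightarrow> 'p"
  far :: "'m \<Rightarrow> 'n"

definition is_functor :: "('o, 'm) cat \<Rightarrow> ('p, 'n) cat \<Rightarrow> ('o, 'm, 'p, 'n) fctr \<Rightarrow> bool" where
  "is_functor C D F \<longleftrightarrow>
     (\<forall>x \<in> Obj C. fob F x \<in> Obj D) \<and>
     (\<forall>f \<in> Arr C. far F f \<in> Hom D (fob F (Dom C f)) (fob F (Cod C f))) \<and>
     (\<forall>x \<in> Obj C. far F (Idn C x) = Idn D (fob F x)) \<and>
     (\<forall>f \<in> Arr C. \<forall>g \<in> Arr C. Cod C f = Dom C g \<longrightarrow>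
        far F (g \<bullet>\<^bsub>C\<^esub> f) = far F g \<bullet>\<^bsub>D\<^esub> far F f)"

definition fctr_comp :: "('p, 'n, 'q, 'l) fctr \<Rightarrow> ('o, 'm, 'p, 'n) fctr \<Rightarrow> ('o, 'm, 'q, 'l) fctr" where
  "fctr_comp G F = \<lparr>fob = fob G \<circ> fob F, far = far G \<circ> far F\<rparr>"

definition is_nat_trans ::
  "('o, 'm) cat \<Rightarrow> ('p, 'n) cat \<Rightarrow> ('o, 'm, 'p, 'n) fctr \<Rightarrow> ('o, 'm, 'p, 'n) fctr \<Rightarrow> ('o \<Rightarrow> 'n) \<Rightarrow> bool" where
  "is_nat_trans C D F G t \<longleftrightarrow>
     (\<forall>x \<in> Obj C. t x \<in> Hom D (fob F x) (fob G x)) \<and>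
     (\<forall>f \<in> Arr C. t (Cod C f) \<bullet>\<^bsub>D\<^esub> far F f = far G f \<bullet>\<^bsub>D\<^esub> t (Dom C f))"

text \<open>The category of functors \<open>J \<rightarrow> C\<close>. An arrow is a natural transformation together with its
  source and target. Object and arrow maps are required to be \<open>undefined\<close> outside \<open>J\<close>, so that
  equality in HOL is equality of functors and of natural transformations.\<close>

type_synonym ('i, 'k, 'o, 'm) ntrans =
  "('i, 'k, 'o, 'm) fctr \<times> ('i \<Rightarrow> 'm) \<times> ('i, 'k, 'o, 'm) fctr"

abbreviation component :: "('i, 'k, 'o, 'm) ntrans \<Rightarrow> 'i \<Rightarrow> 'm" where
  "component t \<equiv> fst (snd t)"

definition diagrams :: "('i, 'k) cat \<Rightarrow> ('o, 'm) cat \<Rightarrow> ('i, 'k, 'o, 'm) fctr set" where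
  "diagrams J C =
     {F. is_functor J C F \<and> fob F \<in> extensional (Obj J) \<and> far F \<in> extensional (Arr J)}"

definition functor_cat ::
  "('i, 'k) cat \<Rightarrow> ('o, 'm) cat \<Rightarrow> (('i, 'k, 'o, 'm) fctr, ('i, 'k, 'o, 'm) ntrans) cat" where
  "functor_cat J C = \<lparr>
     Obj = diagrams J C,
     Arr = {(F, t, G). F \<in> diagrams J C \<and> G \<in> diagrams J C \<and>
              t \<in> extensional (Obj J) \<and> is_nat_trans J C F G t},
     Dom = fst,
     Cod = snd \<circ> snd,
     Idn = (\<lambda>F. (F, \<lambda>j\<in>Obj J. Idn C (fob F j), F)),
     Cmp = (\<lambda>s t. (fst t, \<lambda>j\<in>Obj J. component s j \<bullet>\<^bsub>C\<^esub> component t j, snd (snd s)))\<rparr>"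

text \<open>The slice category \<open>C/X\<close>: objects are the arrows \<open>p\<close> of \<open>C\<close> with codomain \<open>X\<close>; an arrow
  \<open>p \<rightarrow> q\<close> is written \<open>(p, u, q)\<close>, where \<open>q u = p\<close>.\<close>

definition slice :: "('o, 'm) cat \<Rightarrow> 'o \<Rightarrow> ('m, 'm \<times> 'm \<times> 'm) cat" where
  "slice C X = \<lparr>
     Obj = {p \<in> Arr C. Cod C p = X},
     Arr = {(p, u, q). p \<in> Arr C \<and> Cod C p = X \<and> q \<in> Arr C \<and> Cod C q = X \<and>
              u \<in> Hom C (Dom C p) (Dom C q) \<and> q \<bullet>\<^bsub>C\<^esub> u = p},
     Dom = fst,
     Cod = snd \<circ> snd,
     Idn = (\<lambda>p. (p, Idn C (Dom C p), p)),
     Cmp = (\<lambda>v u. (fst u, fst (snd v) \<bullet>\<^bsub>C\<^esub> fst (snd u), snd (snd v)))\<rparr>"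


section \<open>Abelian group objects and modules\<close>

text \<open>The data of a group object include the terminal object \<open>gone\<close> and the product cone
  \<open>gpr1, gpr2 : gob \<times> gob \<rightarrow> gob\<close> on which the structure maps \<open>gzero : 1 \<rightarrow> gob\<close>,
  \<open>gadd : gob \<times> gob \<rightarrow> gob\<close>, \<open>gneg : gob \<rightarrow> gob\<close> are defined, so that no choice of
  products in the ambient category has to be fixed.\<close>

record ('o, 'm) grp_obj =
  gob :: 'o
  gone :: 'o
  gpr1 :: 'm
  gpr2 :: 'm
  gzero :: 'm
  gadd :: 'm
  gneg :: 'm

definition is_terminal :: "('o, 'm) cat \<Rightarrow> 'o \<Rightarrow> bool" where
  "is_terminal C t \<longleftrightarrow> t \<in> Obj C \<and> (\<forall>z \<in> Obj C. \<exists>!u. u \<in> Hom C z t)"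

definition is_product :: "('o, 'm) cat \<Rightarrow> 'o \<Rightarrow> 'o \<Rightarrow> 'm \<Rightarrow> 'm \<Rightarrow> bool" where
  "is_product C x y p q \<longleftrightarrow>
     p \<in> Hom C (Dom C p) x \<and> q \<in> Hom C (Dom C p) y \<and>
     (\<forall>z \<in> Obj C. \<forall>f \<in> Hom C z x. \<forall>g \<in> Hom C z y.
        \<exists>!u. u \<in> Hom C z (Dom C p) \<and> p \<bullet>\<^bsub>C\<^esub> u = f \<and> q \<bullet>\<^bsub>C\<^esub> u = g)"

definition to_one :: "('o, 'm) cat \<Rightarrow> ('o, 'm) grp_obj \<Rightarrow> 'o \<Rightarrow> 'm" where
  "to_one C N z = (THE u. u \<in> Hom C z (gone N))"

definition pairing :: "('o, 'm) cat \<Rightarrow> ('o, 'm) grp_obj \<Rightarrow> 'm \<Rightarrow> 'm \<Rightarrow> 'm" where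
  "pairing C N f g =
     (THE u. u \<in> Hom C (Dom C f) (Dom C (gpr1 N)) \<and> gpr1 N \<bullet>\<^bsub>C\<^esub> u = f \<and> gpr2 N \<bullet>\<^bsub>C\<^esub> u = g)"

definition plus_arr :: "('o, 'm) cat \<Rightarrow> ('o, 'm) grp_obj \<Rightarrow> 'm \<Rightarrow> 'm \<Rightarrow> 'm" where
  "plus_arr C N f g = gadd N \<bullet>\<^bsub>C\<^esub> pairing C N f g"

text \<open>In the associativity law the triple of projections \<open>N \<times> N \<times> N \<rightarrow> N\<close> is replaced by an
  arbitrary triple of arrows into \<open>N\<close> with a common source, which avoids naming a triple product;
  for a triple of projections it is the usual diagram, and the general case follows from that one.\<close>

definition is_ab_grp_obj :: "('o, 'm) cat \<Rightarrow> ('o, 'm) grp_obj \<Rightarrow> bool" where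
  "is_ab_grp_obj C N \<longleftrightarrow>
     gob N \<in> Obj C \<and> is_terminal C (gone N) \<and> is_product C (gob N) (gob N) (gpr1 N) (gpr2 N) \<and>
     gzero N \<in> Hom C (gone N) (gob N) \<and>
     gadd N \<in> Hom C (Dom C (gpr1 N)) (gob N) \<and>
     gneg N \<in> Hom C (gob N) (gob N) \<and>
     (\<forall>z \<in> Obj C. \<forall>f \<in> Hom C z (gob N). \<forall>g \<in> Hom C z (gob N). \<forall>h \<in> Hom C z (gob N).
        plus_arr C N (plus_arr C N f g) h = plus_arr C N f (plus_arr C N g h)) \<and>
     plus_arr C N (gpr2 N) (gpr1 N) = gadd N \<and>
     plus_arr C N (gzero N \<bullet>\<^bsub>C\<^esub> to_one C N (gob N)) (Idn C (gob N)) = Idn C (gob N) \<and>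
     plus_arr C N (gneg N) (Idn C (gob N)) = gzero N \<bullet>\<^bsub>C\<^esub> to_one C N (gob N)"

text \<open>The abelian group \<open>Hom(z, N)\<close>, written multiplicatively as all groups in HOL-Algebra.\<close>

definition hom_grp :: "('o, 'm) cat \<Rightarrow> 'o \<Rightarrow> ('o, 'm) grp_obj \<Rightarrow> 'm monoid" where
  "hom_grp C z N =
     \<lparr>carrier = Hom C z (gob N), mult = plus_arr C N, one = gzero N \<bullet>\<^bsub>C\<^esub> to_one C N z\<rparr>"

text \<open>Transport of a group object along a functor preserving finite products.\<close>

definition map_grp_obj :: "('o, 'm, 'p, 'n) fctr \<Rightarrow> ('o, 'm) grp_obj \<Rightarrow> ('p, 'n) grp_obj" where
  "map_grp_obj F N = \<lparr>gob = fob F (gob N), gone = fob F (gone N),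
     gpr1 = far F (gpr1 N), gpr2 = far F (gpr2 N),
     gzero = far F (gzero N), gadd = far F (gadd N), gneg = far F (gneg N)\<rparr>"

type_synonym 'm module_obj = "('m, 'm \<times> 'm \<times> 'm) grp_obj"

definition is_module :: "('o, 'm) cat \<Rightarrow> 'o \<Rightarrow> 'm module_obj \<Rightarrow> bool" where
  "is_module C X N \<longleftrightarrow> is_ab_grp_obj (slice C X) N"

definition Der :: "('o, 'm) cat \<Rightarrow> 'o \<Rightarrow> 'm \<Rightarrow> 'm module_obj \<Rightarrow> ('m \<times> 'm \<times> 'm) monoid" where
  "Der C X z N = hom_grp (slice C X) z N"

text \<open>For \<open>f : X \<rightarrow> Y\<close> a chosen pullback of \<open>q : N \<rightarrow> Y\<close> along \<open>f\<close>, as a pair of projections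
  \<open>p : P \<rightarrow> X\<close>, \<open>r : P \<rightarrow> N\<close>; the resulting functor \<open>f\<^sup>* : C/Y \<rightarrow> C/X\<close> preserves limits and
  hence takes \<open>Y\<close>-modules to \<open>X\<close>-modules.\<close>

definition is_pullback :: "('o, 'm) cat \<Rightarrow> 'm \<Rightarrow> 'm \<Rightarrow> 'm \<Rightarrow> 'm \<Rightarrow> bool" where
  "is_pullback C f q p r \<longleftrightarrow>
     p \<in> Hom C (Dom C p) (Dom C f) \<and> r \<in> Hom C (Dom C p) (Dom C q) \<and>
     f \<bullet>\<^bsub>C\<^esub> p = q \<bullet>\<^bsub>C\<^esub> r \<and>
     (\<forall>z \<in> Obj C. \<forall>h \<in> Hom C z (Dom C f). \<forall>k \<in> Hom C z (Dom C q). f \<bullet>\<^bsub>C\<^esub> h = q \<bullet>\<^bsub>C\<^esub> k \<longrightarrow>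
        (\<exists>!u. u \<in> Hom C z (Dom C p) \<and> p \<bullet>\<^bsub>C\<^esub> u = h \<and> r \<bullet>\<^bsub>C\<^esub> u = k))"

definition pullback :: "('o, 'm) cat \<Rightarrow> 'm \<Rightarrow> 'm \<Rightarrow> 'm \<times> 'm" where
  "pullback C f q = (SOME (p, r). is_pullback C f q p r)"

definition pb_lift :: "('o, 'm) cat \<Rightarrow> 'm \<Rightarrow> 'm \<Rightarrow> 'm \<Rightarrow> 'm \<Rightarrow> 'm" where
  "pb_lift C f q h k =
     (let (p, r) = pullback C f q
      in THE u. u \<in> Hom C (Dom C h) (Dom C p) \<and> p \<bullet>\<^bsub>C\<^esub> u = h \<and> r \<bullet>\<^bsub>C\<^esub> u = k)"

definition pullback_functor ::
  "('o, 'm) cat \<Rightarrow> 'm \<Rightarrow> ('m, 'm \<times> 'm \<times> 'm, 'm, 'm \<times> 'm \<times> 'm) fctr" where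
  "pullback_functor C f = \<lparr>
     fob = (\<lambda>q. fst (pullback C f q)),
     far = (\<lambda>(q, u, q').
              (fst (pullback C f q),
               pb_lift C f q' (fst (pullback C f q)) (u \<bullet>\<^bsub>C\<^esub> snd (pullback C f q)),
               fst (pullback C f q')))\<rparr>"

definition pullback_module :: "('o, 'm) cat \<Rightarrow> 'm \<Rightarrow> 'm module_obj \<Rightarrow> 'm module_obj" where
  "pullback_module C f N = map_grp_obj (pullback_functor C f) N"

text \<open>The functor \<open>C\<^sup>J/A \<rightarrow> C/A(j)\<close>, and the \<open>A(j)\<close>-module \<open>M(j)\<close> of an \<open>A\<close>-module \<open>M\<close>.\<close>

definition eval_slice :: "'i \<Rightarrow>
  (('i, 'k, 'o, 'm) ntrans, ('i, 'k, 'o, 'm) ntrans \<times> ('i, 'k, 'o, 'm) ntrans \<times> ('i, 'k, 'o, 'm) ntrans,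
   'm, 'm \<times> 'm \<times> 'm) fctr" where
  "eval_slice j = \<lparr>
     fob = (\<lambda>p. component p j),
     far = (\<lambda>(p, u, q). (component p j, component u j, component q j))\<rparr>"

definition module_at :: "('i, 'k, 'o, 'm) ntrans module_obj \<Rightarrow> 'i \<Rightarrow> 'm module_obj" where
  "module_at M j = map_grp_obj (eval_slice j) M"


section \<open>Cochain complexes and comonad cohomology\<close>

definition alt_sum :: "('a, 'b) monoid_scheme \<Rightarrow> nat set \<Rightarrow> (nat \<Rightarrow> 'a) \<Rightarrow> 'a" where
  "alt_sum G S f = finprod G (\<lambda>i. f i [^]\<^bsub>G\<^esub> ((-1) ^ i :: int)) S"

definition coboundaries :: "(nat \<Rightarrow> 'a monoid) \<Rightarrow> (nat \<Rightarrow> 'a \<Rightarrow> 'a) \<Rightarrow> nat \<Rightarrow> 'a set" where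
  "coboundaries K d n =
     (case n of 0 \<Rightarrow> {\<one>\<^bsub>K 0\<^esub>} | Suc m \<Rightarrow> d m ` carrier (K m))"

definition cohomology :: "(nat \<Rightarrow> 'a monoid) \<Rightarrow> (nat \<Rightarrow> 'a \<Rightarrow> 'a) \<Rightarrow> nat \<Rightarrow> 'a set monoid" where
  "cohomology K d n =
     (K n\<lparr>carrier := kernel (K n) (K (Suc n)) (d n)\<rparr>) Mod coboundaries K d n"

text \<open>The map on cohomology induced by a cochain map \<open>h\<close> into the complex \<open>(K, d)\<close>: a class, i.e.
  a coset \<open>S\<close> of cocycles, is sent to the coset of the coboundaries containing \<open>h ` S\<close>.\<close>

definition cohomology_map ::
  "(nat \<Rightarrow> 'a monoid) \<Rightarrow> (nat \<Rightarrow> 'a \<Rightarrow> 'a) \<Rightarrow> nat \<Rightarrow> ('b \<Rightarrow> 'a) \<Rightarrow> 'b set \<Rightarrow> 'a set" where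
  "cohomology_map K d n h S = coboundaries K d n <#>\<^bsub>K n\<^esub> (h ` S)"

record ('o, 'm) comonad =
  cfun :: "('o, 'm, 'o, 'm) fctr"
  ceps :: "'o \<Rightarrow> 'm"
  cdelta :: "'o \<Rightarrow> 'm"

definition cpow_ob :: "('o, 'm) comonad \<Rightarrow> nat \<Rightarrow> 'o \<Rightarrow> 'o" where
  "cpow_ob G n = (fob (cfun G) ^^ n)"

definition cpow_ar :: "('o, 'm) comonad \<Rightarrow> nat \<Rightarrow> 'm \<Rightarrow> 'm" where
  "cpow_ar G n = (far (cfun G) ^^ n)"

text \<open>\<open>G\<^sup>i \<epsilon> G\<^sup>n\<^sup>-\<^sup>i : G\<^sup>n\<^sup>+\<^sup>1 X \<rightarrow> G\<^sup>n X\<close>, for \<open>i \<le> n\<close>.\<close>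

definition cface :: "('o, 'm) comonad \<Rightarrow> 'o \<Rightarrow> nat \<Rightarrow> nat \<Rightarrow> 'm" where
  "cface G X n i = cpow_ar G i (ceps G (cpow_ob G (n - i) X))"

text \<open>The structure map \<open>G\<^sup>n X \<rightarrow> X\<close>, which makes \<open>G\<^sup>n X\<close> an object of \<open>C/X\<close>.\<close>

primrec caug :: "('o, 'm) cat \<Rightarrow> ('o, 'm) comonad \<Rightarrow> 'o \<Rightarrow> nat \<Rightarrow> 'm" where
  "caug C G X 0 = Idn C X"
| "caug C G X (Suc n) = caug C G X n \<bullet>\<^bsub>C\<^esub> cface G X n 0"

definition cm_complex ::
  "('o, 'm) cat \<Rightarrow> ('o, 'm) comonad \<Rightarrow> 'o \<Rightarrow> 'm module_obj \<Rightarrow> nat \<Rightarrow> ('m \<times> 'm \<times> 'm) monoid" where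
  "cm_complex C G X N n = Der C X (caug C G X (Suc n)) N"

definition cm_diff ::
  "('o, 'm) cat \<Rightarrow> ('o, 'm) comonad \<Rightarrow> 'o \<Rightarrow> 'm module_obj \<Rightarrow> nat \<Rightarrow> 'm \<times> 'm \<times> 'm \<Rightarrow> 'm \<times> 'm \<times> 'm" where
  "cm_diff C G X N n f =
     alt_sum (cm_complex C G X N (Suc n)) {0..Suc n}
       (\<lambda>i. f \<bullet>\<^bsub>slice C X\<^esub> (caug C G X (Suc (Suc n)), cface G X (Suc n) i, caug C G X (Suc n)))"

definition cm_cohomology ::
  "('o, 'm) cat \<Rightarrow> ('o, 'm) comonad \<Rightarrow> 'o \<Rightarrow> 'm module_obj \<Rightarrow> nat \<Rightarrow> ('m \<times> 'm \<times> 'm) set monoid" where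
  "cm_cohomology C G X N n = cohomology (cm_complex C G X N) (cm_diff C G X N) n"


section \<open>Comonads of adjunctions\<close>

record ('o, 'm, 'p, 'n) adj =
  ladj :: "('o, 'm, 'p, 'n) fctr"
  radj :: "('p, 'n, 'o, 'm) fctr"
  aunit :: "'o \<Rightarrow> 'm"
  acounit :: "'p \<Rightarrow> 'n"

definition adj_comonad :: "('o, 'm, 'p, 'n) adj \<Rightarrow> ('p, 'n) comonad" where
  "adj_comonad P = \<lparr>
     cfun = fctr_comp (ladj P) (radj P),
     ceps = acounit P,
     cdelta = (\<lambda>y. far (ladj P) (aunit P (fob (radj P) y)))\<rparr>"

text \<open>The composite of an adjunction \<open>P\<close> between \<open>C\<close> and \<open>D\<close> with an adjunction \<open>Q\<close> between
  \<open>D\<close> and \<open>E\<close>.\<close>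

definition adj_comp ::
  "('o, 'm) cat \<Rightarrow> ('q, 'l) cat \<Rightarrow> ('o, 'm, 'p, 'n) adj \<Rightarrow> ('p, 'n, 'q, 'l) adj \<Rightarrow> ('o, 'm, 'q, 'l) adj" where
  "adj_comp C E P Q = \<lparr>
     ladj = fctr_comp (ladj Q) (ladj P),
     radj = fctr_comp (radj P) (radj Q),
     aunit = (\<lambda>x. far (radj P) (aunit Q (fob (ladj P) x)) \<bullet>\<^bsub>C\<^esub> aunit P x),
     acounit = (\<lambda>z. acounit Q z \<bullet>\<^bsub>E\<^esub> far (ladj Q) (acounit P (fob (radj Q) z)))\<rparr>"

text \<open>Objectwise application of a functor, or of an adjunction, to \<open>J\<close>-indexed diagrams.\<close>

definition post_ob ::
  "('i, 'k) cat \<Rightarrow> ('o, 'm, 'p, 'n) fctr \<Rightarrow> ('i, 'k, 'o, 'm) fctr \<Rightarrow> ('i, 'k, 'p, 'n) fctr" where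
  "post_ob J F H = \<lparr>fob = (\<lambda>j\<in>Obj J. fob F (fob H j)), far = (\<lambda>a\<in>Arr J. far F (far H a))\<rparr>"

definition post_functor ::
  "('i, 'k) cat \<Rightarrow> ('o, 'm, 'p, 'n) fctr \<Rightarrow>
   (('i, 'k, 'o, 'm) fctr, ('i, 'k, 'o, 'm) ntrans, ('i, 'k, 'p, 'n) fctr, ('i, 'k, 'p, 'n) ntrans) fctr" where
  "post_functor J F = \<lparr>
     fob = post_ob J F,
     far = (\<lambda>(H, t, K). (post_ob J F H, \<lambda>j\<in>Obj J. far F (t j), post_ob J F K))\<rparr>"

definition post_adj ::
  "('i, 'k) cat \<Rightarrow> ('o, 'm, 'p, 'n) adj \<Rightarrow>
   (('i, 'k, 'o, 'm) fctr, ('i, 'k, 'o, 'm) ntrans, ('i, 'k, 'p, 'n) fctr, ('i, 'k, 'p, 'n) ntrans) adj" where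
  "post_adj J P = \<lparr>
     ladj = post_functor J (ladj P),
     radj = post_functor J (radj P),
     aunit = (\<lambda>H. (H, \<lambda>j\<in>Obj J. aunit P (fob H j), post_ob J (radj P) (post_ob J (ladj P) H))),
     acounit = (\<lambda>H. (post_ob J (ladj P) (post_ob J (radj P) H), \<lambda>j\<in>Obj J. acounit P (fob H j), H))\<rparr>"


section \<open>The category of sets\<close>

text \<open>Sets are the subsets of cardinality less than \<open>\<kappa>\<close> of a type \<open>'u\<close> of cardinality \<open>\<kappa>\<close>, where
  \<open>\<kappa>\<close> is a regular cardinal. For inaccessible \<open>\<kappa>\<close> these are, up to equivalence of categories, the
  sets of a Grothendieck universe. That \<open>\<kappa>\<close> be a strong limit is not required: the notions below
  use no exponentials, and infinite regular cardinals, unlike uncountable inaccessible ones,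
  provably occur as cardinalities of types.\<close>

definition small :: "'u itself \<Rightarrow> 'a set \<Rightarrow> bool" where
  "small _ X \<longleftrightarrow> X \<prec> (UNIV :: 'u set)"

definition regular_universe :: "'u itself \<Rightarrow> bool" where
  "regular_universe u \<longleftrightarrow> infinite (UNIV :: 'u set) \<and>
     (\<forall>(S :: 'u set) (F :: 'u \<Rightarrow> 'u set).
        small u S \<and> (\<forall>x \<in> S. small u (F x)) \<longrightarrow> small u (\<Union>x \<in> S. F x))"

definition small_category :: "'u itself \<Rightarrow> ('i, 'k) cat \<Rightarrow> bool" where
  "small_category u I \<longleftrightarrow> is_category I \<and> small u (Obj I) \<and> small u (Arr I)"

type_synonym 'u smap = "'u set \<times> ('u \<Rightarrow> 'u) \<times> 'u set"

abbreviation smap_fun :: "'u smap \<Rightarrow> 'u \<Rightarrow> 'u" where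
  "smap_fun f \<equiv> fst (snd f)"

definition set_cat :: "('u set, 'u smap) cat" where
  "set_cat = \<lparr>
     Obj = {X. small TYPE('u) X},
     Arr = {(X, f, Y). small TYPE('u) X \<and> small TYPE('u) Y \<and> f \<in> X \<rightarrow>\<^sub>E Y},
     Dom = fst,
     Cod = snd \<circ> snd,
     Idn = (\<lambda>X. (X, \<lambda>x\<in>X. x, X)),
     Cmp = (\<lambda>g f. (fst f, compose (fst f) (smap_fun g) (smap_fun f), snd (snd g)))\<rparr>"


section \<open>Monads and their algebras\<close>

record ('o, 'm) monad =
  mfun :: "('o, 'm, 'o, 'm) fctr"
  meta :: "'o \<Rightarrow> 'm"
  mmu :: "'o \<Rightarrow> 'm"

definition is_monad :: "('o, 'm) cat \<Rightarrow> ('o, 'm) monad \<Rightarrow> bool" where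
  "is_monad C T \<longleftrightarrow>
     is_functor C C (mfun T) \<and>
     is_nat_trans C C \<lparr>fob = id, far = id\<rparr> (mfun T) (meta T) \<and>
     is_nat_trans C C (fctr_comp (mfun T) (mfun T)) (mfun T) (mmu T) \<and>
     (\<forall>x \<in> Obj C.
        mmu T x \<bullet>\<^bsub>C\<^esub> meta T (fob (mfun T) x) = Idn C (fob (mfun T) x) \<and>
        mmu T x \<bullet>\<^bsub>C\<^esub> far (mfun T) (meta T x) = Idn C (fob (mfun T) x) \<and>
        mmu T x \<bullet>\<^bsub>C\<^esub> mmu T (fob (mfun T) x) = mmu T x \<bullet>\<^bsub>C\<^esub> far (mfun T) (mmu T x))"

type_synonym ('o, 'm) em_ob = "'o \<times> 'm"
type_synonym ('o, 'm) em_ar = "('o \<times> 'm) \<times> 'm \<times> ('o \<times> 'm)"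

definition em_algebras :: "('o, 'm) cat \<Rightarrow> ('o, 'm) monad \<Rightarrow> ('o, 'm) em_ob set" where
  "em_algebras C T = {(x, a). x \<in> Obj C \<and> a \<in> Hom C (fob (mfun T) x) x \<and>
     a \<bullet>\<^bsub>C\<^esub> meta T x = Idn C x \<and> a \<bullet>\<^bsub>C\<^esub> mmu T x = a \<bullet>\<^bsub>C\<^esub> far (mfun T) a}"

definition em_cat :: "('o, 'm) cat \<Rightarrow> ('o, 'm) monad \<Rightarrow> (('o, 'm) em_ob, ('o, 'm) em_ar) cat" where
  "em_cat C T = \<lparr>
     Obj = em_algebras C T,
     Arr = {(A, f, B). A \<in> em_algebras C T \<and> B \<in> em_algebras C T \<and>
              f \<in> Hom C (fst A) (fst B) \<and> f \<bullet>\<^bsub>C\<^esub> snd A = snd B \<bullet>\<^bsub>C\<^esub> far (mfun T) f},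
     Dom = fst,
     Cod = snd \<circ> snd,
     Idn = (\<lambda>A. (A, Idn C (fst A), A)),
     Cmp = (\<lambda>g f. (fst f, fst (snd g) \<bullet>\<^bsub>C\<^esub> fst (snd f), snd (snd g)))\<rparr>"

definition free_algebra :: "('o, 'm) monad \<Rightarrow> 'o \<Rightarrow> ('o, 'm) em_ob" where
  "free_algebra T x = (fob (mfun T) x, mmu T x)"

definition free_adj ::
  "('o, 'm) cat \<Rightarrow> ('o, 'm) monad \<Rightarrow> ('o, 'm, ('o, 'm) em_ob, ('o, 'm) em_ar) adj" where
  "free_adj C T = \<lparr>
     ladj = \<lparr>fob = free_algebra T,
             far = (\<lambda>f. (free_algebra T (Dom C f), far (mfun T) f, free_algebra T (Cod C f)))\<rparr>,
     radj = \<lparr>fob = fst, far = (\<lambda>(A, f, B). f)\<rparr>,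
     aunit = meta T,
     acounit = (\<lambda>A. (free_algebra T (fst A), snd A, A))\<rparr>"


section \<open>Left Kan extension along the inclusion of the discrete subcategory\<close>

definition discrete :: "('i, 'k) cat \<Rightarrow> ('i, 'k) cat" where
  "discrete I = I\<lparr>Arr := Idn I ` Obj I\<rparr>"

text \<open>The left Kan extension of \<open>S\<close> along the inclusion of \<open>discrete I\<close> takes \<open>j\<close> to the coproduct
  of the sets \<open>S(i)\<close> over all \<open>\<alpha> : i \<rightarrow> j\<close>. As this has to be a subset of \<open>'u\<close>, the element \<open>s\<close> of
  the summand of \<open>\<alpha>\<close> is represented by the code of \<open>(\<alpha>, s)\<close> under a chosen injection, which exists
  for small \<open>I\<close>.\<close>

definition encode :: "('i, 'k) cat \<Rightarrow> 'k \<times> 'u \<Rightarrow> 'u" where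
  "encode I = (SOME c. inj_on c (Arr I \<times> UNIV))"

definition decode :: "('i, 'k) cat \<Rightarrow> 'u \<Rightarrow> 'k \<times> 'u" where
  "decode I = inv_into (Arr I \<times> UNIV) (encode I)"

definition lan_set :: "('i, 'k) cat \<Rightarrow> ('i, 'k, 'u set, 'u smap) fctr \<Rightarrow> 'i \<Rightarrow> 'u set" where
  "lan_set I S j = {encode I (\<alpha>, s) | \<alpha> s. \<alpha> \<in> Arr I \<and> Cod I \<alpha> = j \<and> s \<in> fob S (Dom I \<alpha>)}"

definition lan_map ::
  "('i, 'k) cat \<Rightarrow> ('i, 'k, 'u set, 'u smap) fctr \<Rightarrow> 'i \<Rightarrow> ('k \<Rightarrow> 'u \<Rightarrow> 'u) \<Rightarrow> 'u set \<Rightarrow> 'u smap" where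
  "lan_map I S j h Y = (lan_set I S j, \<lambda>x\<in>lan_set I S j. (case decode I x of (\<alpha>, s) \<Rightarrow> h \<alpha> s), Y)"

definition lan_ob ::
  "('i, 'k) cat \<Rightarrow> ('i, 'k, 'u set, 'u smap) fctr \<Rightarrow> ('i, 'k, 'u set, 'u smap) fctr" where
  "lan_ob I S = \<lparr>
     fob = (\<lambda>j\<in>Obj I. lan_set I S j),
     far = (\<lambda>\<beta>\<in>Arr I. lan_map I S (Dom I \<beta>) (\<lambda>\<alpha> s. encode I (\<beta> \<bullet>\<^bsub>I\<^esub> \<alpha>, s)) (lan_set I S (Cod I \<beta>)))\<rparr>"

definition res_ob ::
  "('i, 'k) cat \<Rightarrow> ('i, 'k, 'u set, 'u smap) fctr \<Rightarrow> ('i, 'k, 'u set, 'u smap) fctr" where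
  "res_ob I H = \<lparr>fob = fob H, far = restrict (far H) (Arr (discrete I))\<rparr>"

definition lan_adj ::
  "('i, 'k) cat \<Rightarrow>
   (('i, 'k, 'u set, 'u smap) fctr, ('i, 'k, 'u set, 'u smap) ntrans,
    ('i, 'k, 'u set, 'u smap) fctr, ('i, 'k, 'u set, 'u smap) ntrans) adj" where
  "lan_adj I = \<lparr>
     ladj = \<lparr>
       fob = lan_ob I,
       far = (\<lambda>(S, t, S'). (lan_ob I S,
          \<lambda>j\<in>Obj I. lan_map I S j (\<lambda>\<alpha> s. encode I (\<alpha>, smap_fun (t (Dom I \<alpha>)) s)) (lan_set I S' j),
          lan_ob I S'))\<rparr>,
     radj = \<lparr>fob = res_ob I, far = (\<lambda>(H, t, K). (res_ob I H, t, res_ob I K))\<rparr>,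
     aunit = (\<lambda>S. (S,
          \<lambda>i\<in>Obj I. (fob S i, \<lambda>s\<in>fob S i. encode I (Idn I i, s), lan_set I S i),
          res_ob I (lan_ob I S))),
     acounit = (\<lambda>H. (lan_ob I (res_ob I H),
          \<lambda>j\<in>Obj I. lan_map I (res_ob I H) j (\<lambda>\<alpha> s. smap_fun (far H \<alpha>) s) (fob H j),
          H))\<rparr>"


section \<open>The categories and comonads of algebras and of diagrams of algebras\<close>

type_synonym 'u alg = "('u set, 'u smap) em_ob"
type_synonym 'u alg_hom = "('u set, 'u smap) em_ar"
type_synonym ('i, 'k, 'u) alg_diagram = "('i, 'k, 'u alg, 'u alg_hom) fctr"
type_synonym ('i, 'k, 'u) alg_diagram_hom = "('i, 'k, 'u alg, 'u alg_hom) ntrans"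

definition Alg :: "('u set, 'u smap) monad \<Rightarrow> ('u alg, 'u alg_hom) cat" where
  "Alg T = em_cat set_cat T"

definition DiagAlg ::
  "('i, 'k) cat \<Rightarrow> ('u set, 'u smap) monad \<Rightarrow>
   (('i, 'k, 'u) alg_diagram, ('i, 'k, 'u) alg_diagram_hom) cat" where
  "DiagAlg I T = functor_cat I (Alg T)"

definition free_comonad :: "('u set, 'u smap) monad \<Rightarrow> ('u alg, 'u alg_hom) comonad" where
  "free_comonad T = adj_comonad (free_adj set_cat T)"

definition diag_comonad ::
  "('i, 'k) cat \<Rightarrow> ('u set, 'u smap) monad \<Rightarrow>
   (('i, 'k, 'u) alg_diagram, ('i, 'k, 'u) alg_diagram_hom) comonad" where
  "diag_comonad I T = adj_comonad
     (adj_comp (functor_cat (discrete I) set_cat) (DiagAlg I T)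
        (lan_adj I) (post_adj I (free_adj set_cat T)))"


section \<open>Natural systems and Baues--Wirsching cohomology\<close>

text \<open>The category of factorizations; \<open>(f, (\<alpha>, \<beta>), g)\<close> is the arrow \<open>(\<alpha>, \<beta>) : f \<rightarrow> g\<close>, where
  \<open>g = \<alpha> f \<beta>\<close>.\<close>

definition fact_cat :: "('i, 'k) cat \<Rightarrow> ('k, 'k \<times> ('k \<times> 'k) \<times> 'k) cat" where
  "fact_cat I = \<lparr>
     Obj = Arr I,
     Arr = {(f, (\<alpha>, \<beta>), g). f \<in> Arr I \<and> \<alpha> \<in> Arr I \<and> \<beta> \<in> Arr I \<and> g \<in> Arr I \<and>
              Dom I \<alpha> = Cod I f \<and> Cod I \<beta> = Dom I f \<and> g = \<alpha> \<bullet>\<^bsub>I\<^esub> f \<bullet>\<^bsub>I\<^esub> \<beta>},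
     Dom = fst,
     Cod = snd \<circ> snd,
     Idn = (\<lambda>f. (f, (Idn I (Cod I f), Idn I (Dom I f)), f)),
     Cmp = (\<lambda>(g, (\<alpha>', \<beta>'), k) (f, (\<alpha>, \<beta>), g'). (f, (\<alpha>' \<bullet>\<^bsub>I\<^esub> \<alpha>, \<beta> \<bullet>\<^bsub>I\<^esub> \<beta>'), k))\<rparr>"

type_synonym 'a ab_hom = "'a monoid \<times> ('a \<Rightarrow> 'a) \<times> 'a monoid"

definition ab_cat :: "('a monoid, 'a ab_hom) cat" where
  "ab_cat = \<lparr>
     Obj = {G. comm_group G},
     Arr = {(G, h, H). comm_group G \<and> comm_group H \<and> h \<in> hom G H \<and> h \<in> extensional (carrier G)},
     Dom = fst,
     Cod = snd \<circ> snd,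
     Idn = (\<lambda>G. (G, \<lambda>x\<in>carrier G. x, G)),
     Cmp = (\<lambda>k h. (fst h, compose (carrier (fst h)) (fst (snd k)) (fst (snd h)), snd (snd k)))\<rparr>"

type_synonym ('k, 'a) natsys = "('k, 'k \<times> ('k \<times> 'k) \<times> 'k, 'a monoid, 'a ab_hom) fctr"

definition is_natural_system :: "('i, 'k) cat \<Rightarrow> ('k, 'a) natsys \<Rightarrow> bool" where
  "is_natural_system I D \<longleftrightarrow> is_functor (fact_cat I) ab_cat D"

definition ns_left :: "('i, 'k) cat \<Rightarrow> ('k, 'a) natsys \<Rightarrow> 'k \<Rightarrow> 'k \<Rightarrow> 'a \<Rightarrow> 'a" where
  "ns_left I D \<alpha> f = fst (snd (far D (f, (\<alpha>, Idn I (Dom I f)), \<alpha> \<bullet>\<^bsub>I\<^esub> f)))"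

definition ns_right :: "('i, 'k) cat \<Rightarrow> ('k, 'a) natsys \<Rightarrow> 'k \<Rightarrow> 'k \<Rightarrow> 'a \<Rightarrow> 'a" where
  "ns_right I D \<beta> f = fst (snd (far D (f, (Idn I (Cod I f), \<beta>), f \<bullet>\<^bsub>I\<^esub> \<beta>)))"

text \<open>The chain with arrows \<open>\<alpha>\<^sub>1, \<dots>, \<alpha>\<^sub>n\<close> ending in the object \<open>i\<^sub>0 = Cod \<alpha>\<^sub>1\<close> is the pair
  \<open>(i\<^sub>0, [\<alpha>\<^sub>1, \<dots>, \<alpha>\<^sub>n])\<close>; for \<open>n = 0\<close> it is the object \<open>i\<^sub>0\<close>.\<close>

fun is_chain :: "('i, 'k) cat \<Rightarrow> 'i \<Rightarrow> 'k list \<Rightarrow> bool" where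
  "is_chain I i [] \<longleftrightarrow> i \<in> Obj I"
| "is_chain I i (\<alpha> # as) \<longleftrightarrow> \<alpha> \<in> Arr I \<and> Cod I \<alpha> = i \<and> is_chain I (Dom I \<alpha>) as"

definition chains :: "('i, 'k) cat \<Rightarrow> nat \<Rightarrow> ('i \<times> 'k list) set" where
  "chains I n = {(i, as). is_chain I i as \<and> length as = n}"

fun chain_comp :: "('i, 'k) cat \<Rightarrow> 'i \<Rightarrow> 'k list \<Rightarrow> 'k" where
  "chain_comp I i [] = Idn I i"
| "chain_comp I i (\<alpha> # as) = \<alpha> \<bullet>\<^bsub>I\<^esub> chain_comp I (Dom I \<alpha>) as"

definition bw_complex ::
  "('i, 'k) cat \<Rightarrow> ('k, 'a) natsys \<Rightarrow> nat \<Rightarrow> ('i \<times> 'k list \<Rightarrow> 'a) monoid" where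
  "bw_complex I D n = product_group (chains I n) (\<lambda>(i, as). fob D (chain_comp I i as))"

text \<open>The terms of the coboundary, numbered by \<open>0, \<dots>, n + 1\<close>. The list index of \<open>\<alpha>\<^sub>j\<close> is
  \<open>j - 1\<close>.\<close>

definition bw_term ::
  "('i, 'k) cat \<Rightarrow> ('k, 'a) natsys \<Rightarrow> nat \<Rightarrow> ('i \<times> 'k list \<Rightarrow> 'a) \<Rightarrow> 'i \<Rightarrow> 'k list \<Rightarrow> nat \<Rightarrow> 'a" where
  "bw_term I D n f i as j =
     (if j = 0 then ns_left I D (hd as) (chain_comp I (Dom I (hd as)) (tl as)) (f (Dom I (hd as), tl as))
      else if j \<le> n then f (i, take (j - 1) as @ (as ! (j - 1) \<bullet>\<^bsub>I\<^esub> as ! j) # drop (j + 1) as)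
      else ns_right I D (last as) (chain_comp I i (butlast as)) (f (i, butlast as)))"

definition bw_diff ::
  "('i, 'k) cat \<Rightarrow> ('k, 'a) natsys \<Rightarrow> nat \<Rightarrow> ('i \<times> 'k list \<Rightarrow> 'a) \<Rightarrow> ('i \<times> 'k list \<Rightarrow> 'a)" where
  "bw_diff I D n f =
     (\<lambda>(i, as)\<in>chains I (Suc n).
        alt_sum (fob D (chain_comp I i as)) {0..Suc n} (bw_term I D n f i as))"

definition bw_cohomology ::
  "('i, 'k) cat \<Rightarrow> ('k, 'a) natsys \<Rightarrow> nat \<Rightarrow> ('i \<times> 'k list \<Rightarrow> 'a) set monoid" where
  "bw_cohomology I D n = cohomology (bw_complex I D) (bw_diff I D) n"


section \<open>The natural system of comonad cohomology groups\<close>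

definition restricted_module ::
  "('i, 'k) cat \<Rightarrow> ('o, 'm) cat \<Rightarrow> ('i, 'k, 'o, 'm) fctr \<Rightarrow> ('i, 'k, 'o, 'm) ntrans module_obj \<Rightarrow>
   'k \<Rightarrow> 'm module_obj" where
  "restricted_module I C A M \<alpha> = pullback_module C (far A \<alpha>) (module_at M (Cod I \<alpha>))"

text \<open>For \<open>\<alpha> : i \<rightarrow> j\<close>, \<open>\<beta> : j \<rightarrow> j'\<close>, \<open>\<gamma> : i' \<rightarrow> i\<close> the cochain map
  \<open>Der(G\<^sup>n\<^sup>+\<^sup>1 A(i), \<alpha>\<^sup>*M(j)) \<rightarrow> Der(G\<^sup>n\<^sup>+\<^sup>1 A(i'), (\<beta>\<alpha>\<gamma>)\<^sup>*M(j'))\<close> sends a derivation with underlying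
  arrow \<open>u\<close> to the one whose composite with the projection \<open>(\<beta>\<alpha>\<gamma>)\<^sup>*M(j') \<rightarrow> M(j')\<close> is
  \<open>M(\<beta>) r u G\<^sup>n\<^sup>+\<^sup>1(A(\<gamma>))\<close>, where \<open>r\<close> is the projection \<open>\<alpha>\<^sup>*M(j) \<rightarrow> M(j)\<close>.\<close>

definition der_map ::
  "('i, 'k) cat \<Rightarrow> ('o, 'm) cat \<Rightarrow> ('o, 'm) comonad \<Rightarrow> ('i, 'k, 'o, 'm) fctr \<Rightarrow>
   ('i, 'k, 'o, 'm) ntrans module_obj \<Rightarrow> nat \<Rightarrow> 'k \<Rightarrow> 'k \<Rightarrow> 'k \<Rightarrow>
   'm \<times> 'm \<times> 'm \<Rightarrow> 'm \<times> 'm \<times> 'm" where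
  "der_map I C G A M n \<alpha> \<beta> \<gamma> = (\<lambda>(z, u, p).
     (let \<alpha>' = \<beta> \<bullet>\<^bsub>I\<^esub> \<alpha> \<bullet>\<^bsub>I\<^esub> \<gamma>;
          q = gob (module_at M (Cod I \<alpha>));
          q' = gob (module_at M (Cod I \<alpha>'));
          z' = caug C G (fob A (Dom I \<alpha>')) (Suc n);
          r = snd (pullback C (far A \<alpha>) q);
          M\<beta> = far (fst (gob M)) \<beta>
      in (z',
          pb_lift C (far A \<alpha>') q' z'
            (M\<beta> \<bullet>\<^bsub>C\<^esub> r \<bullet>\<^bsub>C\<^esub> u \<bullet>\<^bsub>C\<^esub> cpow_ar G (Suc n) (far A \<gamma>)),
          gob (restricted_module I C A M \<alpha>'))))"

definition cohomology_system ::
  "('i, 'k) cat \<Rightarrow> ('o, 'm) cat \<Rightarrow> ('o, 'm) comonad \<Rightarrow> ('i, 'k, 'o, 'm) fctr \<Rightarrow>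
   ('i, 'k, 'o, 'm) ntrans module_obj \<Rightarrow> nat \<Rightarrow> ('k, ('m \<times> 'm \<times> 'm) set) natsys" where
  "cohomology_system I C G A M n =
     (let value_at = (\<lambda>\<alpha>. cm_cohomology C G (fob A (Dom I \<alpha>)) (restricted_module I C A M \<alpha>) n)
      in \<lparr>fob = value_at,
          far = (\<lambda>(\<alpha>, (\<beta>, \<gamma>), \<alpha>').
            (value_at \<alpha>,
             \<lambda>S\<in>carrier (value_at \<alpha>).
               cohomology_map
                 (cm_complex C G (fob A (Dom I \<alpha>')) (restricted_module I C A M \<alpha>'))
                 (cm_diff C G (fob A (Dom I \<alpha>')) (restricted_module I C A M \<alpha>'))
                 n (der_map I C G A M n \<alpha> \<beta> \<gamma>) S,
             value_at \<alpha>'))\<rparr>)"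


section \<open>Spectral sequences\<close>

text \<open>A first quadrant cohomological spectral sequence starting at the page \<open>E\<^sub>2\<close>; the differential
  \<open>d r p q\<close> goes from \<open>E r p q\<close> to \<open>E r (p + r) (q - r + 1)\<close>.\<close>

definition first_quadrant_ss ::
  "(nat \<Rightarrow> int \<Rightarrow> int \<Rightarrow> 'e monoid) \<Rightarrow> (nat \<Rightarrow> int \<Rightarrow> int \<Rightarrow> 'e \<Rightarrow> 'e) \<Rightarrow> bool" where
  "first_quadrant_ss E d \<longleftrightarrow> (\<forall>r \<ge> 2. \<forall>p q.
     comm_group (E r p q) \<and>
     (p < 0 \<or> q < 0 \<longrightarrow> carrier (E r p q) = {\<one>\<^bsub>E r p q\<^esub>}) \<and>
     d r p q \<in> hom (E r p q) (E r (p + int r) (q - int r + 1)) \<and>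
     (\<forall>x \<in> carrier (E r p q).
        d r (p + int r) (q - int r + 1) (d r p q x) =
          \<one>\<^bsub>E r (p + 2 * int r) (q - 2 * int r + 2)\<^esub>) \<and>
     E (Suc r) p q \<cong>
       (E r p q\<lparr>carrier := kernel (E r p q) (E r (p + int r) (q - int r + 1)) (d r p q)\<rparr>)
         Mod (d r (p - int r) (q + int r - 1) ` carrier (E r (p - int r) (q + int r - 1))))"

text \<open>Convergence \<open>E\<^sub>2\<^sup>p\<^sup>q \<Longrightarrow> H\<^sup>p\<^sup>+\<^sup>q\<close>: each \<open>H\<^sup>n\<close> has a finite decreasing filtration
  \<open>H\<^sup>n = F\<^sup>0 \<supseteq> \<dots> \<supseteq> F\<^sup>n\<^sup>+\<^sup>1 = 0\<close> with \<open>F\<^sup>p / F\<^sup>p\<^sup>+\<^sup>1\<close> isomorphic to \<open>E\<^sub>\<infinity>\<^sup>p\<^sup>,\<^sup>n\<^sup>-\<^sup>p\<close>, the common value of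
  the \<open>E\<^sub>r\<^sup>p\<^sup>,\<^sup>n\<^sup>-\<^sup>p\<close> for large \<open>r\<close>.\<close>

definition ss_converges ::
  "(nat \<Rightarrow> int \<Rightarrow> int \<Rightarrow> 'e monoid) \<Rightarrow> (nat \<Rightarrow> 'h monoid) \<Rightarrow> bool" where
  "ss_converges E H \<longleftrightarrow> (\<forall>n. comm_group (H n) \<and> (\<exists>F :: nat \<Rightarrow> 'h set.
     F 0 = carrier (H n) \<and> F (Suc n) = {\<one>\<^bsub>H n\<^esub>} \<and>
     (\<forall>p \<le> n. subgroup (F p) (H n) \<and> F (Suc p) \<subseteq> F p \<and>
        (\<exists>r\<^sub>0 \<ge> 2. \<forall>r \<ge> r\<^sub>0.
           E r (int p) (int n - int p) \<cong> (H n\<lparr>carrier := F p\<rparr>) Mod F (Suc p)))))"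

end

theory Submission
  imports Defs Complex_Main "HOL-Library.Function_Algebras"
begin

text \<open>
  Let \<open>Y\<close> be the comonad resolution of \<open>A\<close> for \<open>G\<^sub>I\<close>. The double complex has as its \<open>(p, q)\<close> term the
  product, over the chains \<open>i\<^sub>p \<rightarrow> \<dots> \<rightarrow> i\<^sub>0\<close> of \<open>I\<close> with composite \<open>\<alpha>\<close>, of the groups
  \<open>Der(Y\<^sub>q(i\<^sub>p), \<alpha>\<^sup>*M(i\<^sub>0))\<close>; its horizontal differential is the Baues--Wirsching one, its vertical
  differential comes from \<open>Y\<close>. As \<open>Y\<^sub>q\<close> is free on a family of sets indexed by \<open>I\<^sub>0\<close>, a natural
  transformation or a cochain is determined by its values on generators, which gives a contraction of each
  row onto \<open>Der(Y\<^sub>q, M)\<close>; hence the total complex computes \<open>H(A, M)\<close> for \<open>G\<^sub>I\<close>. A column computes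
  \<open>H(A(i\<^sub>p), \<alpha>\<^sup>*M(i\<^sub>0))\<close> for \<open>G\<close>: there are simplicial maps \<open>tau\<close>, \<open>theta\<close> over \<open>A(i)\<close> between \<open>Y(i)\<close> and the
  resolution of \<open>A(i)\<close>, with \<open>tau\<close> natural in \<open>i\<close>, \<open>tau theta = id\<close> and \<open>theta tau\<close> homotopic to the
  identity. The spectral sequence is the one of the filtration by \<open>p\<close>.

  The values of a derivation at different points lie in different groups, the fibres of \<open>M\<close>. In order
  to add cochains in a single type-class group, all these groups are embedded into the type \<open>uab\<close>, the product
  of all abelian groups on subsets of \<open>'u\<close>. A group \<open>H\<close> in the sense of HOL-Algebra is then related to
  a subquotient \<open>S/N\<close> of such a type-class group by \<open>presents S N f H\<close>.
\<close>

subsection \<open>A type carrying all abelian groups\<close>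

text \<open>\<open>Y\<close> is used for the columns, and not the resolutions of the algebras
  \<open>A(i)\<close> themselves, because a free generator of \<open>Y\<close> is a pair
  \<open>(gm, b)\<close> with an arrow \<open>gm\<close> ending in the current object. Appending
  \<open>gm\<close> to a chain is the extra degeneracy that contracts a row. The price is the
  comparison of columns: \<open>theta\<close> puts generators into the summands of identity arrows,
  which the transition maps of \<open>Y\<close> do not preserve, so it is not natural in
  \<open>I\<close>. It respects the contravariant action only up to coboundaries; naturality of
  \<open>tau\<close> and the homotopy yield this, and it suffices because the second page sees only
  cohomology classes. Pullback modules stay out of the double complex: a derivation into the
  pullback of \<open>M(j)\<close> along \<open>\<alpha> : i \<rightarrow> j\<close> is a map to
  \<open>M(j)\<close> over the composite into \<open>A(j)\<close>, hence a function into the fibres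
  of \<open>M(j)\<close>. A spectral sequence in the sense of \<open>first_quadrant_ss\<close> has
  all pages on one type, and the theorem prescribes the second page on the nose, so that iterated
  quotients cannot serve as later pages. They are put on that type by choosing
  representatives.\<close>

typedef 'a uab = "{f :: 'a monoid => 'a. \<forall>G. if comm_group G then f G : carrier G else f G = undefined}"
 by (rule exI[of _ "%G. if comm_group G then \<one>\<^bsub>G\<^esub> else undefined"])
  (auto intro: monoid.one_closed simp: comm_group_def group_def)

definition uab_of :: "('a monoid => 'a) => 'a uab" where
 "uab_of f = Abs_uab (%G. if comm_group G then f G else undefined)"

definition coord :: "'a monoid => 'a uab => 'a" where
 "coord G x = Rep_uab x G"

lemma coord_carrier [simp]: "comm_group G ==> coord G x : carrier G"
 using Rep_uab[of x] unfolding coord_def by (smt (verit) mem_Collect_eq)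

lemma coord_uab_of:
 assumes "!!G. comm_group G ==> f G : carrier G" "comm_group G"
 shows "coord G (uab_of f) = f G"
proof -
 have "(%G. if comm_group G then f G else undefined)
  : {f :: 'a monoid => 'a. \<forall>G. if comm_group G then f G : carrier G else f G = undefined}"
  using assms(1) by auto
 thus ?thesis
  unfolding coord_def uab_of_def using assms(2) by (simp add: Abs_uab_inverse)
qed

lemma uab_eqI:
 assumes "!!G. comm_group G ==> coord G x = coord G y"
 shows "x = y"
proof -
 have "Rep_uab x G = Rep_uab y G" for G
 proof (cases "comm_group G")
  case True thus ?thesis using assms unfolding coord_def by blast
 next
  case False
  thus ?thesis using Rep_uab[of x] Rep_uab[of y] by (smt (verit) mem_Collect_eq)
 qed
 thus ?thesis by (meson Rep_uab_inject ext)
qed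

instantiation uab :: (type) ab_group_add
begin

definition zero_uab :: "'a uab" where
 "zero_uab = uab_of (%G. \<one>\<^bsub>G\<^esub>)"
definition plus_uab :: "'a uab => 'a uab => 'a uab" where
 "plus_uab x y = uab_of (%G. coord G x \<otimes>\<^bsub>G\<^esub> coord G y)"
definition uminus_uab :: "'a uab => 'a uab" where
 "uminus_uab x = uab_of (%G. inv\<^bsub>G\<^esub> coord G x)"
definition minus_uab :: "'a uab => 'a uab => 'a uab" where
 "minus_uab x y = x + (- y)"

lemma coord_zero: "comm_group G ==> coord G 0 = \<one>\<^bsub>G\<^esub>"
 unfolding zero_uab_def
 by (rule coord_uab_of) (auto simp: comm_group_def group_def intro: monoid.one_closed)

lemma coord_plus: "comm_group G ==> coord G (x + y) = coord G x \<otimes>\<^bsub>G\<^esub> coord G y"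
 unfolding plus_uab_def
 by (rule coord_uab_of) (auto simp: comm_group_def group_def intro!: monoid.m_closed)

lemma coord_uminus: "comm_group G ==> coord G (- x) = inv\<^bsub>G\<^esub> coord G x"
 unfolding uminus_uab_def
 by (rule coord_uab_of) (auto simp: comm_group_def intro!: group.inv_closed)

instance
proof
 fix a b c :: "'a uab"
 note [simp] = coord_zero coord_plus coord_uminus
 show "a + b + c = a + (b + c)"
  by (rule uab_eqI) (simp add: comm_group_def group_def monoid.m_assoc)
 show "a + b = b + a"
  by (rule uab_eqI) (simp add: comm_group_def comm_monoid.m_comm)
 show "0 + a = a"
  by (rule uab_eqI) (simp add: comm_group_def group_def monoid.l_one)
 show "- a + a = 0"
  by (rule uab_eqI) (simp add: comm_group_def group.l_inv)
 show "a - b = a + - b"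
  by (rule minus_uab_def)
qed

end

text \<open>The inclusion of the factor \<open>G\<close> into the product. Distinct groups go to
  independent factors, and the homomorphism \<open>coord G\<close> is a left inverse on
  \<open>carrier G\<close>, whence injectivity.\<close>

definition embed :: "'a monoid => 'a => 'a uab" where
 "embed G x = uab_of (%H. if H = G then x else \<one>\<^bsub>H\<^esub>)"

lemma coord_embed:
 assumes "comm_group G" "x : carrier G" "comm_group H"
 shows "coord H (embed G x) = (if H = G then x else \<one>\<^bsub>H\<^esub>)"
 unfolding embed_def using assms
 by (intro coord_uab_of) (auto simp: comm_group_def group_def intro: monoid.one_closed)

lemma coord_embed_same [simp]:
 "comm_group G ==> x : carrier G ==> coord G (embed G x) = x"
 by (simp add: coord_embed)

lemma embed_mult:
 assumes "comm_group G" "x : carrier G" "y : carrier G"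
 shows "embed G (x \<otimes>\<^bsub>G\<^esub> y) = embed G x + embed G y"
proof (rule uab_eqI)
 interpret G: comm_group G by fact
 fix H :: "'a monoid" assume H: "comm_group H"
 then interpret H: comm_group H .
 show "coord H (embed G (x \<otimes>\<^bsub>G\<^esub> y)) = coord H (embed G x + embed G y)"
  using assms H by (simp add: coord_plus coord_embed)
qed

lemma embed_one:
 assumes "comm_group G" shows "embed G \<one>\<^bsub>G\<^esub> = 0"
proof (rule uab_eqI)
 fix H :: "'a monoid" assume H: "comm_group H"
 thus "coord H (embed G \<one>\<^bsub>G\<^esub>) = coord H 0"
  using assms by (auto simp: coord_zero coord_embed comm_group_def group_def intro!: monoid.one_closed)
qed

lemma embed_inv:
 assumes "comm_group G" "x : carrier G"
 shows "embed G (inv\<^bsub>G\<^esub> x) = - embed G x"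
proof (rule uab_eqI)
 interpret G: comm_group G by fact
 fix H :: "'a monoid" assume H: "comm_group H"
 then interpret H: comm_group H .
 show "coord H (embed G (inv\<^bsub>G\<^esub> x)) = coord H (- embed G x)"
  using assms H by (simp add: coord_uminus coord_embed)
qed

lemma embed_inj:
 assumes "comm_group G" "x : carrier G" "y : carrier G" "embed G x = embed G y"
 shows "x = y"
 by (metis assms coord_embed_same)


subsection \<open>Presentations of abelian groups as subquotients\<close>

definition subgp :: "'a::ab_group_add set => bool" where
 "subgp S \<longleftrightarrow> 0 : S & (\<forall>x\<in>S. \<forall>y\<in>S. x - y : S)"

lemma subgp_zero: "subgp S ==> 0 : S"
 and subgp_diff: "subgp S ==> x : S ==> y : S ==> x - y : S"
 by (auto simp: subgp_def)

lemma subgp_minus: "subgp S ==> x : S ==> - x : S"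
 by (metis subgp_def diff_0)

lemma subgp_add: "subgp S ==> x : S ==> y : S ==> x + y : S"
 by (metis subgp_def diff_0 diff_minus_eq_add)

lemma subgp_sum: "subgp S ==> (!!i. i : A ==> f i : S) ==> sum f A : S"
 by (induction A rule: infinite_finite_induct) (auto simp: subgp_zero subgp_add)

lemma subgpI:
 assumes "0 : S" "!!x y. x : S ==> y : S ==> x + y : S" "!!x. x : S ==> - x : S"
 shows "subgp S"
 unfolding subgp_def using assms by (metis diff_conv_add_uminus)

lemma subgp_trivial: "subgp {0}"
 by (auto simp: subgp_def)

text \<open>Working with \<open>S\<close>, \<open>N\<close> and \<open>f\<close> instead of cosets
  lets kernels, images and quotients of HOL-Algebra groups be computed by additive arithmetic in a
  type class. \<open>N\<close> is the exact kernel of \<open>f\<close> on \<open>S\<close>, and so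
  is itself a subgroup (\<open>presents_subgp\<close>).\<close>

definition presents :: "'a::ab_group_add set => 'a set => ('a => 'h) => 'h monoid => bool" where
 "presents S N f H \<longleftrightarrow> subgp S & N \<subseteq> S & comm_group H & f ` S = carrier H &
  (\<forall>x\<in>S. \<forall>y\<in>S. f (x + y) = f x \<otimes>\<^bsub>H\<^esub> f y) & (\<forall>x\<in>S. f x = \<one>\<^bsub>H\<^esub> \<longleftrightarrow> x : N)"

lemma presentsD:
 assumes "presents S N f H"
 shows "subgp S" "N \<subseteq> S" "comm_group H" "f ` S = carrier H"
  "!!x. x : S ==> f x : carrier H"
  "!!x y. x : S ==> y : S ==> f (x + y) = f x \<otimes>\<^bsub>H\<^esub> f y"
  "!!x. x : S ==> f x = \<one>\<^bsub>H\<^esub> \<longleftrightarrow> x : N"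
 using assms unfolding presents_def by auto

lemma presents_surj:
 assumes "presents S N f H" "h : carrier H"
 obtains x where "x : S" "h = f x"
 using presentsD(4)[OF assms(1)] assms(2) by (metis imageE)

lemma presents_zero:
 assumes "presents S N f H"
 shows "f 0 = \<one>\<^bsub>H\<^esub>" "0 : N"
proof -
 interpret H: comm_group H by (rule presentsD[OF assms])
 have 0: "0 : S" using presentsD(1)[OF assms] by (rule subgp_zero)
 have "f 0 \<otimes>\<^bsub>H\<^esub> f 0 = f 0" using presentsD(6)[OF assms 0 0] by simp
 thus "f 0 = \<one>\<^bsub>H\<^esub>" using presentsD(5)[OF assms 0] by (metis H.l_cancel_one')
 thus "0 : N" using presentsD(7)[OF assms 0] by simp
qed

lemma presents_minus:
 assumes "presents S N f H" "x : S"
 shows "f (- x) = inv\<^bsub>H\<^esub> f x"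
proof -
 interpret H: comm_group H by (rule presentsD[OF assms(1)])
 have m: "- x : S" using presentsD(1)[OF assms(1)] assms(2) by (rule subgp_minus)
 have "f (- x) \<otimes>\<^bsub>H\<^esub> f x = \<one>\<^bsub>H\<^esub>"
  using presentsD(6)[OF assms(1) m assms(2)] presents_zero[OF assms(1)] by simp
 thus ?thesis using presentsD(5)[OF assms(1)] m assms(2) by (metis H.inv_equality)
qed

lemma presents_eq:
 assumes "presents S N f H" "x : S" "y : S"
 shows "f x = f y \<longleftrightarrow> x - y : N"
proof -
 interpret H: comm_group H by (rule presentsD[OF assms(1)])
 have m: "x - y : S" using presentsD(1)[OF assms(1)] assms(2,3) by (rule subgp_diff)
 have "f x = f (x - y) \<otimes>\<^bsub>H\<^esub> f y"
  using presentsD(6)[OF assms(1) m assms(3)] by simp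
 hence "f x = f y \<longleftrightarrow> f (x - y) = \<one>\<^bsub>H\<^esub>"
  using H.r_cancel_one[OF presentsD(5)[OF assms(1,3)] presentsD(5)[OF assms(1) m]] by auto
 thus ?thesis using presentsD(7)[OF assms(1) m] by simp
qed

lemma presents_subgp:
 assumes "presents S N f H"
 shows "subgp N"
proof -
 have "x - y : N" if "x : N" "y : N" for x y
 proof -
  have xy: "x : S" "y : S" using that presentsD(2)[OF assms] by auto
  hence "f x = f y" using that presentsD(7)[OF assms xy(1)] presentsD(7)[OF assms xy(2)] by simp
  thus ?thesis using presents_eq[OF assms xy] by simp
 qed
 thus ?thesis using presents_zero(2)[OF assms] by (auto simp: subgp_def)
qed

text \<open>Both groups are \<open>S/N\<close>: \<open>f x = f y\<close> and
  \<open>g x = g y\<close> express the same relation \<open>x - y : N\<close>, so \<open>g\<close>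
  after any section of \<open>f\<close> is well defined and additive.\<close>

lemma presents_iso:
 assumes f: "presents S N f H" and g: "presents S N g K"
 shows "H \<cong> K"
proof -
 define s where "s h = (SOME x. x : S & h = f x)" for h
 have s: "s h : S" "f (s h) = h" if "h : carrier H" for h
  using someI_ex[of "%x. x : S & h = f x"] presents_surj[OF f that] unfolding s_def by metis+
 have eq: "f x = f y \<longleftrightarrow> g x = g y" if "x : S" "y : S" for x y
  using presents_eq[OF f that] presents_eq[OF g that] by simp
 interpret H: comm_group H by (rule presentsD[OF f])
 have "(%h. g (s h)) : hom H K"
 proof (rule homI)
  show "g (s h) : carrier K" if "h : carrier H" for h
   using s[OF that] presentsD(5)[OF g] by auto
  fix h h' assume h: "h : carrier H" "h' : carrier H"
  have "f (s (h \<otimes>\<^bsub>H\<^esub> h')) = f (s h + s h')"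
   using s h presentsD(6)[OF f] H.m_closed by metis
  hence "g (s (h \<otimes>\<^bsub>H\<^esub> h')) = g (s h + s h')"
   using eq s h H.m_closed subgp_add[OF presentsD(1)[OF f]] by metis
  thus "g (s (h \<otimes>\<^bsub>H\<^esub> h')) = g (s h) \<otimes>\<^bsub>K\<^esub> g (s h')"
   using s h presentsD(6)[OF g] by metis
 qed
 moreover have "bij_betw (%h. g (s h)) (carrier H) (carrier K)"
 proof (rule bij_betwI')
  show "(g (s h) = g (s h')) = (h = h')" if "h : carrier H" "h' : carrier H" for h h'
   using that s eq by metis
  show "g (s h) : carrier K" if "h : carrier H" for h
   using s[OF that] presentsD(5)[OF g] by auto
  show "\<exists>h\<in>carrier H. k = g (s h)" if k: "k : carrier K" for k
  proof -
   obtain x where x: "x : S" "k = g x" using presents_surj[OF g k] by blast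
   hence "f x : carrier H" "g (s (f x)) = g x"
    using presentsD(5)[OF f] s eq by metis+
   thus ?thesis using x by metis
  qed
 qed
 ultimately show ?thesis unfolding is_iso_def iso_def by blast
qed

lemma presents_sub:
 assumes f: "presents S N f H" and S': "subgp S'" "N \<subseteq> S'" "S' \<subseteq> S"
 shows "presents S' N f (H\<lparr>carrier := f ` S'\<rparr>)" "subgroup (f ` S') H"
proof -
 interpret H: comm_group H by (rule presentsD[OF f])
 show sub: "subgroup (f ` S') H"
 proof
  show "f ` S' \<subseteq> carrier H" using S'(3) presentsD(5)[OF f] by auto
  show "\<one>\<^bsub>H\<^esub> : f ` S'" using presents_zero[OF f] subgp_zero[OF S'(1)] by (metis imageI)
  show "a \<otimes>\<^bsub>H\<^esub> b : f ` S'" if ab: "a : f ` S'" "b : f ` S'" for a b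
  proof -
   obtain x y where "a = f x" "b = f y" "x : S'" "y : S'" using ab by blast
   hence "a \<otimes>\<^bsub>H\<^esub> b = f (x + y)" "x + y : S'"
    using presentsD(6)[OF f subsetD[OF S'(3)] subsetD[OF S'(3)]] subgp_add[OF S'(1)] by metis+
   thus ?thesis by blast
  qed
  show "inv\<^bsub>H\<^esub> a : f ` S'" if a: "a : f ` S'" for a
  proof -
   obtain x where "a = f x" "x : S'" using a by blast
   hence "inv\<^bsub>H\<^esub> a = f (- x)" "- x : S'"
    using presents_minus[OF f subsetD[OF S'(3)]] subgp_minus[OF S'(1)] by metis+
   thus ?thesis by blast
  qed
 qed
 have "comm_group (H\<lparr>carrier := f ` S'\<rparr>)"
  using subgroup.subgroup_is_group[OF sub H.is_group] H.m_comm subgroup.subset[OF sub]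
  by (intro group.group_comm_groupI) auto
 thus "presents S' N f (H\<lparr>carrier := f ` S'\<rparr>)"
  unfolding presents_def using S' presentsD[OF f]
  by (intro conjI ballI) (simp_all add: subset_iff)
qed

lemma presents_Mod:
 assumes f: "presents S N f H" and N': "subgp N'" "N \<subseteq> N'" "N' \<subseteq> S"
 shows "presents S N' (%x. f ` N' #>\<^bsub>H\<^esub> f x) (H Mod f ` N')"
proof -
 interpret H: comm_group H by (rule presentsD[OF f])
 note sub = presents_sub(2)[OF f N']
 interpret nrm: normal "f ` N'" H by (rule H.subgroup_imp_normal[OF sub])
 have 1: "comm_group (H Mod f ` N')" by (rule H.abelian_FactGroup[OF sub])
 have 2: "(%x. f ` N' #>\<^bsub>H\<^esub> f x) ` S = carrier (H Mod f ` N')"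
  by (auto simp: FactGroup_def RCOSETS_def presentsD(4)[OF f, symmetric])
 have 3: "f ` N' #>\<^bsub>H\<^esub> f (x + y) = (f ` N' #>\<^bsub>H\<^esub> f x) \<otimes>\<^bsub>H Mod f ` N'\<^esub> (f ` N' #>\<^bsub>H\<^esub> f y)"
  if "x : S" "y : S" for x y
  using that presentsD(5,6)[OF f] nrm.rcos_sum by (simp add: FactGroup_def)
 have 4: "f ` N' #>\<^bsub>H\<^esub> f x = \<one>\<^bsub>H Mod f ` N'\<^esub> \<longleftrightarrow> x : N'" if x: "x : S" for x
 proof -
  have "f ` N' #>\<^bsub>H\<^esub> f x = \<one>\<^bsub>H Mod f ` N'\<^esub> \<longleftrightarrow> f x : f ` N'"
   using presentsD(5)[OF f x] H.coset_join1[OF _ _ sub] H.coset_join2[OF _ sub] sub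
   by (auto simp: FactGroup_def subgroup.subset)
  also have "... \<longleftrightarrow> x : N'"
  proof
   assume "f x : f ` N'"
   then obtain y where y: "y : N'" "f x = f y" by auto
   hence "x - y : N'" using presents_eq[OF f x] N' by auto
   thus "x : N'" using subgp_add[OF N'(1) _ y(1)] by fastforce
  qed auto
  finally show ?thesis .
 qed
 show ?thesis unfolding presents_def using presentsD(1)[OF f] N' 1 2 3 4 by auto
qed

text \<open>A function whose fibres are the cosets of \<open>N\<close> transports the structure of
  \<open>S/N\<close> to its image, on whatever type it takes values. It creates groups on a
  prescribed type: later pages, and trivial groups by way of constant functions.\<close>

lemma presents_any:
 fixes g :: "'a::ab_group_add => 'h"
 assumes S: "subgp S" "subgp N" "N \<subseteq> S"
  and g: "!!x y. x : S ==> y : S ==> g x = g y \<longleftrightarrow> x - y : N"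
 shows "\<exists>G. presents S N g G"
proof -
 define s where "s = inv_into S g"
 have s: "s h : S" "g (s h) = h" if "h : g ` S" for h
  using that unfolding s_def by (auto simp: inv_into_into f_inv_into_f)
 define G where "G = \<lparr>carrier = g ` S, mult = (%h k. g (s h + s k)), one = g 0\<rparr>"
 have add: "g (x + y) = g (s (g x) + s (g y))" if "x : S" "y : S" for x y
 proof -
  have "x - s (g x) : N" "y - s (g y) : N" using that g s by (metis imageI)+
  hence "(x - s (g x)) + (y - s (g y)) : N" by (rule subgp_add[OF S(2)])
  hence "(x + y) - (s (g x) + s (g y)) : N" by (simp add: algebra_simps)
  thus ?thesis using g that s subgp_add[OF S(1)] by (metis imageI)
 qed
 have 0: "0 : S" by (rule subgp_zero[OF S(1)])
 have "comm_group G"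
 proof (rule comm_groupI)
  fix h k l assume "h : carrier G" "k : carrier G" "l : carrier G"
  then obtain x y z where x: "x : S" "h = g x" and y: "y : S" "k = g y" and z: "z : S" "l = g z"
   by (auto simp: G_def)
  note a = subgp_add[OF S(1)]
  show "h \<otimes>\<^bsub>G\<^esub> k : carrier G" using s x y a by (auto simp: G_def)
  show "h \<otimes>\<^bsub>G\<^esub> k \<otimes>\<^bsub>G\<^esub> l = h \<otimes>\<^bsub>G\<^esub> (k \<otimes>\<^bsub>G\<^esub> l)"
   using x y z a add by (simp add: G_def add[symmetric] add.assoc)
  show "h \<otimes>\<^bsub>G\<^esub> k = k \<otimes>\<^bsub>G\<^esub> h" by (simp add: G_def add.commute)
  show "\<one>\<^bsub>G\<^esub> \<otimes>\<^bsub>G\<^esub> h = h" using x 0 by (simp add: G_def add[symmetric])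
  show "\<exists>y\<in>carrier G. y \<otimes>\<^bsub>G\<^esub> h = \<one>\<^bsub>G\<^esub>"
   using x subgp_minus[OF S(1) x(1)] by (auto simp: G_def add[symmetric] intro!: bexI[of _ "-x"])
 qed (auto simp: G_def 0)
 moreover have "\<forall>x\<in>S. g x = g 0 \<longleftrightarrow> x : N" using g 0 by auto
 ultimately have "presents S N g G"
  using S add by (auto simp: presents_def G_def)
 thus ?thesis ..
qed

text \<open>An isomorphism of subquotients that is given by an additive correspondence
  \<open>R\<close> rather than by a map; totality on both sides gives bijectivity, and
  \<open>ker\<close> matches the denominators. It serves where representatives have to be corrected
  before they can be compared.\<close>

lemma presents_rel:
 fixes R :: "'b::ab_group_add => 'a::ab_group_add => bool"
 assumes f: "presents S N f H" and S': "subgp S'" "N' \<subseteq> S'"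
  and tot: "!!y. y : S' ==> \<exists>x\<in>S. R y x" and sur: "!!x. x : S ==> \<exists>y\<in>S'. R y x"
  and diff: "!!y x y' x'. R y x ==> R y' x' ==> R (y - y') (x - x')"
  and ker: "!!y x. R y x ==> y : S' ==> x : S ==> y : N' \<longleftrightarrow> x : N"
 shows "\<exists>f'. presents S' N' f' H"
proof -
 define s where "s y = (SOME x. x : S & R y x)" for y
 have s: "s y : S" "R y (s y)" if "y : S'" for y
  using someI_ex[of "%x. x : S & R y x"] tot[OF that] unfolding s_def by blast+
 define f' where "f' y = f (s y)" for y
 have R0: "R 0 0"
  using tot[OF subgp_zero[OF S'(1)]] diff by (metis cancel_comm_monoid_add_class.diff_cancel)
 have N0: "0 : N'" using ker[OF R0] subgp_zero[OF S'(1)] subgp_zero[OF presentsD(1)[OF f]]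
   presents_zero[OF f] by blast
 have val: "f' y = f x" if "y : S'" "x : S" "R y x" for x y
 proof -
  have "R 0 (s y - x)" using diff[OF s(2)[OF that(1)] that(3)] by simp
  hence "s y - x : N"
   using ker N0 S' s that subgp_diff[OF presentsD(1)[OF f]] by (metis subsetD)
  thus ?thesis using presents_eq[OF f] s that unfolding f'_def by blast
 qed
 have Rp: "R (y + y') (x + x')" if "R y x" "R y' x'" for x y x' y'
  using diff[OF that(1) diff[OF R0 that(2)]] by simp
 have add: "f' (y + y') = f' y \<otimes>\<^bsub>H\<^esub> f' y'" if "y : S'" "y' : S'" for y y'
 proof -
  have "f' (y + y') = f (s y + s y')"
   using that s val Rp subgp_add[OF S'(1)] subgp_add[OF presentsD(1)[OF f]] by metis
  thus ?thesis using presentsD(6)[OF f] s that unfolding f'_def by metis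
 qed
 have "presents S' N' f' H"
  unfolding presents_def
 proof (intro conjI ballI)
  show "f' ` S' = carrier H"
  proof
   show "f' ` S' \<subseteq> carrier H" using s presentsD(5)[OF f] by (auto simp: f'_def)
   show "carrier H \<subseteq> f' ` S'"
   proof
    fix h assume "h : carrier H"
    then obtain x where "x : S" "h = f x" using presents_surj[OF f] by blast
    thus "h : f' ` S'" using sur val by (metis imageI)
   qed
  qed
  show "(f' y = \<one>\<^bsub>H\<^esub>) = (y : N')" if "y : S'" for y
   using that s ker presentsD(7)[OF f] unfolding f'_def by metis
 qed (use S' presentsD[OF f] add in auto)
 thus ?thesis by blast
qed

locale addmap =
 fixes f :: "'a::ab_group_add => 'b::ab_group_add"
 assumes add: "f (x + y) = f x + f y"
begin

lemma zero: "f 0 = 0"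
 using add[of 0 0] by simp

lemma minus: "f (- x) = - f x"
 using add[of x "- x"] by (simp add: zero eq_neg_iff_add_eq_0 add.commute)

lemma diff: "f (x - y) = f x - f y"
 using add[of x "- y"] by (simp add: minus)

lemma sum: "f (\<Sum>i\<in>A. g i) = (\<Sum>i\<in>A. f (g i))"
 by (induction A rule: infinite_finite_induct) (simp_all add: zero add)

end

text \<open>The maps \<open>D0\<close>, \<open>D1\<close> between quotients are known through lifts
  \<open>de0\<close>, \<open>de1\<close>. An element is a cycle when its lift lands in
  \<open>N2\<close>, and a boundary when it is some \<open>de0 x\<close> up to
  \<open>N1\<close>.\<close>

lemma presents_homology:
 fixes de0 :: "'a::ab_group_add => 'b::ab_group_add" and de1 :: "'b => 'c::ab_group_add"
 assumes P0: "presents S0 N0 f0 H0" and P1: "presents S1 N1 f1 H1" and P2: "presents S2 N2 f2 H2"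
  and a0: "addmap de0" and a1: "addmap de1"
  and d0: "!!x. x : S0 ==> de0 x : S1" and d1: "!!x. x : S1 ==> de1 x : S2"
  and n1: "!!x. x : N1 ==> de1 x : N2" and n0: "!!x. x : S0 ==> de1 (de0 x) : N2"
  and D0: "!!x. x : S0 ==> D0 (f0 x) = f1 (de0 x)"
  and D1: "!!x. x : S1 ==> D1 (f1 x) = f2 (de1 x)"
 shows "presents {x\<in>S1. de1 x : N2} {n + de0 x | n x. n : N1 & x : S0}
  (%x. D0 ` carrier H0 #>\<^bsub>H1\<lparr>carrier := kernel H1 H2 D1\<rparr>\<^esub> f1 x)
  (H1\<lparr>carrier := kernel H1 H2 D1\<rparr> Mod D0 ` carrier H0)"
proof -
 interpret a0: addmap de0 by fact
 interpret a1: addmap de1 by fact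
 let ?Z = "{x\<in>S1. de1 x : N2}" and ?B = "{n + de0 x | n x. n : N1 & x : S0}"
 note s = presentsD(1)[OF P0] presentsD(1)[OF P1] presentsD(1)[OF P2]
 note n = presents_subgp[OF P0] presents_subgp[OF P1] presents_subgp[OF P2]
 have Z: "subgp ?Z"
  using s n by (auto simp: subgp_def a1.zero a1.diff)
 have BZ: "?B \<subseteq> ?Z"
  using d0 n0 n1 presentsD(2)[OF P1] subgp_add[OF s(2)] subgp_add[OF n(3)]
  by (auto simp: a1.add)
 have NB: "N1 \<subseteq> ?B" using subgp_zero[OF s(1)] by (force simp: a0.zero)
 have B: "subgp ?B"
  unfolding subgp_def
 proof (intro conjI ballI)
  show "0 : ?B" using NB subgp_zero[OF n(2)] by blast
  fix x y assume "x : ?B" "y : ?B"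
  then obtain a b c d where "x = a + de0 b" "y = c + de0 d" "a : N1" "c : N1" "b : S0" "d : S0" by auto
  hence "x - y = (a - c) + de0 (b - d)" "a - c : N1" "b - d : S0"
   using subgp_diff[OF n(2)] subgp_diff[OF s(1)] by (auto simp: a0.diff)
  thus "x - y : ?B" by blast
 qed
 have kz: "f1 ` ?Z = kernel H1 H2 D1"
 proof
  show "f1 ` ?Z \<subseteq> kernel H1 H2 D1"
   using presentsD(5)[OF P1] presentsD(7)[OF P2] d1 D1 by (auto simp: kernel_def)
  show "kernel H1 H2 D1 \<subseteq> f1 ` ?Z"
  proof
   fix h assume h: "h : kernel H1 H2 D1"
   then obtain x where x: "x : S1" "h = f1 x"
    using presents_surj[OF P1] by (auto simp: kernel_def)
   hence "de1 x : N2" using h D1 presentsD(7)[OF P2] d1 by (auto simp: kernel_def)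
   thus "h : f1 ` ?Z" using x by auto
  qed
 qed
 have "D0 ` carrier H0 = f1 ` de0 ` S0"
  using D0 by (simp add: presentsD(4)[OF P0, symmetric] image_image)
 moreover have "f1 ` de0 ` S0 = f1 ` ?B"
 proof
  show "f1 ` de0 ` S0 \<subseteq> f1 ` ?B"
   using subgp_zero[OF n(2)] by (force intro!: imageI)
  show "f1 ` ?B \<subseteq> f1 ` de0 ` S0"
  proof
   fix h assume "h : f1 ` ?B"
   then obtain a b where ab: "h = f1 (a + de0 b)" "a : N1" "b : S0" by auto
   hence "f1 (a + de0 b) = f1 (de0 b)"
    using presents_eq[OF P1] d0 presentsD(2)[OF P1] subgp_add[OF s(2)] by (metis add_diff_cancel_right' subsetD)
   thus "h : f1 ` de0 ` S0" using ab by auto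
  qed
 qed
 ultimately have im: "D0 ` carrier H0 = f1 ` ?B" by simp
 have "presents ?Z N1 f1 (H1\<lparr>carrier := kernel H1 H2 D1\<rparr>)"
  using presents_sub(1)[OF P1 Z] NB BZ kz by auto
 from presents_Mod[OF this B NB BZ] show ?thesis by (simp add: im)
qed

subsection \<open>The spectral sequence of a filtered complex\<close>

text \<open>All degrees share one type and only the subgroups \<open>F p n\<close> vary;
  \<open>d n\<close> is additive on the whole type, but respects degrees and squares to zero on
  these subgroups. That \<open>F p n\<close> is everything for \<open>p <= 0\<close> and zero for
  \<open>p > n\<close> confines the spectral sequence to the first quadrant and makes it
  converge.\<close>

locale filtered_complex =
 fixes F :: "int => int => 'a::ab_group_add set" and d :: "int => 'a => 'a"
 assumes F_subgp: "subgp (F p n)"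
  and F_mono: "p <= p' ==> F p' n \<subseteq> F p n"
  and F_below: "p <= 0 ==> F p n = F 0 n"
  and F_above: "n < p ==> F p n = {0}"
  and d_add: "addmap (d n)"
  and d_F: "x : F p n ==> d n x : F p (n + 1)"
  and d_d: "x : F p n ==> d (n + 1) (d n x) = 0"
begin

text \<open>The classical description of the pages: \<open>Z\<close> consists of the elements of
  filtration \<open>p\<close> whose boundary has filtration \<open>p + r\<close>, and the page
  \<open>r\<close> is \<open>Z r\<close> modulo \<open>B r\<close>, where \<open>B r\<close>
  collects cycles of deeper filtration and boundaries from filtration
  \<open>p - r + 1\<close>.\<close>

definition Z :: "int => int => int => 'a set" where
 "Z r p n = {x : F p n. d n x : F (p + r) (n + 1)}"

definition B :: "int => int => int => 'a set" where
 "B r p n = {x + d (n - 1) y | x y. x : Z (r - 1) (p + 1) n & y : Z (r - 1) (p - r + 1) (n - 1)}"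

lemma Z_mono: "p <= p' ==> p + r <= p' + r' ==> Z r' p' n \<subseteq> Z r p n"
 unfolding Z_def using F_mono by blast

lemma Z_subgp: "subgp (Z r p n)"
 unfolding Z_def subgp_def
 using F_subgp addmap.zero[OF d_add] addmap.diff[OF d_add]
 by (auto simp: subgp_zero subgp_diff)

lemma BI: "x : Z (r - 1) (p + 1) n ==> y : Z (r - 1) (p - r + 1) (n - 1) ==> x + d (n - 1) y : B r p n"
 unfolding B_def by blast

lemma B_subgp: "subgp (B r p n)"
 unfolding subgp_def
proof (intro conjI ballI)
 show "0 : B r p n"
  using BI[OF subgp_zero[OF Z_subgp] subgp_zero[OF Z_subgp]] by (simp add: addmap.zero[OF d_add])
 fix x y assume "x : B r p n" "y : B r p n"
 then obtain a b a' b' where "x = a + d (n - 1) b" "a : Z (r - 1) (p + 1) n" "b : Z (r - 1) (p - r + 1) (n - 1)"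
  "y = a' + d (n - 1) b'" "a' : Z (r - 1) (p + 1) n" "b' : Z (r - 1) (p - r + 1) (n - 1)"
  unfolding B_def by blast
 thus "x - y : B r p n"
  using BI[of "a - a'" r p n "b - b'"] Z_subgp
  by (simp add: subgp_diff addmap.diff[OF d_add] algebra_simps)
qed

lemma d_Z: "y : Z r p n ==> d n y : F (p + r) (n + 1)"
 by (simp add: Z_def)

lemma dd_Z: "y : Z r p n ==> d (n + 1) (d n y) = 0"
 using d_d[of y p n] by (simp add: Z_def)

lemma d_Z_Z: "y : Z r p n ==> d n y : Z r' (p + r) (n + 1)"
 unfolding Z_def[of r'] using d_Z[of y r p n] dd_Z[of y r p n] subgp_zero[OF F_subgp] by auto

lemma B_sub_Z: "1 <= r ==> B r p n \<subseteq> Z r p n"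
proof
 fix x assume "1 <= r" "x : B r p n"
 then obtain a b where ab: "x = a + d (n - 1) b" "a : Z (r - 1) (p + 1) n" "b : Z (r - 1) (p - r + 1) (n - 1)"
  unfolding B_def by blast
 have "a : Z r p n" using ab Z_mono[of p "p + 1" r "r - 1" n] by auto
 moreover have "d (n - 1) b : Z r p n" using d_Z_Z[OF ab(3), of r] by simp
 ultimately show "x : Z r p n" using ab Z_subgp subgp_add by blast
qed

lemma d_B: "x : B r p n ==> d n x : B r (p + r) (n + 1)"
proof -
 assume "x : B r p n"
 then obtain a b where ab: "x = a + d (n - 1) b" "a : Z (r - 1) (p + 1) n" "b : Z (r - 1) (p - r + 1) (n - 1)"
  unfolding B_def by blast
 have "d n x = 0 + d n a"
  using ab dd_Z[OF ab(3)] by (simp add: addmap.add[OF d_add])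
 also have "... : B r (p + r) (n + 1)"
  using BI[of 0 r "p + r" "n + 1" a] ab(2) subgp_zero[OF Z_subgp] by (simp add: add.commute)
 finally show ?thesis .
qed

text \<open>If \<open>d x = a + d b\<close> with \<open>a\<close> one step deeper in the filtration,
  then \<open>x - b\<close> has boundary \<open>a\<close> and survives to the next page. So a cycle
  of page \<open>r\<close> is represented in \<open>Z (r + 1)\<close>.\<close>

lemma next_cycles:
 assumes "1 <= r" and x: "x : Z r p n" "d n x : B r (p + r) (n + 1)"
 shows "\<exists>b. b : B r p n & x - b : Z (r + 1) p n"
proof -
 obtain a b where ab: "d n x = a + d n b" "a : Z (r - 1) (p + r + 1) (n + 1)" "b : Z (r - 1) (p + 1) n"
  using x(2) unfolding B_def by auto
 have "d n (x - b) = a" using ab by (simp add: addmap.diff[OF d_add])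
 hence "x - b : Z (r + 1) p n"
  using ab x subgp_diff[OF F_subgp[of p n]] F_mono[of p "p + 1" n] by (auto simp: Z_def add.assoc)
 moreover have "b : B r p n"
  using BI[OF ab(3) subgp_zero[OF Z_subgp]] by (simp add: addmap.zero[OF d_add])
 ultimately show ?thesis by blast
qed

text \<open>On \<open>Z (r + 1)\<close> the new denominator is the old one together with the image
  of the differential of page \<open>r\<close>. Hence \<open>Z (r + 1)\<close> modulo
  \<open>B (r + 1)\<close> is the homology of page \<open>r\<close>.\<close>

lemma next_boundaries:
 assumes "1 <= r" and x: "x : Z (r + 1) p n"
 shows "x : B (r + 1) p n \<longleftrightarrow> (\<exists>b y. b : B r p n & y : Z r (p - r) (n - 1) & x = b + d (n - 1) y)"
proof
 assume "x : B (r + 1) p n"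
 then obtain a y where ay: "x = a + d (n - 1) y" "a : Z r (p + 1) n" "y : Z r (p - r) (n - 1)"
  unfolding B_def by (auto simp: algebra_simps)
 have "a : Z (r - 1) (p + 1) n" using ay Z_mono[of "p + 1" "p + 1" "r - 1" r n] by auto
 hence "a : B r p n"
  using BI[OF _ subgp_zero[OF Z_subgp]] by (fastforce simp: addmap.zero[OF d_add])
 thus "\<exists>b y. b : B r p n & y : Z r (p - r) (n - 1) & x = b + d (n - 1) y" using ay by blast
next
 assume "\<exists>b y. b : B r p n & y : Z r (p - r) (n - 1) & x = b + d (n - 1) y"
 then obtain a c y where y: "y : Z r (p - r) (n - 1)" "x = a + d (n - 1) c + d (n - 1) y"
  "a : Z (r - 1) (p + 1) n" "c : Z (r - 1) (p - r + 1) (n - 1)"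
  unfolding B_def by blast
 have c: "c : Z r (p - r) (n - 1)" using y(4) Z_mono[of "p - r" "p - r + 1" r "r - 1" "n - 1"] by auto
 \<comment> \<open>The remaining summands of \<open>x\<close> are boundaries, so \<open>a\<close>
   inherits from \<open>x\<close> that its boundary has filtration \<open>p + r + 1\<close>; this
   upgrades \<open>a\<close> from \<open>Z (r - 1)\<close> to \<open>Z r\<close>.\<close>
 have "d n a = d n x" using y dd_Z[OF y(1)] dd_Z[OF y(4)] by (simp add: addmap.add[OF d_add])
 hence "a : Z r (p + 1) n" using x y(3) by (simp add: Z_def algebra_simps)
 moreover have "c + y : Z r (p - r) (n - 1)" using c y(1) Z_subgp subgp_add by blast
 ultimately show "x : B (r + 1) p n"
  using BI[of a "r + 1" p n "c + y"] y by (simp add: addmap.add[OF d_add] algebra_simps)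
qed

text \<open>For \<open>p < 0\<close> the filtration steps \<open>p\<close> and \<open>p + 1\<close>
  coincide, so a cycle already counts as one of deeper filtration; for \<open>n < p\<close> there
  are no nonzero elements.\<close>

lemma Z_trivial: "p < 0 \<or> n < p ==> 1 <= r ==> Z r p n \<subseteq> B r p n"
proof
 fix x assume r: "1 <= r" and "p < 0 \<or> n < p" and x: "x : Z r p n"
 thus "x : B r p n"
 proof (elim disjE)
  assume "p < 0"
  hence "x : Z (r - 1) (p + 1) n" using x F_below[of p] F_below[of "p + 1"] by (auto simp: Z_def)
  thus ?thesis using BI[OF _ subgp_zero[OF Z_subgp]] by (fastforce simp: addmap.zero[OF d_add])
 next
  assume "n < p"
  hence "x = 0" using x F_above by (auto simp: Z_def)
  thus ?thesis using subgp_zero[OF B_subgp] by simp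
 qed
qed

text \<open>All pages are realized on the type carrying the second page, by choosing representatives.\<close>

lemma pages_exist:
 fixes E2 :: "int => int => 'e monoid"
 assumes E2: "!!p q. \<exists>f. presents (Z 2 p (p + q)) (B 2 p (p + q)) f (E2 p q)"
 shows "\<exists>(G::'e monoid) g. presents (Z (int r + 2) p n) (B (int r + 2) p n) g G"
proof (induction r)
 case 0
 show ?case using E2[of p "n - p"] by auto
next
 case (Suc r)
 let ?r = "int r + 2"
 let ?Z = "Z (?r + 1) p n" and ?B = "B (?r + 1) p n"
 obtain G :: "'e monoid" and g where g: "presents (Z ?r p n) (B ?r p n) g G" using Suc by blast
 \<comment> \<open>\<open>rh\<close> picks one element of \<open>Z (r + 1)\<close> in each class
   modulo \<open>B (r + 1)\<close>. Then \<open>g\<close> after \<open>rh\<close> depends on the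
   class only and separates classes, although \<open>g\<close> alone would identify elements modulo
   \<open>B r\<close>; so the next page gets its elements from the same type.\<close>
 define rh where "rh x = (SOME y. y : ?Z & x - y : ?B)" for x
 have rh: "rh x : ?Z" "x - rh x : ?B" if "x : ?Z" for x
  using someI_ex[of "%y. y : ?Z & x - y : ?B"] that subgp_zero[OF B_subgp]
  unfolding rh_def by (metis diff_self)+
 have rh_eq: "rh x = rh y" if "x - y : ?B" for x y
 proof -
  have "x - z : ?B \<longleftrightarrow> y - z : ?B" for z
   using subgp_diff[OF B_subgp that, of "x - z"] subgp_add[OF B_subgp that, of "y - z"]
    subgp_diff[OF B_subgp, of "x - z" "?r + 1" p n "x - y"] that by (auto simp: algebra_simps)
  thus ?thesis by (simp add: rh_def)
 qed
 have sub: "?Z \<subseteq> Z ?r p n" by (rule Z_mono) auto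
 have "g (rh x) = g (rh y) \<longleftrightarrow> x - y : ?B" if xy: "x : ?Z" "y : ?Z" for x y
 proof
  assume "g (rh x) = g (rh y)"
  hence "rh x - rh y : B ?r p n" using presents_eq[OF g] rh xy sub by blast
  moreover have "rh x - rh y : ?Z" using rh xy subgp_diff[OF Z_subgp] by blast
  moreover have "rh x - rh y = (rh x - rh y) + d (n - 1) 0" by (simp add: addmap.zero[OF d_add])
  moreover have "1 <= ?r" by simp
  ultimately have 1: "rh x - rh y : ?B"
   using next_boundaries[of ?r "rh x - rh y" p n] subgp_zero[OF Z_subgp, of ?r "p - ?r" "n - 1"] by blast
  have "(x - rh x) - (y - rh y) + (rh x - rh y) : ?B"
   by (rule subgp_add[OF B_subgp subgp_diff[OF B_subgp rh(2)[OF xy(1)] rh(2)[OF xy(2)]] 1])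
  thus "x - y : ?B" by (simp add: algebra_simps)
 qed (simp add: rh_eq)
 hence "\<exists>G. presents ?Z ?B (%x. g (rh x)) G"
  by (intro presents_any Z_subgp B_subgp B_sub_Z) auto
 thus ?case by (auto simp: add.commute)
qed

text \<open>Every page is presented by \<open>Z r\<close> modulo \<open>B r\<close>, so
  \<open>d\<close> itself induces all differentials. Homology of a page and graded pieces of
  \<open>H n\<close> then become comparisons of subquotients of the filtered complex.\<close>

theorem spectral_sequence_exists:
 fixes E2 :: "int => int => 'e monoid" and H :: "nat => 'h monoid"
 assumes E2: "!!p q. \<exists>f. presents (Z 2 p (p + q)) (B 2 p (p + q)) f (E2 p q)"
  and H: "!!n. \<exists>f. presents {x : F 0 (int n). d (int n) x = 0} (d (int n - 1) ` F 0 (int n - 1)) f (H n)"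
 shows "\<exists>E d'. first_quadrant_ss E d' & (\<forall>p q. E 2 p q = E2 p q) & ss_converges E H"
proof -
 let ?Y = "%r p q. Z (int r) p (p + q)" and ?X = "%r p q. B (int r) p (p + q)"
 \<comment> \<open>At \<open>r = 2\<close> the page has to be the given group itself and not an
   isomorphic copy; below \<open>2\<close> it is arbitrary.\<close>
 have "\<exists>G g. 2 <= r --> presents (?Y r p q) (?X r p q) g (G::'e monoid) & (r = 2 --> G = E2 p q)"
  for r p q
 proof (cases "2 < r")
  case True
  thus ?thesis using pages_exist[OF E2, of "r - 2" p "p + q"] by (auto simp: of_nat_diff)
 next
  case False
  thus ?thesis using E2[of p q] by (cases "r = 2") auto
 qed
 then obtain E :: "nat => int => int => 'e monoid" and g where
  g: "!!r p q. 2 <= r ==> presents (?Y r p q) (?X r p q) (g r p q) (E r p q)"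
  and E_2: "!!p q. E 2 p q = E2 p q" by (metis order_refl)
 \<comment> \<open>A choice of representatives. Changing a representative by \<open>B r\<close>
   changes its boundary by an element of \<open>B r\<close> again (\<open>d_B\<close>), so
   \<open>d'\<close> is independent of the choice.\<close>
 define s where "s r p q h = inv_into (?Y r p q) (g r p q) h" for r p q h
 define d' where "d' r p q h = g r (p + int r) (q - int r + 1) (d (p + q) (s r p q h))" for r p q h
 have dZ: "d (p + q) x : Z (int r) (p + int r) (p + int r + (q - int r + 1))"
  if "x : ?Y r p q" for x r p q
  using d_Z_Z[OF that, of "int r"] by (simp add: algebra_simps)
 have dB: "d (p + q) x : B (int r) (p + int r) (p + int r + (q - int r + 1))"
  if "x : ?X r p q" for x r p q
  using d_B[OF that] by (simp add: algebra_simps)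
 have d': "d' r p q (g r p q x) = g r (p + int r) (q - int r + 1) (d (p + q) x)"
  if r: "2 <= r" and x: "x : ?Y r p q" for r p q x
 proof -
  let ?y = "s r p q (g r p q x)"
  have y: "?y : ?Y r p q" "g r p q ?y = g r p q x"
   using x unfolding s_def by (auto simp: inv_into_into f_inv_into_f)
  hence "?y - x : ?X r p q" using presents_eq[OF g[OF r]] x by blast
  from dB[OF this] show ?thesis
   using presents_eq[OF g[OF r] dZ[OF y(1)] dZ[OF x]] by (simp add: d'_def addmap.diff[OF d_add])
 qed
 have one: "d' r p q h : carrier (E r (p + int r) (q - int r + 1))" if r: "2 <= r" and h: "h : carrier (E r p q)" for r p q h
 proof -
  obtain x where "x : ?Y r p q" "h = g r p q x" using presents_surj[OF g[OF r] h] by metis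
  thus ?thesis using d'[OF r] presentsD(5)[OF g[OF r] dZ] by metis
 qed
 have 1: "first_quadrant_ss E d'"
  unfolding first_quadrant_ss_def
 proof (intro allI impI conjI ballI)
  fix r :: nat and p q :: int assume r: "2 <= r"
  note gr = g[OF r]
  show "comm_group (E r p q)" by (rule presentsD(3)[OF gr])
  show "carrier (E r p q) = {\<one>\<^bsub>E r p q\<^esub>}" if "p < 0 \<or> q < 0"
  proof -
   have "?Y r p q \<subseteq> ?X r p q" using that r by (intro Z_trivial) auto
   hence "g r p q ` ?Y r p q \<subseteq> {\<one>\<^bsub>E r p q\<^esub>}"
    using presentsD(7)[OF gr[of p q]] by (auto simp: subset_iff)
   moreover have "g r p q 0 : g r p q ` ?Y r p q" using subgp_zero[OF Z_subgp] by (rule imageI)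
   ultimately show ?thesis unfolding presentsD(4)[OF gr[of p q], symmetric] by (metis empty_iff subset_singleton_iff)
  qed
  show "d' r p q : hom (E r p q) (E r (p + int r) (q - int r + 1))"
  proof (rule homI)
   fix h k assume "h : carrier (E r p q)" "k : carrier (E r p q)"
   then obtain x y where x: "x : ?Y r p q" "h = g r p q x"
    and y: "y : ?Y r p q" "k = g r p q y" using presents_surj[OF gr] by metis
   have "d' r p q (g r p q (x + y)) = g r (p + int r) (q - int r + 1) (d (p + q) x + d (p + q) y)"
    using d'[OF r] x y subgp_add[OF Z_subgp] by (simp add: addmap.add[OF d_add])
   also have "... = d' r p q h \<otimes>\<^bsub>E r (p + int r) (q - int r + 1)\<^esub> d' r p q k"
    using x y dZ presentsD(6)[OF gr] d'[OF r] by metis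
   finally show "d' r p q (h \<otimes>\<^bsub>E r p q\<^esub> k) = d' r p q h \<otimes>\<^bsub>E r (p + int r) (q - int r + 1)\<^esub> d' r p q k"
    using x y presentsD(6)[OF gr] by metis
  qed (rule one[OF r])
  show "d' r (p + int r) (q - int r + 1) (d' r p q h) = \<one>\<^bsub>E r (p + 2 * int r) (q - 2 * int r + 2)\<^esub>"
   if h: "h : carrier (E r p q)" for h
  proof -
   obtain x where x: "x : ?Y r p q" "h = g r p q x" using presents_surj[OF gr h] by metis
   have "d (p + int r + (q - int r + 1)) (d (p + q) x) = 0"
    using dd_Z[OF x(1)] by (simp add: algebra_simps)
   hence "d' r (p + int r) (q - int r + 1) (d' r p q h) =
     g r (p + int r + int r) (q - int r + 1 - int r + 1) 0"
    using x d'[OF r x(1)] d'[OF r dZ[OF x(1)]] by simp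
   also have "... = \<one>\<^bsub>E r (p + int r + int r) (q - int r + 1 - int r + 1)\<^esub>"
    by (rule presents_zero(1)[OF gr])
   finally show ?thesis
    using arg_cong2[of "p + int r + int r" "p + 2 * int r" "q - int r + 1 - int r + 1" "q - 2 * int r + 2" "E r"]
    by simp
  qed
  let ?p = "p - int r" and ?q = "q + int r - 1"
  have i: "?p + int r = p" "?q - int r + 1 = q" "?p + ?q = p + q - 1"
   "p + int r + (q - int r + 1) = p + q + 1" by auto
  let ?K = "{x : ?Y r p q. d (p + q) x : B (int r) (p + int r) (p + q + 1)}"
  let ?N = "{n + d (p + q - 1) x | n x. n : ?X r p q & x : Z (int r) ?p (p + q - 1)}"
  let ?H = "E r p q\<lparr>carrier := kernel (E r p q) (E r (p + int r) (q - int r + 1)) (d' r p q)\<rparr>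
   Mod d' r ?p ?q ` carrier (E r ?p ?q)"
  have dd0: "d (p + q) (d (p + q - 1) x) = 0" if "x : Z (int r) ?p (p + q - 1)" for x
   using dd_Z[OF that] by simp
  have P: "presents ?K ?N (%x. d' r ?p ?q ` carrier (E r ?p ?q) #>\<^bsub>E r p q\<lparr>carrier :=
    kernel (E r p q) (E r (p + int r) (q - int r + 1)) (d' r p q)\<rparr>\<^esub> g r p q x) ?H"
   using gr[of ?p ?q] gr[of p q] gr[of "p + int r" "q - int r + 1"] d_add d_add
   unfolding i
  proof (rule presents_homology)
   show "d (p + q - 1) x : ?Y r p q" if "x : Z (int r) ?p (p + q - 1)" for x
    using d_Z_Z[OF that, of "int r"] by simp
   show "d (p + q) x : Z (int r) (p + int r) (p + q + 1)" if "x : ?Y r p q" for x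
    using d_Z_Z[OF that, of "int r"] by simp
   show "d (p + q) x : B (int r) (p + int r) (p + q + 1)" if "x : ?X r p q" for x
    using d_B[OF that] by simp
   show "d (p + q) (d (p + q - 1) x) : B (int r) (p + int r) (p + q + 1)" if "x : Z (int r) ?p (p + q - 1)" for x
    using dd0[OF that] subgp_zero[OF B_subgp] by simp
   show "d' r ?p ?q (g r ?p ?q x) = g r p q (d (p + q - 1) x)" if "x : Z (int r) ?p (p + q - 1)" for x
    using d'[OF r, of x ?p ?q] that unfolding i by simp
   show "d' r p q (g r p q x) = g r (p + int r) (q - int r + 1) (d (p + q) x)" if "x : ?Y r p q" for x
    by (rule d'[OF r that])
  qed
  have r1: "1 <= int r" using r by simp
  have BK: "?X r p q \<subseteq> ?K" using B_sub_Z[OF r1] d_B by auto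
  have ZK: "Z (int r + 1) p (p + q) \<subseteq> ?K"
  proof
   fix x assume x: "x : Z (int r + 1) p (p + q)"
   have 1: "x : ?Y r p q" using x Z_mono[of p p "int r" "int r + 1"] by auto
   have "d (p + q) x : Z (int r - 1) (p + int r + 1) (p + q + 1)"
    using d_Z_Z[OF x, of "int r - 1"] by (simp add: add.assoc)
   hence "d (p + q) x : B (int r) (p + int r) (p + q + 1)"
    using BI[OF _ subgp_zero[OF Z_subgp]] by (fastforce simp: addmap.zero[OF d_add])
   thus "x : ?K" using 1 by simp
  qed
  \<comment> \<open>The homology \<open>?H\<close> is presented by \<open>?K\<close> modulo
    \<open>?N\<close>. Congruence modulo \<open>B r\<close> relates this to the next page:
    \<open>next_cycles\<close> finds representatives in \<open>Z (r + 1)\<close>, and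
    \<open>next_boundaries\<close> matches the denominators.\<close>
  have "\<exists>f. presents (Z (int r + 1) p (p + q)) (B (int r + 1) p (p + q)) f ?H"
  proof (rule presents_rel[where R = "%y x. y - x : ?X r p q", OF P Z_subgp])
   show "B (int r + 1) p (p + q) \<subseteq> Z (int r + 1) p (p + q)" by (rule B_sub_Z) simp
   show "\<exists>x\<in>?K. y - x : ?X r p q" if "y : Z (int r + 1) p (p + q)" for y
    using that ZK subgp_zero[OF B_subgp] by (intro bexI[of _ y]) auto
   show "\<exists>y\<in>Z (int r + 1) p (p + q). y - x : ?X r p q" if x: "x : ?K" for x
   proof -
    obtain b where "b : ?X r p q" "x - b : Z (int r + 1) p (p + q)"
     using next_cycles[OF r1, of x p "p + q"] x by blast
    thus ?thesis using subgp_minus[OF B_subgp, of b] by (intro bexI[of _ "x - b"]) auto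
   qed
   show "(y - y') - (x - x') : ?X r p q"
    if "y - x : ?X r p q" "y' - x' : ?X r p q" for y y' x x'
    using subgp_diff[OF B_subgp that] by (simp add: algebra_simps)
   fix y x assume yx: "y - x : ?X r p q" and y: "y : Z (int r + 1) p (p + q)" and x: "x : ?K"
   have "y : B (int r + 1) p (p + q) \<longleftrightarrow> y : ?N"
    unfolding next_boundaries[OF r1 y] by auto
   also have "... \<longleftrightarrow> x : ?N"
   proof -
    have *: "u : ?N" if "v : ?N" "u - v : ?X r p q" for u v
    proof -
     obtain n z where "v = n + d (p + q - 1) z" "n : ?X r p q" "z : Z (int r) ?p (p + q - 1)"
      using \<open>v : ?N\<close> by blast
     hence "u = (n + (u - v)) + d (p + q - 1) z" "n + (u - v) : ?X r p q"
      "z : Z (int r) ?p (p + q - 1)"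
      using that subgp_add[OF B_subgp, of n "int r" p "p + q" "u - v"] by auto
     thus ?thesis by blast
    qed
    have "x - y : ?X r p q" using subgp_minus[OF B_subgp yx] by simp
    thus ?thesis using * yx by blast
   qed
   finally show "y : B (int r + 1) p (p + q) \<longleftrightarrow> x : ?N" .
  qed
  then obtain f where f: "presents (Z (int r + 1) p (p + q)) (B (int r + 1) p (p + q)) f ?H" by blast
  have "presents (Z (int r + 1) p (p + q)) (B (int r + 1) p (p + q)) (g (Suc r) p q) (E (Suc r) p q)"
   using g[of "Suc r" p q] r by (simp add: add.commute)
  thus "E (Suc r) p q \<cong> ?H" using presents_iso f by blast
 qed
 have 2: "ss_converges E H"
  unfolding ss_converges_def
 proof (intro allI conjI)
  fix n
  let ?Z = "{x : F 0 (int n). d (int n) x = 0}" and ?B = "d (int n - 1) ` F 0 (int n - 1)"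
  obtain f where f: "presents ?Z ?B f (H n)" using H by blast
  show "comm_group (H n)" by (rule presentsD(3)[OF f])
  define ZF where "ZF p = {x : F p (int n). d (int n) x = 0}" for p
  have ZF: "subgp (ZF p)" for p
   unfolding ZF_def subgp_def using F_subgp
   by (auto simp: addmap.zero[OF d_add] addmap.diff[OF d_add] subgp_zero subgp_diff)
  \<comment> \<open>The cocycles that are cohomologous to one of filtration \<open>p\<close>; their
    classes form the filtration step of \<open>H n\<close>.\<close>
  define BF where "BF p = {x + b | x b. x : ZF p & b : ?B}" for p
  have Bs: "subgp ?B" by (rule presents_subgp[OF f])
  have BFs: "subgp (BF p)" for p
   unfolding subgp_def
  proof (intro conjI ballI)
   show "0 : BF p" using subgp_zero[OF Bs] subgp_zero[OF ZF] unfolding BF_def by force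
   fix x y assume "x : BF p" "y : BF p"
   then obtain a b a' b' where "x = a + b" "y = a' + b'" "a : ZF p" "a' : ZF p" "b : ?B" "b' : ?B"
    unfolding BF_def by blast
   hence "x - y = (a - a') + (b - b')" "a - a' : ZF p" "b - b' : ?B"
    using subgp_diff[OF ZF] subgp_diff[OF Bs] by auto
   thus "x - y : BF p" unfolding BF_def by blast
  qed
  have ZF0: "ZF p \<subseteq> ?Z" for p
   unfolding ZF_def using F_below[of "min p 0" "int n"] F_mono[of "min p 0" p "int n"] by auto
  have BFZ: "BF p \<subseteq> ?Z" for p
   unfolding BF_def using ZF0 presentsD(2)[OF f] subgp_add[OF presentsD(1)[OF f]] by blast
  have ZB: "ZF p \<subseteq> BF p" for p using subgp_zero[OF Bs] unfolding BF_def by force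
  have BB: "?B \<subseteq> BF p" for p using subgp_zero[OF ZF] unfolding BF_def by force
  have BFm: "BF (int (Suc p)) \<subseteq> BF (int p)" for p
   using F_mono[of "int p" "int (Suc p)" "int n"] unfolding BF_def ZF_def by auto
  define FH where "FH p = f ` BF (int p)" for p :: nat
  show "\<exists>F. F 0 = carrier (H n) & F (Suc n) = {\<one>\<^bsub>H n\<^esub>} &
      (\<forall>p\<le>n. subgroup (F p) (H n) & F (Suc p) \<subseteq> F p &
        (\<exists>r\<^sub>0\<ge>2. \<forall>r\<ge>r\<^sub>0. E r (int p) (int n - int p) \<cong> H n\<lparr>carrier := F p\<rparr> Mod F (Suc p)))"
  proof (intro exI[of _ FH] conjI allI impI)
   have "BF 0 = ?Z" using BFZ[of 0] ZB[of 0] by (auto simp: ZF_def)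
   thus "FH 0 = carrier (H n)" using presentsD(4)[OF f] by (simp add: FH_def)
   have "F (int (Suc n)) (int n) = {0}" by (rule F_above) simp
   hence "ZF (int (Suc n)) = {0}"
    unfolding ZF_def using addmap.zero[OF d_add[of "int n"]] by blast
   hence "BF (int (Suc n)) = ?B" by (auto simp: BF_def)
   hence "FH (Suc n) = f ` ?B" by (simp add: FH_def)
   also have "... = (%_. \<one>\<^bsub>H n\<^esub>) ` ?B"
    using presentsD(7)[OF f subsetD[OF presentsD(2)[OF f]]] by (intro image_cong) simp_all
   also have "... = {\<one>\<^bsub>H n\<^esub>}"
    by (rule image_constant[OF subgp_zero[OF Bs]])
   finally show "FH (Suc n) = {\<one>\<^bsub>H n\<^esub>}" .
   fix p assume p: "p <= n"
   note sub = presents_sub[OF f BFs BB BFZ, of "int p"]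
   show "subgroup (FH p) (H n)" using sub(2) by (simp add: FH_def)
   show "FH (Suc p) \<subseteq> FH p" using BFm by (auto simp: FH_def)
   have Q: "\<exists>f'. presents (BF (int p)) (BF (int (Suc p))) f' (H n\<lparr>carrier := FH p\<rparr> Mod FH (Suc p))"
    using presents_Mod[OF sub(1) BFs BB BFm] unfolding FH_def by blast
   show "\<exists>r\<^sub>0\<ge>2. \<forall>r\<ge>r\<^sub>0. E r (int p) (int n - int p) \<cong> H n\<lparr>carrier := FH p\<rparr> Mod FH (Suc p)"
   \<comment> \<open>For such \<open>r\<close> and \<open>p <= n\<close> the filtration step
     \<open>p + r\<close> in degree \<open>n + 1\<close> is zero, and the step
     \<open>p - r + 1\<close> in degree \<open>n - 1\<close> is everything. So \<open>Z r\<close>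
     consists of all cocycles of filtration \<open>p\<close>, and \<open>B r\<close> sees all
     coboundaries.\<close>
   proof (intro exI[of _ "n + 3"] conjI allI impI)
    fix r assume r: "n + 3 <= r"
    have "F (int p + int r) (int n + 1) = {0}" using r by (intro F_above) auto
    hence Zr: "Z (int r) (int p) (int n) = ZF (int p)" by (auto simp: Z_def ZF_def)
    have "F (int p + 1 + (int r - 1)) (int n + 1) = {0}" using r by (intro F_above) auto
    hence Zr': "Z (int r - 1) (int p + 1) (int n) = ZF (int p + 1)" by (auto simp: Z_def ZF_def)
    have "F (int p - int r + 1) (int n - 1) = F 0 (int n - 1)" using r p by (intro F_below) auto
    hence Zb: "Z (int r - 1) (int p - int r + 1) (int n - 1) =
      {y : F 0 (int n - 1). d (int n - 1) y : F (int p) (int n)}" by (simp add: Z_def)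
    have dB0: "d (int n) b = 0" if "b : ?B" for b
     using that d_d[of _ 0 "int n - 1"] by auto
    have Br: "B (int r) (int p) (int n) = BF (int (Suc p)) \<inter> ZF (int p)"
    proof
     show "B (int r) (int p) (int n) \<subseteq> BF (int (Suc p)) \<inter> ZF (int p)"
     proof
      fix x assume x: "x : B (int r) (int p) (int n)"
      hence "x : BF (int (Suc p))"
       unfolding B_def Zr' Zb BF_def by (auto simp: add.commute)
      moreover have "x : ZF (int p)" using B_sub_Z[of "int r" "int p" "int n"] x r Zr by auto
      ultimately show "x : BF (int (Suc p)) \<inter> ZF (int p)" by blast
     qed
     show "BF (int (Suc p)) \<inter> ZF (int p) \<subseteq> B (int r) (int p) (int n)"
     proof
      fix x assume x: "x : BF (int (Suc p)) \<inter> ZF (int p)"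
      then obtain a y where ay: "x = a + d (int n - 1) y" "a : ZF (int p + 1)" "y : F 0 (int n - 1)"
       by (auto simp: BF_def add.commute)
      hence "d (int n - 1) y = x - a" by simp
      moreover have "a : F (int p) (int n)"
       using ay(2) F_mono[of "int p" "int p + 1" "int n"] by (auto simp: ZF_def)
      moreover have "x : F (int p) (int n)" using x by (simp add: ZF_def)
      ultimately have "d (int n - 1) y : F (int p) (int n)" using F_subgp subgp_diff by metis
      thus "x : B (int r) (int p) (int n)"
       unfolding ay(1) using ay by (intro BI) (auto simp: Zr' Zb)
     qed
    qed
    obtain f' where f': "presents (BF (int p)) (BF (int (Suc p))) f' (H n\<lparr>carrier := FH p\<rparr> Mod FH (Suc p))"
     using Q by blast
    \<comment> \<open>The second isomorphism theorem: \<open>BF p\<close> is \<open>ZF p\<close>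
      plus coboundaries, and the coboundaries all lie in \<open>BF (p + 1)\<close>.\<close>
    have "\<exists>f. presents (ZF (int p)) (BF (int (Suc p)) \<inter> ZF (int p)) f (H n\<lparr>carrier := FH p\<rparr> Mod FH (Suc p))"
    proof (rule presents_rel[where R = "%y x. y - x : BF (int (Suc p))", OF f' ZF])
     show "\<exists>x\<in>BF (int p). y - x : BF (int (Suc p))" if "y : ZF (int p)" for y
      using that ZB subgp_zero[OF BFs] by (intro bexI[of _ y]) auto
     show "\<exists>y\<in>ZF (int p). y - x : BF (int (Suc p))" if x: "x : BF (int p)" for x
     proof -
      obtain a b where "x = a + b" "a : ZF (int p)" "b : ?B" using x unfolding BF_def by blast
      thus ?thesis using subgp_minus[OF Bs] BB by (intro bexI[of _ a]) auto
     qed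
     show "(y - y') - (x - x') : BF (int (Suc p))"
      if "y - x : BF (int (Suc p))" "y' - x' : BF (int (Suc p))" for y y' x x'
      using subgp_diff[OF BFs that] by (simp add: algebra_simps)
     show "y : BF (int (Suc p)) \<inter> ZF (int p) \<longleftrightarrow> x : BF (int (Suc p))"
      if "y - x : BF (int (Suc p))" "y : ZF (int p)" for y x
      using that subgp_add[OF BFs that(1), of x] subgp_diff[OF BFs _ that(1), of y] by auto
    qed auto
    then obtain f'' where f'': "presents (ZF (int p)) (BF (int (Suc p)) \<inter> ZF (int p)) f'' (H n\<lparr>carrier := FH p\<rparr> Mod FH (Suc p))"
     by blast
    have "presents (Z (int r) (int p) (int n)) (B (int r) (int p) (int n)) (g r (int p) (int n - int p)) (E r (int p) (int n - int p))"
     using g[of r "int p" "int n - int p"] r by simp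
    thus "E r (int p) (int n - int p) \<cong> H n\<lparr>carrier := FH p\<rparr> Mod FH (Suc p)"
     using f'' unfolding Zr Br by (rule presents_iso)
   qed simp
  qed
 qed
 show ?thesis using 1 2 E_2 by blast
qed

end

subsection \<open>First quadrant double complexes\<close>

text \<open>The two differentials anticommute, so that their plain sum squares to zero on the total
  complex.\<close>

locale double_complex =
 fixes D :: "int => int => 'a::ab_group_add set" and h v :: "int => int => 'a => 'a"
 assumes D_subgp: "subgp (D p q)"
  and D_neg: "p < 0 \<or> q < 0 ==> D p q = {0}"
  and h_add: "addmap (h p q)" and v_add: "addmap (v p q)"
  and h_D: "x : D p q ==> h p q x : D (p + 1) q"
  and v_D: "x : D p q ==> v p q x : D p (q + 1)"
  and h_h: "x : D p q ==> h (p + 1) q (h p q x) = 0"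
  and v_v: "x : D p q ==> v p (q + 1) (v p q x) = 0"
  and v_h: "x : D p q ==> v (p + 1) q (h p q x) = - h p (q + 1) (v p q x)"
begin

lemmas h_zero [simp] = addmap.zero[OF h_add]
lemmas v_zero [simp] = addmap.zero[OF v_add]
lemmas D_zero [simp] = subgp_zero[OF D_subgp]

text \<open>A total cochain of degree \<open>n\<close> is a family indexed by the column
  \<open>k\<close> alone, its row being \<open>n - k\<close>; the filtration is by columns.\<close>

definition TF :: "int => int => (int => 'a) set" where
 "TF p n = {x. \<forall>k. x k : D k (n - k) & (k < p --> x k = 0)}"

definition Td :: "int => (int => 'a) => int => 'a" where
 "Td n x k = h (k - 1) (n - k + 1) (x (k - 1)) + v k (n - k) (x k)"

lemma TF_D: "x : TF p n ==> m = n - k ==> x k : D k m"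
 by (simp add: TF_def)

lemma TF_zero: "x : TF p n ==> k < p ==> x k = 0"
 by (simp add: TF_def)

lemma Td_D:
 assumes "x : TF p n"
 shows "Td n x k : D k (n + 1 - k)"
proof -
 have "h (k - 1) (n - k + 1) (x (k - 1)) : D k (n + 1 - k)"
  using h_D[OF TF_D[OF assms], of "n - k + 1" "k - 1"] by (simp add: algebra_simps)
 moreover have "v k (n - k) (x k) : D k (n + 1 - k)"
  using v_D[OF TF_D[OF assms], of "n - k" k] by (simp add: algebra_simps)
 ultimately show ?thesis unfolding Td_def by (rule subgp_add[OF D_subgp])
qed

lemma Td_add: "addmap (Td n)"
 by unfold_locales (auto simp: Td_def addmap.add[OF h_add] addmap.add[OF v_add] fun_eq_iff)

sublocale filtered_complex TF Td
proof
 show "subgp (TF p n)" for p n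
  using D_subgp by (auto simp: TF_def subgp_def)
 show "p <= p' ==> TF p' n \<subseteq> TF p n" for p p' n
  by (auto simp: TF_def)
 show "p <= 0 ==> TF p n = TF 0 n" for p n
  using D_neg by (auto simp: TF_def)
 show "TF p n = {0}" if "n < p" for p n
 proof
  show "TF p n \<subseteq> {0}"
  proof
   fix x assume x: "x : TF p n"
   have "x k = 0" for k
   proof (cases "k < p")
    case False
    hence "D k (n - k) = {0}" using that by (intro D_neg) auto
    thus ?thesis using TF_D[OF x, of "n - k" k] by simp
   qed (use TF_zero[OF x] in simp)
   thus "x : {0}" by (simp add: fun_eq_iff)
  qed
 qed (simp add: TF_def)
 show "Td n (x + y) = Td n x + Td n y" for n x y
  by (rule addmap.add[OF Td_add])
 show "Td n x : TF p (n + 1)" if "x : TF p n" for x p n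
  using Td_D[OF that] TF_zero[OF that] by (auto simp: TF_def Td_def)
 show "Td (n + 1) (Td n x) = 0" if x: "x : TF p n" for x p n
 proof
  fix k
  have 1: "h (k - 1) (n + 1 - k + 1) (h (k - 2) (n - k + 2) (x (k - 2))) = 0"
   using h_h[OF TF_D[OF x], of "n - k + 2" "k - 2"] by (simp add: algebra_simps)
  have 2: "v k (n + 1 - k) (v k (n - k) (x k)) = 0"
   using v_v[OF TF_D[OF x], of "n - k" k] by (simp add: algebra_simps)
  have 3: "v k (n + 1 - k) (h (k - 1) (n - k + 1) (x (k - 1))) =
    - h (k - 1) (n + 1 - k + 1) (v (k - 1) (n - k + 1) (x (k - 1)))"
   using v_h[OF TF_D[OF x], of "n - k + 1" "k - 1"] by (simp add: algebra_simps)
  have 4: "Td n x (k - 1) = h (k - 2) (n - k + 2) (x (k - 2)) + v (k - 1) (n - k + 1) (x (k - 1))"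
   by (simp add: Td_def algebra_simps)
  show "Td (n + 1) (Td n x) k = 0 k"
   unfolding Td_def[of "n + 1"] 4 Td_def[of n x k]
   by (simp only: addmap.add[OF h_add] addmap.add[OF v_add] 1 2 3) simp
 qed
qed

definition sgl :: "int => 'a => int => 'a" where
 "sgl p x = (%k. if k = p then x else 0)"

lemma sgl_TF: "x : D p (n - p) ==> p' <= p ==> sgl p x : TF p' n"
 by (auto simp: TF_def sgl_def)

lemma Td_sgl: "Td n (sgl p x) = sgl p (v p (n - p) x) + sgl (p + 1) (h p (n - p) x)"
 by (auto simp: Td_def sgl_def fun_eq_iff)

text \<open>The column cohomology \<open>C p\<close> is the first page in row \<open>q\<close>, and
  \<open>de\<close> is its differential. A cycle of \<open>Z 2\<close> is compared with its leading
  component \<open>y p\<close>: that \<open>y p\<close> is a vertical cocycle and that its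
  horizontal image is a vertical coboundary are the two leading conditions on
  \<open>Td y\<close>.\<close>

lemma second_page:
 fixes C :: "int => 'c monoid"
 assumes C: "!!p. presents {x : D p q. v p q x = 0} (v p (q - 1) ` D p (q - 1)) (Tt p) (C p)"
  and de: "!!p x. x : D p q ==> v p q x = 0 ==> de p (Tt p x) = Tt (p + 1) (h p q x)"
 shows "\<exists>f. presents (Z 2 p (p + q)) (B 2 p (p + q)) f
  (C p\<lparr>carrier := kernel (C p) (C (p + 1)) (de p)\<rparr> Mod de (p - 1) ` carrier (C (p - 1)))"
proof -
 let ?Zv = "%p. {x : D p q. v p q x = 0}" and ?Bv = "%p. v p (q - 1) ` D p (q - 1)"
 let ?H = "C p\<lparr>carrier := kernel (C p) (C (p + 1)) (de p)\<rparr> Mod de (p - 1) ` carrier (C (p - 1))"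
 let ?K = "{x : ?Zv p. h p q x : ?Bv (p + 1)}"
 let ?N = "{n + h (p - 1) q x | n x. n : ?Bv p & x : ?Zv (p - 1)}"
 have hZ: "h p q x : ?Zv (p + 1)" if "x : ?Zv p" for x p
  using that v_h[of x p q] h_D[of x p q] by simp
 have hB: "h p q x : ?Bv (p + 1)" if "x : ?Bv p" for x p
 proof -
  obtain y where y: "x = v p (q - 1) y" "y : D p (q - 1)" using \<open>x : ?Bv p\<close> by blast
  have "h p q x = v (p + 1) (q - 1) (h p (q - 1) (- y))"
   using v_h[OF y(2)] y by (simp add: addmap.minus[OF h_add] addmap.minus[OF v_add])
  moreover have "h p (q - 1) (- y) : D (p + 1) (q - 1)"
   by (rule h_D[OF subgp_minus[OF D_subgp y(2)]])
  ultimately show ?thesis by blast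
 qed
 have P: "presents ?K ?N
   (%x. de (p - 1) ` carrier (C (p - 1)) #>\<^bsub>C p\<lparr>carrier := kernel (C p) (C (p + 1)) (de p)\<rparr>\<^esub> Tt p x) ?H"
 proof (rule presents_homology[OF C C C h_add h_add])
  show "h (p - 1) q x : ?Zv p" if "x : ?Zv (p - 1)" for x
   using hZ[OF that] by simp
  show "h p q (h (p - 1) q x) : ?Bv (p + 1)" if "x : ?Zv (p - 1)" for x
   using h_h[of x "p - 1" q] that by (auto intro!: image_eqI[of _ _ 0])
  show "de (p - 1) (Tt (p - 1) x) = Tt p (h (p - 1) q x)" if "x : ?Zv (p - 1)" for x
   using that de[of x "p - 1"] by simp
 qed (use hZ hB de in auto)
 have TdZ: "Td n x k = 0" if "x : Z r p' n" "k < p' + r" for x r p' n k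
  using that by (auto simp: Z_def TF_def)
 have y0: "y k = 0" if "y : Z r p' n" "k < p'" for y k r p' n
  using that by (auto simp: Z_def TF_def)
 have yD: "y k : D k m" if "y : Z r p' n" "m = n - k" for y k r p' n m
  using that by (auto simp: Z_def TF_def)
 have "\<exists>f. presents (Z 2 p (p + q)) (B 2 p (p + q)) f ?H"
 proof (rule presents_rel[where R = "%y x. y p = x", OF P Z_subgp])
  show "B 2 p (p + q) \<subseteq> Z 2 p (p + q)" by (rule B_sub_Z) simp
  show "\<exists>x\<in>?K. y p = x" if y: "y : Z 2 p (p + q)" for y
  proof -
   have 1: "v p q (y p) = 0" using TdZ[OF y, of p] y0[OF y, of "p - 1"] by (simp add: Td_def)
   have "h p q (y p) = - v (p + 1) (q - 1) (y (p + 1))"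
    using TdZ[OF y, of "p + 1"] by (simp add: Td_def eq_neg_iff_add_eq_0)
   also have "... = v (p + 1) (q - 1) (- y (p + 1))" by (simp add: addmap.minus[OF v_add])
   finally have "h p q (y p) : ?Bv (p + 1)"
    using subgp_minus[OF D_subgp yD[OF y, of "q - 1" "p + 1"]] by auto
   thus ?thesis using 1 yD[OF y, of q p] by auto
  qed
  show "\<exists>y\<in>Z 2 p (p + q). y p = x" if x: "x : ?K" for x
  proof -
   obtain w where w: "h p q x = v (p + 1) (q - 1) w" "w : D (p + 1) (q - 1)" using x by blast
   \<comment> \<open>The second component cancels the horizontal boundary of \<open>x\<close> in
     column \<open>p + 1\<close>, so that \<open>Td ?y\<close> begins in column
     \<open>p + 2\<close>.\<close>
   let ?y = "sgl p x - sgl (p + 1) w"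
   have yF: "?y : TF p (p + q)"
    using x w by (intro subgp_diff[OF F_subgp] sgl_TF) auto
   have "Td (p + q) ?y = - sgl (p + 2) (h (p + 1) (q - 1) w)"
    unfolding addmap.diff[OF Td_add] Td_sgl using x w
    by (auto simp: fun_eq_iff sgl_def diff_add_eq_diff_diff_swap)
   moreover have "- sgl (p + 2) (h (p + 1) (q - 1) w) : TF (p + 2) (p + q + 1)"
    using h_D[OF w(2)] by (intro subgp_minus[OF F_subgp] sgl_TF) (auto simp: algebra_simps)
   ultimately have "?y : Z 2 p (p + q)" using yF by (simp add: Z_def)
   thus ?thesis by (intro bexI[of _ ?y]) (auto simp: sgl_def)
  qed
  fix y x assume yx: "y p = x" and y: "y : Z 2 p (p + q)"
  show "y : B 2 p (p + q) \<longleftrightarrow> x : ?N"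
  proof
   assume "y : B 2 p (p + q)"
   then obtain a z where az: "y = a + Td (p + q - 1) z" "a : Z 1 (p + 1) (p + q)" "z : Z 1 (p - 1) (p + q - 1)"
    unfolding B_def by auto
   have "v (p - 1) q (z (p - 1)) = 0"
    using TdZ[OF az(3), of "p - 1"] y0[OF az(3), of "p - 2"] by (simp add: Td_def)
   moreover have "x = v p (q - 1) (z p) + h (p - 1) q (z (p - 1))"
    using yx az(1) y0[OF az(2), of p] by (simp add: Td_def algebra_simps)
   moreover have "z (p - 1) : D (p - 1) q" "z p : D p (q - 1)"
    using yD[OF az(3), of q "p - 1"] yD[OF az(3), of "q - 1" p] by auto
   ultimately show "x : ?N" by blast
  next
   assume "x : ?N"
   then obtain b c where bc: "x = v p (q - 1) b + h (p - 1) q c" "b : D p (q - 1)"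
    "c : D (p - 1) q" "v (p - 1) q c = 0" by auto
   \<comment> \<open>As \<open>c\<close> is a vertical cocycle, \<open>Td ?z\<close> lives in the
     columns \<open>p\<close> and \<open>p + 1\<close>, with component \<open>x\<close> in column
     \<open>p\<close>. Subtracting it pushes \<open>y\<close> into filtration
     \<open>p + 1\<close>.\<close>
   let ?z = "sgl (p - 1) c + sgl p b"
   have zF: "?z : TF (p - 1) (p + q - 1)"
    using bc by (intro subgp_add[OF F_subgp] sgl_TF) auto
   have Tz: "Td (p + q - 1) ?z = sgl p x + sgl (p + 1) (h p (q - 1) b)"
    unfolding addmap.add[OF Td_add] Td_sgl using bc by (auto simp: fun_eq_iff sgl_def)
   have xD: "x : D p q" using yD[OF y, of q p] yx by simp
   have TzF: "Td (p + q - 1) ?z : TF p (p + q)"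
    unfolding Tz using h_D[OF bc(2)] xD by (intro subgp_add[OF F_subgp] sgl_TF) auto
   hence z: "?z : Z 1 (p - 1) (p + q - 1)" using zF by (simp add: Z_def)
   have "y - Td (p + q - 1) ?z : TF p (p + q)"
    using TzF y subgp_diff[OF F_subgp] by (simp add: Z_def)
   moreover have "(y - Td (p + q - 1) ?z) p = 0" unfolding Tz using yx by (simp add: sgl_def)
   ultimately have "y - Td (p + q - 1) ?z : TF (p + 1) (p + q)"
    by (auto simp: TF_def) (metis add1_zle_eq less_add_one linorder_not_less order_le_less)
   moreover have "Td (p + q) (y - Td (p + q - 1) ?z) = Td (p + q) y"
    using dd_Z[OF z] by (simp add: addmap.diff[OF Td_add])
   ultimately have "y - Td (p + q - 1) ?z : Z 1 (p + 1) (p + q)"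
    using y by (simp add: Z_def add.assoc)
   thus "y : B 2 p (p + q)"
    using BI[of "y - Td (p + q - 1) ?z" 2 p "p + q" ?z] z by simp
  qed
 qed auto
 thus ?thesis by blast
qed

text \<open>With exact rows the components of a cochain can be removed from the last column
  backwards, until only column \<open>0\<close> is left; what remains lies in the kernel of the
  horizontal differential.\<close>

lemma total_cohomology:
 assumes exact: "!!p q x. 0 < p ==> x : D p q ==> h p q x = 0 ==> \<exists>y\<in>D (p - 1) q. h (p - 1) q y = x"
  and P: "presents {x : D 0 n. h 0 n x = 0 & v 0 n x = 0}
   (v 0 (n - 1) ` {x : D 0 (n - 1). h 0 (n - 1) x = 0}) f H"
 shows "\<exists>g. presents {x : TF 0 n. Td n x = 0} (Td (n - 1) ` TF 0 (n - 1)) g H"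
proof -
 \<comment> \<open>Vanishing of \<open>Td n x\<close> is asked only outside column \<open>0\<close>.
   This covers cocycles as well as cochains whose coboundary is concentrated in column
   \<open>0\<close>, and the second case is used to compare coboundaries.\<close>
 have reduce: "\<exists>y\<in>TF 0 (n - 1). \<exists>u\<in>D 0 n. x - Td (n - 1) y = sgl 0 u"
  if x: "x : TF 0 n" "!!k. 1 <= k ==> Td n x k = 0" for x n
 proof -
  have "\<exists>y\<in>TF 0 (n - 1). \<exists>u\<in>D 0 n. x - Td (n - 1) y = sgl 0 u"
   if "x : TF 0 n" "!!k. 1 <= k ==> Td n x k = 0" "!!k. int m < k ==> x k = 0" for x and m :: nat
   using that
  proof (induction m arbitrary: x)
   case 0
   have "x = sgl 0 (x 0)"
   proof
    fix k show "x k = sgl 0 (x 0) k"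
     using 0(3)[of k] TF_zero[OF 0(1), of k] by (cases "k = 0"; cases "k < 0") (auto simp: sgl_def)
   qed
   moreover have "x 0 : D 0 n" using TF_D[OF 0(1), of n 0] by simp
   moreover have "Td (n - 1) 0 = 0" by (rule addmap.zero[OF Td_add])
   ultimately show ?case
    using subgp_zero[OF F_subgp, of 0 "n - 1"] by (metis diff_zero)
  next
   case (Suc m)
   let ?p = "int m + 1"
   have xD: "x ?p : D ?p (n - ?p)" using TF_D[OF Suc(2)] by simp
   have "Td n x (?p + 1) = 0" using Suc(3)[of "?p + 1"] by simp
   moreover have "x (?p + 1) = 0" using Suc(4)[of "?p + 1"] by simp
   ultimately have "h ?p (n - ?p) (x ?p) = 0" by (simp add: Td_def algebra_simps)
   then obtain w where w: "w : D (int m) (n - ?p)" "h (int m) (n - ?p) w = x ?p"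
    using exact[OF _ xD] by auto
   let ?w = "sgl (int m) w"
   have wF: "?w : TF 0 (n - 1)" using w by (intro sgl_TF) (auto simp: algebra_simps)
   let ?x = "x - Td (n - 1) ?w"
   have Tw: "Td (n - 1) ?w = sgl (int m) (v (int m) (n - ?p) w) + sgl ?p (x ?p)"
    using w by (simp add: Td_sgl algebra_simps)
   have 1: "?x : TF 0 n" using Suc(2) d_F[OF wF] subgp_diff[OF F_subgp] by simp
   have 2: "Td n ?x = Td n x"
    using d_d[OF wF] by (simp add: addmap.diff[OF Td_add])
   have 3: "?x k = 0" if "int m < k" for k
    using that Suc(4)[of k] unfolding Tw by (cases "k = ?p") (auto simp: sgl_def)
   obtain y u where yu: "y : TF 0 (n - 1)" "u : D 0 n" "?x - Td (n - 1) y = sgl 0 u"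
    using Suc(1)[OF 1 _ 3] Suc(3) unfolding 2 by blast
   hence "x - Td (n - 1) (?w + y) = sgl 0 u" by (simp add: addmap.add[OF Td_add] algebra_simps)
   thus ?case using yu subgp_add[OF F_subgp wF yu(1)] by blast
  qed
  moreover have "x k = 0" if "int (nat n) < k" for k
  proof -
   have "D k (n - k) = {0}" using that by (intro D_neg) arith
   thus ?thesis using TF_D[OF x(1), of "n - k" k] by simp
  qed
  ultimately show ?thesis using x by blast
 qed
 have sgl_cocycle: "h 0 n u = 0 & v 0 n u = w" if "Td n (sgl 0 u) = sgl 0 w" for u w n
  using fun_cong[OF that, of 0] fun_cong[OF that, of 1] unfolding Td_sgl by (simp add: sgl_def)
 let ?Z = "{x : TF 0 n. Td n x = 0}" and ?B = "Td (n - 1) ` TF 0 (n - 1)"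
 have Zs: "subgp ?Z"
  unfolding subgp_def using F_subgp by (auto simp: addmap.zero[OF Td_add] addmap.diff[OF Td_add] subgp_zero subgp_diff)
 have Bs: "subgp ?B"
  unfolding subgp_def
 proof (intro conjI ballI)
  show "0 : ?B" using subgp_zero[OF F_subgp] addmap.zero[OF Td_add] by (metis imageI)
  show "x - y : ?B" if "x : ?B" "y : ?B" for x y
   using that subgp_diff[OF F_subgp] addmap.diff[OF Td_add] by (smt (verit) imageE imageI)
 qed
 have sgl0: "sgl 0 (x - x') = sgl 0 x - sgl 0 x'" "sgl 0 0 = 0" for x x'
  by (auto simp: sgl_def fun_eq_iff)
 have "\<exists>g. presents ?Z ?B g H"
 proof (rule presents_rel[where R = "%y x. y - sgl 0 x : ?B", OF P Zs])
  show "?B \<subseteq> ?Z" using d_F[of _ 0 "n - 1"] d_d[of _ 0 "n - 1"] by auto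
  show "\<exists>x\<in>{x : D 0 n. h 0 n x = 0 & v 0 n x = 0}. y - sgl 0 x : ?B" if y: "y : ?Z" for y
  proof -
   obtain z u where zu: "z : TF 0 (n - 1)" "u : D 0 n" "y - Td (n - 1) z = sgl 0 u"
    using reduce[of y n] y by auto
   have "Td n (sgl 0 u) = sgl 0 0"
    unfolding zu(3)[symmetric] sgl0 using y d_d[OF zu(1)] by (simp add: addmap.diff[OF Td_add])
   hence "h 0 n u = 0 & v 0 n u = 0" by (rule sgl_cocycle)
   moreover have "y - sgl 0 u = Td (n - 1) z" using zu(3) by (simp add: algebra_simps)
   ultimately show ?thesis using zu by auto
  qed
  show "\<exists>y\<in>?Z. y - sgl 0 x : ?B" if "x : {x : D 0 n. h 0 n x = 0 & v 0 n x = 0}" for x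
  proof -
   have "Td n (sgl 0 x) = 0" unfolding Td_sgl using that by (auto simp: sgl_def)
   thus ?thesis using that sgl_TF[of x 0 n 0] subgp_zero[OF Bs] by (intro bexI[of _ "sgl 0 x"]) auto
  qed
  show "(y - y') - sgl 0 (x - x') : ?B" if "y - sgl 0 x : ?B" "y' - sgl 0 x' : ?B" for y y' x x'
   using subgp_diff[OF Bs that] unfolding sgl0 by (simp add: algebra_simps)
  fix y x assume yx: "y - sgl 0 x : ?B" and "y : ?Z"
  have "y : ?B \<longleftrightarrow> sgl 0 x : ?B"
   using subgp_diff[OF Bs _ yx, of y] subgp_add[OF Bs yx, of "sgl 0 x"] by auto
  also have "... \<longleftrightarrow> x : v 0 (n - 1) ` {x : D 0 (n - 1). h 0 (n - 1) x = 0}"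
  proof
   assume "sgl 0 x : ?B"
   then obtain z where z: "z : TF 0 (n - 1)" "Td (n - 1) z = sgl 0 x" by auto
   hence "Td (n - 1) z k = 0" if "1 <= k" for k using that z(2) by (auto simp: sgl_def)
   then obtain z' u where zu: "z' : TF 0 (n - 1 - 1)" "u : D 0 (n - 1)" "z - Td (n - 1 - 1) z' = sgl 0 u"
    using reduce[OF z(1)] by blast
   have "Td (n - 1) (sgl 0 u) = sgl 0 x"
    unfolding zu(3)[symmetric] using z d_d[OF zu(1)] by (simp add: addmap.diff[OF Td_add])
   thus "x : v 0 (n - 1) ` {x : D 0 (n - 1). h 0 (n - 1) x = 0}"
    using sgl_cocycle zu(2) by blast
  next
   assume "x : v 0 (n - 1) ` {x : D 0 (n - 1). h 0 (n - 1) x = 0}"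
   then obtain u where u: "x = v 0 (n - 1) u" "u : D 0 (n - 1)" "h 0 (n - 1) u = 0" by auto
   hence "sgl 0 x = Td (n - 1) (sgl 0 u)" unfolding Td_sgl by (auto simp: sgl_def fun_eq_iff)
   thus "sgl 0 x : ?B" using sgl_TF[of u 0 "n - 1" 0] u by auto
  qed
  finally show "y : ?B \<longleftrightarrow> x : v 0 (n - 1) ` {x : D 0 (n - 1). h 0 (n - 1) x = 0}" .
 qed
 thus ?thesis by blast
qed

end

subsection \<open>Categories\<close>

lemma Hom_iff: "f : Hom C x y \<longleftrightarrow> f : Arr C & Dom C f = x & Cod C f = y"
 by (simp add: Hom_def)

locale category =
 fixes C :: "('o, 'm) cat" (structure)
 assumes is_category: "is_category C"
begin

lemma Arr_Hom: "f : Arr C ==> f : Hom C (Dom C f) (Cod C f)"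
 by (simp add: Hom_def)

lemma Hom_Obj: "f : Hom C x y ==> x : Obj C" "f : Hom C x y ==> y : Obj C"
proof -
 have "\<forall>f\<in>Arr C. Dom C f : Obj C & Cod C f : Obj C"
  using is_category unfolding is_category_def by (elim conjE)
 thus "f : Hom C x y ==> x : Obj C" "f : Hom C x y ==> y : Obj C"
  unfolding Hom_def by auto
qed

lemma HomD: "f : Hom C x y ==> Dom C f = x" "f : Hom C x y ==> Cod C f = y"
 by (auto simp: Hom_iff)

lemma Idn_Hom [intro]: "x : Obj C ==> Idn C x : Hom C x x"
proof -
 have "\<forall>x\<in>Obj C. Idn C x : Hom C x x"
  using is_category unfolding is_category_def by (elim conjE)
 thus "x : Obj C ==> Idn C x : Hom C x x" ..
qed

lemma comp_Hom [intro]: "g : Hom C y z ==> f : Hom C x y ==> g \<bullet> f : Hom C x z"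
proof -
 have "\<forall>f\<in>Arr C. \<forall>g\<in>Arr C. Cod C f = Dom C g --> g \<bullet> f : Hom C (Dom C f) (Cod C g)"
  using is_category unfolding is_category_def by (elim conjE)
 thus "g : Hom C y z ==> f : Hom C x y ==> g \<bullet> f : Hom C x z"
  unfolding Hom_iff by auto
qed

lemma comp_assoc:
 "f : Hom C w x ==> g : Hom C x y ==> h : Hom C y z ==> (h \<bullet> g) \<bullet> f = h \<bullet> (g \<bullet> f)"
proof -
 have "\<forall>f\<in>Arr C. \<forall>g\<in>Arr C. \<forall>h\<in>Arr C. Cod C f = Dom C g & Cod C g = Dom C h -->
    (h \<bullet> g) \<bullet> f = h \<bullet> (g \<bullet> f)"
  using is_category unfolding is_category_def by (elim conjE)
 thus "f : Hom C w x ==> g : Hom C x y ==> h : Hom C y z ==> (h \<bullet> g) \<bullet> f = h \<bullet> (g \<bullet> f)"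
  unfolding Hom_iff by auto
qed

lemma comp_Idn: "f : Hom C x y ==> f \<bullet> Idn C x = f" "f : Hom C x y ==> Idn C y \<bullet> f = f"
proof -
 have "\<forall>f\<in>Arr C. f \<bullet> Idn C (Dom C f) = f & Idn C (Cod C f) \<bullet> f = f"
  using is_category unfolding is_category_def by (elim conjE)
 thus "f : Hom C x y ==> f \<bullet> Idn C x = f" "f : Hom C x y ==> Idn C y \<bullet> f = f"
  unfolding Hom_iff by auto
qed

end

lemma is_categoryI:
 assumes "!!f. f : Arr C ==> Dom C f : Obj C & Cod C f : Obj C"
  and "!!x. x : Obj C ==> Idn C x : Hom C x x"
  and "!!f g x y z. f : Hom C x y ==> g : Hom C y z ==> g \<bullet>\<^bsub>C\<^esub> f : Hom C x z"
  and "!!f x y. f : Hom C x y ==> f \<bullet>\<^bsub>C\<^esub> Idn C x = f"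
  and "!!f x y. f : Hom C x y ==> Idn C y \<bullet>\<^bsub>C\<^esub> f = f"
  and "!!f g h w x y z. f : Hom C w x ==> g : Hom C x y ==> h : Hom C y z ==>
   (h \<bullet>\<^bsub>C\<^esub> g) \<bullet>\<^bsub>C\<^esub> f = h \<bullet>\<^bsub>C\<^esub> (g \<bullet>\<^bsub>C\<^esub> f)"
 shows "is_category C"
 unfolding is_category_def
 using assms(1,2) assms(3-6)[unfolded Hom_iff] by (simp add: Hom_iff)

lemma set_cat_simps [simp]:
 "Obj (set_cat :: ('u set, 'u smap) cat) = {X. small TYPE('u) X}"
 "Dom set_cat f = fst f" "Cod set_cat f = snd (snd f)"
 "Idn set_cat X = (X, \<lambda>x\<in>X. x, X)"
 "(g :: 'u smap) \<bullet>\<^bsub>set_cat\<^esub> f = (fst f, compose (fst f) (smap_fun g) (smap_fun f), snd (snd g))"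
 by (simp_all add: set_cat_def)

lemma set_cat_Hom:
 "(f :: 'u smap) : Hom set_cat X Y \<longleftrightarrow>
  (\<exists>h. f = (X, h, Y) & small TYPE('u) X & small TYPE('u) Y & h : X \<rightarrow>\<^sub>E Y)"
 by (cases f) (auto simp: Hom_iff set_cat_def)

lemma category_set_cat: "is_category (set_cat :: ('u set, 'u smap) cat)"
proof (rule is_categoryI)
 fix f :: "'u smap" assume "f : Arr set_cat"
 thus "Dom set_cat f : Obj set_cat & Cod set_cat f : Obj set_cat" by (auto simp: set_cat_def)
next
 fix f g h :: "'u smap" and w x y z
 assume "f : Hom set_cat w x" "g : Hom set_cat x y" "h : Hom set_cat y z"
 thus "h \<bullet>\<^bsub>set_cat\<^esub> g \<bullet>\<^bsub>set_cat\<^esub> f = h \<bullet>\<^bsub>set_cat\<^esub> (g \<bullet>\<^bsub>set_cat\<^esub> f)"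
  by (auto simp: set_cat_Hom compose_def fun_eq_iff)
next
 fix X :: "'u set" assume "X : Obj set_cat"
 thus "Idn set_cat X : Hom set_cat X X" by (auto simp: set_cat_Hom)
next
 fix f g :: "'u smap" and x y z
 assume "f : Hom set_cat x y" "g : Hom set_cat y z"
 thus "g \<bullet>\<^bsub>set_cat\<^esub> f : Hom set_cat x z"
  by (auto simp: set_cat_Hom compose_def)
next
 fix f :: "'u smap" and x y
 assume "f : Hom set_cat x y"
 thus "f \<bullet>\<^bsub>set_cat\<^esub> Idn set_cat x = f" "Idn set_cat y \<bullet>\<^bsub>set_cat\<^esub> f = f"
  by (auto simp: set_cat_Hom compose_def fun_eq_iff PiE_def extensional_def Pi_iff | metis)+
qed

lemma slice_simps [simp]:
 "Obj (slice C X) = {p : Arr C. Cod C p = X}"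
 "Dom (slice C X) = fst" "Cod (slice C X) = snd \<circ> snd"
 "Idn (slice C X) p = (p, Idn C (Dom C p), p)"
 "v \<bullet>\<^bsub>slice C X\<^esub> u = (fst u, fst (snd v) \<bullet>\<^bsub>C\<^esub> fst (snd u), snd (snd v))"
 by (simp_all add: slice_def)

lemma slice_Hom:
 "f : Hom (slice C X) p q \<longleftrightarrow> (\<exists>u. f = (p, u, q) & p : Arr C & Cod C p = X & q : Arr C & Cod C q = X &
  u : Hom C (Dom C p) (Dom C q) & q \<bullet>\<^bsub>C\<^esub> u = p)"
 by (cases f) (auto simp: Hom_iff slice_def)

lemma (in category) category_slice: "is_category (slice C X)"
proof (rule is_categoryI)
 fix f assume "f : Arr (slice C X)"
 thus "Dom (slice C X) f : Obj (slice C X) & Cod (slice C X) f : Obj (slice C X)"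
  by (auto simp: slice_def)
next
 fix p assume "p : Obj (slice C X)"
 thus "Idn (slice C X) p : Hom (slice C X) p p"
  using Hom_Obj(1)[OF Arr_Hom] comp_Idn(1)[OF Arr_Hom] by (auto simp: slice_Hom)
next
 fix f g p q r assume "f : Hom (slice C X) p q" "g : Hom (slice C X) q r"
 thus "g \<bullet>\<^bsub>slice C X\<^esub> f : Hom (slice C X) p r"
  by (auto simp: slice_Hom comp_assoc[OF _ _ Arr_Hom, symmetric])
next
 fix f p q assume "f : Hom (slice C X) p q"
 thus "f \<bullet>\<^bsub>slice C X\<^esub> Idn (slice C X) p = f" by (auto simp: slice_Hom comp_Idn)
next
 fix f p q assume "f : Hom (slice C X) p q"
 thus "Idn (slice C X) q \<bullet>\<^bsub>slice C X\<^esub> f = f" by (auto simp: slice_Hom comp_Idn)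
next
 fix f g h p q r s
 assume "f : Hom (slice C X) p q" "g : Hom (slice C X) q r" "h : Hom (slice C X) r s"
 thus "h \<bullet>\<^bsub>slice C X\<^esub> g \<bullet>\<^bsub>slice C X\<^esub> f = h \<bullet>\<^bsub>slice C X\<^esub> (g \<bullet>\<^bsub>slice C X\<^esub> f)"
  by (auto simp: slice_Hom comp_assoc)
qed

lemma functor_cat_simps [simp]:
 "Obj (functor_cat J C) = diagrams J C"
 "Dom (functor_cat J C) = fst" "Cod (functor_cat J C) = snd \<circ> snd"
 "Idn (functor_cat J C) F = (F, \<lambda>j\<in>Obj J. Idn C (fob F j), F)"
 "s \<bullet>\<^bsub>functor_cat J C\<^esub> t = (fst t, \<lambda>j\<in>Obj J. component s j \<bullet>\<^bsub>C\<^esub> component t j, snd (snd s))"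
 by (simp_all add: functor_cat_def)

lemma functor_cat_Hom:
 "f : Hom (functor_cat J C) F G \<longleftrightarrow> (\<exists>t. f = (F, t, G) & F : diagrams J C & G : diagrams J C &
  t : extensional (Obj J) & is_nat_trans J C F G t)"
 by (cases f) (auto simp: Hom_iff functor_cat_def)

lemma diagramsD:
 assumes "F : diagrams J C"
 shows "x : Obj J ==> fob F x : Obj C"
  and "f : Hom J x y ==> far F f : Hom C (fob F x) (fob F y)"
  and "x : Obj J ==> far F (Idn J x) = Idn C (fob F x)"
  and "f : Hom J x y ==> g : Hom J y z ==> far F (g \<bullet>\<^bsub>J\<^esub> f) = far F g \<bullet>\<^bsub>C\<^esub> far F f"
 using assms by (auto simp: diagrams_def is_functor_def Hom_iff)

lemma nat_transD:
 assumes "is_nat_trans J C F G t"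
 shows "x : Obj J ==> t x : Hom C (fob F x) (fob G x)"
  and "f : Hom J x y ==> t y \<bullet>\<^bsub>C\<^esub> far F f = far G f \<bullet>\<^bsub>C\<^esub> t x"
 using assms by (auto simp: is_nat_trans_def Hom_iff)

lemma category_functor_cat:
 assumes "is_category J" "is_category C"
 shows "is_category (functor_cat J C)"
proof (rule is_categoryI)
 interpret J: category J by unfold_locales fact
 interpret C: category C by unfold_locales fact
 fix f assume "f : Arr (functor_cat J C)"
 thus "Dom (functor_cat J C) f : Obj (functor_cat J C) & Cod (functor_cat J C) f : Obj (functor_cat J C)"
  by (auto simp: functor_cat_def)
next
 interpret J: category J by unfold_locales fact
 interpret C: category C by unfold_locales fact
 fix F assume F: "F : Obj (functor_cat J C)"
 have "is_nat_trans J C F F (\<lambda>j\<in>Obj J. Idn C (fob F j))"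
  unfolding is_nat_trans_def
 proof (intro conjI ballI)
  show "(\<lambda>j\<in>Obj J. Idn C (fob F j)) x : Hom C (fob F x) (fob F x)" if "x : Obj J" for x
   using that diagramsD(1)[of F] F by auto
  fix f assume f: "f : Arr J"
  note fH = diagramsD(2)[OF F[simplified] J.Arr_Hom[OF f]]
  show "(\<lambda>j\<in>Obj J. Idn C (fob F j)) (Cod J f) \<bullet>\<^bsub>C\<^esub> far F f = far F f \<bullet>\<^bsub>C\<^esub> (\<lambda>j\<in>Obj J. Idn C (fob F j)) (Dom J f)"
   using C.comp_Idn[OF fH] J.Hom_Obj[OF J.Arr_Hom[OF f]] by simp
 qed
 thus "Idn (functor_cat J C) F : Hom (functor_cat J C) F F"
  using F by (auto simp: functor_cat_Hom)
next
 interpret J: category J by unfold_locales fact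
 interpret C: category C by unfold_locales fact
 fix s t F G H assume s: "s : Hom (functor_cat J C) F G" and t: "t : Hom (functor_cat J C) G H"
 obtain s' where s': "s = (F, s', G)" "is_nat_trans J C F G s'" "F : diagrams J C" "G : diagrams J C"
  using s by (auto simp: functor_cat_Hom)
 obtain t' where t': "t = (G, t', H)" "is_nat_trans J C G H t'" "H : diagrams J C"
  using t by (auto simp: functor_cat_Hom)
 have "is_nat_trans J C F H (\<lambda>j\<in>Obj J. t' j \<bullet>\<^bsub>C\<^esub> s' j)"
  unfolding is_nat_trans_def
 proof (intro conjI ballI)
  show "(\<lambda>j\<in>Obj J. t' j \<bullet>\<^bsub>C\<^esub> s' j) x : Hom C (fob F x) (fob H x)" if "x : Obj J" for x
   using that nat_transD(1)[OF s'(2)] nat_transD(1)[OF t'(2)] by auto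
  fix f assume f: "f : Arr J"
  note fJ = J.Arr_Hom[OF f]
  note o = J.Hom_Obj[OF fJ]
  note a = nat_transD(1)[OF s'(2) o(1)] nat_transD(1)[OF s'(2) o(2)] nat_transD(1)[OF t'(2) o(1)] nat_transD(1)[OF t'(2) o(2)]
   diagramsD(2)[OF s'(3) fJ] diagramsD(2)[OF s'(4) fJ] diagramsD(2)[OF t'(3) fJ]
  have "(t' (Cod J f) \<bullet>\<^bsub>C\<^esub> s' (Cod J f)) \<bullet>\<^bsub>C\<^esub> far F f = far H f \<bullet>\<^bsub>C\<^esub> (t' (Dom J f) \<bullet>\<^bsub>C\<^esub> s' (Dom J f))"
   using C.comp_assoc[OF a(5) a(2) a(4)] C.comp_assoc[OF a(1) a(6) a(4)] C.comp_assoc[OF a(1) a(3) a(7)]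
    nat_transD(2)[OF s'(2) fJ] nat_transD(2)[OF t'(2) fJ] by simp
  thus "(\<lambda>j\<in>Obj J. t' j \<bullet>\<^bsub>C\<^esub> s' j) (Cod J f) \<bullet>\<^bsub>C\<^esub> far F f = far H f \<bullet>\<^bsub>C\<^esub> (\<lambda>j\<in>Obj J. t' j \<bullet>\<^bsub>C\<^esub> s' j) (Dom J f)"
   using o by simp
 qed
 thus "t \<bullet>\<^bsub>functor_cat J C\<^esub> s : Hom (functor_cat J C) F H"
  using s' t' by (auto simp: functor_cat_Hom)
next
 interpret C: category C by unfold_locales fact
 fix f F G assume "f : Hom (functor_cat J C) F G"
 then obtain t where t: "f = (F, t, G)" "t : extensional (Obj J)" "is_nat_trans J C F G t"
  by (auto simp: functor_cat_Hom)
 note tH = nat_transD(1)[OF t(3)]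
 show "f \<bullet>\<^bsub>functor_cat J C\<^esub> Idn (functor_cat J C) F = f"
  using t C.comp_Idn(1)[OF tH] by (auto simp: fun_eq_iff extensional_def)
 show "Idn (functor_cat J C) G \<bullet>\<^bsub>functor_cat J C\<^esub> f = f"
  using t C.comp_Idn(2)[OF tH] by (auto simp: fun_eq_iff extensional_def)
next
 interpret C: category C by unfold_locales fact
 fix f g h F G H K
 assume "f : Hom (functor_cat J C) F G" "g : Hom (functor_cat J C) G H" "h : Hom (functor_cat J C) H K"
 then obtain r s t where r: "f = (F, r, G)" "is_nat_trans J C F G r"
  and s: "g = (G, s, H)" "is_nat_trans J C G H s" and t: "h = (H, t, K)" "is_nat_trans J C H K t"
  by (auto simp: functor_cat_Hom)
 show "h \<bullet>\<^bsub>functor_cat J C\<^esub> g \<bullet>\<^bsub>functor_cat J C\<^esub> f = h \<bullet>\<^bsub>functor_cat J C\<^esub> (g \<bullet>\<^bsub>functor_cat J C\<^esub> f)"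
  using C.comp_assoc[OF nat_transD(1)[OF r(2)] nat_transD(1)[OF s(2)] nat_transD(1)[OF t(2)]] r s t
  by (auto simp: fun_eq_iff)
qed

lemma em_cat_simps [simp]:
 "Obj (em_cat C T) = em_algebras C T"
 "Dom (em_cat C T) = fst" "Cod (em_cat C T) = snd \<circ> snd"
 "Idn (em_cat C T) A = (A, Idn C (fst A), A)"
 "g \<bullet>\<^bsub>em_cat C T\<^esub> f = (fst f, fst (snd g) \<bullet>\<^bsub>C\<^esub> fst (snd f), snd (snd g))"
 by (simp_all add: em_cat_def)

lemma em_cat_Hom:
 "f : Hom (em_cat C T) A B \<longleftrightarrow> (\<exists>u. f = (A, u, B) & A : em_algebras C T & B : em_algebras C T &
  u : Hom C (fst A) (fst B) & u \<bullet>\<^bsub>C\<^esub> snd A = snd B \<bullet>\<^bsub>C\<^esub> far (mfun T) u)"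
 by (cases f) (auto simp: Hom_iff em_cat_def)

lemma category_em_cat:
 assumes "is_category C" and F: "is_functor C C (mfun T)"
 shows "is_category (em_cat C T)"
proof -
 interpret C: category C by unfold_locales fact
 have ob: "fst A : Obj C" "snd A : Hom C (fob (mfun T) (fst A)) (fst A)" if "A : em_algebras C T" for A
  using that by (auto simp: em_algebras_def)
 have Fh: "far (mfun T) f : Hom C (fob (mfun T) x) (fob (mfun T) y)" if "f : Hom C x y" for f x y
  using F that by (auto simp: is_functor_def Hom_iff)
 have Fc: "far (mfun T) (g \<bullet>\<^bsub>C\<^esub> f) = far (mfun T) g \<bullet>\<^bsub>C\<^esub> far (mfun T) f" if "f : Hom C x y" "g : Hom C y z" for f g x y z
  using F that by (auto simp: is_functor_def Hom_iff)
 have Fi: "far (mfun T) (Idn C x) = Idn C (fob (mfun T) x)" if "x : Obj C" for x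
  using F that by (auto simp: is_functor_def)
 show ?thesis
 proof (rule is_categoryI)
  fix f assume "f : Arr (em_cat C T)"
  thus "Dom (em_cat C T) f : Obj (em_cat C T) & Cod (em_cat C T) f : Obj (em_cat C T)"
   by (auto simp: em_cat_def)
 next
  fix A assume A: "A : Obj (em_cat C T)"
  thus "Idn (em_cat C T) A : Hom (em_cat C T) A A"
   using ob[of A] Fi C.comp_Idn[OF ob(2)[of A]] by (auto simp: em_cat_Hom)
 next
  fix f g A B D assume "f : Hom (em_cat C T) A B" "g : Hom (em_cat C T) B D"
  then obtain u v where u: "f = (A, u, B)" "u : Hom C (fst A) (fst B)" "u \<bullet>\<^bsub>C\<^esub> snd A = snd B \<bullet>\<^bsub>C\<^esub> far (mfun T) u"
   and v: "g = (B, v, D)" "v : Hom C (fst B) (fst D)" "v \<bullet>\<^bsub>C\<^esub> snd B = snd D \<bullet>\<^bsub>C\<^esub> far (mfun T) v"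
   and AB: "A : em_algebras C T" "B : em_algebras C T" "D : em_algebras C T"
   by (auto simp: em_cat_Hom)
  have "(v \<bullet>\<^bsub>C\<^esub> u) \<bullet>\<^bsub>C\<^esub> snd A = snd D \<bullet>\<^bsub>C\<^esub> far (mfun T) (v \<bullet>\<^bsub>C\<^esub> u)"
   using C.comp_assoc[OF ob(2)[OF AB(1)] u(2) v(2)] C.comp_assoc[OF Fh[OF u(2)] ob(2)[OF AB(2)] v(2)]
    C.comp_assoc[OF Fh[OF u(2)] Fh[OF v(2)] ob(2)[OF AB(3)]] Fc[OF u(2) v(2)] u(3) v(3) by simp
  thus "g \<bullet>\<^bsub>em_cat C T\<^esub> f : Hom (em_cat C T) A D"
   using u v AB by (auto simp: em_cat_Hom)
 next
  fix f A B assume "f : Hom (em_cat C T) A B"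
  thus "f \<bullet>\<^bsub>em_cat C T\<^esub> Idn (em_cat C T) A = f" "Idn (em_cat C T) B \<bullet>\<^bsub>em_cat C T\<^esub> f = f"
   by (auto simp: em_cat_Hom C.comp_Idn)
 next
  fix f g h A B D E
  assume "f : Hom (em_cat C T) A B" "g : Hom (em_cat C T) B D" "h : Hom (em_cat C T) D E"
  thus "h \<bullet>\<^bsub>em_cat C T\<^esub> g \<bullet>\<^bsub>em_cat C T\<^esub> f = h \<bullet>\<^bsub>em_cat C T\<^esub> (g \<bullet>\<^bsub>em_cat C T\<^esub> f)"
   by (auto simp: em_cat_Hom C.comp_assoc)
 qed
qed

subsection \<open>Group objects\<close>

locale ab_object = category C for C :: "('o, 'm) cat" (structure) +
 fixes N :: "('o, 'm) grp_obj"
 assumes ab_obj: "is_ab_grp_obj C N"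
begin

lemma terminal: "z : Obj C ==> \<exists>!u. u : Hom C z (gone N)"
proof -
 have "is_terminal C (gone N)"
  using ab_obj unfolding is_ab_grp_obj_def by (elim conjE)
 thus "z : Obj C ==> \<exists>!u. u : Hom C z (gone N)"
  unfolding is_terminal_def by (elim conjE bspec)
qed

lemma to_one: "z : Obj C ==> to_one C N z : Hom C z (gone N)"
 unfolding to_one_def by (rule theI'[OF terminal])

lemma to_one_unique: "u : Hom C z (gone N) ==> u = to_one C N z"
 using terminal[OF Hom_Obj(1)] to_one[OF Hom_Obj(1)] by (metis (full_types))

lemma gpr: "gpr1 N : Hom C (Dom C (gpr1 N)) (gob N)" "gpr2 N : Hom C (Dom C (gpr1 N)) (gob N)"
 using ab_obj unfolding is_ab_grp_obj_def is_product_def by blast+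

lemma gzero: "gzero N : Hom C (gone N) (gob N)"
 and gadd: "gadd N : Hom C (Dom C (gpr1 N)) (gob N)"
 and gneg: "gneg N : Hom C (gob N) (gob N)"
 using ab_obj unfolding is_ab_grp_obj_def by blast+

lemma pairing_ex1:
 assumes "f : Hom C z (gob N)" "g : Hom C z (gob N)"
 shows "\<exists>!u. u : Hom C z (Dom C (gpr1 N)) & gpr1 N \<bullet> u = f & gpr2 N \<bullet> u = g"
 using ab_obj Hom_Obj(1)[OF assms(1)] assms unfolding is_ab_grp_obj_def is_product_def by blast

lemma pairing:
 assumes "f : Hom C z (gob N)" "g : Hom C z (gob N)"
 shows "pairing C N f g : Hom C z (Dom C (gpr1 N))" "gpr1 N \<bullet> pairing C N f g = f" "gpr2 N \<bullet> pairing C N f g = g"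
 using theI'[OF pairing_ex1[OF assms]] assms(1) unfolding pairing_def by (auto simp: Hom_iff)

lemma pairing_unique:
 assumes "u : Hom C z (Dom C (gpr1 N))"
 shows "pairing C N (gpr1 N \<bullet> u) (gpr2 N \<bullet> u) = u"
 using pairing_ex1[of "gpr1 N \<bullet> u" z "gpr2 N \<bullet> u"] pairing[of "gpr1 N \<bullet> u" z "gpr2 N \<bullet> u"]
  comp_Hom[OF gpr(1) assms] comp_Hom[OF gpr(2) assms] assms by blast

lemma pairing_comp:
 assumes f: "f : Hom C z (gob N)" and g: "g : Hom C z (gob N)" and w: "w : Hom C z' z"
 shows "pairing C N f g \<bullet> w = pairing C N (f \<bullet> w) (g \<bullet> w)"
proof -
 note p = pairing[OF f g]
 have "gpr1 N \<bullet> (pairing C N f g \<bullet> w) = f \<bullet> w" "gpr2 N \<bullet> (pairing C N f g \<bullet> w) = g \<bullet> w"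
  using comp_assoc[OF w p(1) gpr(1)] comp_assoc[OF w p(1) gpr(2)] p by simp_all
 thus ?thesis using pairing_unique[OF comp_Hom[OF p(1) w]] by simp
qed

lemma plus_Hom:
 assumes "f : Hom C z (gob N)" "g : Hom C z (gob N)"
 shows "plus_arr C N f g : Hom C z (gob N)"
 unfolding plus_arr_def by (rule comp_Hom[OF gadd pairing(1)[OF assms]])

lemma plus_comp:
 assumes f: "f : Hom C z (gob N)" and g: "g : Hom C z (gob N)" and w: "w : Hom C z' z"
 shows "plus_arr C N f g \<bullet> w = plus_arr C N (f \<bullet> w) (g \<bullet> w)"
 unfolding plus_arr_def using comp_assoc[OF w pairing(1)[OF f g] gadd] pairing_comp[OF f g w] by simp

lemma zero_comp:
 assumes w: "w : Hom C z' z"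
 shows "(gzero N \<bullet> to_one C N z) \<bullet> w = gzero N \<bullet> to_one C N z'"
 using comp_assoc[OF w to_one gzero] Hom_Obj(2)[OF w] to_one_unique[OF comp_Hom[OF to_one w]] by simp

text \<open>Commutativity, unit and inverse are imposed on universal arrows (projections and
  identity) only. Each of them passes to arbitrary arrows by precomposition, since addition commutes
  with precomposition.\<close>

lemma comm_group_hom_grp:
 assumes z: "z : Obj C"
 shows "comm_group (hom_grp C z N)"
proof (rule comm_groupI)
 have obN: "gob N : Obj C" using ab_obj by (simp add: is_ab_grp_obj_def)
 have comm: "plus_arr C N (gpr2 N) (gpr1 N) = gadd N"
  and zero: "plus_arr C N (gzero N \<bullet> to_one C N (gob N)) (Idn C (gob N)) = Idn C (gob N)"
  and neg: "plus_arr C N (gneg N) (Idn C (gob N)) = gzero N \<bullet> to_one C N (gob N)"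
  using ab_obj by (auto simp: is_ab_grp_obj_def)
 fix f g h assume "f : carrier (hom_grp C z N)" "g : carrier (hom_grp C z N)" "h : carrier (hom_grp C z N)"
 hence f: "f : Hom C z (gob N)" and g: "g : Hom C z (gob N)" and h: "h : Hom C z (gob N)"
  by (auto simp: hom_grp_def)
 show "f \<otimes>\<^bsub>hom_grp C z N\<^esub> g : carrier (hom_grp C z N)"
  using plus_Hom[OF f g] by (simp add: hom_grp_def)
 show "f \<otimes>\<^bsub>hom_grp C z N\<^esub> g \<otimes>\<^bsub>hom_grp C z N\<^esub> h = f \<otimes>\<^bsub>hom_grp C z N\<^esub> (g \<otimes>\<^bsub>hom_grp C z N\<^esub> h)"
  using ab_obj f g h z by (simp add: hom_grp_def is_ab_grp_obj_def)
 have "plus_arr C N f g = gadd N \<bullet> pairing C N f g" by (simp add: plus_arr_def)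
 also have "... = plus_arr C N (gpr2 N \<bullet> pairing C N f g) (gpr1 N \<bullet> pairing C N f g)"
  using plus_comp[OF gpr(2,1) pairing(1)[OF f g]] comm by simp
 finally show "f \<otimes>\<^bsub>hom_grp C z N\<^esub> g = g \<otimes>\<^bsub>hom_grp C z N\<^esub> f"
  using pairing[OF f g] by (simp add: hom_grp_def)
 note z0 = comp_Hom[OF gzero to_one]
 have "plus_arr C N (gzero N \<bullet> to_one C N z) f = f"
  using plus_comp[OF z0[OF obN] Idn_Hom[OF obN] f] zero zero_comp[OF f] comp_Idn[OF f] by simp
 thus "\<one>\<^bsub>hom_grp C z N\<^esub> \<otimes>\<^bsub>hom_grp C z N\<^esub> f = f" by (simp add: hom_grp_def)
 have "plus_arr C N (gneg N \<bullet> f) f = gzero N \<bullet> to_one C N z"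
  using plus_comp[OF gneg Idn_Hom[OF obN] f] neg zero_comp[OF f] comp_Idn[OF f] by simp
 thus "\<exists>y\<in>carrier (hom_grp C z N). y \<otimes>\<^bsub>hom_grp C z N\<^esub> f = \<one>\<^bsub>hom_grp C z N\<^esub>"
  using comp_Hom[OF gneg f] by (intro bexI[of _ "gneg N \<bullet> f"]) (auto simp: hom_grp_def)
next
 show "\<one>\<^bsub>hom_grp C z N\<^esub> : carrier (hom_grp C z N)"
  using comp_Hom[OF gzero to_one[OF z]] by (simp add: hom_grp_def)
qed

lemma hom_grp_inv:
 assumes f: "f : Hom C z (gob N)"
 shows "inv\<^bsub>hom_grp C z N\<^esub> f = gneg N \<bullet> f"
proof -
 interpret G: comm_group "hom_grp C z N" by (rule comm_group_hom_grp[OF Hom_Obj(1)[OF f]])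
 have obN: "gob N : Obj C" using ab_obj by (simp add: is_ab_grp_obj_def)
 have neg: "plus_arr C N (gneg N) (Idn C (gob N)) = gzero N \<bullet> to_one C N (gob N)"
  using ab_obj by (auto simp: is_ab_grp_obj_def)
 have "plus_arr C N (gneg N \<bullet> f) f = gzero N \<bullet> to_one C N z"
  using plus_comp[OF gneg Idn_Hom[OF obN] f] neg zero_comp[OF f] comp_Idn[OF f] by simp
 thus ?thesis
  using f comp_Hom[OF gneg f] by (intro G.inv_equality) (auto simp: hom_grp_def)
qed

end

subsection \<open>Face maps of a comonad resolution\<close>

text \<open>The functor and the natural counit from which the faces and augmentations of the
  resolution are built, with their laws relative to the objects and arrows of
  \<open>C\<close>.\<close>

locale augmented_functor = category C for C :: "('o, 'm) cat" (structure) +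
 fixes G :: "('o, 'm) comonad"
 assumes G_fob: "x : Obj C ==> fob (cfun G) x : Obj C"
  and G_far: "f : Hom C x y ==> far (cfun G) f : Hom C (fob (cfun G) x) (fob (cfun G) y)"
  and G_comp: "f : Hom C x y ==> g : Hom C y z ==> far (cfun G) (g \<bullet> f) = far (cfun G) g \<bullet> far (cfun G) f"
  and G_eps: "x : Obj C ==> ceps G x : Hom C (fob (cfun G) x) x"
  and G_eps_nat: "f : Hom C x y ==> ceps G y \<bullet> far (cfun G) f = f \<bullet> ceps G x"
begin

lemma cpow_ob_Suc: "cpow_ob G (Suc n) x = fob (cfun G) (cpow_ob G n x)"
 by (simp add: cpow_ob_def)

lemma cpow_ob_0: "cpow_ob G 0 x = x"
 by (simp add: cpow_ob_def)

lemma cpow_ob_Obj: "x : Obj C ==> cpow_ob G n x : Obj C"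
 by (induction n) (auto simp: cpow_ob_Suc cpow_ob_0 G_fob)

lemma cpow_ar_Hom: "f : Hom C x y ==> cpow_ar G n f : Hom C (cpow_ob G n x) (cpow_ob G n y)"
 by (induction n) (auto simp: cpow_ob_def cpow_ar_def G_far)

lemma cface_0: "cface G x n 0 = ceps G (cpow_ob G n x)"
 by (simp add: cface_def cpow_ar_def)

lemma cface_Suc: "i <= n ==> cface G x (Suc n) (Suc i) = far (cfun G) (cface G x n i)"
 by (simp add: cface_def cpow_ar_def)

lemma cface_Hom:
 "x : Obj C ==> i <= n ==> cface G x n i : Hom C (cpow_ob G (Suc n) x) (cpow_ob G n x)"
proof (induction n arbitrary: i)
 case 0
 thus ?case using G_eps[of x] by (simp add: cface_0 cpow_ob_Suc cpow_ob_0)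
next
 case (Suc n)
 thus ?case
  using G_far[OF Suc.IH] G_eps[OF cpow_ob_Obj[of x "Suc n"]]
  by (cases i) (auto simp: cface_0 cface_Suc cpow_ob_Suc)
qed

text \<open>Two faces of positive index are the functor applied to faces of index one less, so the
  identity descends by induction to \<open>i = 0\<close>, where it is naturality of the counit at a
  face map.\<close>

lemma cface_cface:
 assumes x: "x : Obj C"
 shows "i < j ==> j <= Suc n ==> cface G x n i \<bullet> cface G x (Suc n) j = cface G x n (j - 1) \<bullet> cface G x (Suc n) i"
proof (induction n arbitrary: i j)
 case 0
 hence "i = 0" "j = 1" by auto
 thus ?case
  using G_eps_nat[OF cface_Hom[OF x, of 0 0]] by (simp add: cface_Suc cface_0 cpow_ob_0 cpow_ob_Suc)
next
 case (Suc n)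
 then obtain j' where j': "j = Suc j'" by (cases j) auto
 show ?case
 proof (cases i)
  case 0
  thus ?thesis
   using G_eps_nat[OF cface_Hom[OF x, of j' "Suc n"]] Suc.prems j'
   by (simp add: cface_Suc cface_0)
 next
  case (Suc i')
  then obtain j'' where j'': "j' = Suc j''" using Suc.prems j' by (cases j') auto
  have "far (cfun G) (cface G x n i' \<bullet> cface G x (Suc n) j') = far (cfun G) (cface G x n (j' - 1) \<bullet> cface G x (Suc n) i')"
   using Suc.IH[of i' j'] Suc.prems j' Suc by simp
  thus ?thesis
   using G_comp[OF cface_Hom[OF x, of j' "Suc n"] cface_Hom[OF x, of i' n]]
    G_comp[OF cface_Hom[OF x, of i' "Suc n"] cface_Hom[OF x, of "j' - 1" n]] Suc Suc.prems j' j''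
   by (simp add: cface_Suc)
 qed
qed

lemma caug_Hom: "x : Obj C ==> caug C G x n : Hom C (cpow_ob G n x) x"
 by (induction n) (auto simp: cpow_ob_0 intro: cface_Hom)

text \<open>The augmentation ends in a face \<open>0\<close>; the simplicial identity exchanges it
  with the given face, which lowers the index and the level and lets induction apply.\<close>

lemma caug_cface:
 assumes x: "x : Obj C"
 shows "i <= n ==> caug C G x n \<bullet> cface G x n i = caug C G x (Suc n)"
proof (induction n arbitrary: i)
 case (Suc n)
 show ?case
 proof (cases i)
  case (Suc i')
  note h = caug_Hom[OF x, of n] cface_Hom[OF x, of 0 n] cface_Hom[OF x, of i' n]
   cface_Hom[OF x, of i "Suc n"] cface_Hom[OF x, of 0 "Suc n"]
  have "caug C G x (Suc n) \<bullet> cface G x (Suc n) i = caug C G x n \<bullet> (cface G x n 0 \<bullet> cface G x (Suc n) i)"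
   using comp_assoc[OF h(4) h(2) h(1)] Suc.prems by simp
  also have "... = caug C G x n \<bullet> (cface G x n i' \<bullet> cface G x (Suc n) 0)"
   using cface_cface[OF x, of 0 i n] Suc Suc.prems by simp
  also have "... = (caug C G x n \<bullet> cface G x n i') \<bullet> cface G x (Suc n) 0"
   using comp_assoc[OF h(5) h(3) h(1)] Suc Suc.prems by simp
  finally show ?thesis using Suc.IH[of i'] Suc Suc.prems by simp
 qed simp
qed simp

lemma cface_nat:
 assumes f: "f : Hom C x y"
 shows "i <= n ==> cface G y n i \<bullet> cpow_ar G (Suc n) f = cpow_ar G n f \<bullet> cface G x n i"
proof (induction n arbitrary: i)
 case 0
 thus ?case using G_eps_nat[OF f] by (simp add: cface_0 cpow_ob_0 cpow_ar_def)
next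
 case (Suc n)
 show ?case
 proof (cases i)
  case 0
  thus ?thesis
   using G_eps_nat[OF cpow_ar_Hom[OF f, of "Suc n"]] by (simp add: cface_0 cpow_ob_Suc cpow_ar_def)
 next
  case (Suc i')
  note o = Hom_Obj[OF f]
  have "far (cfun G) (cface G y n i' \<bullet> cpow_ar G (Suc n) f) = far (cfun G) (cpow_ar G n f \<bullet> cface G x n i')"
   using Suc.IH[of i'] Suc Suc.prems by simp
  thus ?thesis
   using G_comp[OF cpow_ar_Hom[OF f, of "Suc n"] cface_Hom[OF o(2), of i' n]]
    G_comp[OF cface_Hom[OF o(1), of i' n] cpow_ar_Hom[OF f, of n]] Suc Suc.prems
   by (simp add: cface_Suc cpow_ar_def)
 qed
qed

lemma caug_nat:
 assumes f: "f : Hom C x y"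
 shows "caug C G y n \<bullet> cpow_ar G n f = f \<bullet> caug C G x n"
proof (induction n)
 case 0
 thus ?case using comp_Idn[OF f] by (simp add: cpow_ar_def)
next
 case (Suc n)
 note o = Hom_Obj[OF f]
 have "caug C G y (Suc n) \<bullet> cpow_ar G (Suc n) f = caug C G y n \<bullet> (cface G y n 0 \<bullet> cpow_ar G (Suc n) f)"
  using comp_assoc[OF cpow_ar_Hom[OF f, of "Suc n"] cface_Hom[OF o(2), of 0 n] caug_Hom[OF o(2), of n]] by simp
 also have "... = (caug C G y n \<bullet> cpow_ar G n f) \<bullet> cface G x n 0"
  using comp_assoc[OF cface_Hom[OF o(1), of 0 n] cpow_ar_Hom[OF f, of n] caug_Hom[OF o(2), of n]] cface_nat[OF f, of 0 n] by simp
 also have "... = f \<bullet> caug C G x (Suc n)"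
  using comp_assoc[OF cface_Hom[OF o(1), of 0 n] caug_Hom[OF o(1), of n] f] Suc by simp
 finally show ?case .
qed

end

subsection \<open>Small sets\<close>

lemma small_subset: "small u Y ==> X \<subseteq> Y ==> small u X"
 unfolding small_def by (meson lesspoll_trans1 subset_imp_lepoll)

lemma small_image: "small u X ==> small u (f ` X)"
 unfolding small_def by (meson lesspoll_trans1 image_lepoll)

locale universe =
 fixes u :: "'u itself"
 assumes regular: "regular_universe u"
begin

lemma infinite_universe: "infinite (UNIV :: 'u set)"
 using regular by (simp add: regular_universe_def)

text \<open>Regularity speaks of index sets inside \<open>'u\<close>; a small index set of any type
  injects into \<open>'u\<close>.\<close>

lemma small_UN:
 fixes S :: "'a set" and X :: "'a => 'u set"
 assumes S: "small u S" and X: "!!x. x : S ==> small u (X x)"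
 shows "small u (\<Union>x\<in>S. X x)"
proof -
 obtain g :: "'a => 'u" where g: "inj_on g S"
  using S unfolding small_def lesspoll_def lepoll_def by blast
 have "small u (g ` S)" by (rule small_image[OF S])
 moreover have "small u (X (inv_into S g y))" if "y : g ` S" for y
  using that by (intro X inv_into_into)
 moreover have "\<forall>(S :: 'u set) (F :: 'u => 'u set). small u S & (\<forall>x\<in>S. small u (F x)) --> small u (\<Union>x\<in>S. F x)"
  using regular by (simp add: regular_universe_def)
 ultimately have "small u (\<Union>y\<in>g ` S. X (inv_into S g y))"
  by (metis (no_types, lifting))
 moreover have "(\<Union>y\<in>g ` S. X (inv_into S g y)) = (\<Union>x\<in>S. X x)"
  using g by simp
 ultimately show ?thesis by simp
qed

lemma pair_code: "\<exists>c :: 'u \<times> 'u => 'u. inj c"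
proof -
 obtain f :: "'u \<times> 'u => 'u" where "bij_betw f (UNIV \<times> UNIV) UNIV"
  using card_of_Times_same_infinite[OF infinite_universe] unfolding card_of_ordIso[symmetric] by blast
 thus ?thesis by (auto simp: bij_betw_def)
qed

text \<open>\<open>K\<close> injects into \<open>'u\<close>, and the square of the infinite type
  \<open>'u\<close> injects into \<open>'u\<close>. This justifies the choice in the definition of
  \<open>encode\<close>.\<close>

lemma code_exists:
 assumes "small u K"
 shows "\<exists>c :: 'k \<times> 'u => 'u. inj_on c (K \<times> UNIV)"
proof -
 obtain g :: "'k => 'u" where g: "inj_on g K"
  using assms unfolding small_def lesspoll_def lepoll_def by blast
 obtain c :: "'u \<times> 'u => 'u" where c: "inj c" using pair_code by blast
 have "inj_on (%(k, x). c (g k, x)) (K \<times> UNIV)"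
  by (rule inj_onI) (clarsimp simp: inj_eq[OF c] inj_on_eq_iff[OF g])
 thus ?thesis by blast
qed

end

subsection \<open>Monads on sets and their algebras, elementwise\<close>

locale set_monad = universe "TYPE('u)" for T :: "('u set, 'u smap) monad" +
 assumes monad: "is_monad set_cat T"
begin

abbreviation small_set :: "'u set => bool" where
 "small_set \<equiv> small TYPE('u)"

abbreviation "FA \<equiv> free_algebra T"
abbreviation "GA \<equiv> free_comonad T"
abbreviation "HA \<equiv> Hom (Alg T)"

section \<open>The functor, unit and multiplication of the monad on elements\<close>

definition TO :: "'u set => 'u set" where
 "TO S = fob (mfun T) S"

text \<open>Arrows of \<open>set_cat\<close> carry extensional functions. Restricting
  \<open>g\<close> to \<open>S\<close> inside the definition allows arbitrary lambda terms for
  \<open>g\<close> and makes \<open>Tm\<close> depend on the values on \<open>S\<close>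
  only.\<close>

definition Tm :: "'u set => 'u set => ('u => 'u) => 'u => 'u" where
 "Tm S S' g = smap_fun (far (mfun T) (S, restrict g S, S'))"

definition eta :: "'u set => 'u => 'u" where
 "eta S = smap_fun (meta T S)"

definition mu :: "'u set => 'u => 'u" where
 "mu S = smap_fun (mmu T S)"

lemma T_functor: "is_functor set_cat set_cat (mfun T)"
 using monad unfolding is_monad_def by blast

lemma arr_Hom: "g : S \<rightarrow> S' ==> small_set S ==> small_set S' ==> (S, restrict g S, S') : Hom set_cat S S'"
 by (auto simp: set_cat_Hom)

lemma small_TO: "small_set S ==> small_set (TO S)"
 using T_functor unfolding is_functor_def TO_def by simp

lemma T_far:
 assumes "g : S \<rightarrow> S'" "small_set S" "small_set S'"
 shows "far (mfun T) (S, restrict g S, S') = (TO S, Tm S S' g, TO S')" "Tm S S' g : TO S \<rightarrow>\<^sub>E TO S'"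
proof -
 have "\<forall>f\<in>Arr set_cat. far (mfun T) f : Hom set_cat (fob (mfun T) (Dom set_cat f)) (fob (mfun T) (Cod set_cat f))"
  using T_functor unfolding is_functor_def by (elim conjE)
 hence "far (mfun T) (S, restrict g S, S') : Hom set_cat (TO S) (TO S')"
  using arr_Hom[OF assms] by (simp add: Hom_iff TO_def)
 thus "far (mfun T) (S, restrict g S, S') = (TO S, Tm S S' g, TO S')" "Tm S S' g : TO S \<rightarrow>\<^sub>E TO S'"
  by (auto simp: set_cat_Hom Tm_def)
qed

lemma T_far_ext:
 assumes "g : S \<rightarrow>\<^sub>E S'" "small_set S" "small_set S'"
 shows "far (mfun T) (S, g, S') = (TO S, Tm S S' g, TO S')"
 using T_far(1)[of g S S'] assms by (auto simp: PiE_restrict)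

lemma Tm_in: "g : S \<rightarrow> S' ==> small_set S ==> small_set S' ==> x : TO S ==> Tm S S' g x : TO S'"
 using T_far(2)[of g S S'] by auto

lemma Tm_cong: "(!!x. x : S ==> g x = g' x) ==> Tm S S' g = Tm S S' g'"
 unfolding Tm_def using restrict_ext[of S g g'] by simp

lemma Tm_id: "small_set S ==> x : TO S ==> Tm S S (%x. x) x = x"
proof -
 assume S: "small_set S" and x: "x : TO S"
 have "\<forall>x\<in>Obj set_cat. far (mfun T) (Idn set_cat x) = Idn set_cat (fob (mfun T) x)"
  using T_functor unfolding is_functor_def by (elim conjE)
 hence "far (mfun T) (S, \<lambda>x\<in>S. x, S) = (TO S, \<lambda>x\<in>TO S. x, TO S)"
  using S by (simp add: TO_def)
 thus ?thesis using x by (simp add: Tm_def)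
qed

lemma Tm_comp:
 assumes "g : S \<rightarrow> S'" "g' : S' \<rightarrow> S''" "small_set S" "small_set S'" "small_set S''" "x : TO S"
 shows "Tm S' S'' g' (Tm S S' g x) = Tm S S'' (%s. g' (g s)) x"
proof -
 have "\<forall>f\<in>Arr set_cat. \<forall>g\<in>Arr set_cat. Cod set_cat f = Dom set_cat g -->
    far (mfun T) (g \<bullet>\<^bsub>set_cat\<^esub> f) = far (mfun T) g \<bullet>\<^bsub>set_cat\<^esub> far (mfun T) f"
  using T_functor unfolding is_functor_def by (elim conjE)
 hence "far (mfun T) ((S', restrict g' S', S'') \<bullet>\<^bsub>set_cat\<^esub> (S, restrict g S, S')) =
  far (mfun T) (S', restrict g' S', S'') \<bullet>\<^bsub>set_cat\<^esub> far (mfun T) (S, restrict g S, S')"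
  using arr_Hom[OF assms(1,3,4)] arr_Hom[OF assms(2,4,5)] unfolding Hom_iff
  by (simp del: set_cat_simps(5))
 moreover have "(S', restrict g' S', S'') \<bullet>\<^bsub>set_cat\<^esub> (S, restrict g S, S') = (S, restrict (%s. g' (g s)) S, S'')"
  using assms(1) by (auto simp: compose_def fun_eq_iff Pi_iff)
 ultimately have "(TO S, Tm S S'' (%s. g' (g s)), TO S'') = (TO S, compose (TO S) (Tm S' S'' g') (Tm S S' g), TO S'')"
  using T_far(1)[OF assms(1,3,4)] T_far(1)[OF assms(2,4,5)] T_far(1)[of "%s. g' (g s)" S S''] assms
  by (simp add: Pi_iff)
 thus ?thesis using assms(6) by (simp add: compose_def)
qed

lemma meta_Hom: "small_set S ==> meta T S = (S, eta S, TO S)" "small_set S ==> eta S : S \<rightarrow>\<^sub>E TO S"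
proof -
 have "is_nat_trans set_cat set_cat \<lparr>fob = id, far = id\<rparr> (mfun T) (meta T)"
  using monad unfolding is_monad_def by (elim conjE)
 hence "\<forall>x\<in>Obj set_cat. meta T x : Hom set_cat x (TO x)"
  unfolding is_nat_trans_def TO_def by auto
 thus "small_set S ==> meta T S = (S, eta S, TO S)" "small_set S ==> eta S : S \<rightarrow>\<^sub>E TO S"
  unfolding eta_def by (force simp: set_cat_Hom)+
qed

lemma mmu_Hom: "small_set S ==> mmu T S = (TO (TO S), mu S, TO S)" "small_set S ==> mu S : TO (TO S) \<rightarrow>\<^sub>E TO S"
proof -
 have "is_nat_trans set_cat set_cat (fctr_comp (mfun T) (mfun T)) (mfun T) (mmu T)"
  using monad unfolding is_monad_def by (elim conjE)
 hence "\<forall>x\<in>Obj set_cat. mmu T x : Hom set_cat (TO (TO x)) (TO x)"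
  unfolding is_nat_trans_def TO_def by (auto simp: fctr_comp_def)
 thus "small_set S ==> mmu T S = (TO (TO S), mu S, TO S)" "small_set S ==> mu S : TO (TO S) \<rightarrow>\<^sub>E TO S"
  unfolding mu_def by (force simp: set_cat_Hom)+
qed

lemma eta_in: "small_set S ==> s : S ==> eta S s : TO S"
 using meta_Hom(2) by auto

lemma mu_in: "small_set S ==> x : TO (TO S) ==> mu S x : TO S"
 using mmu_Hom(2) by auto

lemma eta_nat:
 assumes "g : S \<rightarrow> S'" "small_set S" "small_set S'" "s : S"
 shows "Tm S S' g (eta S s) = eta S' (g s)"
proof -
 have "is_nat_trans set_cat set_cat \<lparr>fob = id, far = id\<rparr> (mfun T) (meta T)"
  using monad unfolding is_monad_def by (elim conjE)
 hence "\<forall>f\<in>Arr set_cat. meta T (Cod set_cat f) \<bullet>\<^bsub>set_cat\<^esub> f = far (mfun T) f \<bullet>\<^bsub>set_cat\<^esub> meta T (Dom set_cat f)"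
  unfolding is_nat_trans_def by auto
 hence "meta T S' \<bullet>\<^bsub>set_cat\<^esub> (S, restrict g S, S') = far (mfun T) (S, restrict g S, S') \<bullet>\<^bsub>set_cat\<^esub> meta T S"
  using arr_Hom[OF assms(1-3)] by (auto simp: Hom_iff)
 hence "compose S (eta S') (restrict g S) s = compose S (Tm S S' g) (eta S) s"
  using T_far(1)[OF assms(1-3)] meta_Hom(1)[OF assms(2)] meta_Hom(1)[OF assms(3)] by simp
 thus ?thesis using assms(4) by (simp add: compose_def)
qed

lemma mu_nat:
 assumes g: "g : S \<rightarrow> S'" and S: "small_set S" "small_set S'" and x: "x : TO (TO S)"
 shows "mu S' (Tm (TO S) (TO S') (Tm S S' g) x) = Tm S S' g (mu S x)"
proof -
 have "is_nat_trans set_cat set_cat (fctr_comp (mfun T) (mfun T)) (mfun T) (mmu T)"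
  using monad unfolding is_monad_def by (elim conjE)
 hence "\<forall>f\<in>Arr set_cat. mmu T (Cod set_cat f) \<bullet>\<^bsub>set_cat\<^esub> far (mfun T) (far (mfun T) f) =
   far (mfun T) f \<bullet>\<^bsub>set_cat\<^esub> mmu T (Dom set_cat f)"
  unfolding is_nat_trans_def by (auto simp: fctr_comp_def)
 hence "mmu T S' \<bullet>\<^bsub>set_cat\<^esub> far (mfun T) (far (mfun T) (S, restrict g S, S')) =
   far (mfun T) (S, restrict g S, S') \<bullet>\<^bsub>set_cat\<^esub> mmu T S"
  using arr_Hom[OF assms(1-3)] by (auto simp: Hom_iff)
 moreover have "far (mfun T) (TO S, Tm S S' g, TO S') = (TO (TO S), Tm (TO S) (TO S') (Tm S S' g), TO (TO S'))"
  using T_far_ext[OF T_far(2)[OF assms(1-3)]] small_TO S by simp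
 ultimately have "compose (TO (TO S)) (mu S') (Tm (TO S) (TO S') (Tm S S' g)) x = compose (TO (TO S)) (Tm S S' g) (mu S) x"
  using T_far(1)[OF assms(1-3)] mmu_Hom(1)[OF S(1)] mmu_Hom(1)[OF S(2)] by simp
 thus ?thesis using x by (simp add: compose_def)
qed

lemma monad_laws:
 assumes S: "small_set S"
 shows "x : TO S ==> mu S (eta (TO S) x) = x"
  and "x : TO S ==> mu S (Tm S (TO S) (eta S) x) = x"
  and "x : TO (TO (TO S)) ==> mu S (mu (TO S) x) = mu S (Tm (TO (TO S)) (TO S) (mu S) x)"
proof -
 have "\<forall>x\<in>Obj set_cat.
    mmu T x \<bullet>\<^bsub>set_cat\<^esub> meta T (fob (mfun T) x) = Idn set_cat (fob (mfun T) x) &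
    mmu T x \<bullet>\<^bsub>set_cat\<^esub> far (mfun T) (meta T x) = Idn set_cat (fob (mfun T) x) &
    mmu T x \<bullet>\<^bsub>set_cat\<^esub> mmu T (fob (mfun T) x) = mmu T x \<bullet>\<^bsub>set_cat\<^esub> far (mfun T) (mmu T x)"
  using monad unfolding is_monad_def by (elim conjE)
 hence 1: "mmu T S \<bullet>\<^bsub>set_cat\<^esub> meta T (TO S) = Idn set_cat (TO S)"
  and 2: "mmu T S \<bullet>\<^bsub>set_cat\<^esub> far (mfun T) (meta T S) = Idn set_cat (TO S)"
  and 3: "mmu T S \<bullet>\<^bsub>set_cat\<^esub> mmu T (TO S) = mmu T S \<bullet>\<^bsub>set_cat\<^esub> far (mfun T) (mmu T S)"
  using S by (auto simp: TO_def)
 note [simp] = mmu_Hom(1)[OF S] mmu_Hom(1)[OF small_TO[OF S]] meta_Hom(1)[OF S] meta_Hom(1)[OF small_TO[OF S]]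
  T_far_ext[OF meta_Hom(2)[OF S] S small_TO[OF S]]
  T_far_ext[OF mmu_Hom(2)[OF S] small_TO[OF small_TO[OF S]] small_TO[OF S]]
 show "mu S (eta (TO S) x) = x" if "x : TO S"
  using 1 that by (auto simp: compose_def dest!: fun_cong[where x = x])
 show "mu S (Tm S (TO S) (eta S) x) = x" if "x : TO S"
  using 2 that by (auto simp: compose_def dest!: fun_cong[where x = x])
 show "mu S (mu (TO S) x) = mu S (Tm (TO (TO S)) (TO S) (mu S) x)" if "x : TO (TO (TO S))"
  using 3 that by (auto simp: compose_def dest!: fun_cong[where x = x])
qed

section \<open>Algebras and homomorphisms on elements\<close>

definition algs :: "'u alg set" where
 "algs = em_algebras set_cat T"

definition st :: "'u alg => 'u => 'u" where
 "st B = smap_fun (snd B)"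

lemma algs_small: "B : algs ==> small_set (fst B)"
 by (auto simp: algs_def em_algebras_def)

lemma algs_snd: "B : algs ==> snd B = (TO (fst B), st B, fst B)" "B : algs ==> st B : TO (fst B) \<rightarrow>\<^sub>E fst B"
 by (auto simp: algs_def em_algebras_def set_cat_Hom st_def TO_def)

lemma st_in: "B : algs ==> x : TO (fst B) ==> st B x : fst B"
 using algs_snd(2) by blast

lemma algs_iff:
 "(X, TO X, s, X) : algs \<longleftrightarrow> small_set X & s : TO X \<rightarrow>\<^sub>E X & (\<forall>x\<in>X. s (eta X x) = x) &
  (\<forall>x\<in>TO (TO X). s (mu X x) = s (Tm (TO X) X s x))"
proof (cases "small_set X & s : TO X \<rightarrow>\<^sub>E X")
 case True
 hence X: "small_set X" and s: "s : TO X \<rightarrow>\<^sub>E X" by auto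
 have 1: "(TO X, s, X) \<bullet>\<^bsub>set_cat\<^esub> meta T X = Idn set_cat X \<longleftrightarrow> (\<forall>x\<in>X. s (eta X x) = x)"
  using meta_Hom[OF X] by (auto simp: compose_def fun_eq_iff)
 have 2: "(TO X, s, X) \<bullet>\<^bsub>set_cat\<^esub> mmu T X = (TO X, s, X) \<bullet>\<^bsub>set_cat\<^esub> far (mfun T) (TO X, s, X) \<longleftrightarrow>
   (\<forall>x\<in>TO (TO X). s (mu X x) = s (Tm (TO X) X s x))"
  using mmu_Hom[OF X] T_far_ext[OF s small_TO[OF X] X] by (auto simp: compose_def fun_eq_iff)
 have 3: "(TO X, s, X) : Hom set_cat (TO X) X"
  using X s small_TO by (auto simp: set_cat_Hom)
 show ?thesis
  using True 1 2 3 by (simp add: algs_def em_algebras_def TO_def[symmetric] del: set_cat_simps(4,5))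
next
 case False
 thus ?thesis by (auto simp: algs_def em_algebras_def set_cat_Hom TO_def)
qed

lemma algs_laws:
 assumes B: "B : algs"
 shows "x : fst B ==> st B (eta (fst B) x) = x"
  and "x : TO (TO (fst B)) ==> st B (mu (fst B) x) = st B (Tm (TO (fst B)) (fst B) (st B) x)"
proof -
 have "(fst B, TO (fst B), st B, fst B) : algs"
  using algs_snd(1)[OF B] B by (metis prod.collapse)
 thus "x : fst B ==> st B (eta (fst B) x) = x"
  "x : TO (TO (fst B)) ==> st B (mu (fst B) x) = st B (Tm (TO (fst B)) (fst B) (st B) x)"
  unfolding algs_iff by blast+
qed

definition ahom :: "'u alg => 'u alg => ('u => 'u) => bool" where
 "ahom B B' f \<longleftrightarrow> f : fst B \<rightarrow> fst B' & (\<forall>x\<in>TO (fst B). f (st B x) = st B' (Tm (fst B) (fst B') f x))"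

definition afn :: "'u alg_hom => 'u => 'u" where
 "afn h = smap_fun (fst (snd h))"

definition mkarr :: "'u alg => 'u alg => ('u => 'u) => 'u alg_hom" where
 "mkarr B B' f = (B, (fst B, restrict f (fst B), fst B'), B')"

lemma ahom_in: "ahom B B' f ==> x : fst B ==> f x : fst B'"
 by (auto simp: ahom_def)

lemma ahom_Pi: "ahom B B' f ==> f : fst B \<rightarrow> fst B'"
 by (auto simp: ahom_def)

lemma ahom_st: "ahom B B' f ==> x : TO (fst B) ==> f (st B x) = st B' (Tm (fst B) (fst B') f x)"
 by (auto simp: ahom_def)

lemma ahom_cong:
 assumes "!!x. x : fst B ==> f x = g x" "B : algs"
 shows "ahom B B' f \<longleftrightarrow> ahom B B' g"
proof -
 have "Tm (fst B) (fst B') f = Tm (fst B) (fst B') g" by (rule Tm_cong[OF assms(1)])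
 thus ?thesis
  unfolding ahom_def using assms st_in[OF assms(2)] by (simp add: Pi_iff)
qed

lemma ahom_comp:
 assumes f: "ahom B B' f" and g: "ahom B' B'' g" and B: "B : algs" "B' : algs" "B'' : algs"
 shows "ahom B B'' (%x. g (f x))"
 unfolding ahom_def
proof (intro conjI ballI)
 show "(%x. g (f x)) : fst B \<rightarrow> fst B''" using ahom_in[OF f] ahom_in[OF g] by auto
 fix x assume x: "x : TO (fst B)"
 note s = algs_small[OF B(1)] algs_small[OF B(2)] algs_small[OF B(3)]
 show "g (f (st B x)) = st B'' (Tm (fst B) (fst B'') (%x. g (f x)) x)"
  using ahom_st[OF f x] ahom_st[OF g Tm_in[OF ahom_Pi[OF f] s(1,2) x]]
   Tm_comp[OF ahom_Pi[OF f] ahom_Pi[OF g] s x] by simp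
qed

lemma ahom_id: "B : algs ==> ahom B B (%x. x)"
 using Tm_id algs_small by (auto simp: ahom_def)

lemma Alg_Hom:
 "h : HA B B' \<longleftrightarrow> h = mkarr B B' (afn h) & B : algs & B' : algs & ahom B B' (afn h)"
proof (cases "B : algs & B' : algs")
 case True
 hence B: "B : algs" "B' : algs" by auto
 note s = algs_small[OF B(1)] algs_small[OF B(2)]
 have *: "f \<bullet>\<^bsub>set_cat\<^esub> snd B = snd B' \<bullet>\<^bsub>set_cat\<^esub> far (mfun T) f \<longleftrightarrow>
   (\<forall>x\<in>TO (fst B). smap_fun f (st B x) = st B' (Tm (fst B) (fst B') (smap_fun f) x))"
  if f: "f : Hom set_cat (fst B) (fst B')" for f
 proof -
  obtain g where g: "f = (fst B, g, fst B')" "g : fst B \<rightarrow>\<^sub>E fst B'" using f unfolding set_cat_Hom by blast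
  show ?thesis
   unfolding g(1) T_far_ext[OF g(2) s] algs_snd(1)[OF B(1)] algs_snd(1)[OF B(2)]
   by (auto simp: compose_def fun_eq_iff)
 qed
 have "h : HA B B' \<longleftrightarrow> (\<exists>f. h = (B, f, B') & f : Hom set_cat (fst B) (fst B') &
  (\<forall>x\<in>TO (fst B). smap_fun f (st B x) = st B' (Tm (fst B) (fst B') (smap_fun f) x)))"
 proof -
  have "h : HA B B' \<longleftrightarrow> (\<exists>f. h = (B, f, B') & B : algs & B' : algs & f : Hom set_cat (fst B) (fst B') &
    f \<bullet>\<^bsub>set_cat\<^esub> snd B = snd B' \<bullet>\<^bsub>set_cat\<^esub> far (mfun T) f)"
   unfolding Alg_def algs_def by (rule em_cat_Hom)
  thus ?thesis using B * by blast
 qed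
 also have "... \<longleftrightarrow> h = mkarr B B' (afn h) & ahom B B' (afn h)"
 proof
  assume "\<exists>f. h = (B, f, B') & f : Hom set_cat (fst B) (fst B') &
  (\<forall>x\<in>TO (fst B). smap_fun f (st B x) = st B' (Tm (fst B) (fst B') (smap_fun f) x))"
  thus "h = mkarr B B' (afn h) & ahom B B' (afn h)"
   by (auto simp: mkarr_def afn_def ahom_def set_cat_Hom PiE_restrict)
 next
  assume h: "h = mkarr B B' (afn h) & ahom B B' (afn h)"
  let ?f = "(fst B, restrict (afn h) (fst B), fst B')"
  have "Tm (fst B) (fst B') (restrict (afn h) (fst B)) = Tm (fst B) (fst B') (afn h)"
   by (rule Tm_cong) simp
  hence "h = (B, ?f, B')" "?f : Hom set_cat (fst B) (fst B')"
   "\<forall>x\<in>TO (fst B). smap_fun ?f (st B x) = st B' (Tm (fst B) (fst B') (smap_fun ?f) x)"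
   using h arr_Hom[OF ahom_Pi s] ahom_st[of B B' "afn h"] st_in[OF B(1)] by (auto simp: mkarr_def)
  thus "\<exists>f. h = (B, f, B') & f : Hom set_cat (fst B) (fst B') &
  (\<forall>x\<in>TO (fst B). smap_fun f (st B x) = st B' (Tm (fst B) (fst B') (smap_fun f) x))" by blast
 qed
 finally show ?thesis using True by blast
next
 case False
 thus ?thesis unfolding Alg_def em_cat_Hom by (auto simp: algs_def)
qed

lemma category_Alg: "is_category (Alg T)"
 unfolding Alg_def by (rule category_em_cat[OF category_set_cat T_functor])

sublocale Alg: category "Alg T"
 by unfold_locales (rule category_Alg)

abbreviation Alg_comp (infixl "\<cdot>" 70) where "g \<cdot> f \<equiv> g \<bullet>\<^bsub>Alg T\<^esub> f"

lemma Obj_Alg [simp]: "Obj (Alg T) = algs"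
 by (simp add: Alg_def algs_def)

lemma Dom_Alg [simp]: "Dom (Alg T) h = fst h" and Cod_Alg [simp]: "Cod (Alg T) h = snd (snd h)"
 by (simp_all add: Alg_def)

lemma afn_mkarr: "x : fst B ==> afn (mkarr B B' f) x = f x"
 by (simp add: afn_def mkarr_def)

lemma mkarr_cong: "(!!x. x : fst B ==> f x = g x) ==> mkarr B B' f = mkarr B B' g"
 by (auto simp: mkarr_def)

lemma mkarr_Hom: "B : algs ==> B' : algs ==> ahom B B' f ==> mkarr B B' f : HA B B'"
 using ahom_cong[of B "afn (mkarr B B' f)" f B'] mkarr_cong[of B "afn (mkarr B B' f)" f B'] afn_mkarr[of _ B B' f]
 by (auto simp: Alg_Hom)

lemma Alg_HomD:
 assumes "h : HA B B'"
 shows "h = mkarr B B' (afn h)" "B : algs" "B' : algs" "ahom B B' (afn h)" "x : fst B ==> afn h x : fst B'"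
proof -
 show "h = mkarr B B' (afn h)" "B : algs" "B' : algs" "ahom B B' (afn h)"
  using assms unfolding Alg_Hom by blast+
 thus "x : fst B ==> afn h x : fst B'" by (simp add: ahom_in)
qed

lemma Alg_arr_eqI:
 assumes "h : HA B B'" "h' : HA B B'" "!!x. x : fst B ==> afn h x = afn h' x"
 shows "h = h'"
 using Alg_HomD(1)[OF assms(1)] Alg_HomD(1)[OF assms(2)] mkarr_cong[OF assms(3)] by simp

lemma afn_comp:
 assumes "h : HA B B'" "x : fst B"
 shows "afn (h' \<cdot> h) x = afn h' (afn h x)"
proof -
 have "h = mkarr B B' (afn h)" using Alg_HomD(1)[OF assms(1)] .
 hence "fst (fst (snd h)) = fst B" by (metis fst_conv mkarr_def snd_conv)
 thus ?thesis using assms(2) by (simp add: Alg_def afn_def compose_def)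
qed

lemma afn_Idn: "x : fst B ==> afn (Idn (Alg T) B) x = x"
 by (simp add: Alg_def afn_def)

section \<open>Free algebras and detection of homomorphisms\<close>

lemma free_algs: "small_set S ==> FA S : algs"
 using mmu_Hom[of S] monad_laws[of S] small_TO[of S] algs_iff[of "TO S" "mu S"]
 by (simp add: free_algebra_def TO_def[symmetric])

lemma free_fst: "fst (FA S) = TO S" and free_st: "st (FA S) = mu S"
 by (simp_all add: free_algebra_def TO_def st_def mu_def)

text \<open>The extension is the structure map after \<open>T g\<close>; it is a homomorphism by
  naturality of \<open>mu\<close> and associativity of the structure map of
  \<open>B\<close>.\<close>

lemma free_ext:
 assumes S: "small_set S" and B: "B : algs" and g: "g : S \<rightarrow> fst B"
 shows "ahom (FA S) B (%x. st B (Tm S (fst B) g x))"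
  and "s : S ==> st B (Tm S (fst B) g (eta S s)) = g s"
proof -
 note sB = algs_small[OF B]
 have sg: "st B : TO (fst B) \<rightarrow> fst B" using st_in[OF B] by auto
 have Tg: "Tm S (fst B) g : TO S \<rightarrow> TO (fst B)" using Tm_in[OF g S sB] by auto
 show "s : S ==> st B (Tm S (fst B) g (eta S s)) = g s"
  using eta_nat[OF g S sB] algs_laws(1)[OF B] g by auto
 show "ahom (FA S) B (%x. st B (Tm S (fst B) g x))"
  unfolding ahom_def free_fst free_st
 proof (intro conjI ballI)
  show "(%x. st B (Tm S (fst B) g x)) : TO S \<rightarrow> fst B" using sg Tg by auto
  fix x assume x: "x : TO (TO S)"
  have "st B (Tm S (fst B) g (mu S x)) = st B (mu (fst B) (Tm (TO S) (TO (fst B)) (Tm S (fst B) g) x))"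
   using mu_nat[OF g S sB x] by simp
  also have "... = st B (Tm (TO (fst B)) (fst B) (st B) (Tm (TO S) (TO (fst B)) (Tm S (fst B) g) x))"
   using algs_laws(2)[OF B Tm_in[OF Tg small_TO[OF S] small_TO[OF sB] x]] .
  also have "... = st B (Tm (TO S) (fst B) (%s. st B (Tm S (fst B) g s)) x)"
   using Tm_comp[OF Tg sg small_TO[OF S] small_TO[OF sB] sB x] by simp
  finally show "st B (Tm S (fst B) g (mu S x)) = st B (Tm (TO S) (fst B) (%x. st B (Tm S (fst B) g x)) x)" .
 qed
qed

text \<open>By the unit law \<open>x\<close> is \<open>mu\<close> applied to \<open>T eta x\<close>,
  and \<open>f\<close> commutes with structure maps; so \<open>f\<close> is recovered from its
  values on generators.\<close>

lemma free_repr: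
 assumes S: "small_set S" and B: "B : algs" and f: "ahom (FA S) B f" and x: "x : TO S"
 shows "f x = st B (Tm S (fst B) (%s. f (eta S s)) x)"
proof -
 have eta: "eta S : S \<rightarrow> TO S" using eta_in[OF S] by auto
 have fP: "f : TO S \<rightarrow> fst B" using ahom_Pi[OF f] by (simp add: free_fst)
 have "f x = f (mu S (Tm S (TO S) (eta S) x))" using monad_laws(2)[OF S x] by simp
 also have "... = st B (Tm (TO S) (fst B) f (Tm S (TO S) (eta S) x))"
  using ahom_st[OF f] Tm_in[OF eta S small_TO[OF S] x] by (simp add: free_fst free_st)
 also have "... = st B (Tm S (fst B) (%s. f (eta S s)) x)"
  using Tm_comp[OF eta fP S small_TO[OF S] algs_small[OF B] x] by simp
 finally show ?thesis .
qed

lemma free_unique: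
 assumes S: "small_set S" and B: "B : algs" and f: "ahom (FA S) B f" and g: "ahom (FA S) B g"
  and eq: "!!s. s : S ==> f (eta S s) = g (eta S s)" and x: "x : TO S"
 shows "f x = g x"
 using free_repr[OF S B f x] free_repr[OF S B g x] Tm_cong[of S "%s. f (eta S s)" "%s. g (eta S s)" "fst B"] eq by simp

text \<open>Jointly injective homomorphisms detect homomorphisms: the two sides of the equation for
  \<open>u\<close> agree after \<open>p\<close> and after \<open>q\<close>. It makes functions into
  pullbacks, products and terminal objects homomorphisms, once they are given pointwise.\<close>

lemma ahom_joint:
 assumes B: "B : algs" "P : algs" "X : algs" "Y : algs"
  and p: "ahom P X p" and q: "ahom P Y q"
  and inj: "!!z z'. z : fst P ==> z' : fst P ==> p z = p z' ==> q z = q z' ==> z = z'"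
  and u: "u : fst B \<rightarrow> fst P" and pu: "ahom B X (%x. p (u x))" and qu: "ahom B Y (%x. q (u x))"
 shows "ahom B P u"
 unfolding ahom_def
proof (intro conjI ballI u)
 note s = algs_small[OF B(1)] algs_small[OF B(2)] algs_small[OF B(3)] algs_small[OF B(4)]
 fix x assume x: "x : TO (fst B)"
 note Tu = Tm_in[OF u s(1,2) x]
 show "u (st B x) = st P (Tm (fst B) (fst P) u x)"
 proof (rule inj)
  show "u (st B x) : fst P" using u st_in[OF B(1) x] by auto
  show "st P (Tm (fst B) (fst P) u x) : fst P" by (rule st_in[OF B(2) Tu])
  show "p (u (st B x)) = p (st P (Tm (fst B) (fst P) u x))"
   using ahom_st[OF pu x] ahom_st[OF p Tu] Tm_comp[OF u ahom_Pi[OF p] s(1,2,3) x] by simp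
  show "q (u (st B x)) = q (st P (Tm (fst B) (fst P) u x))"
   using ahom_st[OF qu x] ahom_st[OF q Tu] Tm_comp[OF u ahom_Pi[OF q] s(1,2,4) x] by simp
 qed
qed

subsection \<open>Pullbacks of algebras\<close>

text \<open>The fibre product of the underlying sets, coded into \<open>'u\<close> by an injection
  of pairs. Smallness comes from regularity, and the structure map is taken componentwise.\<close>

lemma pullback_algebra_exists:
 assumes B: "X : algs" "Y : algs" "Z : algs" and f: "ahom X Z f" and g: "ahom Y Z g"
 shows "\<exists>P\<in>algs. \<exists>p q. ahom P X p & ahom P Y q & (\<forall>z\<in>fst P. f (p z) = g (q z)) &
  (\<forall>x\<in>fst X. \<forall>y\<in>fst Y. f x = g y --> (\<exists>z\<in>fst P. p z = x & q z = y)) &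
  (\<forall>z\<in>fst P. \<forall>z'\<in>fst P. p z = p z' --> q z = q z' --> z = z')"
proof -
 obtain c :: "'u \<times> 'u => 'u" where c: "inj c" using pair_code by blast
 define P where "P = c ` {(x, y). x : fst X & y : fst Y & f x = g y}"
 define p where "p z = fst (inv_into UNIV c z)" for z
 define q where "q z = snd (inv_into UNIV c z)" for z
 have pc: "p (c (x, y)) = x" "q (c (x, y)) = y" for x y
  using c by (simp_all add: p_def q_def)
 have PI: "c (x, y) : P" if "x : fst X" "y : fst Y" "f x = g y" for x y
  using that by (auto simp: P_def)
 have PD: "p z : fst X" "q z : fst Y" "f (p z) = g (q z)" "z = c (p z, q z)" if "z : P" for z
  using that by (auto simp: P_def pc)
 note s = algs_small[OF B(1)] algs_small[OF B(2)] algs_small[OF B(3)]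
 have "small_set (\<Union>x\<in>fst X. (%y. c (x, y)) ` fst Y)"
  by (intro small_UN small_image s)
 hence sP: "small_set P" by (rule small_subset) (auto simp: P_def)
 have pP: "p : P \<rightarrow> fst X" and qP: "q : P \<rightarrow> fst Y" using PD by auto
 \<comment> \<open>The pair of structure maps applied to the two projections of \<open>t\<close>;
   \<open>fg\<close> shows that it stays in the fibre product.\<close>
 define sg where "sg = (\<lambda>t\<in>TO P. c (st X (Tm P (fst X) p t), st Y (Tm P (fst Y) q t)))"
 have fg: "f (st X (Tm P (fst X) p t)) = g (st Y (Tm P (fst Y) q t))" if t: "t : TO P" for t
 proof -
  have "f (st X (Tm P (fst X) p t)) = st Z (Tm P (fst Z) (%z. f (p z)) t)"
   using ahom_st[OF f Tm_in[OF pP sP s(1) t]] Tm_comp[OF pP ahom_Pi[OF f] sP s(1,3) t] by simp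
  also have "... = st Z (Tm P (fst Z) (%z. g (q z)) t)"
   using Tm_cong[of P "%z. f (p z)" "%z. g (q z)" "fst Z"] PD by simp
  also have "... = g (st Y (Tm P (fst Y) q t))"
   using ahom_st[OF g Tm_in[OF qP sP s(2) t]] Tm_comp[OF qP ahom_Pi[OF g] sP s(2,3) t] by simp
  finally show ?thesis .
 qed
 have sgP: "sg t : P" if "t : TO P" for t
  using that fg[OF that] st_in[OF B(1) Tm_in[OF pP sP s(1) that]] st_in[OF B(2) Tm_in[OF qP sP s(2) that]]
  by (auto simp: sg_def intro: PI)
 have psg: "p (sg t) = st X (Tm P (fst X) p t)" "q (sg t) = st Y (Tm P (fst Y) q t)" if "t : TO P" for t
  using that by (simp_all add: sg_def pc)
 have sgPi: "sg : TO P \<rightarrow> P" using sgP by auto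
 \<comment> \<open>Associativity of \<open>sg\<close> is checked after each projection;
   \<open>h\<close> stands for \<open>p\<close> or \<open>q\<close>, which intertwine
   \<open>sg\<close> with a structure map by construction.\<close>
 have laws: "h (sg (mu P t)) = h (sg (Tm (TO P) P sg t))"
  if t: "t : TO (TO P)" and W: "W : algs" and h: "h : P \<rightarrow> fst W"
   and hs: "!!t. t : TO P ==> h (sg t) = st W (Tm P (fst W) h t)" for t h W
 proof -
  note sW = algs_small[OF W]
  have stW: "st W : TO (fst W) \<rightarrow> fst W" using st_in[OF W] by auto
  have Th: "Tm P (fst W) h : TO P \<rightarrow> TO (fst W)" using Tm_in[OF h sP sW] by auto
  have "h (sg (mu P t)) = st W (mu (fst W) (Tm (TO P) (TO (fst W)) (Tm P (fst W) h) t))"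
   using hs[OF mu_in[OF sP t]] mu_nat[OF h sP sW t] by simp
  also have "... = st W (Tm (TO P) (fst W) (%z. st W (Tm P (fst W) h z)) t)"
   using algs_laws(2)[OF W Tm_in[OF Th small_TO[OF sP] small_TO[OF sW] t]]
    Tm_comp[OF Th stW small_TO[OF sP] small_TO[OF sW] sW t] by simp
  also have "... = st W (Tm (TO P) (fst W) (%z. h (sg z)) t)"
   using Tm_cong[of "TO P" "%z. st W (Tm P (fst W) h z)" "%z. h (sg z)" "fst W"] hs by simp
  also have "... = h (sg (Tm (TO P) P sg t))"
   using hs[OF Tm_in[OF sgPi small_TO[OF sP] sP t]] Tm_comp[OF sgPi h small_TO[OF sP] sP sW t] by simp
  finally show ?thesis .
 qed
 have alg: "(P, TO P, sg, P) : algs"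
  unfolding algs_iff
 proof (intro conjI ballI sP)
  show "sg : TO P \<rightarrow>\<^sub>E P" using sgP by (auto simp: sg_def)
  show "sg (eta P z) = z" if z: "z : P" for z
   using eta_in[OF sP z] eta_nat[OF pP sP s(1) z] eta_nat[OF qP sP s(2) z] PD[OF z]
    algs_laws(1)[OF B(1)] algs_laws(1)[OF B(2)] by (simp add: sg_def)
  show "sg (mu P t) = sg (Tm (TO P) P sg t)" if t: "t : TO (TO P)" for t
   using laws[OF t B(1) pP psg(1)] laws[OF t B(2) qP psg(2)]
    PD(4)[OF sgP[OF mu_in[OF sP t]]] PD(4)[OF sgP[OF Tm_in[OF sgPi small_TO[OF sP] sP t]]] by simp
 qed
 have "ahom (P, TO P, sg, P) X p" "ahom (P, TO P, sg, P) Y q"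
  using pP qP psg by (auto simp: ahom_def st_def)
 moreover have "\<exists>z\<in>P. p z = x & q z = y" if "x : fst X" "y : fst Y" "f x = g y" for x y
  using PI[OF that] pc by blast
 moreover have "z = z'" if "z : P" "z' : P" "p z = p z'" "q z = q z'" for z z'
  using PD(4)[OF that(1)] PD(4)[OF that(2)] that(3,4) by simp
 ultimately show ?thesis using alg PD(1-3)
  by - (rule bexI[of _ "(P, TO P, sg, P)"], rule exI[of _ p], rule exI[of _ q], auto)
qed

text \<open>An elementwise criterion: lifts exist pointwise by \<open>ex\<close>, are unique by
  \<open>inj\<close>, and are homomorphisms by \<open>ahom_joint\<close>.\<close>

lemma is_pullbackI:
 assumes f: "f : HA X Z" and g: "g : HA Y Z"
  and p: "p : HA P X" and q: "q : HA P Y"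
  and comm: "!!z. z : fst P ==> afn f (afn p z) = afn g (afn q z)"
  and ex: "!!x y. x : fst X ==> y : fst Y ==> afn f x = afn g y ==> \<exists>z\<in>fst P. afn p z = x & afn q z = y"
  and inj: "!!z z'. z : fst P ==> z' : fst P ==> afn p z = afn p z' ==> afn q z = afn q z' ==> z = z'"
 shows "is_pullback (Alg T) f g p q"
 unfolding is_pullback_def
proof (intro conjI ballI impI)
 have d: "Dom (Alg T) f = X" "Dom (Alg T) g = Y" "Dom (Alg T) p = P" "Cod (Alg T) f = Z"
  using f g p by (auto simp: Hom_iff)
 show "p : HA (Dom (Alg T) p) (Dom (Alg T) f)" "q : HA (Dom (Alg T) p) (Dom (Alg T) g)"
  using p q by (simp_all only: d)
 show "f \<cdot> p = g \<cdot> q"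
  by (rule Alg_arr_eqI[OF Alg.comp_Hom[OF f p] Alg.comp_Hom[OF g q]])
   (simp add: afn_comp[OF p] afn_comp[OF q] comm)
 fix W h k assume W: "W : Obj (Alg T)" and h: "h : HA W (Dom (Alg T) f)"
  and k: "k : HA W (Dom (Alg T) g)" and hk: "f \<cdot> h = g \<cdot> k"
 note h = h[unfolded d] and k = k[unfolded d]
 have hk': "afn f (afn h x) = afn g (afn k x)" if "x : fst W" for x
  using hk afn_comp[OF h that, of f] afn_comp[OF k that, of g] by simp
 define u where "u x = (SOME z. z : fst P & afn p z = afn h x & afn q z = afn k x)" for x
 have u: "u x : fst P" "afn p (u x) = afn h x" "afn q (u x) = afn k x" if "x : fst W" for x
  using someI_ex[of "%z. z : fst P & afn p z = afn h x & afn q z = afn k x"]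
   ex[OF Alg_HomD(5)[OF h that] Alg_HomD(5)[OF k that] hk'[OF that]] unfolding u_def by blast+
 have "ahom W P u"
 proof (rule ahom_joint[OF Alg_HomD(2)[OF h] Alg_HomD(2)[OF p] Alg_HomD(3)[OF p] Alg_HomD(3)[OF q]
    Alg_HomD(4)[OF p] Alg_HomD(4)[OF q] inj])
  show "ahom W X (%x. afn p (u x))"
   using ahom_cong[of W "%x. afn p (u x)" "afn h" X, OF u(2) Alg_HomD(2)[OF h]] Alg_HomD(4)[OF h] by simp
  show "ahom W Y (%x. afn q (u x))"
   using ahom_cong[of W "%x. afn q (u x)" "afn k" Y, OF u(3) Alg_HomD(2)[OF h]] Alg_HomD(4)[OF k] by simp
 qed (use u in auto)
 hence uH: "mkarr W P u : HA W P" by (rule mkarr_Hom[OF Alg_HomD(2)[OF h] Alg_HomD(2)[OF p]])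
 show "\<exists>!u. u : HA W (Dom (Alg T) p) & p \<cdot> u = h & q \<cdot> u = k"
  unfolding d
 proof (rule ex1I[of _ "mkarr W P u"])
  show "mkarr W P u : HA W P & p \<cdot> mkarr W P u = h & q \<cdot> mkarr W P u = k"
   using uH u
   by (auto simp: afn_comp[OF uH] afn_mkarr intro!: Alg_arr_eqI[OF Alg.comp_Hom[OF p uH] h] Alg_arr_eqI[OF Alg.comp_Hom[OF q uH] k])
  fix v assume v: "v : HA W P & p \<cdot> v = h & q \<cdot> v = k"
  hence vH: "v : HA W P" by blast
  show "v = mkarr W P u"
  proof (rule Alg_arr_eqI[OF vH uH])
   fix x assume x: "x : fst W"
   show "afn v x = afn (mkarr W P u) x"
    unfolding afn_mkarr[OF x]
    using inj[OF Alg_HomD(5)[OF vH x] u(1)[OF x]] u[OF x] v afn_comp[OF vH x, of p] afn_comp[OF vH x, of q] by simp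
  qed
 qed
qed

lemma pullback_exists:
 assumes f: "f : HA X Z" and g: "g : HA Y Z"
 shows "\<exists>p q. is_pullback (Alg T) f g p q"
proof -
 obtain P p q where P: "P : algs" "ahom P X p" "ahom P Y q" "\<forall>z\<in>fst P. afn f (p z) = afn g (q z)"
  "\<forall>x\<in>fst X. \<forall>y\<in>fst Y. afn f x = afn g y --> (\<exists>z\<in>fst P. p z = x & q z = y)"
  "\<forall>z\<in>fst P. \<forall>z'\<in>fst P. p z = p z' --> q z = q z' --> z = z'"
  using pullback_algebra_exists[OF Alg_HomD(2)[OF f] Alg_HomD(2)[OF g] Alg_HomD(3)[OF f] Alg_HomD(4)[OF f] Alg_HomD(4)[OF g]]
  by blast
 have "is_pullback (Alg T) f g (mkarr P X p) (mkarr P Y q)"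
  using P afn_mkarr[of _ P] by (intro is_pullbackI[OF f g mkarr_Hom mkarr_Hom] Alg_HomD(2)[OF f] Alg_HomD(2)[OF g]) auto
 thus ?thesis by blast
qed

lemma Tm_ahom:
 assumes "g : S \<rightarrow> S'" "small_set S" "small_set S'"
 shows "ahom (FA S) (FA S') (Tm S S' g)"
 unfolding ahom_def free_fst free_st using Tm_in[OF assms] mu_nat[OF assms] by auto

text \<open>Existence of pullbacks turns the pair chosen in the definition of
  \<open>pullback\<close> into an actual pullback.\<close>

lemma pullback_pullback:
 assumes f: "f : HA X Z" and g: "g : HA Y Z"
 shows "is_pullback (Alg T) f g (fst (pullback (Alg T) f g)) (snd (pullback (Alg T) f g))"
proof -
 obtain p q where "is_pullback (Alg T) f g p q" using pullback_exists[OF f g] by blast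
 hence "case pullback (Alg T) f g of (p, r) => is_pullback (Alg T) f g p r"
  unfolding pullback_def by (intro someI[where P = "%(p, r). is_pullback (Alg T) f g p r" and x = "(p, q)"]) simp
 thus ?thesis by (simp add: case_prod_unfold)
qed

end

subsection \<open>Diagrams of algebras, elementwise\<close>

locale diagram_setup = set_monad T for T :: "('u set, 'u smap) monad" +
 fixes I :: "('i, 'k) cat" (structure)
 assumes small_I: "small_category TYPE('u) I"
begin

sublocale I: category I
 using small_I by unfold_locales (simp add: small_category_def)

abbreviation "cc \<equiv> chain_comp I"

abbreviation DA :: "(('i, 'k, 'u) alg_diagram, ('i, 'k, 'u) alg_diagram_hom) cat" where
 "DA \<equiv> DiagAlg I T"

sublocale DA: category "DiagAlg I T"
 unfolding DiagAlg_def by unfold_locales (rule category_functor_cat[OF I.is_category category_Alg])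

lemma small_Arr: "small TYPE('u) (Arr I)"
 using small_I by (simp add: small_category_def)

definition code :: "'k => 'u => 'u" where
 "code al s = encode I (al, s)"

lemma encode_inj: "inj_on (encode I :: 'k \<times> 'u => 'u) (Arr I \<times> UNIV)"
 unfolding encode_def by (rule someI_ex[OF code_exists[OF small_Arr]])

lemma decode_code: "al : Arr I ==> decode I (code al s) = (al, s)"
 unfolding decode_def code_def by (rule inv_into_f_f[OF encode_inj]) simp

abbreviation diag :: "('i, 'k, 'u) alg_diagram set" where
 "diag \<equiv> diagrams I (Alg T)"

lemma Obj_DA [simp]: "Obj DA = diag"
 by (simp add: DiagAlg_def)

lemma Dom_DA [simp]: "Dom DA h = fst h" and Cod_DA [simp]: "Cod DA h = snd (snd h)"
 by (simp_all add: DiagAlg_def)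

definition U :: "('i, 'k, 'u) alg_diagram => 'i => 'u set" where
 "U B j = fst (fob B j)"

definition Bf :: "('i, 'k, 'u) alg_diagram => 'k => 'u => 'u" where
 "Bf B al = afn (far B al)"

lemma diag_ob: "B : diag ==> j : Obj I ==> fob B j : algs"
 using diagramsD(1)[of B I "Alg T" j] by simp

lemma U_small: "B : diag ==> j : Obj I ==> small_set (U B j)"
 unfolding U_def by (rule algs_small[OF diag_ob])

lemma diag_ar: "B : diag ==> al : Hom I i j ==> far B al : HA (fob B i) (fob B j)"
 by (rule diagramsD(2))

lemma Bf_ahom: "B : diag ==> al : Hom I i j ==> ahom (fob B i) (fob B j) (Bf B al)"
 unfolding Bf_def by (rule Alg_HomD(4)[OF diag_ar])

lemma Bf_in: "B : diag ==> al : Hom I i j ==> x : U B i ==> Bf B al x : U B j"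
 unfolding U_def by (rule ahom_in[OF Bf_ahom])

lemma Bf_Idn: "B : diag ==> j : Obj I ==> x : U B j ==> Bf B (Idn I j) x = x"
 unfolding Bf_def U_def using diagramsD(3)[of B I "Alg T" j] afn_Idn by simp

lemma Bf_comp:
 "B : diag ==> al : Hom I i j ==> bt : Hom I j k ==> x : U B i ==> Bf B (bt \<bullet> al) x = Bf B bt (Bf B al x)"
 unfolding Bf_def U_def using diagramsD(4)[of B I "Alg T" al i j bt k] afn_comp[OF diag_ar] by simp

definition tf :: "('i, 'k, 'u) alg_diagram_hom => 'i => 'u => 'u" where
 "tf t j = afn (component t j)"

definition mk_nt :: "('i, 'k, 'u) alg_diagram => ('i, 'k, 'u) alg_diagram => ('i => 'u => 'u) => ('i, 'k, 'u) alg_diagram_hom" where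
 "mk_nt B B' f = (B, \<lambda>j\<in>Obj I. mkarr (fob B j) (fob B' j) (f j), B')"

lemma DA_Hom:
 "t : Hom DA B B' \<longleftrightarrow> (\<exists>s. t = (B, s, B') & B : diag & B' : diag &
  s : extensional (Obj I) & is_nat_trans I (Alg T) B B' s)"
 unfolding DiagAlg_def by (rule functor_cat_Hom)

lemma DA_HomD:
 assumes "t : Hom DA B B'"
 shows "B : diag" "B' : diag" "fst t = B" "snd (snd t) = B'" "component t : extensional (Obj I)"
  and "j : Obj I ==> component t j : HA (fob B j) (fob B' j)"
  and "j : Obj I ==> ahom (fob B j) (fob B' j) (tf t j)"
  and "j : Obj I ==> x : U B j ==> tf t j x : U B' j"
  and "al : Hom I i j ==> x : U B i ==> tf t j (Bf B al x) = Bf B' al (tf t i x)"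
proof -
 obtain s where s: "t = (B, s, B')" "s : extensional (Obj I)" "is_nat_trans I (Alg T) B B' s"
  and B: "B : diag" "B' : diag"
  using assms unfolding DA_Hom by blast
 show "B : diag" "B' : diag" by fact+
 show "fst t = B" "snd (snd t) = B'" "component t : extensional (Obj I)" using s by simp_all
 show 1: "component t j : HA (fob B j) (fob B' j)" if "j : Obj I" for j
  using nat_transD(1)[OF s(3) that] s(1) by simp
 show 2: "ahom (fob B j) (fob B' j) (tf t j)" if "j : Obj I" for j
  unfolding tf_def by (rule Alg_HomD(4)[OF 1[OF that]])
 show "j : Obj I ==> x : U B j ==> tf t j x : U B' j"
  unfolding U_def by (rule ahom_in[OF 2])
 show "tf t j (Bf B al x) = Bf B' al (tf t i x)" if a: "al : Hom I i j" and x: "x : U B i"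
 proof -
  have "component t j \<cdot> far B al = far B' al \<cdot> component t i"
   using nat_transD(2)[OF s(3) a] s(1) by simp
  thus ?thesis
   using afn_comp[OF diag_ar[OF B(1) a], of x "component t j"] afn_comp[OF 1[OF I.Hom_Obj(1)[OF a]], of x "far B' al"] x
   by (simp add: U_def tf_def Bf_def)
 qed
qed

lemma mk_nt_Hom:
 assumes B: "B : diag" "B' : diag" and f: "!!j. j : Obj I ==> ahom (fob B j) (fob B' j) (f j)"
  and nat: "!!al i j x. al : Hom I i j ==> x : U B i ==> f j (Bf B al x) = Bf B' al (f i x)"
 shows "mk_nt B B' f : Hom DA B B'"
proof -
 have c: "mkarr (fob B j) (fob B' j) (f j) : HA (fob B j) (fob B' j)" if "j : Obj I" for j
  by (rule mkarr_Hom[OF diag_ob[OF B(1) that] diag_ob[OF B(2) that] f[OF that]])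
 have "is_nat_trans I (Alg T) B B' (\<lambda>j\<in>Obj I. mkarr (fob B j) (fob B' j) (f j))"
  unfolding is_nat_trans_def
 proof (intro conjI ballI)
  show "(\<lambda>j\<in>Obj I. mkarr (fob B j) (fob B' j) (f j)) j : HA (fob B j) (fob B' j)" if "j : Obj I" for j
   using c[OF that] that by simp
  fix al assume "al : Arr I"
  hence a: "al : Hom I (Dom I al) (Cod I al)" by (rule I.Arr_Hom)
  note o = I.Hom_Obj[OF a]
  note ar = diag_ar[OF B(1) a] diag_ar[OF B(2) a]
  have "mkarr (fob B (Cod I al)) (fob B' (Cod I al)) (f (Cod I al)) \<cdot> far B al =
   far B' al \<cdot> mkarr (fob B (Dom I al)) (fob B' (Dom I al)) (f (Dom I al))"
  proof (rule Alg_arr_eqI[OF Alg.comp_Hom[OF c[OF o(2)] ar(1)] Alg.comp_Hom[OF ar(2) c[OF o(1)]]])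
   fix x assume x: "x : fst (fob B (Dom I al))"
   show "afn (mkarr (fob B (Cod I al)) (fob B' (Cod I al)) (f (Cod I al)) \<cdot> far B al) x =
    afn (far B' al \<cdot> mkarr (fob B (Dom I al)) (fob B' (Dom I al)) (f (Dom I al))) x"
    unfolding afn_comp[OF ar(1) x] afn_comp[OF c[OF o(1)] x] afn_mkarr[OF x]
     afn_mkarr[OF Alg_HomD(5)[OF ar(1) x]]
    using nat[OF a] x by (simp add: U_def Bf_def)
  qed
  thus "(\<lambda>j\<in>Obj I. mkarr (fob B j) (fob B' j) (f j)) (Cod I al) \<cdot> far B al =
   far B' al \<cdot> (\<lambda>j\<in>Obj I. mkarr (fob B j) (fob B' j) (f j)) (Dom I al)"
   using o by simp
 qed
 thus ?thesis unfolding DA_Hom mk_nt_def using B by auto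
qed

lemma tf_mk_nt: "j : Obj I ==> x : U B j ==> tf (mk_nt B B' f) j x = f j x"
 by (simp add: tf_def mk_nt_def U_def afn_mkarr)

lemma DA_eqI:
 assumes "t : Hom DA B B'" "t' : Hom DA B B'" "!!j x. j : Obj I ==> x : U B j ==> tf t j x = tf t' j x"
 shows "t = t'"
proof -
 have "component t = component t'"
 proof (rule extensionalityI[OF DA_HomD(5)[OF assms(1)] DA_HomD(5)[OF assms(2)]])
  fix j assume "j : Obj I"
  thus "component t j = component t' j"
   using assms(3) by (intro Alg_arr_eqI[OF DA_HomD(6)[OF assms(1)] DA_HomD(6)[OF assms(2)]]) (auto simp: tf_def U_def)
 qed
 thus ?thesis
  using DA_HomD(3,4)[OF assms(1)] DA_HomD(3,4)[OF assms(2)] by (metis prod.collapse)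
qed

lemma component_comp: "j : Obj I ==> component (s \<bullet>\<^bsub>DA\<^esub> t) j = component s j \<cdot> component t j"
 by (simp add: DiagAlg_def)

lemma tf_comp:
 "t : Hom DA B B' ==> j : Obj I ==> x : U B j ==> tf (s \<bullet>\<^bsub>DA\<^esub> t) j x = tf s j (tf t j x)"
 using afn_comp[OF DA_HomD(6)] by (simp add: tf_def U_def component_comp)

subsection \<open>Free diagrams\<close>

definition free_diag :: "('i => 'u set) => ('k => 'u => 'u) => ('i, 'k, 'u) alg_diagram" where
 "free_diag S si = \<lparr>fob = (\<lambda>j\<in>Obj I. FA (S j)),
  far = (\<lambda>al\<in>Arr I. mkarr (FA (S (Dom I al))) (FA (S (Cod I al)))
    (Tm (S (Dom I al)) (S (Cod I al)) (si al)))\<rparr>"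

lemma free_diag_fob: "j : Obj I ==> fob (free_diag S si) j = FA (S j)"
 and U_free_diag: "j : Obj I ==> U (free_diag S si) j = TO (S j)"
 by (simp_all add: free_diag_def U_def free_fst)

lemma Bf_free_diag:
 "al : Hom I i j ==> x : TO (S i) ==> Bf (free_diag S si) al x = Tm (S i) (S j) (si al) x"
 by (auto simp: free_diag_def Bf_def Hom_iff afn_mkarr free_fst)

lemma free_diag:
 assumes S: "!!j. j : Obj I ==> small_set (S j)"
  and si: "!!al i j. al : Hom I i j ==> si al : S i \<rightarrow> S j"
  and si1: "!!j s. j : Obj I ==> s : S j ==> si (Idn I j) s = s"
  and si2: "!!al bt i j k s. al : Hom I i j ==> bt : Hom I j k ==> s : S i ==> si (bt \<bullet> al) s = si bt (si al s)"
 shows "free_diag S si : diag"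
proof -
 let ?F = "%j. FA (S j)"
 have ob: "?F j : algs" if "j : Obj I" for j using free_algs[OF S[OF that]] .
 have ar: "mkarr (?F i) (?F j) (Tm (S i) (S j) (si al)) : HA (?F i) (?F j)" if "al : Hom I i j" for al i j
  using Tm_ahom[OF si[OF that] S S] I.Hom_Obj[OF that] ob by (intro mkarr_Hom) auto
 have "is_functor I (Alg T) (free_diag S si)"
  unfolding is_functor_def
 proof (intro conjI ballI impI)
  show "fob (free_diag S si) x : Obj (Alg T)" if "x : Obj I" for x
   using ob[OF that] that by (simp add: free_diag_fob)
  show "far (free_diag S si) f : HA (fob (free_diag S si) (Dom I f)) (fob (free_diag S si) (Cod I f))" if "f : Arr I" for f
   using ar[OF I.Arr_Hom[OF that]] that I.Hom_Obj[OF I.Arr_Hom[OF that]] by (simp add: free_diag_def)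
  show "far (free_diag S si) (Idn I x) = Idn (Alg T) (fob (free_diag S si) x)" if x: "x : Obj I" for x
  proof -
   note i = I.Idn_Hom[OF x]
   have "mkarr (?F x) (?F x) (Tm (S x) (S x) (si (Idn I x))) = Idn (Alg T) (?F x)"
   proof (rule Alg_arr_eqI[OF ar[OF i] Alg.Idn_Hom])
    show "?F x : Obj (Alg T)" using ob[OF x] by simp
    fix t assume t: "t : fst (?F x)"
    thus "afn (mkarr (?F x) (?F x) (Tm (S x) (S x) (si (Idn I x)))) t = afn (Idn (Alg T) (?F x)) t"
     using Tm_cong[of "S x" "si (Idn I x)" "%x. x" "S x", OF si1[OF x]] Tm_id[OF S[OF x]]
     by (simp add: afn_mkarr afn_Idn free_fst)
   qed
   thus ?thesis using i x by (simp add: free_diag_def Hom_iff)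
  qed
  fix f g assume f: "f : Arr I" and g: "g : Arr I" and fg: "Cod I f = Dom I g"
  let ?i = "Dom I f" and ?j = "Dom I g" and ?k = "Cod I g"
  have fH: "f : Hom I ?i ?j" and gH: "g : Hom I ?j ?k" using f g fg by (auto simp: Hom_iff)
  note gf = I.comp_Hom[OF gH fH]
  note o = S[OF I.Hom_Obj(1)[OF fH]] S[OF I.Hom_Obj(2)[OF fH]] S[OF I.Hom_Obj(2)[OF gH]]
  have "mkarr (?F ?i) (?F ?k) (Tm (S ?i) (S ?k) (si (g \<bullet> f))) =
   mkarr (?F ?j) (?F ?k) (Tm (S ?j) (S ?k) (si g)) \<cdot> mkarr (?F ?i) (?F ?j) (Tm (S ?i) (S ?j) (si f))"
  proof (rule Alg_arr_eqI[OF ar[OF gf] Alg.comp_Hom[OF ar[OF gH] ar[OF fH]]])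
   fix t assume t: "t : fst (?F ?i)"
   have t': "Tm (S ?i) (S ?j) (si f) t : fst (?F ?j)"
    using Tm_in[OF si[OF fH] o(1,2)] t by (simp add: free_fst)
   show "afn (mkarr (?F ?i) (?F ?k) (Tm (S ?i) (S ?k) (si (g \<bullet> f)))) t =
    afn (mkarr (?F ?j) (?F ?k) (Tm (S ?j) (S ?k) (si g)) \<cdot> mkarr (?F ?i) (?F ?j) (Tm (S ?i) (S ?j) (si f))) t"
    unfolding afn_comp[OF ar[OF fH] t] afn_mkarr[OF t] afn_mkarr[OF t']
    using Tm_comp[OF si[OF fH] si[OF gH] o] t Tm_cong[of "S ?i" "si (g \<bullet> f)" "%s. si g (si f s)" "S ?k", OF si2[OF fH gH]]
    by (simp add: free_fst)
  qed
  thus "far (free_diag S si) (g \<bullet> f) = far (free_diag S si) g \<cdot> far (free_diag S si) f"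
   using f g gf fg by (simp add: free_diag_def Hom_iff)
 qed
 thus ?thesis by (simp add: diagrams_def free_diag_def)
qed

text \<open>The free diagram on one element at \<open>j\<close> represents the functor \<open>B \<mapsto> U B j\<close>.\<close>

definition rset :: "'i => 'i => 'u set" where
 "rset j k = (%al. code al undefined) ` Hom I j k"

definition ract :: "'k => 'u => 'u" where
 "ract bt c = code (bt \<bullet> fst (decode I c)) undefined"

definition rep :: "'i => ('i, 'k, 'u) alg_diagram" where
 "rep j = free_diag (rset j) ract"

definition gen :: "'i => 'u" where
 "gen j = eta (rset j j) (code (Idn I j) undefined)"

lemma rset_small: "small_set (rset j k)"
 unfolding rset_def by (rule small_image, rule small_subset[OF small_Arr]) (auto simp: Hom_iff)

lemma ract_code: "al : Arr I ==> ract bt (code al undefined) = code (bt \<bullet> al) undefined"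
 by (simp add: ract_def decode_code)

lemma rset_code: "al : Hom I j k ==> code al undefined : rset j k"
 by (simp add: rset_def)

lemma rsetE:
 assumes "c : rset j k" obtains al where "al : Hom I j k" "al : Arr I" "c = code al undefined" "decode I c = (al, undefined)"
 using assms decode_code by (auto simp: rset_def Hom_iff)

lemma ract_Pi: "bt : Hom I k l ==> ract bt : rset j k \<rightarrow> rset j l"
 by (auto elim!: rsetE simp: ract_code intro!: rset_code)

lemma rep_diag: "rep j : diag"
 unfolding rep_def
proof (rule free_diag[OF rset_small ract_Pi])
 show "ract (Idn I k) s = s" if "s : rset j k" for k s
  using that by (auto elim!: rsetE simp: ract_code I.comp_Idn)
 fix al bt k l m s assume a: "al : Hom I k l" "bt : Hom I l m" and s: "s : rset j k"
 obtain gm where g: "gm : Hom I j k" "s = code gm undefined" using s by (rule rsetE)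
 have "gm : Arr I" "al \<bullet> gm : Arr I" using g I.comp_Hom[OF a(1) g(1)] by (auto simp: Hom_iff)
 thus "ract (bt \<bullet> al) s = ract bt (ract al s)"
  using I.comp_assoc[OF g(1) a] by (simp add: g(2) ract_code)
qed

lemma gen_in: "j : Obj I ==> gen j : U (rep j) j"
 unfolding gen_def rep_def U_free_diag by (rule eta_in[OF rset_small rset_code[OF I.Idn_Hom]])

text \<open>The Yoneda correspondence: the generator of an arrow
  \<open>al : j \<rightarrow> k\<close> goes to \<open>Bf B al b\<close>, and this is extended
  freely at every \<open>k\<close>.\<close>

definition hat :: "'i => ('i, 'k, 'u) alg_diagram => 'u => ('i, 'k, 'u) alg_diagram_hom" where
 "hat j B b = mk_nt (rep j) B (%k x. st (fob B k) (Tm (rset j k) (U B k) (%c. Bf B (fst (decode I c)) b) x))"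

lemma hat:
 assumes B: "B : diag" and j: "j : Obj I" and b: "b : U B j"
 shows "hat j B b : Hom DA (rep j) B" "tf (hat j B b) j (gen j) = b"
proof -
 let ?g = "%c. Bf B (fst (decode I c)) b"
 have g: "?g : rset j k \<rightarrow> U B k" if "k : Obj I" for k
  using Bf_in[OF B _ b] by (auto elim!: rsetE)
 have gA: "ahom (FA (rset j k)) (fob B k) (%x. st (fob B k) (Tm (rset j k) (U B k) ?g x))"
  if "k : Obj I" for k
  unfolding U_def by (rule free_ext(1)[OF rset_small diag_ob[OF B that] g[OF that, unfolded U_def]])
 show "hat j B b : Hom DA (rep j) B"
  unfolding hat_def
 proof (rule mk_nt_Hom[OF rep_diag B])
  show "ahom (fob (rep j) k) (fob B k) (%x. st (fob B k) (Tm (rset j k) (U B k) ?g x))" if "k : Obj I" for k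
   using gA[OF that] that by (simp add: rep_def free_diag_fob)
  fix bt k l x assume be: "bt : Hom I k l" and "x : U (rep j) k"
  note o = I.Hom_Obj[OF be]
  hence x: "x : TO (rset j k)" using \<open>x : U (rep j) k\<close> by (simp add: rep_def U_free_diag)
  note s = rset_small[of j k] rset_small[of j l] U_small[OF B o(2)] U_small[OF B o(1)]
  have bP: "Bf B bt : U B k \<rightarrow> U B l" using Bf_in[OF B be] by auto
  have eq: "?g (ract bt c) = Bf B bt (?g c)" if c: "c : rset j k" for c
  proof -
   obtain al where a: "al : Hom I j k" "al : Arr I" "c = code al undefined" using c by (rule rsetE)
   have "bt \<bullet> al : Arr I" using I.comp_Hom[OF be a(1)] by (simp add: Hom_iff)
   thus ?thesis using a Bf_comp[OF B a(1) be b] by (simp add: ract_code decode_code)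
  qed
  have "st (fob B l) (Tm (rset j l) (U B l) ?g (Tm (rset j k) (rset j l) (ract bt) x))
   = st (fob B l) (Tm (rset j k) (U B l) (%c. Bf B bt (?g c)) x)"
   using Tm_comp[OF ract_Pi[OF be, of j] g[OF o(2)] s(1,2,3) x]
    Tm_cong[of "rset j k" "%c. ?g (ract bt c)" "%c. Bf B bt (?g c)" "U B l", OF eq] by simp
  also have "... = Bf B bt (st (fob B k) (Tm (rset j k) (U B k) ?g x))"
   using Tm_comp[OF g[OF o(1)] bP s(1,4,3) x] ahom_st[OF Bf_ahom[OF B be], folded U_def] Tm_in[OF g[OF o(1)] s(1,4) x]
   by simp
  finally show "st (fob B l) (Tm (rset j l) (U B l) ?g (Bf (rep j) bt x)) =
    Bf B bt (st (fob B k) (Tm (rset j k) (U B k) ?g x))"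
   using Bf_free_diag[OF be, of x "rset j" ract] x by (simp add: rep_def)
 qed
 show "tf (hat j B b) j (gen j) = b"
  unfolding hat_def tf_mk_nt[OF j gen_in[OF j]] unfolding gen_def U_def
  using free_ext(2)[OF rset_small diag_ob[OF B j] g[OF j, unfolded U_def] rset_code[OF I.Idn_Hom[OF j]]]
   I.Idn_Hom[OF j] Bf_Idn[OF B j b] by (simp add: decode_code Hom_iff)
qed

text \<open>Each free generator at \<open>k\<close> is the image of \<open>gen j\<close> under a
  transition map, so naturality and freeness leave no choice.\<close>

lemma hat_unique:
 assumes t: "t : Hom DA (rep j) B" and t': "t' : Hom DA (rep j) B" and j: "j : Obj I"
  and eq: "tf t j (gen j) = tf t' j (gen j)"
 shows "t = t'"
proof (rule DA_eqI[OF t t'])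
 fix k x assume k: "k : Obj I" and x: "x : U (rep j) k"
 have F: "fob (rep j) k = FA (rset j k)" using k by (simp add: rep_def free_diag_fob)
 show "tf t k x = tf t' k x"
 proof (rule free_unique[where f = "tf t k" and g = "tf t' k", OF rset_small[of j k] diag_ob[OF DA_HomD(2)[OF t] k]])
  show "ahom (FA (rset j k)) (fob B k) (tf t k)" using DA_HomD(7)[OF t k] F by simp
  show "ahom (FA (rset j k)) (fob B k) (tf t' k)" using DA_HomD(7)[OF t' k] F by simp
  show "x : TO (rset j k)" using x k by (simp add: rep_def U_free_diag)
  fix c assume "c : rset j k"
  then obtain al where a: "al : Hom I j k" "al : Arr I" "c = code al undefined" by (rule rsetE)
  have i: "Idn I j : Arr I" using I.Idn_Hom[OF j] by (simp add: Hom_iff)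
  have "Bf (rep j) al (gen j) = Tm (rset j j) (rset j k) (ract al) (gen j)"
   unfolding rep_def by (rule Bf_free_diag[OF a(1)]) (use gen_in[OF j] j in \<open>simp add: rep_def U_free_diag\<close>)
  also have "... = eta (rset j k) c"
   unfolding gen_def
   using eta_nat[OF ract_Pi[OF a(1)] rset_small rset_small rset_code[OF I.Idn_Hom[OF j]]] i I.comp_Idn(1)[OF a(1)] a
   by (simp add: ract_code)
  finally have c: "eta (rset j k) c = Bf (rep j) al (gen j)" by simp
  show "tf t k (eta (rset j k) c) = tf t' k (eta (rset j k) c)"
   unfolding c using DA_HomD(9)[OF t a(1) gen_in[OF j]] DA_HomD(9)[OF t' a(1) gen_in[OF j]] eq by simp
 qed
qed

end

subsection \<open>Modules, elementwise\<close>

lemma comm_group_transfer: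
 fixes G :: "'a monoid" and H :: "'b monoid"
 assumes G: "comm_group G" and ph: "ph ` carrier H = carrier G" "inj_on ph (carrier H)"
  and closed: "!!x y. x : carrier H ==> y : carrier H ==> x \<otimes>\<^bsub>H\<^esub> y : carrier H"
  and mult: "!!x y. x : carrier H ==> y : carrier H ==> ph (x \<otimes>\<^bsub>H\<^esub> y) = ph x \<otimes>\<^bsub>G\<^esub> ph y"
  and one: "\<one>\<^bsub>H\<^esub> : carrier H" "ph \<one>\<^bsub>H\<^esub> = \<one>\<^bsub>G\<^esub>"
 shows "comm_group H"
proof (rule comm_groupI)
 interpret G: comm_group G by fact
 have phc: "ph x : carrier G" if "x : carrier H" for x using that ph by blast
 fix x y z assume x: "x : carrier H" and y: "y : carrier H" and z: "z : carrier H"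
 show "x \<otimes>\<^bsub>H\<^esub> y : carrier H" using closed x y .
 show "x \<otimes>\<^bsub>H\<^esub> y \<otimes>\<^bsub>H\<^esub> z = x \<otimes>\<^bsub>H\<^esub> (y \<otimes>\<^bsub>H\<^esub> z)"
  using x y z closed mult phc by (intro inj_onD[OF ph(2)]) (auto simp: G.m_assoc)
 show "x \<otimes>\<^bsub>H\<^esub> y = y \<otimes>\<^bsub>H\<^esub> x"
  using x y closed mult phc by (intro inj_onD[OF ph(2)]) (auto simp: G.m_comm)
 show "\<one>\<^bsub>H\<^esub> \<otimes>\<^bsub>H\<^esub> x = x"
  using x one closed mult phc by (intro inj_onD[OF ph(2)]) auto
 obtain w where w: "w : carrier H" "ph w = inv\<^bsub>G\<^esub> ph x"
  using ph(1) G.inv_closed[OF phc[OF x]] by (metis imageE)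
 thus "\<exists>y\<in>carrier H. y \<otimes>\<^bsub>H\<^esub> x = \<one>\<^bsub>H\<^esub>"
  using x one closed mult phc by (intro bexI[of _ w] inj_onD[OF ph(2)]) auto
qed (rule one)

locale module_setup = diagram_setup T I for T :: "('u set, 'u smap) monad" and I :: "('i, 'k) cat" (structure) +
 fixes A :: "('i, 'k, 'u) alg_diagram" and M :: "('i, 'k, 'u) alg_diagram_hom module_obj"
 assumes A: "A : Obj (DiagAlg I T)"
  and M: "is_module (DiagAlg I T) A M"
begin

lemma A_diag: "A : diag"
 using A by simp

abbreviation SL where "SL \<equiv> slice (DiagAlg I T) A"

sublocale SL: category "slice (DiagAlg I T) A"
 by unfold_locales (rule DA.category_slice)

sublocale MA: ab_object "slice (DiagAlg I T) A" M
 using M by unfold_locales (simp add: is_module_def)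

lemma Obj_SL: "p : Obj SL \<longleftrightarrow> p : Hom DA (fst p) A"
 by (simp add: Hom_iff)

lemma SL_HomD:
 assumes "f : Hom SL p q"
 shows "f = (p, fst (snd f), q)" "p : Hom DA (fst p) A" "q : Hom DA (fst q) A"
  "fst (snd f) : Hom DA (fst p) (fst q)" "q \<bullet>\<^bsub>DA\<^esub> fst (snd f) = p"
 using assms unfolding slice_Hom by (auto simp: Hom_iff)

definition sf where "sf f = tf (fst (snd f))"

lemma sf_in: "f : Hom SL p q ==> j : Obj I ==> x : U (fst p) j ==> sf f j x : U (fst q) j"
 unfolding sf_def by (rule DA_HomD(8)[OF SL_HomD(4)])

lemma sf_over: "f : Hom SL p q ==> j : Obj I ==> x : U (fst p) j ==> tf q j (sf f j x) = tf p j x"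
 unfolding sf_def using tf_comp[OF SL_HomD(4)] SL_HomD(5) by metis

lemma sf_ahom: "f : Hom SL p q ==> j : Obj I ==> ahom (fob (fst p) j) (fob (fst q) j) (sf f j)"
 unfolding sf_def by (rule DA_HomD(7)[OF SL_HomD(4)])

lemma sf_nat: "f : Hom SL p q ==> al : Hom I i j ==> x : U (fst p) i ==>
  sf f j (Bf (fst p) al x) = Bf (fst q) al (sf f i x)"
 unfolding sf_def by (rule DA_HomD(9)[OF SL_HomD(4)])

lemma sf_comp: "f : Hom SL p q ==> g : Hom SL q r ==> j : Obj I ==> x : U (fst p) j ==>
  sf (g \<bullet>\<^bsub>SL\<^esub> f) j x = sf g j (sf f j x)"
 unfolding sf_def using tf_comp[OF SL_HomD(4)] by simp

text \<open>The element \<open>x\<close> of \<open>p\<close> at \<open>j\<close> as a generalized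
  point of the slice, with the representable over the image of \<open>x\<close> in
  \<open>A(j)\<close> as its source. It translates universal properties in the slice into statements
  about elements.\<close>

definition pt where "pt p j x = (hat j A (tf p j x), hat j (fst p) x, p)"

lemma pt_Hom:
 assumes p: "p : Obj SL" and j: "j : Obj I" and x: "x : U (fst p) j"
 shows "pt p j x : Hom SL (hat j A (tf p j x)) p" "sf (pt p j x) j (gen j) = x"
proof -
 note pH = p[unfolded Obj_SL]
 note h = hat[OF DA_HomD(1)[OF pH] j x]
 note hA = hat[OF A_diag j DA_HomD(8)[OF pH j x]]
 have "p \<bullet>\<^bsub>DA\<^esub> hat j (fst p) x = hat j A (tf p j x)"
  using tf_comp[OF h(1) j gen_in[OF j], of p] h(2) hA by (intro hat_unique[OF DA.comp_Hom[OF pH h(1)] hA(1) j]) simp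
 thus "pt p j x : Hom SL (hat j A (tf p j x)) p"
  using h(1) hA(1) pH unfolding pt_def slice_Hom by (simp add: Hom_iff)
 show "sf (pt p j x) j (gen j) = x" using h(2) by (simp add: pt_def sf_def)
qed

lemma fst_hat: "fst (hat j B b) = rep j"
 by (simp add: hat_def mk_nt_def)

lemma pt_unique:
 assumes f: "f : Hom SL (hat j A a) p" and j: "j : Obj I" and a: "a : U A j"
 shows "f = pt p j (sf f j (gen j))" "sf f j (gen j) : U (fst p) j" "tf p j (sf f j (gen j)) = a"
proof -
 have g: "gen j : U (fst (hat j A a)) j" using gen_in[OF j] by (simp add: fst_hat)
 show x: "sf f j (gen j) : U (fst p) j" by (rule sf_in[OF f j g])
 show ta: "tf p j (sf f j (gen j)) = a" using sf_over[OF f j g] hat(2)[OF A_diag j a] by simp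
 have p: "p : Obj SL" using SL_HomD(3)[OF f] Obj_SL by simp
 have u: "fst (snd f) : Hom DA (rep j) (fst p)" using SL_HomD(4)[OF f] by (simp add: fst_hat)
 have "fst (snd f) = hat j (fst p) (sf f j (gen j))"
  using hat[OF DA_HomD(2)[OF u] j x] by (intro hat_unique[OF u _ j]) (auto simp: sf_def)
 thus "f = pt p j (sf f j (gen j))"
  using SL_HomD(1)[OF f] ta by (simp add: pt_def)
qed

lemma pt_comp:
 assumes f: "f : Hom SL p q" and j: "j : Obj I" and x: "x : U (fst p) j"
 shows "f \<bullet>\<^bsub>SL\<^esub> pt p j x = pt q j (sf f j x)"
proof -
 have p: "p : Obj SL" using SL_HomD(2)[OF f] Obj_SL by simp
 note h = pt_Hom[OF p j x]
 have g: "gen j : U (fst (hat j A (tf p j x))) j" using gen_in[OF j] by (simp add: fst_hat)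
 have "tf p j x : U A j" using DA_HomD(8)[OF SL_HomD(2)[OF f] j x] .
 from pt_unique(1)[OF SL.comp_Hom[OF f h(1)] j this] show ?thesis
  using sf_comp[OF h(1) f j g] h(2) by simp
qed

section \<open>The diagram underlying \<open>M\<close>, its fibres and their group laws\<close>

definition Mob where "Mob = fst (gob M)"
definition pim where "pim j = tf (gob M) j"
definition Pob where "Pob = Dom SL (gpr1 M)"

lemma gob: "gob M : Obj SL" "gob M : Hom DA Mob A"
proof -
 show "gob M : Obj SL" using MA.ab_obj unfolding is_ab_grp_obj_def by (elim conjE)
 thus "gob M : Hom DA Mob A" unfolding Mob_def Obj_SL .
qed

lemma Mob_diag: "Mob : diag"
 by (rule DA_HomD(1)[OF gob(2)])

lemma pim_in: "j : Obj I ==> m : U Mob j ==> pim j m : U A j"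
 unfolding pim_def by (rule DA_HomD(8)[OF gob(2)])

lemma pim_ahom: "j : Obj I ==> ahom (fob Mob j) (fob A j) (pim j)"
 unfolding pim_def by (rule DA_HomD(7)[OF gob(2)])

lemma pim_nat: "al : Hom I i j ==> m : U Mob i ==> pim j (Bf Mob al m) = Bf A al (pim i m)"
 unfolding pim_def by (rule DA_HomD(9)[OF gob(2)])

lemmas gpr = MA.gpr[folded Pob_def]
lemmas gadd = MA.gadd[folded Pob_def]

lemma Pob: "Pob : Obj SL" "Pob : Hom DA (fst Pob) A"
 using SL.Hom_Obj(1)[OF gpr(1)] Obj_SL by auto

text \<open>The group structure of the fibre of \<open>M(j)\<close> over \<open>a\<close> is that of \<open>Hom(rep j, M)\<close> over \<open>a\<close>.\<close>

definition fibg where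
 "fibg j a = \<lparr>carrier = {m : U Mob j. pim j m = a},
  mult = (%m m'. sf (plus_arr SL M (pt (gob M) j m) (pt (gob M) j m')) j (gen j)),
  one = sf (gzero M \<bullet>\<^bsub>SL\<^esub> to_one SL M (hat j A a)) j (gen j)\<rparr>"

lemma fibg_carrier: "m : carrier (fibg j a) \<longleftrightarrow> m : U Mob j & pim j m = a"
 by (simp add: fibg_def)

lemma pt_fib:
 assumes "j : Obj I" "m : carrier (fibg j a)"
 shows "pt (gob M) j m : Hom SL (hat j A a) (gob M)"
 using pt_Hom(1)[OF gob(1) assms(1), of m] assms(2) by (simp add: fibg_carrier Mob_def pim_def)

lemma hat_SL: "j : Obj I ==> a : U A j ==> hat j A a : Obj SL"
 using hat(1)[OF A_diag] by (simp add: Hom_iff)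

lemma fibg_mult:
 assumes j: "j : Obj I" and a: "a : U A j" and m: "m : carrier (fibg j a)" "m' : carrier (fibg j a)"
 shows "m \<otimes>\<^bsub>fibg j a\<^esub> m' : carrier (fibg j a)"
  "pt (gob M) j (m \<otimes>\<^bsub>fibg j a\<^esub> m') = plus_arr SL M (pt (gob M) j m) (pt (gob M) j m')"
 using pt_unique[OF MA.plus_Hom[OF pt_fib[OF j m(1)] pt_fib[OF j m(2)]] j a]
 by (simp_all add: fibg_def Mob_def pim_def)

lemma fibg_one:
 assumes j: "j : Obj I" and a: "a : U A j"
 shows "\<one>\<^bsub>fibg j a\<^esub> : carrier (fibg j a)"
  "pt (gob M) j \<one>\<^bsub>fibg j a\<^esub> = gzero M \<bullet>\<^bsub>SL\<^esub> to_one SL M (hat j A a)"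
 using pt_unique[OF SL.comp_Hom[OF MA.gzero MA.to_one[OF hat_SL[OF j a]]] j a]
 by (simp_all add: fibg_def Mob_def pim_def)

lemma pt_inj: "pt p j x = pt p j y ==> p : Obj SL ==> j : Obj I ==> x : U (fst p) j ==> y : U (fst p) j ==> x = y"
 using pt_Hom(2) by metis

lemma fibg_pt:
 assumes j: "j : Obj I" and a: "a : U A j"
 shows "pt (gob M) j ` carrier (fibg j a) = Hom SL (hat j A a) (gob M)" "inj_on (pt (gob M) j) (carrier (fibg j a))"
proof -
 show "pt (gob M) j ` carrier (fibg j a) = Hom SL (hat j A a) (gob M)"
 proof
  show "pt (gob M) j ` carrier (fibg j a) \<subseteq> Hom SL (hat j A a) (gob M)" using pt_fib[OF j] by blast
  show "Hom SL (hat j A a) (gob M) \<subseteq> pt (gob M) j ` carrier (fibg j a)"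
  proof
   fix f assume f: "f : Hom SL (hat j A a) (gob M)"
   show "f : pt (gob M) j ` carrier (fibg j a)"
    using pt_unique[OF f j a] by (intro image_eqI[of _ _ "sf f j (gen j)"]) (simp_all add: fibg_carrier Mob_def pim_def)
  qed
 qed
 show "inj_on (pt (gob M) j) (carrier (fibg j a))"
  using pt_inj[OF _ gob(1) j] by (auto simp: inj_on_def fibg_carrier Mob_def)
qed

lemma comm_group_fibg:
 assumes j: "j : Obj I" and a: "a : U A j"
 shows "comm_group (fibg j a)"
proof (rule comm_group_transfer[OF MA.comm_group_hom_grp[OF hat_SL[OF j a]]])
 show "pt (gob M) j ` carrier (fibg j a) = carrier (hom_grp SL (hat j A a) M)"
  using fibg_pt(1)[OF j a] by (simp add: hom_grp_def)
 show "inj_on (pt (gob M) j) (carrier (fibg j a))" by (rule fibg_pt(2)[OF j a])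
qed (use fibg_mult[OF j a] fibg_one[OF j a] in \<open>simp_all add: hom_grp_def\<close>)

lemma fibg_inv:
 assumes j: "j : Obj I" and a: "a : U A j" and m: "m : carrier (fibg j a)"
 shows "inv\<^bsub>fibg j a\<^esub> m = sf (gneg M) j m"
proof -
 interpret F: comm_group "fibg j a" by (rule comm_group_fibg[OF j a])
 interpret H: comm_group "hom_grp SL (hat j A a) M" by (rule MA.comm_group_hom_grp[OF hat_SL[OF j a]])
 have mU: "m : U (fst (gob M)) j" using m by (simp add: fibg_carrier Mob_def)
 have c: "sf (gneg M) j m : carrier (fibg j a)"
  using sf_in[OF MA.gneg j mU] sf_over[OF MA.gneg j mU] m by (simp add: fibg_carrier Mob_def pim_def)
 have "pt (gob M) j (sf (gneg M) j m \<otimes>\<^bsub>fibg j a\<^esub> m) = plus_arr SL M (gneg M \<bullet>\<^bsub>SL\<^esub> pt (gob M) j m) (pt (gob M) j m)"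
  using fibg_mult(2)[OF j a c m] pt_comp[OF MA.gneg j mU] by simp
 also have "... = gzero M \<bullet>\<^bsub>SL\<^esub> to_one SL M (hat j A a)"
  using H.l_inv[of "pt (gob M) j m"] MA.hom_grp_inv[OF pt_fib[OF j m]] pt_fib[OF j m] by (simp add: hom_grp_def)
 also have "... = pt (gob M) j \<one>\<^bsub>fibg j a\<^esub>" using fibg_one[OF j a] by simp
 finally have "sf (gneg M) j m \<otimes>\<^bsub>fibg j a\<^esub> m = \<one>\<^bsub>fibg j a\<^esub>"
  using fibg_mult(1)[OF j a c m] fibg_one(1)[OF j a] inj_onD[OF fibg_pt(2)[OF j a]] by blast
 thus ?thesis using F.inv_equality c m by simp
qed

text \<open>The product \<open>Pob\<close> of the slice is known only by its universal property.
  Tested on representables it yields an element for every pair in a fibre, on which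
  \<open>gadd\<close> is the fibre multiplication; \<open>pair_inj\<close> gives uniqueness.\<close>

lemma pair_ex1:
 assumes j: "j : Obj I" and a: "a : U A j" and m: "m : carrier (fibg j a)" "m' : carrier (fibg j a)"
 shows "\<exists>x. x : U (fst Pob) j & sf (gpr1 M) j x = m & sf (gpr2 M) j x = m' & sf (gadd M) j x = m \<otimes>\<^bsub>fibg j a\<^esub> m'"
proof -
 note ms = pt_fib[OF j m(1)] pt_fib[OF j m(2)]
 note w = MA.pairing[OF ms, folded Pob_def]
 let ?x = "sf (pairing SL M (pt (gob M) j m) (pt (gob M) j m')) j (gen j)"
 note x = pt_unique[OF w(1) j a]
 have mU: "m : U (fst (gob M)) j" "m' : U (fst (gob M)) j" using m by (simp_all add: fibg_carrier Mob_def)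
 have p: "pt (gob M) j (sf (gpr1 M) j ?x) = pt (gob M) j m" "pt (gob M) j (sf (gpr2 M) j ?x) = pt (gob M) j m'"
  using pt_comp[OF gpr(1) j x(2)] pt_comp[OF gpr(2) j x(2)] x(1) w by metis+
 have "pt (gob M) j (sf (gadd M) j ?x) = plus_arr SL M (pt (gob M) j m) (pt (gob M) j m')"
  using pt_comp[OF gadd j x(2)] x(1) unfolding plus_arr_def by simp
 hence "pt (gob M) j (sf (gadd M) j ?x) = pt (gob M) j (m \<otimes>\<^bsub>fibg j a\<^esub> m')"
  using fibg_mult(2)[OF j a m] by simp
 hence "sf (gadd M) j ?x = m \<otimes>\<^bsub>fibg j a\<^esub> m'"
  using fibg_mult(1)[OF j a m] pt_inj[OF _ gob(1) j sf_in[OF gadd j x(2)]] by (simp add: fibg_carrier Mob_def)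
 thus ?thesis
  using x(2) pt_inj[OF p(1) gob(1) j sf_in[OF gpr(1) j x(2)] mU(1)] pt_inj[OF p(2) gob(1) j sf_in[OF gpr(2) j x(2)] mU(2)]
  by (intro exI[of _ ?x]) simp
qed

lemma pair_inj:
 assumes j: "j : Obj I" and x: "x : U (fst Pob) j" "y : U (fst Pob) j"
  and eq: "sf (gpr1 M) j x = sf (gpr1 M) j y" "sf (gpr2 M) j x = sf (gpr2 M) j y"
 shows "x = y"
proof -
 have "tf Pob j x = tf Pob j y"
  using sf_over[OF gpr(1) j x(1)] sf_over[OF gpr(1) j x(2)] eq by simp
 hence h: "pt Pob j x : Hom SL (hat j A (tf Pob j x)) Pob" "pt Pob j y : Hom SL (hat j A (tf Pob j x)) Pob"
  using pt_Hom(1)[OF Pob(1) j x(1)] pt_Hom(1)[OF Pob(1) j x(2)] by simp_all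
 have "pt Pob j x = pt Pob j y"
  using MA.pairing_unique[folded Pob_def, OF h(1)] MA.pairing_unique[folded Pob_def, OF h(2)]
   pt_comp[OF gpr(1) j x(1)] pt_comp[OF gpr(1) j x(2)] pt_comp[OF gpr(2) j x(1)] pt_comp[OF gpr(2) j x(2)] eq by simp
 thus ?thesis by (rule pt_inj[OF _ Pob(1) j x])
qed

lemma pair_fib:
 assumes "j : Obj I" "x : U (fst Pob) j"
 shows "sf (gpr1 M) j x : carrier (fibg j (tf Pob j x))" "sf (gpr2 M) j x : carrier (fibg j (tf Pob j x))"
 using sf_in[OF gpr(1) assms] sf_over[OF gpr(1) assms] sf_in[OF gpr(2) assms] sf_over[OF gpr(2) assms]
 by (simp_all add: fibg_carrier Mob_def pim_def)

lemma gadd_pair: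
 assumes j: "j : Obj I" and x: "x : U (fst Pob) j"
 shows "sf (gadd M) j x = sf (gpr1 M) j x \<otimes>\<^bsub>fibg j (tf Pob j x)\<^esub> sf (gpr2 M) j x"
 using pair_ex1[OF j DA_HomD(8)[OF Pob(2) j x] pair_fib[OF j x]] pair_inj[OF j _ x] by metis

lemma gone_Obj: "gone M : Obj SL" "gone M : Hom DA (fst (gone M)) A"
proof -
 show "gone M : Obj SL" using SL.Hom_Obj(1)[OF MA.gzero] .
 thus "gone M : Hom DA (fst (gone M)) A" unfolding Obj_SL .
qed

lemma gone_ex:
 assumes j: "j : Obj I" and a: "a : U A j"
 shows "\<exists>x. x : U (fst (gone M)) j & tf (gone M) j x = a & sf (gzero M) j x = \<one>\<^bsub>fibg j a\<^esub>"
proof -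
 note o = MA.to_one[OF hat_SL[OF j a]]
 note x = pt_unique[OF o j a]
 let ?x = "sf (to_one SL M (hat j A a)) j (gen j)"
 have "pt (gob M) j (sf (gzero M) j ?x) = pt (gob M) j \<one>\<^bsub>fibg j a\<^esub>"
  using pt_comp[OF MA.gzero j x(2)] x(1) fibg_one(2)[OF j a] by simp
 hence "sf (gzero M) j ?x = \<one>\<^bsub>fibg j a\<^esub>"
  using fibg_one(1)[OF j a] pt_inj[OF _ gob(1) j sf_in[OF MA.gzero j x(2)]] by (simp add: fibg_carrier Mob_def)
 thus ?thesis using x by blast
qed

lemma gone_inj:
 assumes j: "j : Obj I" and x: "x : U (fst (gone M)) j" "y : U (fst (gone M)) j" and eq: "tf (gone M) j x = tf (gone M) j y"
 shows "x = y"
 using MA.to_one_unique[OF pt_Hom(1)[OF gone_Obj(1) j x(1)]] MA.to_one_unique[OF pt_Hom(1)[OF gone_Obj(1) j x(2)]] eq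
 by (intro pt_inj[OF _ gone_Obj(1) j x]) simp

text \<open>Pointwise pairs exist by \<open>pair_ex1\<close>, and they form a homomorphism because
  the projections are jointly injective. The source is a single algebra \<open>B\<close>, so this is
  the universal property of \<open>Pob\<close> after evaluation at \<open>j\<close>.\<close>

lemma pair_lift:
 assumes B: "B : algs" and j: "j : Obj I" and u: "ahom B (fob Mob j) u" and u': "ahom B (fob Mob j) u'"
  and p: "!!x. x : fst B ==> pim j (u x) = p x" "!!x. x : fst B ==> pim j (u' x) = p x"
 obtains w where "ahom B (fob (fst Pob) j) w"
  "!!x. x : fst B ==> sf (gpr1 M) j (w x) = u x & sf (gpr2 M) j (w x) = u' x & sf (gadd M) j (w x) = u x \<otimes>\<^bsub>fibg j (p x)\<^esub> u' x"
proof -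
 have c: "u x : carrier (fibg j (p x))" "u' x : carrier (fibg j (p x))" "p x : U A j" if "x : fst B" for x
  using ahom_in[OF u that] ahom_in[OF u' that] p[OF that] pim_in[OF j, of "u x"] by (auto simp: fibg_carrier U_def)
 define w where "w x = (SOME y. y : U (fst Pob) j & sf (gpr1 M) j y = u x & sf (gpr2 M) j y = u' x &
   sf (gadd M) j y = u x \<otimes>\<^bsub>fibg j (p x)\<^esub> u' x)" for x
 have w: "w x : U (fst Pob) j & sf (gpr1 M) j (w x) = u x & sf (gpr2 M) j (w x) = u' x &
   sf (gadd M) j (w x) = u x \<otimes>\<^bsub>fibg j (p x)\<^esub> u' x" if "x : fst B" for x
  unfolding w_def by (rule someI_ex[OF pair_ex1[OF j c(3)[OF that] c(1)[OF that] c(2)[OF that]]])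
 note P = diag_ob[OF DA_HomD(1)[OF Pob(2)] j]
 note Mj = diag_ob[OF Mob_diag j]
 have "ahom B (fob (fst Pob) j) w"
 proof (rule ahom_joint[OF B P Mj Mj sf_ahom[OF gpr(1) j, folded Mob_def] sf_ahom[OF gpr(2) j, folded Mob_def]])
  show "z = z'" if "z : fst (fob (fst Pob) j)" "z' : fst (fob (fst Pob) j)"
   "sf (gpr1 M) j z = sf (gpr1 M) j z'" "sf (gpr2 M) j z = sf (gpr2 M) j z'" for z z'
   using pair_inj[OF j] that by (simp add: U_def)
  show "w : fst B \<rightarrow> fst (fob (fst Pob) j)" using w by (auto simp: U_def)
  show "ahom B (fob Mob j) (%x. sf (gpr1 M) j (w x))"
   using ahom_cong[of B "%x. sf (gpr1 M) j (w x)" u] w B u by simp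
  show "ahom B (fob Mob j) (%x. sf (gpr2 M) j (w x))"
   using ahom_cong[of B "%x. sf (gpr2 M) j (w x)" u'] w B u' by simp
 qed
 thus thesis using w that by blast
qed

lemma ahom_add:
 assumes B: "B : algs" and j: "j : Obj I" and u: "ahom B (fob Mob j) u" and u': "ahom B (fob Mob j) u'"
  and p: "!!x. x : fst B ==> pim j (u x) = p x" "!!x. x : fst B ==> pim j (u' x) = p x"
 shows "ahom B (fob Mob j) (%x. u x \<otimes>\<^bsub>fibg j (p x)\<^esub> u' x)"
proof -
 obtain w where w: "ahom B (fob (fst Pob) j) w" "!!x. x : fst B ==> sf (gadd M) j (w x) = u x \<otimes>\<^bsub>fibg j (p x)\<^esub> u' x"
  using pair_lift[OF assms] by metis
 from ahom_comp[OF w(1) sf_ahom[OF gadd j, folded Mob_def] B diag_ob[OF DA_HomD(1)[OF Pob(2)] j] diag_ob[OF Mob_diag j]]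
 show ?thesis using ahom_cong[of B "%x. sf (gadd M) j (w x)"] w(2) B by simp
qed

lemma zero_lift:
 assumes B: "B : algs" and j: "j : Obj I" and p: "ahom B (fob A j) p"
 obtains w where "ahom B (fob (fst (gone M)) j) w"
  "!!x. x : fst B ==> tf (gone M) j (w x) = p x & sf (gzero M) j (w x) = \<one>\<^bsub>fibg j (p x)\<^esub>"
proof -
 have c: "p x : U A j" if "x : fst B" for x using ahom_in[OF p that] by (simp add: U_def)
 define w where "w x = (SOME y. y : U (fst (gone M)) j & tf (gone M) j y = p x & sf (gzero M) j y = \<one>\<^bsub>fibg j (p x)\<^esub>)" for x
 have w: "w x : U (fst (gone M)) j & tf (gone M) j (w x) = p x & sf (gzero M) j (w x) = \<one>\<^bsub>fibg j (p x)\<^esub>"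
  if "x : fst B" for x
  unfolding w_def by (rule someI_ex[OF gone_ex[OF j c[OF that]]])
 note P = diag_ob[OF DA_HomD(1)[OF gone_Obj(2)] j]
 note Aj = diag_ob[OF A_diag j]
 have "ahom B (fob (fst (gone M)) j) w"
 proof (rule ahom_joint[OF B P Aj Aj DA_HomD(7)[OF gone_Obj(2) j] DA_HomD(7)[OF gone_Obj(2) j]])
  show "z = z'" if "z : fst (fob (fst (gone M)) j)" "z' : fst (fob (fst (gone M)) j)" "tf (gone M) j z = tf (gone M) j z'" for z z'
   using gone_inj[OF j] that by (simp add: U_def)
  show "w : fst B \<rightarrow> fst (fob (fst (gone M)) j)" using w by (auto simp: U_def)
  show "ahom B (fob A j) (%x. tf (gone M) j (w x))"
   using ahom_cong[of B "%x. tf (gone M) j (w x)" p] w B p by simp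
  thus "ahom B (fob A j) (%x. tf (gone M) j (w x))" .
 qed
 thus thesis using w that by blast
qed

lemma ahom_zero:
 assumes B: "B : algs" and j: "j : Obj I" and p: "ahom B (fob A j) p"
 shows "ahom B (fob Mob j) (%x. \<one>\<^bsub>fibg j (p x)\<^esub>)"
proof -
 obtain w where w: "ahom B (fob (fst (gone M)) j) w" "!!x. x : fst B ==> sf (gzero M) j (w x) = \<one>\<^bsub>fibg j (p x)\<^esub>"
  using zero_lift[OF assms] by metis
 from ahom_comp[OF w(1) sf_ahom[OF MA.gzero j, folded Mob_def] B diag_ob[OF DA_HomD(1)[OF gone_Obj(2)] j] diag_ob[OF Mob_diag j]]
 show ?thesis using ahom_cong[of B "%x. sf (gzero M) j (w x)"] w(2) B by simp
qed

lemma ahom_inv: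
 assumes B: "B : algs" and j: "j : Obj I" and u: "ahom B (fob Mob j) u"
  and p: "!!x. x : fst B ==> pim j (u x) = p x"
 shows "ahom B (fob Mob j) (%x. inv\<^bsub>fibg j (p x)\<^esub> u x)"
proof -
 have c: "u x : carrier (fibg j (p x))" "p x : U A j" if "x : fst B" for x
  using ahom_in[OF u that] p[OF that] pim_in[OF j, of "u x"] by (auto simp: fibg_carrier U_def)
 note Mj = diag_ob[OF Mob_diag j]
 from ahom_comp[OF u sf_ahom[OF MA.gneg j, folded Mob_def] B Mj Mj] show ?thesis
  using ahom_cong[of B "%x. sf (gneg M) j (u x)" "%x. inv\<^bsub>fibg j (p x)\<^esub> u x"] fibg_inv[OF j c(2) c(1)] B by simp
qed

lemma Mf_fib: "al : Hom I i j ==> m : carrier (fibg i a) ==> Bf Mob al m : carrier (fibg j (Bf A al a))"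
 using Bf_in[OF Mob_diag] pim_nat by (auto simp: fibg_carrier)

text \<open>Both projections and \<open>gadd\<close> are natural, so \<open>al\<close> carries the
  pair \<open>(m, m')\<close> in \<open>Pob\<close> to the pair of images and its sum to their
  sum.\<close>

lemma Mf_mult:
 assumes al: "al : Hom I i j" and a: "a : U A i" and m: "m : carrier (fibg i a)" "m' : carrier (fibg i a)"
 shows "Bf Mob al (m \<otimes>\<^bsub>fibg i a\<^esub> m') = Bf Mob al m \<otimes>\<^bsub>fibg j (Bf A al a)\<^esub> Bf Mob al m'"
proof -
 note o = I.Hom_Obj[OF al]
 obtain x where x: "x : U (fst Pob) i" "sf (gpr1 M) i x = m" "sf (gpr2 M) i x = m'" "sf (gadd M) i x = m \<otimes>\<^bsub>fibg i a\<^esub> m'"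
  using pair_ex1[OF o(1) a m] by blast
 let ?y = "Bf (fst Pob) al x"
 have y: "?y : U (fst Pob) j" by (rule Bf_in[OF DA_HomD(1)[OF Pob(2)] al x(1)])
 have p: "sf (gpr1 M) j ?y = Bf Mob al m" "sf (gpr2 M) j ?y = Bf Mob al m'" "sf (gadd M) j ?y = Bf Mob al (m \<otimes>\<^bsub>fibg i a\<^esub> m')"
  using sf_nat[OF gpr(1) al x(1)] sf_nat[OF gpr(2) al x(1)] sf_nat[OF gadd al x(1)] x by (simp_all add: Mob_def)
 have "tf Pob j ?y = Bf A al a"
  using pair_fib(1)[OF o(2) y] p(1) Mf_fib[OF al m(1)] by (simp add: fibg_carrier)
 thus ?thesis using gadd_pair[OF o(2) y] p by simp
qed

end

subsection \<open>Alternating sums\<close>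

definition alt :: "nat => 'a::ab_group_add => 'a" where
 "alt n x = (if even n then x else - x)"

lemma alt_simps [simp]: "alt 0 x = x" "alt (Suc n) x = - alt n x" "alt n 0 = 0"
 by (auto simp: alt_def)

lemma alt_add: "alt n (x + y) = alt n x + alt n y"
 and alt_minus: "alt n (- x) = - alt n x"
 and alt_alt: "alt m (alt n x) = alt (m + n) x"
 and alt_sum_in: "alt n (\<Sum>i\<in>S. f i) = (\<Sum>i\<in>S. alt n (f i))"
 by (auto simp: alt_def sum_negf)

lemma (in addmap) alt: "f (alt n x) = alt n (f x)"
 by (simp add: alt_def minus)

lemma subgp_alt: "subgp S ==> x : S ==> alt n x : S"
 by (simp add: alt_def subgp_minus)

lemma addmap_alt_sum:
 assumes "!!i. i : S ==> addmap (f i)"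
 shows "addmap (%x. \<Sum>i\<in>S. alt (a i) (f i x))"
 by unfold_locales (simp add: addmap.add[OF assms] alt_add sum.distrib)

text \<open>The cosimplicial identity pairs the term \<open>(l, k)\<close> with \<open>k < l\<close>
  with the term \<open>(k, l - 1)\<close>, whose sign is opposite.\<close>

lemma cosimplicial_square:
 fixes f :: "nat => 'a => 'b::ab_group_add" and g :: "nat => 'b => 'c::ab_group_add"
 assumes g: "!!l. l <= Suc (Suc n) ==> addmap (g l)"
  and fg: "!!k l. k < l ==> l <= Suc (Suc n) ==> g l (f k x) = g k (f (l - 1) x)"
 shows "(\<Sum>l\<le>Suc (Suc n). alt l (g l (\<Sum>k\<le>Suc n. alt k (f k x)))) = 0"
proof -
 define S where "S = {..Suc (Suc n)} \<times> {..Suc n}"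
 define S1 where "S1 = {(l, k) : S. k < l}"
 define S2 where "S2 = {(l, k) : S. l <= k}"
 define t where "t = (%(l, k). alt (l + k) (g l (f k x)))"
 have "(\<Sum>l\<le>Suc (Suc n). alt l (g l (\<Sum>k\<le>Suc n. alt k (f k x)))) =
   (\<Sum>l\<le>Suc (Suc n). \<Sum>k\<le>Suc n. t (l, k))"
 proof (rule sum.cong[OF refl])
  fix l assume "l : {..Suc (Suc n)}"
  then interpret gl: addmap "g l" using g by simp
  show "alt l (g l (\<Sum>k\<le>Suc n. alt k (f k x))) = (\<Sum>k\<le>Suc n. t (l, k))"
   unfolding gl.sum alt_sum_in t_def prod.case by (rule sum.cong[OF refl]) (simp only: gl.alt alt_alt)
 qed
 also have "... = sum t S" unfolding S_def by (subst sum.cartesian_product) (simp only: case_prod_eta)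
 also have "... = sum t S1 + sum t S2"
 proof -
  have "S = S1 \<union> S2" "S1 \<inter> S2 = {}" by (auto simp: S1_def S2_def)
  moreover have "finite S1" "finite S2"
   unfolding S1_def S2_def by (rule finite_subset[of _ S]; auto simp: S_def)+
  ultimately show ?thesis by (simp add: sum.union_disjoint)
 qed
 also have "sum t S1 = sum (%y. - t y) S2"
 proof (rule sum.reindex_bij_witness[of _ "%(l, k). (Suc k, l)" "%(l, k). (k, l - 1)"])
  fix y assume y: "y : S1"
  then obtain l k where lk: "y = (l, k)" "k < l" "l <= Suc (Suc n)" by (auto simp: S1_def S_def)
  then obtain l' where l': "l = Suc l'" by (cases l) auto
  have "t y = alt (l + k) (g k (f (l - 1) x))" using fg[OF lk(2,3)] lk by (simp add: t_def)
  thus "- t ((%(l, k). (k, l - 1)) y) = t y" using lk l' by (simp add: t_def add.commute)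
  show "(%(l, k). (Suc k, l)) ((%(l, k). (k, l - 1)) y) = y" using lk by auto
  show "(%(l, k). (k, l - 1)) y : S2" using lk by (auto simp: S2_def S_def)
 qed (auto simp: S1_def S2_def S_def)
 finally show ?thesis by (simp add: sum_negf)
qed

text \<open>The chain homotopy formula dual to a simplicial homotopy from the identity to the map
  inducing \<open>e\<close>: \<open>D0\<close>, \<open>D1\<close> are cofaces, and
  \<open>s0\<close>, \<open>s1\<close> are induced by the homotopy operators.\<close>

lemma simplicial_homotopy:
 fixes D0 :: "nat => 'a::ab_group_add => 'b::ab_group_add" and D1 :: "nat => 'b => 'c::ab_group_add"
  and s0 :: "nat => 'b => 'a" and s1 :: "nat => 'c => 'b"
 assumes D0: "!!i. i <= Suc n ==> addmap (D0 i)" and s1: "!!j. j <= Suc n ==> addmap (s1 j)"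
  and id: "s1 0 (D1 0 x) = x" and e: "s1 (Suc n) (D1 (Suc (Suc n)) x) = e"
  and lt: "!!i j. i < j ==> j <= Suc n ==> s1 j (D1 i x) = D0 i (s0 (j - 1) x)"
  and eq: "!!j. j < Suc n ==> s1 (Suc j) (D1 (Suc j) x) = s1 j (D1 (Suc j) x)"
  and gt: "!!i j. Suc j < i ==> i <= Suc (Suc n) ==> s1 j (D1 i x) = D0 (i - 1) (s0 j x)"
 shows "(\<Sum>j\<le>Suc n. alt j (s1 j (\<Sum>i\<le>Suc (Suc n). alt i (D1 i x)))) +
  (\<Sum>i\<le>Suc n. alt i (D0 i (\<Sum>j\<le>n. alt j (s0 j x)))) = x - e"
proof -
 define S where "S = {..Suc n} \<times> {..Suc (Suc n)}"
 \<comment> \<open>The terms with \<open>i < j\<close> and those with \<open>i > j + 1\<close>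
   cancel against the two halves \<open>R1\<close> and \<open>R2\<close> of the second double sum.
   The diagonals \<open>i = j\<close> and \<open>i = j + 1\<close> telescope.\<close>
 define S1 where "S1 = {(j, i) : S. i < j}"
 define S2 where "S2 = {(j, i) : S. i = j}"
 define S3 where "S3 = {(j, i) : S. i = Suc j}"
 define S4 where "S4 = {(j, i) : S. Suc j < i}"
 define t where "t = (%(j, i). alt (j + i) (s1 j (D1 i x)))"
 define R where "R = {..Suc n} \<times> {..n}"
 define R1 where "R1 = {(i, j) : R. i <= j}"
 define R2 where "R2 = {(i, j) : R. j < i}"
 define r where "r = (%(i, j). alt (i + j) (D0 i (s0 j x)))"
 have finSR: "finite S" "finite R" by (simp_all add: S_def R_def)
 have "S1 \<subseteq> S" "S2 \<subseteq> S" "S3 \<subseteq> S" "S4 \<subseteq> S" "R1 \<subseteq> R" "R2 \<subseteq> R"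
  by (auto simp: S1_def S2_def S3_def S4_def R1_def R2_def)
 hence fin: "finite S1" "finite S2" "finite S3" "finite S4" "finite R1" "finite R2"
  using finSR finite_subset by blast+
 have "(\<Sum>j\<le>Suc n. alt j (s1 j (\<Sum>i\<le>Suc (Suc n). alt i (D1 i x)))) = (\<Sum>j\<le>Suc n. \<Sum>i\<le>Suc (Suc n). t (j, i))"
 proof (rule sum.cong[OF refl])
  fix j assume "j : {..Suc n}"
  then interpret sj: addmap "s1 j" using s1 by simp
  show "alt j (s1 j (\<Sum>i\<le>Suc (Suc n). alt i (D1 i x))) = (\<Sum>i\<le>Suc (Suc n). t (j, i))"
   unfolding sj.sum alt_sum_in t_def prod.case by (rule sum.cong[OF refl]) (simp only: sj.alt alt_alt)
 qed
 also have "... = sum t S" unfolding S_def by (subst sum.cartesian_product) (simp only: case_prod_eta)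
 also have "... = sum t S1 + sum t S2 + sum t S3 + sum t S4"
 proof -
  have "S = S1 \<union> (S2 \<union> (S3 \<union> S4))" by (auto simp: S1_def S2_def S3_def S4_def)
  moreover have "S1 \<inter> (S2 \<union> (S3 \<union> S4)) = {}" "S2 \<inter> (S3 \<union> S4) = {}" "S3 \<inter> S4 = {}"
   by (auto simp: S1_def S2_def S3_def S4_def)
  ultimately show ?thesis using fin by (simp add: sum.union_disjoint add.assoc)
 qed
 also have "sum t S1 = sum (%y. - r y) R1"
 proof (rule sum.reindex_bij_witness[of _ "%(i, j). (Suc j, i)" "%(j, i). (i, j - 1)"])
  fix y assume y: "y : S1"
  then obtain i j where ij: "y = (j, i)" "i < j" "j <= Suc n" by (auto simp: S1_def S_def)
  then obtain j' where "j = Suc j'" by (cases j) auto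
  thus "- r ((%(j, i). (i, j - 1)) y) = t y" using lt[OF ij(2,3)] ij by (simp add: t_def r_def add.commute)
 qed (auto simp: S1_def R1_def S_def R_def)
 also have "sum t S4 = sum (%y. - r y) R2"
 proof (rule sum.reindex_bij_witness[of _ "%(i, j). (j, Suc i)" "%(j, i). (i - 1, j)"])
  fix y assume y: "y : S4"
  then obtain i j where ij: "y = (j, i)" "Suc j < i" "i <= Suc (Suc n)" by (auto simp: S4_def S_def)
  then obtain i' where "i = Suc i'" by (cases i) auto
  thus "- r ((%(j, i). (i - 1, j)) y) = t y" using gt[OF ij(2,3)] ij by (simp add: t_def r_def add.commute)
 qed (auto simp: S4_def R2_def S_def R_def)
 also have "sum t S2 = (\<Sum>j\<le>Suc n. s1 j (D1 j x))"
  by (rule sum.reindex_bij_witness[of _ "%j. (j, j)" fst]) (auto simp: S2_def S_def t_def alt_def)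
 also have "sum t S3 = (\<Sum>j\<le>Suc n. - s1 j (D1 (Suc j) x))"
  by (rule sum.reindex_bij_witness[of _ "%j. (j, Suc j)" fst]) (auto simp: S3_def S_def t_def alt_def)
 \<comment> \<open>The telescope: apart from its first term \<open>x\<close>, the diagonal
   \<open>i = j\<close> equals by \<open>eq\<close> the terms of the diagonal
   \<open>i = j + 1\<close>, of which only the last, \<open>e\<close>, survives.\<close>
 also have "(\<Sum>j\<le>Suc n. s1 j (D1 j x)) = x + (\<Sum>j\<le>n. s1 (Suc j) (D1 (Suc j) x))"
  using sum.atMost_Suc_shift[of "%j. s1 j (D1 j x)" n] id by simp
 also have "(\<Sum>j\<le>n. s1 (Suc j) (D1 (Suc j) x)) = (\<Sum>j\<le>n. s1 j (D1 (Suc j) x))"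
  by (rule sum.cong) (auto simp: eq)
 also have "(\<Sum>j\<le>Suc n. - s1 j (D1 (Suc j) x)) = (\<Sum>j\<le>n. - s1 j (D1 (Suc j) x)) - e"
  using e by simp
 finally have 1: "(\<Sum>j\<le>Suc n. alt j (s1 j (\<Sum>i\<le>Suc (Suc n). alt i (D1 i x)))) =
  x - e + (sum (%y. - r y) R1 + sum (%y. - r y) R2)" by (simp add: sum_negf algebra_simps)
 have "(\<Sum>i\<le>Suc n. alt i (D0 i (\<Sum>j\<le>n. alt j (s0 j x)))) = (\<Sum>i\<le>Suc n. \<Sum>j\<le>n. r (i, j))"
 proof (rule sum.cong[OF refl])
  fix i assume "i : {..Suc n}"
  then interpret Di: addmap "D0 i" using D0 by simp
  show "alt i (D0 i (\<Sum>j\<le>n. alt j (s0 j x))) = (\<Sum>j\<le>n. r (i, j))"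
   unfolding Di.sum alt_sum_in r_def prod.case by (rule sum.cong[OF refl]) (simp only: Di.alt alt_alt)
 qed
 also have "... = sum r R" unfolding R_def by (subst sum.cartesian_product) (simp only: case_prod_eta)
 also have "... = sum r R1 + sum r R2"
 proof -
  have "R = R1 \<union> R2" "R1 \<inter> R2 = {}" by (auto simp: R1_def R2_def)
  thus ?thesis using fin by (simp add: sum.union_disjoint)
 qed
 finally show ?thesis using 1 by (simp add: sum_negf algebra_simps)
qed

subsection \<open>Derivations as functions into a universal abelian group\<close>

context module_setup
begin

text \<open>The default \<open>0\<close> outside \<open>Z\<close> makes the function determined by
  the derivation. Each value sits in the factor of its own fibre, so that pointwise addition is
  addition of derivations.\<close>

definition demb where
 "demb j Z p w = (%x. if x : Z then embed (fibg j (p x)) (w x) else 0)"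

definition dfun where
 "dfun j z p w \<longleftrightarrow> ahom z (fob Mob j) w & (\<forall>x\<in>fst z. pim j (w x) = p x)"

definition derv where
 "derv j z p = {demb j (fst z) p w | w. dfun j z p w}"

definition over where
 "over j z p \<longleftrightarrow> j : Obj I & z : algs & ahom z (fob A j) p"

lemma over_in: "over j z p ==> x : fst z ==> p x : U A j"
 unfolding over_def U_def using ahom_in by blast

lemma over_fibg: "over j z p ==> x : fst z ==> comm_group (fibg j (p x))"
 using comm_group_fibg over_in over_def by blast

lemma dfun_fib: "dfun j z p w ==> x : fst z ==> w x : carrier (fibg j (p x))"
 using ahom_in[of z "fob Mob j" w x] by (auto simp: dfun_def fibg_carrier U_def)

lemma demb_cong: "(!!x. x : Z ==> p x = p' x) ==> (!!x. x : Z ==> w x = w' x) ==> demb j Z p w = demb j Z p' w'"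
 by (auto simp: demb_def)

lemma derv_cong:
 assumes "!!x. x : fst z ==> p x = p' x"
 shows "derv j z p = derv j z p'"
 unfolding derv_def dfun_def using demb_cong[of "fst z" p p', OF assms] assms by auto

lemma demb_inj:
 assumes "over j z p" "dfun j z p w" "dfun j z p w'" "demb j (fst z) p w = demb j (fst z) p w'" "x : fst z"
 shows "w x = w' x"
 using fun_cong[OF assms(4), of x] embed_inj[OF over_fibg[OF assms(1,5)] dfun_fib[OF assms(2,5)] dfun_fib[OF assms(3,5)]] assms(5)
 by (simp add: demb_def)

lemma dfun_add:
 assumes o: "over j z p" and w: "dfun j z p w" "dfun j z p w'"
 shows "dfun j z p (%x. w x \<otimes>\<^bsub>fibg j (p x)\<^esub> w' x)"
  "demb j (fst z) p (%x. w x \<otimes>\<^bsub>fibg j (p x)\<^esub> w' x) = demb j (fst z) p w + demb j (fst z) p w'"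
proof -
 have j: "j : Obj I" and z: "z : algs" using o by (auto simp: over_def)
 have "w x \<otimes>\<^bsub>fibg j (p x)\<^esub> w' x : carrier (fibg j (p x))" if "x : fst z" for x
  using fibg_mult(1)[OF j over_in[OF o that] dfun_fib[OF w(1) that] dfun_fib[OF w(2) that]] .
 thus "dfun j z p (%x. w x \<otimes>\<^bsub>fibg j (p x)\<^esub> w' x)"
  using ahom_add[OF z j, of w w' p] w by (simp add: dfun_def fibg_carrier)
 show "demb j (fst z) p (%x. w x \<otimes>\<^bsub>fibg j (p x)\<^esub> w' x) = demb j (fst z) p w + demb j (fst z) p w'"
  using embed_mult[OF over_fibg[OF o] dfun_fib[OF w(1)] dfun_fib[OF w(2)]] by (auto simp: demb_def fun_eq_iff)
qed

lemma dfun_zero: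
 assumes o: "over j z p"
 shows "dfun j z p (%x. \<one>\<^bsub>fibg j (p x)\<^esub>)" "demb j (fst z) p (%x. \<one>\<^bsub>fibg j (p x)\<^esub>) = 0"
proof -
 have j: "j : Obj I" and z: "z : algs" using o by (auto simp: over_def)
 show "dfun j z p (%x. \<one>\<^bsub>fibg j (p x)\<^esub>)"
  using ahom_zero[OF z j] o fibg_one(1)[OF j over_in[OF o]] by (simp add: dfun_def fibg_carrier over_def)
 show "demb j (fst z) p (%x. \<one>\<^bsub>fibg j (p x)\<^esub>) = 0"
  using embed_one[OF over_fibg[OF o]] by (auto simp: demb_def fun_eq_iff)
qed

lemma dfun_inv:
 assumes o: "over j z p" and w: "dfun j z p w"
 shows "dfun j z p (%x. inv\<^bsub>fibg j (p x)\<^esub> w x)"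
  "demb j (fst z) p (%x. inv\<^bsub>fibg j (p x)\<^esub> w x) = - demb j (fst z) p w"
proof -
 have j: "j : Obj I" and z: "z : algs" using o by (auto simp: over_def)
 have "inv\<^bsub>fibg j (p x)\<^esub> w x : carrier (fibg j (p x))" if "x : fst z" for x
  using over_fibg[OF o that] dfun_fib[OF w that] by (simp add: comm_group_def group.inv_closed)
 thus "dfun j z p (%x. inv\<^bsub>fibg j (p x)\<^esub> w x)"
  using ahom_inv[OF z j, of w p] w by (simp add: dfun_def fibg_carrier)
 show "demb j (fst z) p (%x. inv\<^bsub>fibg j (p x)\<^esub> w x) = - demb j (fst z) p w"
  using embed_inv[OF over_fibg[OF o] dfun_fib[OF w]] by (auto simp: demb_def fun_eq_iff)
qed

lemma derv_subgp:
 assumes o: "over j z p" shows "subgp (derv j z p)"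
proof (rule subgpI)
 show "0 : derv j z p" using dfun_zero[OF o] unfolding derv_def by (metis (mono_tags, lifting) mem_Collect_eq)
 fix ph ps assume "ph : derv j z p" "ps : derv j z p"
 then obtain w w' where w: "ph = demb j (fst z) p w" "dfun j z p w" "ps = demb j (fst z) p w'" "dfun j z p w'"
  unfolding derv_def by blast
 thus "ph + ps : derv j z p"
  unfolding derv_def w using dfun_add(2)[OF o w(2,4), symmetric] dfun_add(1)[OF o w(2,4)] by blast
next
 fix ph assume "ph : derv j z p"
 then obtain w where w: "ph = demb j (fst z) p w" "dfun j z p w"
  unfolding derv_def by blast
 thus "- ph : derv j z p"
  unfolding derv_def w using dfun_inv(2)[OF o w(2), symmetric] dfun_inv(1)[OF o w(2)] by blast
qed

definition pre :: "'u set => ('u => 'u) => ('u => 'u uab) => 'u => 'u uab" where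
 "pre Z g ph = (%x. if x : Z then ph (g x) else 0)"

lemma pre_add: "addmap (pre Z g)"
 by unfold_locales (auto simp: pre_def fun_eq_iff)

lemma pre_cong: "(!!x. x : Z ==> g x = g' x) ==> pre Z g ph = pre Z g' ph"
 by (auto simp: pre_def)

lemma pre_pre: "(!!x. x : Z ==> g x : Z') ==> pre Z g (pre Z' h ph) = pre Z (%x. h (g x)) ph"
 by (auto simp: pre_def)

text \<open>The common core of the statements that maps compatible with faces induce cochain maps:
  \<open>Rc_dC\<close>, \<open>tauC_dC\<close> and \<open>thC_dC\<close>.\<close>

lemma pre_alternating:
 assumes g: "!!x. x : W ==> g x : Y" and e: "!!k x. k <= n ==> x : W ==> e k x : V"
  and eq: "!!k x. k <= n ==> x : W ==> d k (g x) = g' (e k x)"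
 shows "pre W g (\<Sum>k\<le>n. alt k (pre Y (d k) ph)) = (\<Sum>k\<le>n. alt k (pre W (e k) (pre V g' ph)))"
 unfolding addmap.sum[OF pre_add] addmap.alt[OF pre_add]
proof (rule sum.cong[OF refl])
 fix k assume "k : {..n}"
 hence k: "k <= n" by simp
 have "pre W g (pre Y (d k) ph) = pre W (%x. d k (g x)) ph" by (rule pre_pre) (rule g)
 also have "... = pre W (%x. g' (e k x)) ph" by (rule pre_cong) (rule eq[OF k])
 also have "... = pre W (e k) (pre V g' ph)" by (rule pre_pre[symmetric]) (rule e[OF k])
 finally show "alt k (pre W g (pre Y (d k) ph)) = alt k (pre W (e k) (pre V g' ph))" by simp
qed

lemma pre_demb: "(!!x. x : Z ==> g x : Z') ==> pre Z g (demb j Z' p w) = demb j Z (%x. p (g x)) (%x. w (g x))"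
 by (auto simp: pre_def demb_def)

lemma pre_derv:
 assumes o: "over j z p" and g: "ahom z' z g" and z': "z' : algs" and ph: "ph : derv j z p"
 shows "pre (fst z') g ph : derv j z' (%x. p (g x))"
proof -
 obtain w where w: "ph = demb j (fst z) p w" "dfun j z p w" using ph unfolding derv_def by blast
 have "dfun j z' (%x. p (g x)) (%x. w (g x))"
  using ahom_comp[OF g _ z'] w(2) o diag_ob[OF Mob_diag] ahom_in[OF g] by (auto simp: dfun_def over_def)
 moreover have "pre (fst z') g ph = demb j (fst z') (%x. p (g x)) (%x. w (g x))"
  unfolding w(1) by (rule pre_demb[OF ahom_in[OF g]])
 ultimately show ?thesis unfolding derv_def by blast
qed

lemma pre_derv_cong:
 assumes o: "over j z p" and g: "ahom z' z g" and z': "z' : algs"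
  and e: "!!x. x : fst z' ==> p (g x) = p' x" and ph: "ph : derv j z p"
 shows "pre (fst z') g ph : derv j z' p'"
 using pre_derv[OF o g z' ph] derv_cong[of z' "%x. p (g x)" p', OF e] by simp

lemma pre_id: "ph : derv j z p ==> pre (fst z) (%x. x) ph = ph"
 by (auto simp: derv_def pre_def demb_def)

text \<open>The action of \<open>M(bt)\<close> on the fibre over \<open>a\<close>, extended to all
  of \<open>uab\<close>: projecting by \<open>coord\<close> before applying it makes the map
  additive on the whole type, as \<open>addmap\<close> demands.\<close>

definition actv where
 "actv bt a v = embed (fibg (Cod I bt) (Bf A bt a)) (Bf Mob bt (coord (fibg (Dom I bt) a) v))"

lemma actv_add:
 assumes bt: "bt : Hom I i j" and a: "a : U A i"
 shows "actv bt a (v + w) = actv bt a v + actv bt a w"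
proof -
 note o = I.Hom_Obj[OF bt]
 note g = comm_group_fibg[OF o(1) a] comm_group_fibg[OF o(2) Bf_in[OF A_diag bt a]]
 note d = I.HomD[OF bt]
 show ?thesis
  unfolding actv_def d coord_plus[OF g(1)] Mf_mult[OF bt a coord_carrier[OF g(1)] coord_carrier[OF g(1)]]
  by (rule embed_mult[OF g(2) Mf_fib[OF bt coord_carrier[OF g(1)]] Mf_fib[OF bt coord_carrier[OF g(1)]]])
qed

lemma actv_embed:
 assumes bt: "bt : Hom I i j" and a: "a : U A i" and m: "m : carrier (fibg i a)"
 shows "actv bt a (embed (fibg i a) m) = embed (fibg j (Bf A bt a)) (Bf Mob bt m)"
 using bt coord_embed_same[OF comm_group_fibg[OF I.Hom_Obj(1)[OF bt] a] m] by (simp add: actv_def Hom_iff)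

lemma actv_comp:
 assumes bt: "bt : Hom I i j" and bt': "bt' : Hom I j k" and a: "a : U A i"
 shows "actv bt' (Bf A bt a) (actv bt a v) = actv (bt' \<bullet> bt) a v"
proof -
 have m: "coord (fibg i a) v : carrier (fibg i a)"
  by (rule coord_carrier[OF comm_group_fibg[OF I.Hom_Obj(1)[OF bt] a]])
 have 1: "actv bt a v = embed (fibg j (Bf A bt a)) (Bf Mob bt (coord (fibg i a) v))"
  using bt by (simp add: actv_def Hom_iff)
 have 2: "actv (bt' \<bullet> bt) a v = embed (fibg k (Bf A (bt' \<bullet> bt) a)) (Bf Mob (bt' \<bullet> bt) (coord (fibg i a) v))"
  using I.comp_Hom[OF bt' bt] by (simp add: actv_def Hom_iff)
 have mU: "coord (fibg i a) v : U Mob i" using m by (simp add: fibg_carrier)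
 show ?thesis
  unfolding 1 2 actv_embed[OF bt' Bf_in[OF A_diag bt a] Mf_fib[OF bt m]]
  using Bf_comp[OF A_diag bt bt' a] Bf_comp[OF Mob_diag bt bt' mU] by simp
qed

definition lft where
 "lft bt p Z ph = (%x. if x : Z then actv bt (p x) (ph x) else 0)"

lemma lft_add:
 assumes "bt : Hom I i j" "!!x. x : Z ==> p x : U A i"
 shows "addmap (lft bt p Z)"
 by unfold_locales (auto simp: lft_def fun_eq_iff actv_add[OF assms(1) assms(2)])

lemma lft_cong: "(!!x. x : Z ==> p x = p' x) ==> lft bt p Z ph = lft bt p' Z ph"
 by (auto simp: lft_def)

lemma lft_demb:
 assumes bt: "bt : Hom I i j" and o: "over i z p" and w: "dfun i z p w"
 shows "lft bt p (fst z) (demb i (fst z) p w) = demb j (fst z) (%x. Bf A bt (p x)) (%x. Bf Mob bt (w x))"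
  "dfun j z (%x. Bf A bt (p x)) (%x. Bf Mob bt (w x))"
proof -
 show "lft bt p (fst z) (demb i (fst z) p w) = demb j (fst z) (%x. Bf A bt (p x)) (%x. Bf Mob bt (w x))"
  using actv_embed[OF bt over_in[OF o] dfun_fib[OF w]] by (auto simp: lft_def demb_def)
 show "dfun j z (%x. Bf A bt (p x)) (%x. Bf Mob bt (w x))"
  using ahom_comp[OF _ Bf_ahom[OF Mob_diag bt], of z w] w o diag_ob[OF Mob_diag] I.Hom_Obj[OF bt]
   Mf_fib[OF bt dfun_fib[OF w]] by (auto simp: dfun_def over_def fibg_carrier)
qed

lemma lft_derv:
 assumes bt: "bt : Hom I i j" and o: "over i z p" and ph: "ph : derv i z p"
 shows "lft bt p (fst z) ph : derv j z (%x. Bf A bt (p x))"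
 using lft_demb[OF bt o] ph unfolding derv_def by blast

lemma lft_lft:
 assumes "bt : Hom I i j" "bt' : Hom I j k" "!!x. x : Z ==> p x : U A i"
 shows "lft bt' (%x. Bf A bt (p x)) Z (lft bt p Z ph) = lft (bt' \<bullet> bt) p Z ph"
 using actv_comp[OF assms(1,2) assms(3)] by (auto simp: lft_def)

lemma lft_pre: "(!!x. x : Z ==> g x : Z') ==> lft bt (%x. p (g x)) Z (pre Z g ph) = pre Z g (lft bt p Z' ph)"
 by (auto simp: lft_def pre_def)

lemma lft_id:
 assumes o: "over i z p" and ph: "ph : derv i z p"
 shows "lft (Idn I i) p (fst z) ph = ph"
proof -
 obtain w where w: "ph = demb i (fst z) p w" "dfun i z p w" using ph unfolding derv_def by blast
 have i: "i : Obj I" using o by (simp add: over_def)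
 have "Bf Mob (Idn I i) (w x) = w x" "Bf A (Idn I i) (p x) = p x" if "x : fst z" for x
  using Bf_Idn[OF Mob_diag i] Bf_Idn[OF A_diag i over_in[OF o that]] dfun_fib[OF w(2) that] by (simp_all add: fibg_carrier)
 thus ?thesis
  unfolding w(1) lft_demb(1)[OF I.Idn_Hom[OF i] o w(2)] by (intro demb_cong) auto
qed

text \<open>Fibre values on generators extend to a homomorphism into \<open>M(j)\<close>. It lies
  over \<open>p\<close> because its composite with the projection to \<open>A(j)\<close> agrees with
  \<open>p\<close> on generators.\<close>

lemma derv_free_ext:
 assumes S: "small_set S" and o: "over j (FA S) p"
  and c: "!!s. s : S ==> c s : carrier (fibg j (p (eta S s)))"
 shows "\<exists>ph\<in>derv j (FA S) p. \<forall>s\<in>S. ph (eta S s) = embed (fibg j (p (eta S s))) (c s)"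
proof -
 have j: "j : Obj I" and p: "ahom (FA S) (fob A j) p" using o by (auto simp: over_def)
 note Mj = diag_ob[OF Mob_diag j]
 have cP: "c : S \<rightarrow> fst (fob Mob j)" using c by (auto simp: fibg_carrier U_def)
 define w where "w x = st (fob Mob j) (Tm S (fst (fob Mob j)) c x)" for x
 have wh: "ahom (FA S) (fob Mob j) w" and we: "!!s. s : S ==> w (eta S s) = c s"
  using free_ext[OF S Mj cP] by (simp_all add: w_def[abs_def])
 have "pim j (w x) = p x" if x: "x : TO S" for x
 proof (rule free_unique[where f = "%x. pim j (w x)" and g = p, OF S diag_ob[OF A_diag j] _ p _ x])
  show "ahom (FA S) (fob A j) (%x. pim j (w x))"
   by (rule ahom_comp[OF wh pim_ahom[OF j] free_algs[OF S] Mj diag_ob[OF A_diag j]])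
  show "pim j (w (eta S s)) = p (eta S s)" if "s : S" for s
   using we[OF that] c[OF that] by (simp add: fibg_carrier)
 qed
 hence "dfun j (FA S) p w" using wh by (simp add: dfun_def free_fst)
 hence "demb j (TO S) p w : derv j (FA S) p"
  unfolding derv_def by (auto simp: free_fst)
 thus ?thesis
  using we eta_in[OF S] by (intro bexI[of _ "demb j (TO S) p w"]) (auto simp: demb_def)
qed

lemma derv_free_eqI:
 assumes S: "small_set S" and o: "over j (FA S) p"
  and ph: "ph : derv j (FA S) p" and ps: "ps : derv j (FA S) p"
  and eq: "!!s. s : S ==> ph (eta S s) = ps (eta S s)"
 shows "ph = ps"
proof -
 let ?F = "FA S"
 have j: "j : Obj I" using o by (auto simp: over_def)
 obtain w where w: "ph = demb j (fst ?F) p w" "dfun j ?F p w" using ph unfolding derv_def by blast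
 obtain w' where w': "ps = demb j (fst ?F) p w'" "dfun j ?F p w'" using ps unfolding derv_def by blast
 have "w x = w' x" if x: "x : TO S" for x
 proof (rule free_unique[where f = w and g = w', OF S diag_ob[OF Mob_diag j] _ _ _ x])
  show "ahom ?F (fob Mob j) w" "ahom ?F (fob Mob j) w'" using w(2) w'(2) by (simp_all add: dfun_def)
  fix s assume s: "s : S"
  hence e: "eta S s : fst ?F" using eta_in[OF S] by (simp add: free_fst)
  show "w (eta S s) = w' (eta S s)"
   using eq[OF s] e embed_inj[OF over_fibg[OF o e] dfun_fib[OF w(2) e] dfun_fib[OF w'(2) e]]
   unfolding w(1) w'(1) by (simp add: demb_def)
 qed
 thus ?thesis unfolding w(1) w'(1) by (intro demb_cong) (auto simp: free_fst)
qed

lemma derv_embed: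
 assumes "ph : derv j z p" "x : fst z"
 shows "\<exists>m\<in>carrier (fibg j (p x)). ph x = embed (fibg j (p x)) m"
proof -
 obtain w where w: "ph = demb j (fst z) p w" "dfun j z p w" using assms(1) unfolding derv_def by blast
 thus ?thesis using dfun_fib[OF w(2) assms(2)] assms(2) by (auto simp: demb_def)
qed

end

subsection \<open>Chains\<close>

context diagram_setup
begin

fun src :: "'i => 'k list => 'i" where
 "src i [] = i"
| "src i (a # as) = src (Dom I a) as"

text \<open>Positions count from \<open>0\<close>: \<open>mrg k\<close> composes the entries
  \<open>k\<close> and \<open>k + 1\<close>. The recursive form makes the simplicial identities
  inductive, and \<open>mrg_take_drop\<close> leads back to the form of
  \<open>bw_term\<close>.\<close>

fun mrg :: "nat => 'k list => 'k list" where
 "mrg 0 (a # b # as) = (a \<bullet> b) # as"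
| "mrg (Suc k) (a # as) = a # mrg k as"
| "mrg _ as = as"

lemma chain_comp_Hom: "is_chain I i as ==> cc i as : Hom I (src i as) i"
proof (induction as arbitrary: i)
 case Nil
 thus ?case using I.Idn_Hom by simp
next
 case (Cons a as)
 hence "a : Hom I (Dom I a) i" by (simp add: Hom_iff)
 thus ?case using Cons.IH[of "Dom I a"] Cons.prems by auto
qed

lemma src_Obj: "is_chain I i as ==> src i as : Obj I"
 using I.Hom_Obj(1)[OF chain_comp_Hom] .

lemma is_chain_Obj: "is_chain I i as ==> i : Obj I"
 using I.Hom_Obj(2)[OF chain_comp_Hom] .

lemma mrg_take_drop: "Suc k < length as ==> mrg k as = take k as @ (as ! k \<bullet> as ! Suc k) # drop (Suc (Suc k)) as"
 by (induction k as rule: mrg.induct) auto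

lemma length_mrg: "Suc k < length as ==> length (mrg k as) = length as - 1"
 by (simp add: mrg_take_drop)

lemma mrg_chain:
 "Suc k < length as ==> is_chain I i as ==> is_chain I i (mrg k as) & cc i (mrg k as) = cc i as & src i (mrg k as) = src i as"
proof (induction k as arbitrary: i rule: mrg.induct)
 case (1 a b as)
 have a: "a : Hom I (Dom I a) i" and b: "b : Hom I (Dom I b) (Dom I a)" and as: "is_chain I (Dom I b) as"
  using 1 by (auto simp: Hom_iff)
 note ab = I.comp_Hom[OF a b]
 show ?case
  using ab as I.comp_assoc[OF chain_comp_Hom[OF as] b a] by (simp add: Hom_iff)
next
 case (2 k a as)
 thus ?case by simp
qed simp_all

text \<open>Disjoint merges commute, and for \<open>l = k + 1\<close> both sides compose the same
  three arrows, which is associativity in \<open>I\<close>.\<close>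

lemma mrg_mrg:
 "k < l ==> Suc l < length as ==> is_chain I i as ==> mrg k (mrg l as) = mrg (l - 1) (mrg k as)"
proof (induction k as arbitrary: i l rule: mrg.induct)
 case (1 a b as)
 then obtain l' where l: "l = Suc l'" by (cases l) auto
 show ?case
 proof (cases l')
  case 0
  then obtain c as' where as: "as = c # as'" using 1 l by (cases as) auto
  have "a : Hom I (Dom I a) i" "b : Hom I (Dom I b) (Dom I a)" "c : Hom I (Dom I c) (Dom I b)"
   using 1 as by (auto simp: Hom_iff)
  thus ?thesis using I.comp_assoc as l 0 by auto
 next
  case (Suc l'')
  thus ?thesis using l by simp
 qed
next
 case (2 k a as)
 then obtain l' where l: "l = Suc l'" by (cases l) auto
 have "mrg k (mrg l' as) = mrg (l' - 1) (mrg k as)" using 2 l by auto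
 moreover obtain l'' where "l' = Suc l''" using 2(2) l by (cases l') auto
 ultimately show ?case using l by simp
qed simp_all

lemma chain_append: "is_chain I i (as @ bs) \<longleftrightarrow> is_chain I i as & is_chain I (src i as) bs"
proof (induction as arbitrary: i)
 case Nil
 thus ?case using is_chain_Obj by auto
next
 case (Cons a as)
 thus ?case by auto
qed

lemma src_append: "src i (as @ bs) = src (src i as) bs"
 by (induction as arbitrary: i) auto

lemma chain_comp_snoc:
 "is_chain I i (as @ [b]) ==> cc i (as @ [b]) = cc i as \<bullet> b"
proof (induction as arbitrary: i)
 case Nil
 hence "b : Hom I (Dom I b) i" "Dom I b : Obj I" by (auto simp: Hom_iff)
 thus ?case using I.comp_Idn by simp
next
 case (Cons a as)
 hence a: "a : Hom I (Dom I a) i" and c: "is_chain I (Dom I a) as" and b: "b : Hom I (Dom I b) (src (Dom I a) as)"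
  by (auto simp: Hom_iff chain_append)
 show ?case using Cons I.comp_assoc[OF b chain_comp_Hom[OF c] a] by simp
qed

lemma mrg_snoc: "Suc k < length as ==> mrg k (as @ [b]) = mrg k as @ [b]"
 by (induction k as rule: mrg.induct) auto

lemma mrg_last: "mrg (length as) (as @ [b, c]) = as @ [b \<bullet> c]"
 by (induction as) auto

lemma chains_iff: "(i, as) : chains I n \<longleftrightarrow> is_chain I i as & length as = n"
 by (simp add: chains_def)

end

subsection \<open>Resolutions and the double complex of cochains on chains\<close>

text \<open>A simplicial algebra \<open>Z\<close> over each \<open>A(i)\<close>, with augmentation
  \<open>aug\<close>, faces \<open>fc\<close> and an action of the arrows of \<open>I\<close>. Both
  the levelwise resolutions of the algebras \<open>A(i)\<close> and the resolution of the diagram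
  are instances, so cochain groups and actions are set up once. Here \<open>q\<close> is the
  simplicial degree.\<close>

locale resolution = module_setup T I A M
 for T :: "('u set, 'u smap) monad" and I :: "('i, 'k) cat" (structure)
  and A :: "('i, 'k, 'u) alg_diagram" and M :: "('i, 'k, 'u) alg_diagram_hom module_obj" +
 fixes Z :: "nat => 'i => 'u alg" and aug :: "nat => 'i => 'u => 'u"
  and fc :: "nat => nat => 'i => 'u => 'u" and act :: "nat => 'k => 'u => 'u"
 assumes Z_alg: "i : Obj I ==> Z q i : algs"
  and aug_hom: "i : Obj I ==> ahom (Z q i) (fob A i) (aug q i)"
  and fc_hom: "i : Obj I ==> k <= Suc q ==> ahom (Z (Suc q) i) (Z q i) (fc q k i)"
  and act_hom: "gm : Hom I i i' ==> ahom (Z q i) (Z q i') (act q gm)"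
  and aug_fc: "i : Obj I ==> k <= Suc q ==> x : fst (Z (Suc q) i) ==> aug q i (fc q k i x) = aug (Suc q) i x"
  and aug_act: "gm : Hom I i i' ==> x : fst (Z q i) ==> aug q i' (act q gm x) = Bf A gm (aug q i x)"
  and fc_fc: "i : Obj I ==> k < l ==> l <= Suc (Suc q) ==> x : fst (Z (Suc (Suc q)) i) ==>
   fc q k i (fc (Suc q) l i x) = fc q (l - 1) i (fc (Suc q) k i x)"
  and fc_act: "gm : Hom I i i' ==> k <= Suc q ==> x : fst (Z (Suc q) i) ==>
   fc q k i' (act (Suc q) gm x) = act q gm (fc q k i x)"
  and act_comp: "gm : Hom I i i' ==> gm' : Hom I i' i'' ==> x : fst (Z q i) ==>
   act q (gm' \<bullet> gm) x = act q gm' (act q gm x)"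
begin

text \<open>The structure map to \<open>A(j)\<close> for \<open>al : i \<rightarrow> j\<close>.
  Derivations into the pullback of \<open>M(j)\<close> along \<open>A(al)\<close> are the same as
  maps to \<open>M(j)\<close> over this composite, so \<open>Cc\<close> can be formed from the
  fibres of \<open>M(j)\<close>.\<close>

definition base where
 "base q al x = Bf A al (aug q (Dom I al) x)"

definition Cc where
 "Cc q al = derv (Cod I al) (Z q (Dom I al)) (base q al)"

definition cof where
 "cof q k i = pre (fst (Z (Suc q) i)) (fc q k i)"

definition dC where
 "dC q i ph = (\<Sum>k\<le>Suc q. alt k (cof q k i ph))"

text \<open>\<open>Lc\<close> and \<open>Rc\<close> are the covariant and the contravariant part of
  the natural system \<open>al \<mapsto> Cc q al\<close> of cochain groups. Both commute with
  \<open>dC\<close>, and with each other by \<open>Lc_Rc\<close>.\<close>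

definition Lc where
 "Lc q bt al = lft bt (base q al) (fst (Z q (Dom I al)))"

definition Rc where
 "Rc q gm = pre (fst (Z q (Dom I gm))) (act q gm)"

lemma base_over: "al : Hom I i j ==> over j (Z q i) (base q al)"
 unfolding over_def base_def
 using ahom_comp[OF aug_hom Bf_ahom[OF A_diag] Z_alg] diag_ob[OF A_diag] I.Hom_Obj[of al i j] Z_alg
 by (auto simp: Hom_iff)

lemma aug_in: "i : Obj I ==> x : fst (Z q i) ==> aug q i x : U A i"
 unfolding U_def by (rule ahom_in[OF aug_hom])

lemma Cc_subgp: "al : Hom I i j ==> subgp (Cc q al)"
 unfolding Cc_def using derv_subgp[OF base_over] by (auto simp: Hom_iff)

lemma cof_add: "addmap (cof q k i)"
 unfolding cof_def by (rule pre_add)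

lemma dC_add: "addmap (dC q i)"
 unfolding dC_def by (rule addmap_alt_sum) (rule cof_add)

lemma Rc_add: "addmap (Rc q gm)"
 unfolding Rc_def by (rule pre_add)

lemma Lc_add:
 assumes al: "al : Hom I i j" and bt: "bt : Hom I j k"
 shows "addmap (Lc q bt al)"
 unfolding Lc_def using over_in[OF base_over[OF al]] al by (intro lft_add[OF bt]) (simp add: Hom_iff)

lemma cof_Cc:
 assumes al: "al : Hom I i j" and k: "k <= Suc q" and ph: "ph : Cc q al"
 shows "cof q k i ph : Cc (Suc q) al"
proof -
 note i = I.Hom_Obj(1)[OF al]
 note d = I.HomD[OF al]
 show ?thesis
  unfolding cof_def Cc_def d
  by (rule pre_derv_cong[OF base_over[OF al] fc_hom[OF i k] Z_alg[OF i] _ ph[unfolded Cc_def d]]) (simp add: base_def d aug_fc[OF i k])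
qed

lemma dC_Cc: "al : Hom I i j ==> ph : Cc q al ==> dC q i ph : Cc (Suc q) al"
 unfolding dC_def by (intro subgp_sum[OF Cc_subgp] subgp_alt[OF Cc_subgp] cof_Cc) auto

lemma dC_dC: "i : Obj I ==> dC (Suc q) i (dC q i ph) = 0"
 unfolding dC_def
proof (rule cosimplicial_square[OF cof_add])
 fix k l assume i: "i : Obj I" and kl: "k < l" "l <= Suc (Suc q)"
 hence l: "l - 1 <= Suc q" "k <= Suc q" "k <= Suc (Suc q)" by auto
 note f = ahom_in[OF fc_hom[OF i]]
 have "cof (Suc q) l i (cof q k i ph) = pre (fst (Z (Suc (Suc q)) i)) (%x. fc q k i (fc (Suc q) l i x)) ph"
  unfolding cof_def by (rule pre_pre) (rule f[OF kl(2)])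
 also have "... = pre (fst (Z (Suc (Suc q)) i)) (%x. fc q (l - 1) i (fc (Suc q) k i x)) ph"
  by (rule pre_cong) (rule fc_fc[OF i kl])
 also have "... = cof (Suc q) k i (cof q (l - 1) i ph)"
  unfolding cof_def by (rule pre_pre[symmetric]) (rule f[OF l(3)])
 finally show "cof (Suc q) l i (cof q k i ph) = cof (Suc q) k i (cof q (l - 1) i ph)" .
qed

lemma Lc_Cc:
 assumes al: "al : Hom I i j" and bt: "bt : Hom I j k" and ph: "ph : Cc q al"
 shows "Lc q bt al ph : Cc q (bt \<bullet> al)"
proof -
 note btal = I.comp_Hom[OF bt al]
 note d = I.HomD[OF al] I.HomD[OF btal]
 have "Lc q bt al ph : derv k (Z q i) (%x. Bf A bt (base q al x))"
  unfolding Lc_def using lft_derv[OF bt base_over[OF al]] ph d by (simp add: Cc_def)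
 also have "... = Cc q (bt \<bullet> al)"
  unfolding Cc_def d
  by (rule derv_cong) (simp add: base_def d Bf_comp[OF A_diag al bt] aug_in[OF I.Hom_Obj(1)[OF al]])
 finally show ?thesis .
qed

lemma Rc_Cc:
 assumes al: "al : Hom I i j" and gm: "gm : Hom I i' i" and ph: "ph : Cc q al"
 shows "Rc q gm ph : Cc q (al \<bullet> gm)"
proof -
 note algm = I.comp_Hom[OF al gm]
 note o = I.Hom_Obj[OF gm]
 note d = I.HomD[OF al] I.HomD[OF gm] I.HomD[OF algm]
 show ?thesis
  unfolding Rc_def Cc_def d
  by (rule pre_derv_cong[OF base_over[OF al] act_hom[OF gm] Z_alg[OF o(1)] _ ph[unfolded Cc_def d]])
   (simp add: base_def d aug_act[OF gm] Bf_comp[OF A_diag gm al] aug_in[OF o(1)])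
qed

lemma Lc_Lc:
 assumes al: "al : Hom I i j" and bt: "bt : Hom I j k" and bt': "bt' : Hom I k l"
 shows "Lc q bt' (bt \<bullet> al) (Lc q bt al ph) = Lc q (bt' \<bullet> bt) al ph"
proof -
 note btal = I.comp_Hom[OF bt al]
 note d = I.HomD[OF al] I.HomD[OF btal]
 have "Lc q bt' (bt \<bullet> al) (Lc q bt al ph) = lft bt' (%x. Bf A bt (base q al x)) (fst (Z q i)) (Lc q bt al ph)"
  unfolding Lc_def d
  by (rule lft_cong) (simp add: base_def d Bf_comp[OF A_diag al bt] aug_in[OF I.Hom_Obj(1)[OF al]])
 also have "... = Lc q (bt' \<bullet> bt) al ph"
  unfolding Lc_def d using over_in[OF base_over[OF al]] by (rule lft_lft[OF bt bt'])
 finally show ?thesis .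
qed

lemma Rc_Rc:
 assumes gm: "gm : Hom I i' i" and gm': "gm' : Hom I i'' i'"
 shows "Rc q gm' (Rc q gm ph) = Rc q (gm \<bullet> gm') ph"
proof -
 note d = I.HomD[OF gm] I.HomD[OF gm'] I.HomD[OF I.comp_Hom[OF gm gm']]
 have "Rc q gm' (Rc q gm ph) = pre (fst (Z q i'')) (%x. act q gm (act q gm' x)) ph"
  unfolding Rc_def d by (rule pre_pre) (rule ahom_in[OF act_hom[OF gm']])
 also have "... = Rc q (gm \<bullet> gm') ph"
  unfolding Rc_def d by (rule pre_cong) (simp add: act_comp[OF gm' gm])
 finally show ?thesis .
qed

lemma Lc_Rc:
 assumes al: "al : Hom I i j" and bt: "bt : Hom I j k" and gm: "gm : Hom I i' i"
 shows "Lc q bt (al \<bullet> gm) (Rc q gm ph) = Rc q gm (Lc q bt al ph)"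
proof -
 note o = I.Hom_Obj[OF gm]
 note d = I.HomD[OF al] I.HomD[OF gm] I.HomD[OF I.comp_Hom[OF al gm]]
 have "Lc q bt (al \<bullet> gm) (Rc q gm ph) = lft bt (%x. base q al (act q gm x)) (fst (Z q i')) (Rc q gm ph)"
  unfolding Lc_def d
  by (rule lft_cong) (simp add: base_def d aug_act[OF gm] Bf_comp[OF A_diag gm al] aug_in[OF o(1)])
 also have "... = Rc q gm (Lc q bt al ph)"
  unfolding Rc_def Lc_def d using ahom_in[OF act_hom[OF gm]] by (rule lft_pre)
 finally show ?thesis .
qed

lemma Lc_dC:
 assumes al: "al : Hom I i j" and bt: "bt : Hom I j k"
 shows "Lc (Suc q) bt al (dC q i ph) = dC q i (Lc q bt al ph)"
proof -
 interpret L: addmap "Lc (Suc q) bt al" by (rule Lc_add[OF al bt])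
 note i = I.Hom_Obj(1)[OF al]
 note d = I.HomD[OF al]
 have "Lc (Suc q) bt al (cof q l i ph) = cof q l i (Lc q bt al ph)" if l: "l <= Suc q" for l
 proof -
  have "Lc (Suc q) bt al (cof q l i ph) = lft bt (%x. base q al (fc q l i x)) (fst (Z (Suc q) i)) (cof q l i ph)"
   unfolding Lc_def d by (rule lft_cong) (simp add: base_def d aug_fc[OF i l])
  also have "... = cof q l i (Lc q bt al ph)"
   unfolding cof_def Lc_def d using ahom_in[OF fc_hom[OF i l]] by (rule lft_pre)
  finally show ?thesis .
 qed
 thus ?thesis unfolding dC_def L.sum L.alt by (intro sum.cong) auto
qed

lemma Rc_dC:
 assumes gm: "gm : Hom I i' i"
 shows "Rc (Suc q) gm (dC q i ph) = dC q i' (Rc q gm ph)"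
 unfolding Rc_def dC_def cof_def I.HomD[OF gm]
 by (rule pre_alternating) (rule ahom_in[OF act_hom[OF gm]] ahom_in[OF fc_hom[OF I.Hom_Obj(1)[OF gm]]] fc_act[OF gm]; assumption)+

section \<open>Cochains on chains of \<open>I\<close> with the horizontal and vertical
  differentials\<close>

definition chainD where
 "chainD p q = {f. \<forall>c. if c : chains I p then f c : Cc q (case_prod cc c) else f c = 0}"

text \<open>The formula of \<open>bw_term\<close> for cochains instead of classes. Arrows are
  numbered from \<open>1\<close> and list positions from \<open>0\<close>, whence
  \<open>mrg (j - 1)\<close>.\<close>

definition dterm where
 "dterm p q j f i as =
  (if j = 0 then Lc q (hd as) (cc (Dom I (hd as)) (tl as)) (f (Dom I (hd as), tl as))
   else if j <= p then f (i, mrg (j - 1) as)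
   else Rc q (last as) (f (i, butlast as)))"

definition delta where
 "delta p q j f = (%(i, as). if (i, as) : chains I (Suc p) then dterm p q j f i as else 0)"

definition dh where
 "dh p q f = (\<Sum>j\<le>Suc p. alt j (delta p q j f))"

definition dv where
 "dv p q f = (%(i, as). if (i, as) : chains I p then dC q (src i as) (f (i, as)) else 0)"

lemma chainD_in: "f : chainD p q ==> (i, as) : chains I p ==> f (i, as) : Cc q (cc i as)"
 unfolding chainD_def by (auto dest: spec[of _ "(i, as)"])

lemma chainD_out: "f : chainD p q ==> c \<notin> chains I p ==> f c = 0"
 unfolding chainD_def by (metis (mono_tags, lifting) mem_Collect_eq)

lemma chainDI:
 assumes "!!i as. (i, as) : chains I p ==> f (i, as) : Cc q (cc i as)"
  "!!i as. (i, as) \<notin> chains I p ==> f (i, as) = 0"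
 shows "f : chainD p q"
 unfolding chainD_def using assms by auto

lemma chains_Hom: "(i, as) : chains I p ==> cc i as : Hom I (src i as) i"
 by (simp add: chains_iff chain_comp_Hom)

lemma chainD_subgp: "subgp (chainD p q)"
proof (rule subgpI)
 note s = Cc_subgp[OF chains_Hom]
 show "0 : chainD p q" by (rule chainDI) (auto simp: subgp_zero[OF s])
 show "f + g : chainD p q" if "f : chainD p q" "g : chainD p q" for f g
  using chainD_in[OF that(1)] chainD_in[OF that(2)] chainD_out[OF that(1)] chainD_out[OF that(2)]
  by (intro chainDI) (auto simp: subgp_add[OF s])
 show "- f : chainD p q" if "f : chainD p q" for f
  using chainD_in[OF that(1)] chainD_out[OF that(1)]
  by (intro chainDI) (auto simp: subgp_minus[OF s])
qed

lemma chains_Suc: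
 assumes "(i, as) : chains I (Suc p)"
 obtains a bs where "as = a # bs" "a : Hom I (Dom I a) i" "(Dom I a, bs) : chains I p"
  "cc (Dom I a) bs : Hom I (src (Dom I a) bs) (Dom I a)"
  "cc i as = a \<bullet> cc (Dom I a) bs" "src i as = src (Dom I a) bs"
 using assms chain_comp_Hom by (cases as) (auto simp: chains_iff Hom_iff)

lemma chains_snoc:
 assumes "(i, as) : chains I (Suc p)"
 obtains bs b where "as = bs @ [b]" "b : Hom I (src i as) (src i bs)" "(i, bs) : chains I p"
  "cc i bs : Hom I (src i bs) i" "cc i as = cc i bs \<bullet> b"
proof -
 obtain bs b where as: "as = bs @ [b]" using assms by (cases as rule: rev_cases) (auto simp: chains_iff)
 have "is_chain I i (bs @ [b])" using assms as by (simp add: chains_iff)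
 thus thesis
  using that[OF as] chain_comp_snoc[of i bs b] chain_comp_Hom[of i bs] assms as
  by (auto simp: chains_iff chain_append src_append Hom_iff)
qed

lemma chains_mrg:
 assumes "(i, as) : chains I (Suc p)" "k < p"
 shows "(i, mrg k as) : chains I p" "cc i (mrg k as) = cc i as" "src i (mrg k as) = src i as"
 using assms mrg_chain[of k as i] length_mrg[of k as] by (auto simp: chains_iff)

lemma dterm_add:
 assumes "(i, as) : chains I (Suc p)"
 shows "addmap (%f. dterm p q j f i as)"
proof -
 obtain a bs where a: "as = a # bs" "a : Hom I (Dom I a) i"
  "cc (Dom I a) bs : Hom I (src (Dom I a) bs) (Dom I a)"
  using assms by (rule chains_Suc)
 show ?thesis
  by unfold_locales (simp add: dterm_def a(1) addmap.add[OF Lc_add[OF a(3,2)]] addmap.add[OF Rc_add])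
qed

lemma delta_add: "addmap (delta p q j)"
 by unfold_locales (auto simp: delta_def fun_eq_iff addmap.add[OF dterm_add])

lemma dh_add: "addmap (dh p q)"
 unfolding dh_def by (rule addmap_alt_sum) (rule delta_add)

lemma dv_add: "addmap (dv p q)"
 by unfold_locales (auto simp: dv_def fun_eq_iff addmap.add[OF dC_add])

lemma delta_D:
 assumes f: "f : chainD p q" and j: "j <= Suc p"
 shows "delta p q j f : chainD (Suc p) q"
proof (rule chainDI)
 fix i as assume c: "(i, as) : chains I (Suc p)"
 obtain a as' where a: "as = a # as'" "a : Hom I (Dom I a) i" "(Dom I a, as') : chains I p"
  "cc (Dom I a) as' : Hom I (src (Dom I a) as') (Dom I a)"
  "cc i as = a \<bullet> cc (Dom I a) as'"
  using c by (rule chains_Suc)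
 obtain bs b where b: "as = bs @ [b]" "b : Hom I (src i as) (src i bs)" "(i, bs) : chains I p"
  "cc i bs : Hom I (src i bs) i" "cc i as = cc i bs \<bullet> b"
  using c by (rule chains_snoc)
 have 0: "Lc q a (cc (Dom I a) as') (f (Dom I a, as')) : Cc q (cc i as)"
  unfolding a(5) by (rule Lc_Cc[OF a(4,2) chainD_in[OF f a(3)]])
 have 1: "Rc q b (f (i, bs)) : Cc q (cc i as)"
  unfolding b(5) by (rule Rc_Cc[OF b(4,2) chainD_in[OF f b(3)]])
 have 2: "f (i, mrg (j - 1) as) : Cc q (cc i as)" if "j \<noteq> 0" "j <= p"
  using chainD_in[OF f chains_mrg(1)[OF c, of "j - 1"]] chains_mrg(2)[OF c, of "j - 1"] that by simp
 have h: "hd as = a" "tl as = as'" "last as = b" "butlast as = bs" using a(1) by (simp, simp) (simp_all add: b(1))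
 show "delta p q j f (i, as) : Cc q (cc i as)"
  using 0 1 2 c by (simp add: delta_def dterm_def h)
qed (simp add: delta_def)

lemma dh_D: "f : chainD p q ==> dh p q f : chainD (Suc p) q"
 unfolding dh_def by (intro subgp_sum[OF chainD_subgp] subgp_alt[OF chainD_subgp] delta_D) auto

lemma dv_D: "f : chainD p q ==> dv p q f : chainD p (Suc q)"
 using dC_Cc[OF chains_Hom chainD_in[of f p q]] by (intro chainDI) (simp_all add: dv_def)

text \<open>The cosimplicial identities for the nerve with coefficients. Inner terms only merge
  arrows; the actions on coefficients meet only when two outer terms are composed, where
  \<open>Lc_Lc\<close>, \<open>Lc_Rc\<close> and \<open>Rc_Rc\<close> enter.\<close>

lemma delta_delta:
 assumes kl: "k < l" "l <= Suc (Suc p)"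
 shows "delta (Suc p) q l (delta p q k f) = delta (Suc p) q k (delta p q (l - 1) f)"
proof
 fix c :: "'i \<times> 'k list"
 obtain i as where c_eq: "c = (i, as)" by (cases c)
 show "delta (Suc p) q l (delta p q k f) c = delta (Suc p) q k (delta p q (l - 1) f) c"
 proof (cases "(i, as) : chains I (Suc (Suc p))")
  case c: True
  obtain a as' where a: "as = a # as'" "a : Hom I (Dom I a) i" "(Dom I a, as') : chains I (Suc p)"
   "cc (Dom I a) as' : Hom I (src (Dom I a) as') (Dom I a)"
   "cc i as = a \<bullet> cc (Dom I a) as'"
   using c by (rule chains_Suc)
  obtain bs b where b: "as = bs @ [b]" "b : Hom I (src i as) (src i bs)" "(i, bs) : chains I (Suc p)"
   "cc i bs : Hom I (src i bs) i" "cc i as = cc i bs \<bullet> b"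
   using c by (rule chains_snoc)
  have h: "hd as = a" "tl as = as'" "last as = b" "butlast as = bs" using a(1) by (simp, simp) (simp_all add: b(1))
  have len: "length as = Suc (Suc p)" using c by (simp add: chains_iff)
  have m: "(i, mrg n as) : chains I (Suc p)" if "n <= p" for n using chains_mrg(1)[OF c, of n] that by simp
  have dmid: "delta (Suc p) q n g (i, as) = g (i, mrg (n - 1) as)" if "n \<noteq> 0" "n <= Suc p" for n g
   using c that by (simp add: delta_def dterm_def)
  have dfst: "delta (Suc p) q 0 g (i, as) = Lc q a (cc (Dom I a) as') (g (Dom I a, as'))" for g
   using c by (simp add: delta_def dterm_def h)
  have dlst: "delta (Suc p) q (Suc (Suc p)) g (i, as) = Rc q b (g (i, bs))" for g
   using c by (simp add: delta_def dterm_def h)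
  \<comment> \<open>By position: two arrows taken off at the left, left against inner, left against
    right, two inner merges, inner against right, two taken off at the right.\<close>
  consider (A) "k = 0" "l = 1" | (B) "k = 0" "2 <= l" "l <= Suc p" | (C) "k = 0" "l = Suc (Suc p)"
   | (D) "1 <= k" "l <= Suc p" | (E) "1 <= k" "k <= p" "l = Suc (Suc p)" | (F) "k = Suc p" "l = Suc (Suc p)"
   using kl by linarith
  hence "delta (Suc p) q l (delta p q k f) (i, as) = delta (Suc p) q k (delta p q (l - 1) f) (i, as)"
  proof cases
   case A
   obtain e es where e: "as' = e # es" "e : Hom I (Dom I e) (Dom I a)"
    "cc (Dom I e) es : Hom I (src (Dom I e) es) (Dom I e)"
    "cc (Dom I a) as' = e \<bullet> cc (Dom I e) es"
    using a(3) by (rule chains_Suc)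
   have ae: "Dom I (a \<bullet> e) = Dom I e" using I.comp_Hom[OF a(2) e(2)] by (simp add: Hom_iff)
   have "delta (Suc p) q l (delta p q k f) (i, as) = Lc q (a \<bullet> e) (cc (Dom I e) es) (f (Dom I e, es))"
    using m[of 0] A c by (simp add: delta_def dterm_def ae a(1) e(1))
   also have "... = Lc q a (e \<bullet> cc (Dom I e) es) (Lc q e (cc (Dom I e) es) (f (Dom I e, es)))"
    by (rule Lc_Lc[OF e(3,2) a(2), symmetric])
   also have "... = delta (Suc p) q k (delta p q (l - 1) f) (i, as)"
    using a(3) A by (simp add: dfst e(4)) (simp add: delta_def dterm_def e(1))
   finally show ?thesis .
  next
   case B
   hence "l = Suc (Suc (l - 2))" "l - 2 < p" by auto
   then obtain n where n: "l = Suc (Suc n)" "n < p" by blast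
   have mc: "mrg (l - Suc 0) as = a # mrg n as'" using n a(1) by simp
   have mc': "(i, a # mrg n as') : chains I (Suc p)" using m[of "l - Suc 0"] n mc by simp
   have "delta (Suc p) q l (delta p q k f) (i, as) = Lc q a (cc (Dom I a) (mrg n as')) (f (Dom I a, mrg n as'))"
    using B mc' by (simp add: dmid mc) (simp add: delta_def dterm_def)
   also have "cc (Dom I a) (mrg n as') = cc (Dom I a) as'"
    using chains_mrg(2)[OF a(3) n(2)] .
   also have "Lc q a (cc (Dom I a) as') (f (Dom I a, mrg n as')) = delta (Suc p) q k (delta p q (l - 1) f) (i, as)"
    using B n a(3) by (simp add: dfst) (simp add: delta_def dterm_def)
   finally show ?thesis .
  next
   case C
   obtain bs' where bs: "bs = a # bs'" "as' = bs' @ [b]" using a(1) b(1) b(3) by (cases bs) (auto simp: chains_iff)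
   obtain e es where e: "as' = e @ [es]" "es : Hom I (src (Dom I a) as') (src (Dom I a) e)" "(Dom I a, e) : chains I p"
    "cc (Dom I a) e : Hom I (src (Dom I a) e) (Dom I a)" "cc (Dom I a) as' = cc (Dom I a) e \<bullet> es"
    using a(3) by (rule chains_snoc)
   have ee: "e = bs'" "es = b" using e(1) bs(2) by auto
   have "delta (Suc p) q l (delta p q k f) (i, as) = Rc q b (Lc q a (cc (Dom I a) bs') (f (Dom I a, bs')))"
    using C b(3) by (simp add: dlst) (simp add: delta_def dterm_def bs)
   also have "... = Lc q a (cc (Dom I a) bs' \<bullet> b) (Rc q b (f (Dom I a, bs')))"
    using Lc_Rc[OF e(4) a(2) e(2)] ee by simp
   also have "... = delta (Suc p) q k (delta p q (l - 1) f) (i, as)"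
    using C a(3) e(5) ee by (simp add: dfst) (simp add: delta_def dterm_def bs)
   finally show ?thesis .
  next
   case D
   have ch: "is_chain I i as" using c by (simp add: chains_iff)
   have l1: "l - Suc 0 <= p" "l - Suc 0 \<noteq> 0" "k - Suc 0 <= p" using D kl by auto
   have "delta (Suc p) q l (delta p q k f) (i, as) = f (i, mrg (k - 1) (mrg (l - 1) as))"
    using D kl m[of "l - 1"] by (simp add: dmid) (simp add: delta_def dterm_def)
   also have "mrg (k - 1) (mrg (l - 1) as) = mrg (l - 1 - 1) (mrg (k - 1) as)"
    using D kl len by (intro mrg_mrg[OF _ _ ch]) auto
   also have "f (i, mrg (l - 1 - 1) (mrg (k - 1) as)) = delta (Suc p) q k (delta p q (l - 1) f) (i, as)"
    using D kl l1 m[of "k - Suc 0"] by (simp add: dmid) (simp add: delta_def dterm_def)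
   finally show ?thesis .
  next
   case E
   have lb: "length bs = Suc p" using b(3) by (simp add: chains_iff)
   have mb: "mrg (k - Suc 0) as = mrg (k - Suc 0) bs @ [b]" unfolding b(1) using E lb by (intro mrg_snoc) simp
   have "delta (Suc p) q l (delta p q k f) (i, as) = Rc q b (f (i, mrg (k - 1) bs))"
    using E b(3) by (simp add: dlst) (simp add: delta_def dterm_def)
   also have "... = delta (Suc p) q k (delta p q (l - 1) f) (i, as)"
    using E m[of "k - Suc 0"] by (simp add: dmid mb) (simp add: delta_def dterm_def)
   finally show ?thesis .
  next
   case F
   obtain e es where e: "bs = e @ [es]" "es : Hom I (src i bs) (src i e)" "(i, e) : chains I p"
    using b(3) by (rule chains_snoc)
   have le: "length e = p" using e(3) by (simp add: chains_iff)
   have ms: "mrg p as = e @ [es \<bullet> b]" unfolding b(1) e(1) using mrg_last[of e es b] le by simp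
   have "delta (Suc p) q l (delta p q k f) (i, as) = Rc q b (Rc q es (f (i, e)))"
    using F b(3) by (simp add: dlst) (simp add: delta_def dterm_def e(1))
   also have "... = Rc q (es \<bullet> b) (f (i, e))" by (rule Rc_Rc[OF e(2) b(2)])
   also have "... = delta (Suc p) q k (delta p q (l - 1) f) (i, as)"
    using F m[of p] by (simp add: dmid ms) (simp add: delta_def dterm_def)
   finally show ?thesis .
  qed
  thus ?thesis by (simp add: c_eq)
 qed (simp add: delta_def c_eq)
qed

lemma dh_dh: "dh (Suc p) q (dh p q f) = 0"
 unfolding dh_def
 by (rule cosimplicial_square[where g = "delta (Suc p) q" and f = "delta p q", OF delta_add]) (rule delta_delta)

lemma dv_dv: "dv p (Suc q) (dv p q f) = 0"
 by (auto simp: dv_def fun_eq_iff dC_dC chains_iff src_Obj)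

text \<open>The actions of the outer terms are cochain maps, and an inner merge preserves the source
  object of the chain, at which \<open>dC\<close> is formed.\<close>

lemma dv_delta:
 assumes j: "j <= Suc p"
 shows "dv (Suc p) q (delta p q j f) = delta p (Suc q) j (dv p q f)"
proof
 fix c :: "'i \<times> 'k list"
 obtain i as where c_eq: "c = (i, as)" by (cases c)
 show "dv (Suc p) q (delta p q j f) c = delta p (Suc q) j (dv p q f) c"
 proof (cases "(i, as) : chains I (Suc p)")
  case c: True
  obtain a as' where a: "as = a # as'" "a : Hom I (Dom I a) i" "(Dom I a, as') : chains I p"
   "cc (Dom I a) as' : Hom I (src (Dom I a) as') (Dom I a)" "src i as = src (Dom I a) as'"
   using c by (rule chains_Suc)
  obtain bs b where b: "as = bs @ [b]" "b : Hom I (src i as) (src i bs)" "(i, bs) : chains I p"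
   using c by (rule chains_snoc)
  have h: "hd as = a" "tl as = as'" "last as = b" "butlast as = bs" using a(1) by (simp, simp) (simp_all add: b(1))
  have m: "(i, mrg (j - 1) as) : chains I p" "src i (mrg (j - 1) as) = src i as" if "j \<noteq> 0" "j <= p"
   using chains_mrg[OF c, of "j - 1"] that by auto
  have "dC q (src i as) (dterm p q j f i as) = dterm p (Suc q) j (dv p q f) i as"
   using Lc_dC[OF a(4,2)] Rc_dC[OF b(2)] m a(3) b(3) by (auto simp: dterm_def dv_def h a(5)[symmetric])
  thus ?thesis using c by (simp add: c_eq dv_def[of "Suc p"] delta_def)
 qed (simp add: c_eq delta_def dv_def)
qed

lemma dv_dh: "dv (Suc p) q (dh p q f) = dh p (Suc q) (dv p q f)"
 unfolding dh_def addmap.sum[OF dv_add] addmap.alt[OF dv_add]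
 by (rule sum.cong[OF refl]) (simp add: dv_delta)

definition DD where
 "DD p q = (if p < 0 \<or> q < 0 then {0} else chainD (nat p) (nat q))"

definition DH where
 "DH p q f = (if p < 0 \<or> q < 0 then 0 else dh (nat p) (nat q) f)"

text \<open>The sign \<open>(-1)^p\<close> turns the commuting differentials \<open>dh\<close> and
  \<open>dv\<close> into anticommuting ones.\<close>

definition DV where
 "DV p q f = (if p < 0 \<or> q < 0 then 0 else alt (nat p) (dv (nat p) (nat q) f))"

lemma nat_succ: "\<not> p < 0 ==> nat (p + 1) = Suc (nat p)"
 by simp

sublocale DC: double_complex DD DH DV
proof
 show "subgp (DD p q)" for p q by (simp add: DD_def subgp_trivial chainD_subgp)
 show "p < 0 \<or> q < 0 ==> DD p q = {0}" for p q by (simp add: DD_def)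
 show "DH p q (f + g) = DH p q f + DH p q g" for p q f g by (simp add: DH_def addmap.add[OF dh_add])
 show "DV p q (f + g) = DV p q f + DV p q g" for p q f g by (simp add: DV_def addmap.add[OF dv_add] alt_add)
 show "DH p q f : DD (p + 1) q" if "f : DD p q" for p q f
  using that dh_D by (auto simp: DD_def DH_def nat_succ chainD_subgp subgp_zero)
 show "DV p q f : DD p (q + 1)" if "f : DD p q" for p q f
  using that dv_D by (auto simp: DD_def DV_def nat_succ chainD_subgp subgp_zero subgp_alt)
 show "DH (p + 1) q (DH p q f) = 0" if "f : DD p q" for p q f
  by (auto simp: DH_def nat_succ dh_dh addmap.zero[OF dh_add])
 show "DV p (q + 1) (DV p q f) = 0" if "f : DD p q" for p q f
  by (auto simp: DV_def nat_succ dv_dv addmap.alt[OF dv_add] addmap.zero[OF dv_add])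
 show "DV (p + 1) q (DH p q f) = - DH p (q + 1) (DV p q f)" if "f : DD p q" for p q f
  by (auto simp: DV_def DH_def nat_succ dv_dh addmap.alt[OF dh_add] addmap.zero[OF dv_add] addmap.zero[OF dh_add])
qed

end

subsection \<open>The free algebra comonad\<close>

lemma (in augmented_functor) cpow_ar_comp:
 "f : Hom C x y ==> g : Hom C y z ==> cpow_ar G n (g \<bullet> f) = cpow_ar G n g \<bullet> cpow_ar G n f"
proof (induction n)
 case (Suc n)
 thus ?case using G_comp[OF cpow_ar_Hom[of f x y n] cpow_ar_Hom[of g y z n]] by (simp add: cpow_ar_def)
qed (simp add: cpow_ar_def)

context set_monad
begin

text \<open>The workhorse for the comparison maps: an identity between composites of free maps is
  checked on generators only.\<close>

lemma Tm_comp_cong: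
 assumes "g : S \<rightarrow> S'" "g' : S' \<rightarrow> S''" "small_set S" "small_set S'" "small_set S''" "x : TO S"
  and "!!s. s : S ==> g' (g s) = k s"
 shows "Tm S' S'' g' (Tm S S' g x) = Tm S S'' k x"
 using Tm_comp[OF assms(1-6)] Tm_cong[of S "%s. g' (g s)" k S'', OF assms(7)] by simp

lemma G_fob: "fob (cfun GA) B = FA (fst B)"
 by (simp add: free_comonad_def adj_comonad_def fctr_comp_def free_adj_def)

lemma G_far:
 assumes "h : HA B B'"
 shows "far (cfun GA) h =
  mkarr (FA (fst B)) (FA (fst B')) (Tm (fst B) (fst B') (afn h))"
proof -
 note h = Alg_HomD[OF assms]
 have e: "Tm (fst B) (fst B') (afn h) : TO (fst B) \<rightarrow>\<^sub>E TO (fst B')"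
  using T_far(2)[OF ahom_Pi[OF h(4)] algs_small[OF h(2)] algs_small[OF h(3)]] .
 have "far (cfun GA) h = (FA (fst (fst (snd h))), far (mfun T) (fst (snd h)), FA (snd (snd (fst (snd h)))))"
  by (simp add: free_comonad_def adj_comonad_def fctr_comp_def free_adj_def case_prod_unfold)
 also have "fst (snd h) = (fst B, restrict (afn h) (fst B), fst B')" using h(1) by (metis fst_conv mkarr_def snd_conv)
 also have "far (mfun T) (fst B, restrict (afn h) (fst B), fst B') = (TO (fst B), Tm (fst B) (fst B') (afn h), TO (fst B'))"
  by (rule T_far(1)[OF ahom_Pi[OF h(4)] algs_small[OF h(2)] algs_small[OF h(3)]])
 finally show ?thesis by (simp add: mkarr_def free_fst PiE_restrict[OF e])
qed

lemma G_eps: "B : algs ==> ceps GA B = mkarr (FA (fst B)) B (st B)"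
 using algs_snd[of B] by (simp add: free_comonad_def adj_comonad_def free_adj_def mkarr_def free_fst PiE_restrict)

lemma st_ahom: "B : algs ==> ahom (FA (fst B)) B (st B)"
 using st_in algs_laws(2) by (auto simp: ahom_def free_fst free_st)

sublocale GX: augmented_functor "Alg T" "GA"
proof
 fix B assume B: "B : Obj (Alg T)"
 show "fob (cfun GA) B : Obj (Alg T)"
  using B free_algs[OF algs_small] by (simp add: G_fob)
 show "ceps GA B : HA (fob (cfun GA) B) B"
  unfolding G_fob using B mkarr_Hom[OF free_algs[OF algs_small] _ st_ahom] by (simp add: G_eps)
next
 fix f B B' assume f: "f : HA B B'"
 note h = Alg_HomD[OF f]
 note s = algs_small[OF h(2)] algs_small[OF h(3)]
 show fH: "far (cfun GA) f : HA (fob (cfun GA) B) (fob (cfun GA) B')"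
  unfolding G_far[OF f] G_fob by (rule mkarr_Hom[OF free_algs[OF s(1)] free_algs[OF s(2)] Tm_ahom[OF ahom_Pi[OF h(4)] s]])
 have e: "ceps GA C : HA (fob (cfun GA) C) C" if "C : algs" for C
  unfolding G_fob using that mkarr_Hom[OF free_algs[OF algs_small] _ st_ahom] by (simp add: G_eps)
 show "ceps GA B' \<cdot> far (cfun GA) f = f \<cdot> ceps GA B"
 proof (rule Alg_arr_eqI[OF Alg.comp_Hom[OF e[OF h(3)] fH] Alg.comp_Hom[OF f e[OF h(2)]]])
  fix x assume x: "x : fst (fob (cfun GA) B)"
  hence x': "x : fst (FA (fst B))" "x : TO (fst B)" by (simp_all add: G_fob free_fst)
  have "Tm (fst B) (fst B') (afn f) x : fst (FA (fst B'))"
   using Tm_in[OF ahom_Pi[OF h(4)] s x'(2)] by (simp add: free_fst)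
  thus "afn (ceps GA B' \<cdot> far (cfun GA) f) x = afn (f \<cdot> ceps GA B) x"
   unfolding afn_comp[OF fH x] afn_comp[OF e[OF h(2)] x] using ahom_st[OF h(4) x'(2)]
   by (simp add: G_far[OF f] G_eps h(2,3) afn_mkarr x'(1))
 qed
next
 fix f g B B' B'' assume f: "f : HA B B'" and g: "g : HA B' B''"
 note h = Alg_HomD[OF f] and h' = Alg_HomD[OF g]
 note s = algs_small[OF h(2)] algs_small[OF h(3)] algs_small[OF h'(3)]
 note gf = Alg.comp_Hom[OF g f]
 let ?F = "%B. FA (fst B)"
 have mH: "mkarr (?F B) (?F B') (Tm (fst B) (fst B') (afn k)) : HA (?F B) (?F B')" if "k : HA B B'" for k B B'
  using Alg_HomD[OF that] Tm_ahom[OF ahom_Pi algs_small algs_small] free_algs[OF algs_small] by (intro mkarr_Hom) auto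
 show "far (cfun GA) (g \<cdot> f) = far (cfun GA) g \<cdot> far (cfun GA) f"
  unfolding G_far[OF f] G_far[OF g] G_far[OF gf]
 proof (rule Alg_arr_eqI[OF mH[OF gf] Alg.comp_Hom[OF mH[OF g] mH[OF f]]])
  fix x assume x: "x : fst (?F B)"
  hence xT: "x : TO (fst B)" by (simp add: free_fst)
  have x2: "Tm (fst B) (fst B') (afn f) x : fst (?F B')"
   using Tm_in[OF ahom_Pi[OF h(4)] s(1,2) xT] by (simp add: free_fst)
  show "afn (mkarr (?F B) (?F B'') (Tm (fst B) (fst B'') (afn (g \<cdot> f)))) x =
   afn (mkarr (?F B') (?F B'') (Tm (fst B') (fst B'') (afn g)) \<cdot> mkarr (?F B) (?F B') (Tm (fst B) (fst B') (afn f))) x"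
   unfolding afn_comp[OF mH[OF f] x] afn_mkarr[OF x] afn_mkarr[OF x2]
   by (rule Tm_comp_cong[OF ahom_Pi[OF h(4)] ahom_Pi[OF h'(4)] s xT, symmetric]) (simp add: afn_comp[OF f])
 qed
qed

lemma afn_G_far: "h : HA B B' ==> x : TO (fst B) ==> afn (far (cfun GA) h) x = Tm (fst B) (fst B') (afn h) x"
 using afn_mkarr[of x "FA (fst B)"] by (simp add: G_far free_fst)

lemma afn_G_eps: "B : algs ==> x : TO (fst B) ==> afn (ceps GA B) x = st B x"
 using afn_mkarr[of x "FA (fst B)"] by (simp add: G_eps free_fst)

end

subsection \<open>The comonad on diagrams\<close>

context diagram_setup
begin

text \<open>The value at \<open>j\<close> of the left Kan extension of the underlying family of
  sets, with coded pairs \<open>(al, s)\<close>. Its transition map is \<open>lact\<close>, the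
  counit of the Kan extension is \<open>bact\<close>, and \<open>lmap\<close> is its action on
  natural transformations.\<close>

definition L :: "('i, 'k, 'u) alg_diagram => 'i => 'u set" where
 "L B j = {code al s | al s. al : Arr I & Cod I al = j & s : U B (Dom I al)}"

definition lact :: "'k => 'u => 'u" where
 "lact bt c = (case decode I c of (al, s) => code (bt \<bullet> al) s)"

definition bact :: "('i, 'k, 'u) alg_diagram => 'u => 'u" where
 "bact B c = (case decode I c of (al, s) => Bf B al s)"

definition lmap :: "('i, 'k, 'u) alg_diagram_hom => 'u => 'u" where
 "lmap t c = (case decode I c of (al, s) => code al (tf t (Dom I al) s))"

lemma LI: "al : Hom I i j ==> s : U B i ==> code al s : L B j"
 by (auto simp: L_def Hom_iff)

lemma LE:
 assumes "c : L B j"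
 obtains al i s where "al : Hom I i j" "s : U B i" "c = code al s" "decode I c = (al, s)"
 using assms decode_code by (auto simp: L_def Hom_iff)

lemma decode_Hom: "al : Hom I i j ==> decode I (code al s) = (al, s)"
 by (simp add: decode_code Hom_iff)

lemma lact_code: "al : Hom I i j ==> lact bt (code al s) = code (bt \<bullet> al) s"
 and bact_code: "al : Hom I i j ==> bact B (code al s) = Bf B al s"
 and lmap_code: "al : Hom I i j ==> lmap t (code al s) = code al (tf t i s)"
 by (simp_all add: lact_def bact_def lmap_def decode_Hom) (simp add: Hom_iff)

lemma L_small: "B : diag ==> small_set (L B j)"
proof -
 assume B: "B : diag"
 have "small_set (\<Union>al\<in>Arr I. code al ` U B (Dom I al))"
  using I.Hom_Obj[OF I.Arr_Hom] U_small[OF B] by (intro small_UN[OF small_Arr] small_image) auto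
 thus ?thesis by (rule small_subset) (auto simp: L_def)
qed

lemma lact_Pi: "bt : Hom I j k ==> lact bt : L B j \<rightarrow> L B k"
 by (auto elim!: LE simp: lact_code intro!: LI)

lemma bact_Pi: "B : diag ==> bact B : L B j \<rightarrow> U B j"
 by (auto elim!: LE simp: bact_code intro: Bf_in)

lemma lmap_Pi: "t : Hom DA B B' ==> lmap t : L B j \<rightarrow> L B' j"
proof
 fix c assume t: "t : Hom DA B B'" and c: "c : L B j"
 obtain al i s where a: "al : Hom I i j" "s : U B i" "c = code al s" using c by (rule LE)
 thus "lmap t c : L B' j"
  using LI[OF a(1) DA_HomD(8)[OF t I.Hom_Obj(1)[OF a(1)] a(2)]] by (simp add: lmap_code[OF a(1)])
qed

lemma bact_lact: "B : diag ==> bt : Hom I j k ==> c : L B j ==> bact B (lact bt c) = Bf B bt (bact B c)"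
 using bact_code[OF I.comp_Hom] by (auto elim!: LE simp: lact_code bact_code Bf_comp)

lemma bact_lmap: "t : Hom DA B B' ==> c : L B j ==> bact B' (lmap t c) = tf t j (bact B c)"
 by (auto elim!: LE simp: lmap_code bact_code DA_HomD(9))

lemma ins_in: "i : Obj I ==> x : U B i ==> code (Idn I i) x : L B i"
 by (rule LI[OF I.Idn_Hom])

lemma bact_ins: "B : diag ==> i : Obj I ==> x : U B i ==> bact B (code (Idn I i) x) = x"
 by (simp add: bact_code[OF I.Idn_Hom] Bf_Idn)

lemma lmap_ins: "i : Obj I ==> lmap t (code (Idn I i) x) = code (Idn I i) (tf t i x)"
 by (simp add: lmap_code[OF I.Idn_Hom])

definition Gob :: "('i, 'k, 'u) alg_diagram => ('i, 'k, 'u) alg_diagram" where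
 "Gob B = free_diag (L B) lact"

lemma Gob_diag: "B : diag ==> Gob B : diag"
 unfolding Gob_def
proof (rule free_diag[OF L_small lact_Pi])
 show "lact (Idn I j) s = s" if "s : L B j" for j s
  using that by (auto elim!: LE simp: lact_code I.comp_Idn)
 fix al bt i j k s assume a: "al : Hom I i j" "bt : Hom I j k" and s: "s : L B i"
 obtain gm l x where g: "gm : Hom I l i" "s = code gm x" using s by (rule LE)
 show "lact (bt \<bullet> al) s = lact bt (lact al s)"
  unfolding g(2) lact_code[OF g(1)] lact_code[OF I.comp_Hom[OF a(1) g(1)]] I.comp_assoc[OF g(1) a] ..
qed

lemma U_Gob: "j : Obj I ==> U (Gob B) j = TO (L B j)"
 and fob_Gob: "j : Obj I ==> fob (Gob B) j = FA (L B j)"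
 by (simp_all add: Gob_def U_free_diag free_diag_fob)

lemma Bf_Gob: "al : Hom I i j ==> x : TO (L B i) ==> Bf (Gob B) al x = Tm (L B i) (L B j) (lact al) x"
 unfolding Gob_def by (rule Bf_free_diag)

abbreviation GI where "GI \<equiv> diag_comonad I T"

text \<open>The family of underlying sets as an object of the functor category on the discrete
  category, in the form in which the composite right adjoint produces it.\<close>

definition und :: "('i, 'k, 'u) alg_diagram => ('i, 'k, 'u set, 'u smap) fctr" where
 "und B = res_ob I (post_ob I (radj (free_adj set_cat T)) B)"

lemma lan_set_und: "lan_set I (und B) j = L B j"
proof -
 have "fob (und B) (Dom I al) = U B (Dom I al)" if "al : Arr I" for al
  using I.Hom_Obj(1)[OF I.Arr_Hom[OF that]] by (simp add: und_def res_ob_def post_ob_def free_adj_def U_def)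
 thus ?thesis unfolding lan_set_def L_def code_def by blast
qed

lemma lan_map_und:
 assumes "!!al i s. al : Hom I i j ==> s : U B i ==> h al s = g (code al s)"
 shows "lan_map I (und B) j h Y = (L B j, restrict g (L B j), Y)"
 unfolding lan_map_def lan_set_und
 by (auto intro!: restrict_ext elim!: LE simp: assms decode_Hom)

lemma ladj_far:
 assumes "g : S \<rightarrow> S'" "small_set S" "small_set S'"
 shows "far (ladj (free_adj set_cat T)) (S, restrict g S, S') = mkarr (FA S) (FA S') (Tm S S' g)"
 using T_far[OF assms] by (simp add: free_adj_def mkarr_def free_fst PiE_restrict)

text \<open>Unfolding the composite adjunction: the Kan extension of the underlying family has the
  sets \<open>L B j\<close> with transition maps \<open>lact\<close>, and free algebras are taken
  objectwise.\<close>

lemma GI_fob: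
 assumes B: "B : diag"
 shows "fob (cfun GI) B = Gob B"
proof -
 have eq: "fob (cfun GI) B = post_ob I (ladj (free_adj set_cat T)) (lan_ob I (und B))"
  by (simp add: diag_comonad_def adj_comonad_def adj_comp_def fctr_comp_def lan_adj_def post_adj_def
    post_functor_def und_def)
 have 1: "(\<lambda>j\<in>Obj I. fob (ladj (free_adj set_cat T)) (fob (lan_ob I (und B)) j)) = (\<lambda>j\<in>Obj I. FA (L B j))"
  by (auto simp: lan_ob_def lan_set_und free_adj_def)
 have 2: "far (ladj (free_adj set_cat T)) (far (lan_ob I (und B)) al) =
  mkarr (FA (L B (Dom I al))) (FA (L B (Cod I al))) (Tm (L B (Dom I al)) (L B (Cod I al)) (lact al))"
  if a: "al : Arr I" for al
 proof -
  have "far (lan_ob I (und B)) al = lan_map I (und B) (Dom I al) (%al' s. encode I (al \<bullet> al', s)) (L B (Cod I al))"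
   using a by (simp add: lan_ob_def lan_set_und)
  also have "... = (L B (Dom I al), restrict (lact al) (L B (Dom I al)), L B (Cod I al))"
   by (rule lan_map_und) (simp add: lact_code code_def[symmetric])
  finally show ?thesis using ladj_far[OF lact_Pi[OF I.Arr_Hom[OF a]] L_small[OF B] L_small[OF B]] by simp
 qed
 show ?thesis
  unfolding eq Gob_def free_diag_def post_ob_def using 1 2 by (auto intro!: restrict_ext)
qed

lemma GI_far:
 assumes t: "t : Hom DA B B'"
 shows "far (cfun GI) t = mk_nt (Gob B) (Gob B') (%j. Tm (L B j) (L B' j) (lmap t))"
proof -
 note h = DA_HomD[OF t]
 have tt: "t = (B, component t, B')" using h(3,4) by (metis prod.collapse)
 have "far (cfun GI) t = (post_ob I (ladj (free_adj set_cat T)) (lan_ob I (und B)),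
  \<lambda>j\<in>Obj I. far (ladj (free_adj set_cat T)) (lan_map I (und B) j
    (%al s. encode I (al, smap_fun ((\<lambda>j\<in>Obj I. far (radj (free_adj set_cat T)) (component t j)) (Dom I al)) s)) (L B' j)),
  post_ob I (ladj (free_adj set_cat T)) (lan_ob I (und B')))"
  by (subst tt) (auto simp: diag_comonad_def adj_comonad_def adj_comp_def fctr_comp_def lan_adj_def post_adj_def
    post_functor_def und_def[symmetric] lan_set_und intro!: restrict_ext)
 moreover have "far (ladj (free_adj set_cat T)) (lan_map I (und B) j
    (%al s. encode I (al, smap_fun ((\<lambda>j\<in>Obj I. far (radj (free_adj set_cat T)) (component t j)) (Dom I al)) s)) (L B' j)) =
   mkarr (fob (Gob B) j) (fob (Gob B') j) (Tm (L B j) (L B' j) (lmap t))" if j: "j : Obj I" for j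
 proof -
  have "encode I (al, smap_fun ((\<lambda>j\<in>Obj I. far (radj (free_adj set_cat T)) (component t j)) (Dom I al)) s) = lmap t (code al s)"
   if a: "al : Hom I i j" for al i s
   using I.Hom_Obj(1)[OF a] a by (simp add: lmap_code[OF a] code_def[symmetric] tf_def afn_def free_adj_def Hom_iff case_prod_unfold)
  hence "lan_map I (und B) j (%al s. encode I (al, smap_fun ((\<lambda>j\<in>Obj I. far (radj (free_adj set_cat T)) (component t j)) (Dom I al)) s)) (L B' j)
   = (L B j, restrict (lmap t) (L B j), L B' j)"
   by (intro lan_map_und) auto
  thus ?thesis
   using ladj_far[OF lmap_Pi[OF t] L_small[OF h(1)] L_small[OF h(2)]] by (simp add: fob_Gob[OF j])
 qed
 moreover have "post_ob I (ladj (free_adj set_cat T)) (lan_ob I (und B)) = Gob B" if "B : diag" for B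
  using GI_fob[OF that] by (simp add: diag_comonad_def adj_comonad_def adj_comp_def fctr_comp_def lan_adj_def post_adj_def
    post_functor_def und_def)
 ultimately show ?thesis using h(1,2) by (auto simp: mk_nt_def intro!: restrict_ext)
qed

lemma Geps_ahom:
 assumes B: "B : diag" and j: "j : Obj I"
 shows "ahom (fob (Gob B) j) (fob B j) (%x. st (fob B j) (Tm (L B j) (U B j) (bact B) x))"
 unfolding fob_Gob[OF j] U_def
 using free_ext(1)[OF L_small[OF B] diag_ob[OF B j]] bact_Pi[OF B, of j] by (simp add: U_def)

text \<open>The counit of a composite adjunction: the free functor applied to the Kan extension
  counit \<open>bact\<close>, followed by the counit of the free algebra adjunction, which is the
  structure map.\<close>

lemma GI_eps:
 assumes B: "B : diag"
 shows "ceps GI B = mk_nt (Gob B) B (%j x. st (fob B j) (Tm (L B j) (U B j) (bact B) x))"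
proof -
 let ?R = "radj (free_adj set_cat T)" and ?F = "ladj (free_adj set_cat T)"
 have "ceps GI B = (post_ob I ?F (lan_ob I (und B)), \<lambda>j\<in>Obj I.
  (FA (fst (fob B j)), snd (fob B j), fob B j) \<cdot>
   far ?F (lan_map I (und B) j (%al s. smap_fun (far (post_ob I ?R B) al) s) (fob (post_ob I ?R B) j)), B)"
  by (auto simp: diag_comonad_def adj_comonad_def adj_comp_def lan_adj_def post_adj_def fctr_comp_def
    post_functor_def und_def DiagAlg_def free_adj_def intro!: restrict_ext)
 moreover have "post_ob I ?F (lan_ob I (und B)) = Gob B"
  using GI_fob[OF B] by (simp add: diag_comonad_def adj_comonad_def adj_comp_def fctr_comp_def lan_adj_def post_adj_def
    post_functor_def und_def)
 moreover have "(FA (fst (fob B j)), snd (fob B j), fob B j) \<cdot>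
   far ?F (lan_map I (und B) j (%al s. smap_fun (far (post_ob I ?R B) al) s) (fob (post_ob I ?R B) j)) =
   mkarr (fob (Gob B) j) (fob B j) (%x. st (fob B j) (Tm (L B j) (U B j) (bact B) x))" if j: "j : Obj I" for j
 proof -
  have 1: "smap_fun (far (post_ob I ?R B) al) s = bact B (code al s)" if a: "al : Hom I i j" for al i s
   using a by (simp add: bact_code[OF a] post_ob_def Bf_def afn_def free_adj_def case_prod_unfold Hom_iff)
  have 2: "fob (post_ob I ?R B) j = U B j" using j by (simp add: post_ob_def free_adj_def U_def)
  have 3: "lan_map I (und B) j (%al s. smap_fun (far (post_ob I ?R B) al) s) (U B j) = (L B j, restrict (bact B) (L B j), U B j)"
   using 1 by (intro lan_map_und) auto
  have 4: "(FA (fst (fob B j)), snd (fob B j), fob B j) = mkarr (FA (U B j)) (fob B j) (st (fob B j))"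
   using algs_snd[OF diag_ob[OF B j]] by (simp add: mkarr_def U_def free_fst PiE_restrict)
  note Uj = diag_ob[OF B j]
  have e: "mkarr (FA (U B j)) (fob B j) (st (fob B j)) : HA (FA (U B j)) (fob B j)"
   using st_ahom[OF Uj] free_algs[OF U_small[OF B j]] Uj by (intro mkarr_Hom) (auto simp: U_def)
  have f: "mkarr (FA (L B j)) (FA (U B j)) (Tm (L B j) (U B j) (bact B)) : HA (FA (L B j)) (FA (U B j))"
   by (rule mkarr_Hom[OF free_algs[OF L_small[OF B]] free_algs[OF U_small[OF B j]] Tm_ahom[OF bact_Pi[OF B] L_small[OF B] U_small[OF B j]]])
  have g: "mkarr (fob (Gob B) j) (fob B j) (%x. st (fob B j) (Tm (L B j) (U B j) (bact B) x)) : HA (FA (L B j)) (fob B j)"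
   using mkarr_Hom[OF diag_ob[OF Gob_diag[OF B] j] Uj Geps_ahom[OF B j]] by (simp add: fob_Gob[OF j])
  show ?thesis
   unfolding 2 3 4 ladj_far[OF bact_Pi[OF B] L_small[OF B] U_small[OF B j]]
  proof (rule Alg_arr_eqI[OF Alg.comp_Hom[OF e f] g])
   fix x assume x: "x : fst (FA (L B j))"
   have x': "Tm (L B j) (U B j) (bact B) x : fst (FA (U B j))"
    using Tm_in[OF bact_Pi[OF B] L_small[OF B] U_small[OF B j]] x by (simp add: free_fst)
   show "afn (mkarr (FA (U B j)) (fob B j) (st (fob B j)) \<cdot>
     mkarr (FA (L B j)) (FA (U B j)) (Tm (L B j) (U B j) (bact B))) x =
    afn (mkarr (fob (Gob B) j) (fob B j) (%x. st (fob B j) (Tm (L B j) (U B j) (bact B) x))) x"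
    unfolding afn_comp[OF f x] fob_Gob[OF j] afn_mkarr[OF x] afn_mkarr[OF x'] ..
  qed
 qed
 ultimately show ?thesis by (auto simp: mk_nt_def intro!: restrict_ext)
qed

lemma GI_eps_Hom:
 assumes B: "B : diag"
 shows "ceps GI B : Hom DA (Gob B) B"
 unfolding GI_eps[OF B]
proof (rule mk_nt_Hom[OF Gob_diag[OF B] B Geps_ahom[OF B]])
 fix al i j x assume a: "al : Hom I i j" and "x : U (Gob B) i"
 note o = I.Hom_Obj[OF a]
 have x: "x : TO (L B i)" using \<open>x : U (Gob B) i\<close> o by (simp add: U_Gob)
 note s = L_small[OF B, of i] L_small[OF B, of j] U_small[OF B o(1)] U_small[OF B o(2)]
 have aP: "Bf B al : U B i \<rightarrow> U B j" using Bf_in[OF B a] by auto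
 have "Tm (L B j) (U B j) (bact B) (Tm (L B i) (L B j) (lact al) x) = Tm (L B i) (U B j) (%c. Bf B al (bact B c)) x"
  by (rule Tm_comp_cong[OF lact_Pi[OF a] bact_Pi[OF B] s(1,2,4) x bact_lact[OF B a]])
 also have "... = Tm (U B i) (U B j) (Bf B al) (Tm (L B i) (U B i) (bact B) x)"
  by (rule Tm_comp[OF bact_Pi[OF B] aP s(1,3,4) x, symmetric])
 finally show "st (fob B j) (Tm (L B j) (U B j) (bact B) (Bf (Gob B) al x)) = Bf B al (st (fob B i) (Tm (L B i) (U B i) (bact B) x))"
  using ahom_st[OF Bf_ahom[OF B a], folded U_def] Tm_in[OF bact_Pi[OF B] s(1,3) x] by (simp add: Bf_Gob[OF a x])
qed

lemma GI_far_Hom: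
 assumes t: "t : Hom DA B B'"
 shows "far (cfun GI) t : Hom DA (Gob B) (Gob B')"
 unfolding GI_far[OF t]
proof (rule mk_nt_Hom[OF Gob_diag Gob_diag])
 note h = DA_HomD[OF t]
 show "B : diag" "B' : diag" by fact+
 note s = L_small[OF h(1)] L_small[OF h(2)]
 show "ahom (fob (Gob B) j) (fob (Gob B') j) (Tm (L B j) (L B' j) (lmap t))" if "j : Obj I" for j
  unfolding fob_Gob[OF that] by (rule Tm_ahom[OF lmap_Pi[OF t] s])
 fix al i j x assume a: "al : Hom I i j" and "x : U (Gob B) i"
 note o = I.Hom_Obj[OF a]
 have x: "x : TO (L B i)" using \<open>x : U (Gob B) i\<close> o by (simp add: U_Gob)
 have x': "Tm (L B i) (L B' i) (lmap t) x : TO (L B' i)" by (rule Tm_in[OF lmap_Pi[OF t] s x])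
 have eq: "lmap t (lact al c) = lact al (lmap t c)" if c: "c : L B i" for c
 proof -
  obtain gm l y where g: "gm : Hom I l i" "c = code gm y" using c by (rule LE)
  thus ?thesis by (simp add: lact_code[OF g(1)] lmap_code[OF g(1)] lmap_code[OF I.comp_Hom[OF a g(1)]])
 qed
 have "Tm (L B j) (L B' j) (lmap t) (Tm (L B i) (L B j) (lact al) x) = Tm (L B i) (L B' j) (%c. lact al (lmap t c)) x"
  by (rule Tm_comp_cong[OF lact_Pi[OF a] lmap_Pi[OF t] s(1) s(1) s(2) x eq])
 also have "... = Tm (L B' i) (L B' j) (lact al) (Tm (L B i) (L B' i) (lmap t) x)"
  by (rule Tm_comp[OF lmap_Pi[OF t] lact_Pi[OF a] s(1) s(2) s(2) x, symmetric])
 finally show "Tm (L B j) (L B' j) (lmap t) (Bf (Gob B) al x) = Bf (Gob B') al (Tm (L B i) (L B' i) (lmap t) x)"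
  by (simp add: Bf_Gob[OF a x] Bf_Gob[OF a x'])
qed

lemma tf_GI_eps: "B : diag ==> j : Obj I ==> x : TO (L B j) ==>
  tf (ceps GI B) j x = st (fob B j) (Tm (L B j) (U B j) (bact B) x)"
 by (simp add: GI_eps tf_mk_nt U_Gob)

lemma tf_GI_far: "t : Hom DA B B' ==> j : Obj I ==> x : TO (L B j) ==>
  tf (far (cfun GI) t) j x = Tm (L B j) (L B' j) (lmap t) x"
 by (simp add: GI_far tf_mk_nt U_Gob)

sublocale GY: augmented_functor "DiagAlg I T" "diag_comonad I T"
proof
 fix B assume B: "B : Obj DA"
 thus "fob (cfun GI) B : Obj DA" "ceps GI B : Hom DA (fob (cfun GI) B) B"
  using Gob_diag GI_eps_Hom by (simp_all add: GI_fob)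
next
 fix f B B' assume f: "f : Hom DA B B'"
 note h = DA_HomD[OF f]
 note fH = GI_far_Hom[OF f]
 show "far (cfun GI) f : Hom DA (fob (cfun GI) B) (fob (cfun GI) B')"
  using fH by (simp add: GI_fob h)
 show "ceps GI B' \<bullet>\<^bsub>DA\<^esub> far (cfun GI) f = f \<bullet>\<^bsub>DA\<^esub> ceps GI B"
 proof (rule DA_eqI[OF DA.comp_Hom[OF GI_eps_Hom[OF h(2)] fH] DA.comp_Hom[OF f GI_eps_Hom[OF h(1)]]])
  fix j x assume j: "j : Obj I" and xU: "x : U (Gob B) j"
  have x: "x : TO (L B j)" using xU by (simp add: U_Gob[OF j])
  have x': "Tm (L B j) (L B' j) (lmap f) x : TO (L B' j)" by (rule Tm_in[OF lmap_Pi[OF f] L_small[OF h(1)] L_small[OF h(2)] x])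
  note s = L_small[OF h(1), of j] L_small[OF h(2), of j] U_small[OF h(1) j] U_small[OF h(2) j]
  have fP: "tf f j : U B j \<rightarrow> U B' j" using h(8)[OF j] by auto
  have "Tm (L B' j) (U B' j) (bact B') (Tm (L B j) (L B' j) (lmap f) x) = Tm (L B j) (U B' j) (%c. tf f j (bact B c)) x"
   by (rule Tm_comp_cong[OF lmap_Pi[OF f] bact_Pi[OF h(2)] s(1,2,4) x bact_lmap[OF f]])
  also have "... = Tm (U B j) (U B' j) (tf f j) (Tm (L B j) (U B j) (bact B) x)"
   by (rule Tm_comp[OF bact_Pi[OF h(1)] fP s(1,3,4) x, symmetric])
  finally show "tf (ceps GI B' \<bullet>\<^bsub>DA\<^esub> far (cfun GI) f) j x = tf (f \<bullet>\<^bsub>DA\<^esub> ceps GI B) j x"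
   unfolding tf_comp[OF fH j xU] tf_comp[OF GI_eps_Hom[OF h(1)] j xU]
   using ahom_st[OF h(7)[OF j], folded U_def, of "Tm (L B j) (U B j) (bact B) x"] Tm_in[OF bact_Pi[OF h(1)] s(1,3) x]
   by (simp add: tf_GI_far[OF f j x] tf_GI_eps[OF h(2) j x'] tf_GI_eps[OF h(1) j x])
 qed
next
 fix f g B B' B'' assume f: "f : Hom DA B B'" and g: "g : Hom DA B' B''"
 note gf = DA.comp_Hom[OF g f]
 note s = L_small[OF DA_HomD(1)[OF f]] L_small[OF DA_HomD(2)[OF f]] L_small[OF DA_HomD(2)[OF g]]
 show "far (cfun GI) (g \<bullet>\<^bsub>DA\<^esub> f) = far (cfun GI) g \<bullet>\<^bsub>DA\<^esub> far (cfun GI) f"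
 proof (rule DA_eqI[OF GI_far_Hom[OF gf] DA.comp_Hom[OF GI_far_Hom[OF g] GI_far_Hom[OF f]]])
  fix j x assume j: "j : Obj I" and xU: "x : U (Gob B) j"
  have x: "x : TO (L B j)" using xU by (simp add: U_Gob[OF j])
  have x': "Tm (L B j) (L B' j) (lmap f) x : TO (L B' j)" by (rule Tm_in[OF lmap_Pi[OF f] s(1,2) x])
  have eq: "lmap g (lmap f c) = lmap (g \<bullet>\<^bsub>DA\<^esub> f) c" if c: "c : L B j" for c
  proof -
   obtain gm l y where g: "gm : Hom I l j" "y : U B l" "c = code gm y" using c by (rule LE)
   thus ?thesis using tf_comp[OF f I.Hom_Obj(1)[OF g(1)] g(2)] by (simp add: lmap_code[OF g(1)])
  qed
  show "tf (far (cfun GI) (g \<bullet>\<^bsub>DA\<^esub> f)) j x = tf (far (cfun GI) g \<bullet>\<^bsub>DA\<^esub> far (cfun GI) f) j x"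
   unfolding tf_comp[OF GI_far_Hom[OF f] j xU] tf_GI_far[OF f j x] tf_GI_far[OF g j x'] tf_GI_far[OF gf j x]
   by (rule Tm_comp_cong[OF lmap_Pi[OF f] lmap_Pi[OF g] s x eq, symmetric])
 qed
qed

end

subsection \<open>Two resolutions of a diagram\<close>

locale comparison = module_setup T I A M
 for T :: "('u set, 'u smap) monad" and I :: "('i, 'k) cat" (structure)
  and A :: "('i, 'k, 'u) alg_diagram" and M :: "('i, 'k, 'u) alg_diagram_hom module_obj"
begin

text \<open>Indices count powers of the comonad: index \<open>0\<close> is the augmentation level
  \<open>A\<close>, and simplicial degree \<open>q\<close> has index \<open>Suc q\<close>. The
  comparison maps are thereby built by recursion from the identity of \<open>A\<close>.\<close>

definition Yo :: "nat => ('i, 'k, 'u) alg_diagram" where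
 "Yo n = cpow_ob (diag_comonad I T) n A"
definition Xo where
 "Xo n i = cpow_ob GA n (fob A i)"
definition yd where
 "yd n k i = tf (cface (diag_comonad I T) A n k) i"
definition xd where
 "xd n k i = afn (cface GA (fob A i) n k)"
definition yaug where
 "yaug n i = tf (caug DA (diag_comonad I T) A n) i"
definition xaug where
 "xaug n i = afn (caug (Alg T) GA (fob A i) n)"
definition xact where
 "xact n gm = afn (cpow_ar GA n (far A gm))"

lemma Yo_diag: "Yo n : diag"
 unfolding Yo_def using GY.cpow_ob_Obj[of A n] A_diag by simp

lemma Yo_0: "Yo 0 = A" and Yo_Suc: "Yo (Suc n) = Gob (Yo n)"
proof -
 show "Yo 0 = A" by (simp add: Yo_def GY.cpow_ob_0)
 show "Yo (Suc n) = Gob (Yo n)"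
  using GI_fob[OF Yo_diag, of n] by (simp add: Yo_def GY.cpow_ob_Suc)
qed

lemma U_Yo_Suc: "i : Obj I ==> U (Yo (Suc n)) i = TO (L (Yo n) i)"
 and fob_Yo_Suc: "i : Obj I ==> fob (Yo (Suc n)) i = FA (L (Yo n) i)"
 by (simp_all add: Yo_Suc U_Gob fob_Gob)

lemma cface_DA: "k <= n ==> cface GI A n k : Hom DA (Yo (Suc n)) (Yo n)"
 unfolding Yo_def using GY.cface_Hom[of A k n] A_diag by simp

lemma caug_DA: "caug DA GI A n : Hom DA (Yo n) A"
 unfolding Yo_def using GY.caug_Hom[of A n] A_diag by simp

lemma cface_Alg: "i : Obj I ==> k <= n ==> cface GA (fob A i) n k : HA (Xo (Suc n) i) (Xo n i)"
 unfolding Xo_def using GX.cface_Hom[of "fob A i" k n] diag_ob[OF A_diag] by simp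

lemma caug_Alg: "i : Obj I ==> caug (Alg T) GA (fob A i) n : HA (Xo n i) (fob A i)"
 unfolding Xo_def using GX.caug_Hom[of "fob A i" n] diag_ob[OF A_diag] by simp

lemma cpow_ar_Alg: "gm : Hom I i i' ==> cpow_ar GA n (far A gm) : HA (Xo n i) (Xo n i')"
 unfolding Xo_def by (rule GX.cpow_ar_Hom[OF diag_ar[OF A_diag]])

lemma Xo_alg: "i : Obj I ==> Xo n i : algs"
 unfolding Xo_def using GX.cpow_ob_Obj[of "fob A i" n] diag_ob[OF A_diag] by simp

lemma Xo_0: "Xo 0 i = fob A i" and Xo_Suc: "Xo (Suc n) i = FA (fst (Xo n i))"
 by (simp_all add: Xo_def GX.cpow_ob_0 GX.cpow_ob_Suc G_fob)

lemma fst_Xo_Suc: "fst (Xo (Suc n) i) = TO (fst (Xo n i))"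
 by (simp add: Xo_Suc free_fst)

lemmas sX = algs_small[OF Xo_alg]
lemmas sL = L_small[OF Yo_diag]
lemmas sU = U_small[OF Yo_diag]
lemmas bactY = bact_Pi[OF Yo_diag]

lemma yd_hom: "i : Obj I ==> k <= n ==> ahom (fob (Yo (Suc n)) i) (fob (Yo n) i) (yd n k i)"
 unfolding yd_def by (rule DA_HomD(7)[OF cface_DA])

lemma yd_in: "i : Obj I ==> k <= n ==> x : U (Yo (Suc n)) i ==> yd n k i x : U (Yo n) i"
 unfolding yd_def by (rule DA_HomD(8)[OF cface_DA])

lemma xd_hom: "i : Obj I ==> k <= n ==> ahom (Xo (Suc n) i) (Xo n i) (xd n k i)"
 unfolding xd_def by (rule Alg_HomD(4)[OF cface_Alg])

lemma yd_0: "i : Obj I ==> x : TO (L (Yo n) i) ==>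
  yd n 0 i x = st (fob (Yo n) i) (Tm (L (Yo n) i) (U (Yo n) i) (bact (Yo n)) x)"
 unfolding yd_def GY.cface_0 using tf_GI_eps[OF Yo_diag, of i x n] by (simp add: Yo_def)

lemma yd_Suc: "i : Obj I ==> k <= n ==> x : TO (L (Yo (Suc n)) i) ==>
  yd (Suc n) (Suc k) i x = Tm (L (Yo (Suc n)) i) (L (Yo n) i) (lmap (cface GI A n k)) x"
 unfolding yd_def using tf_GI_far[OF cface_DA] by (simp add: GY.cface_Suc)

lemma xd_0: "i : Obj I ==> x : TO (fst (Xo n i)) ==> xd n 0 i x = st (Xo n i) x"
 unfolding xd_def GX.cface_0 using afn_G_eps[OF Xo_alg] by (simp add: Xo_def)

lemma xd_Suc: "i : Obj I ==> k <= n ==> x : TO (fst (Xo (Suc n) i)) ==>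
  xd (Suc n) (Suc k) i x = Tm (fst (Xo (Suc n) i)) (fst (Xo n i)) (xd n k i) x"
 unfolding xd_def using afn_G_far[OF cface_Alg] by (simp add: GX.cface_Suc)

lemma xact_Suc: "gm : Hom I i i' ==> x : TO (fst (Xo n i)) ==>
  xact (Suc n) gm x = Tm (fst (Xo n i)) (fst (Xo n i')) (xact n gm) x"
 unfolding xact_def using afn_G_far[OF cpow_ar_Alg] by (simp add: cpow_ar_def)

lemma xact_in: "gm : Hom I i i' ==> x : fst (Xo n i) ==> xact n gm x : fst (Xo n i')"
 unfolding xact_def by (rule Alg_HomD(5)[OF cpow_ar_Alg])

lemma yd_nat: "gm : Hom I i i' ==> k <= n ==> x : U (Yo (Suc n)) i ==>
  yd n k i' (Bf (Yo (Suc n)) gm x) = Bf (Yo n) gm (yd n k i x)"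
 unfolding yd_def by (rule DA_HomD(9)[OF cface_DA])

sublocale RX: resolution T I A M "%q. Xo (Suc q)" "%q. xaug (Suc q)" "%q. xd (Suc q)" "%q. xact (Suc q)"
proof (unfold_locales, goal_cases)
 case (1 i q)
 thus ?case by (rule Xo_alg)
next
 case (2 i q)
 thus ?case unfolding xaug_def by (rule Alg_HomD(4)[OF caug_Alg])
next
 case (3 i k q)
 thus ?case by (rule xd_hom)
next
 case (4 gm i i' q)
 thus ?case unfolding xact_def by (rule Alg_HomD(4)[OF cpow_ar_Alg])
next
 case (5 i k q x)
 thus ?case
  using GX.caug_cface[of "fob A i" k "Suc q"] diag_ob[OF A_diag 5(1)] afn_comp[OF cface_Alg[OF 5(1,2)] 5(3)]
  unfolding xaug_def xd_def Obj_Alg by metis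
next
 case (6 gm i i' x q)
 thus ?case
  using GX.caug_nat[OF diag_ar[OF A_diag 6(1)], of "Suc q"] afn_comp[OF cpow_ar_Alg[OF 6(1)] 6(2)]
   afn_comp[OF caug_Alg[OF I.Hom_Obj(1)[OF 6(1)]] 6(2)]
  unfolding xaug_def xact_def Bf_def by metis
next
 case (7 i k l q x)
 have "k <= Suc (Suc q)" using 7 by simp
 thus ?case
  using GX.cface_cface[of "fob A i" k l "Suc q"] diag_ob[OF A_diag 7(1)] 7
   afn_comp[OF cface_Alg[OF 7(1), of l "Suc (Suc q)"] 7(4)] afn_comp[OF cface_Alg[OF 7(1), of k "Suc (Suc q)"] 7(4)]
  unfolding xd_def Obj_Alg by metis
next
 case (8 gm i i' k q x)
 thus ?case
  using GX.cface_nat[OF diag_ar[OF A_diag 8(1)], of k "Suc q"] afn_comp[OF cpow_ar_Alg[OF 8(1)] 8(3)]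
   afn_comp[OF cface_Alg[OF I.Hom_Obj(1)[OF 8(1)] 8(2)] 8(3)]
  unfolding xd_def xact_def by metis
next
 case (9 gm i i' gm' i'' x q)
 thus ?case
  using GX.cpow_ar_comp[OF diag_ar[OF A_diag 9(1)] diag_ar[OF A_diag 9(2)], of "Suc q"]
   diagramsD(4)[OF A_diag 9(1,2)] afn_comp[OF cpow_ar_Alg[OF 9(1)] 9(3)]
  unfolding xact_def by metis
qed

sublocale RY: resolution T I A M "%q. fob (Yo (Suc q))" "%q. yaug (Suc q)" "%q. yd (Suc q)" "%q. Bf (Yo (Suc q))"
proof (unfold_locales, goal_cases)
 case (1 i q)
 thus ?case by (rule diag_ob[OF Yo_diag])
next
 case (2 i q)
 thus ?case unfolding yaug_def by (rule DA_HomD(7)[OF caug_DA])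
next
 case (3 i k q)
 thus ?case by (rule yd_hom)
next
 case (4 gm i i' q)
 thus ?case by (rule Bf_ahom[OF Yo_diag])
next
 case (5 i k q x)
 thus ?case
  using GY.caug_cface[of A k "Suc q"] A_diag tf_comp[OF cface_DA[OF 5(2)] 5(1), of x]
  unfolding yaug_def yd_def Obj_DA U_def by metis
next
 case (6 gm i i' x q)
 thus ?case unfolding yaug_def by (intro DA_HomD(9)[OF caug_DA]) (simp_all add: U_def)
next
 case (7 i k l q x)
 have "k <= Suc (Suc q)" using 7 by simp
 thus ?case
  using GY.cface_cface[of A k l "Suc q"] A_diag 7
   tf_comp[OF cface_DA 7(1), of l "Suc (Suc q)" x] tf_comp[OF cface_DA 7(1), of k "Suc (Suc q)" x]
  unfolding yd_def Obj_DA U_def by metis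
next
 case (8 gm i i' k q x)
 thus ?case by (intro yd_nat) (simp_all add: U_def)
next
 case (9 gm i i' gm' i'' x q)
 thus ?case by (intro Bf_comp[OF Yo_diag]) (simp_all add: U_def)
qed

subsection \<open>The comparison maps and the homotopy\<close>

text \<open>On each level a generator \<open>(al, y)\<close> is replaced by the transported element
  \<open>bact\<close>, so the arrows of the Kan extensions are used up.\<close>

primrec tau :: "nat => 'i => 'u => 'u" where
 "tau 0 i = (%x. x)"
| "tau (Suc n) i = Tm (L (Yo n) i) (fst (Xo n i)) (%c. tau n i (bact (Yo n) c))"

text \<open>Each element becomes a generator with identity arrow. A transition map along
  \<open>gm\<close> turns this arrow into \<open>gm\<close>, so \<open>theta\<close> is not natural
  in \<open>i\<close>.\<close>

primrec theta :: "nat => 'i => 'u => 'u" where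
 "theta 0 i = (%x. x)"
| "theta (Suc n) i = Tm (fst (Xo n i)) (L (Yo n) i) (%x. code (Idn I i) (theta n i x))"

text \<open>Layers count from the outside. The outer \<open>k\<close> layers are normalised as in
  \<open>theta\<close> after \<open>tau\<close>: the arrow of a generator is used up by
  \<open>bact\<close> and replaced by an identity. In the next layer each generator \<open>c\<close>
  is doubled to the identity generator of \<open>eta c\<close>. The last clause is a default, as
  only \<open>k <= n\<close> is meant.\<close>

fun hh :: "nat => nat => 'i => 'u => 'u" where
 "hh n 0 i = Tm (L (Yo n) i) (L (Yo (Suc n)) i) (%c. code (Idn I i) (eta (L (Yo n) i) c))"
| "hh (Suc n) (Suc k) i = Tm (L (Yo (Suc n)) i) (L (Yo (Suc (Suc n))) i)
  (%c. code (Idn I i) (hh n k i (bact (Yo (Suc n)) c)))"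
| "hh 0 (Suc k) i = (%x. x)"

lemma tau_hom: "i : Obj I ==> ahom (fob (Yo n) i) (Xo n i) (tau n i)"
proof (induction n)
 case 0
 thus ?case using ahom_id[OF diag_ob[OF A_diag]] by (simp add: Yo_0 Xo_0)
next
 case (Suc n)
 hence "(%c. tau n i (bact (Yo n) c)) : L (Yo n) i \<rightarrow> fst (Xo n i)"
  using bactY[of n i] ahom_in[OF Suc.IH] by (auto simp: U_def)
 thus ?case
  using Tm_ahom[OF _ sL sX[OF Suc.prems]] by (simp add: fob_Yo_Suc[OF Suc.prems] Xo_Suc)
qed

lemma tau_in: "i : Obj I ==> y : U (Yo n) i ==> tau n i y : fst (Xo n i)"
 unfolding U_def by (rule ahom_in[OF tau_hom])

lemma tau_Pi: "i : Obj I ==> tau n i : U (Yo n) i \<rightarrow> fst (Xo n i)"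
 using tau_in by auto

lemma tau_bact_Pi: "i : Obj I ==> (%c. tau n i (bact (Yo n) c)) : L (Yo n) i \<rightarrow> fst (Xo n i)"
 using bactY[of n i] tau_in by auto

lemma theta_hom: "i : Obj I ==> ahom (Xo n i) (fob (Yo n) i) (theta n i)"
proof (induction n)
 case 0
 thus ?case using ahom_id[OF diag_ob[OF A_diag]] by (simp add: Yo_0 Xo_0)
next
 case (Suc n)
 hence "(%x. code (Idn I i) (theta n i x)) : fst (Xo n i) \<rightarrow> L (Yo n) i"
  using ins_in[OF Suc.prems] ahom_in[OF Suc.IH] by (auto simp: U_def)
 thus ?case
  using Tm_ahom[OF _ sX[OF Suc.prems] sL] by (simp add: fob_Yo_Suc[OF Suc.prems] Xo_Suc)
qed

lemma theta_in: "i : Obj I ==> x : fst (Xo n i) ==> theta n i x : U (Yo n) i"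
 unfolding U_def by (rule ahom_in[OF theta_hom])

lemma theta_Pi: "i : Obj I ==> (%x. code (Idn I i) (theta n i x)) : fst (Xo n i) \<rightarrow> L (Yo n) i"
 using ins_in theta_in by auto

text \<open>On each layer \<open>bact\<close> undoes the insertion at the identity arrow.\<close>

lemma tau_theta: "i : Obj I ==> x : fst (Xo n i) ==> tau n i (theta n i x) = x"
proof (induction n arbitrary: x)
 case (Suc n)
 note i = Suc.prems(1)
 have x: "x : TO (fst (Xo n i))" using Suc.prems by (simp add: fst_Xo_Suc)
 have "tau (Suc n) i (theta (Suc n) i x) = Tm (fst (Xo n i)) (fst (Xo n i)) (%x. x) x"
  unfolding tau.simps theta.simps
  by (rule Tm_comp_cong[OF theta_Pi[OF i] tau_bact_Pi[OF i] sX[OF i] sL sX[OF i] x])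
   (simp add: bact_ins[OF Yo_diag i theta_in[OF i]] Suc.IH[OF i])
 thus ?case using Tm_id[OF sX[OF i] x] by simp
qed simp

text \<open>The arrow that \<open>lact gm\<close> adds to a generator is turned by
  \<open>bact\<close> into the transition map along \<open>gm\<close>.\<close>

lemma tau_nat: "gm : Hom I i i' ==> y : U (Yo n) i ==> tau n i' (Bf (Yo n) gm y) = xact n gm (tau n i y)"
proof (induction n arbitrary: y)
 case 0
 thus ?case by (simp add: Yo_0 xact_def cpow_ar_def Bf_def)
next
 case (Suc n)
 note g = Suc.prems(1)
 note o = I.Hom_Obj[OF g]
 have y: "y : TO (L (Yo n) i)" using Suc.prems o by (simp add: U_Yo_Suc)
 have xP: "xact n gm : fst (Xo n i) \<rightarrow> fst (Xo n i')" using xact_in[OF g] by auto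
 have tin: "Tm (L (Yo n) i) (fst (Xo n i)) (%c. tau n i (bact (Yo n) c)) y : TO (fst (Xo n i))"
  by (rule Tm_in[OF tau_bact_Pi[OF o(1)] sL sX[OF o(1)] y])
 have eq: "tau n i' (bact (Yo n) (lact gm c)) = xact n gm (tau n i (bact (Yo n) c))" if c: "c : L (Yo n) i" for c
  using Suc.IH[OF g, of "bact (Yo n) c"] bactY[of n i] c by (auto simp: bact_lact[OF Yo_diag g c])
 have "tau (Suc n) i' (Bf (Yo (Suc n)) gm y) =
   Tm (L (Yo n) i') (fst (Xo n i')) (%c. tau n i' (bact (Yo n) c)) (Tm (L (Yo n) i) (L (Yo n) i') (lact gm) y)"
  by (simp add: Yo_Suc Bf_Gob[OF g y])
 also have "... = Tm (L (Yo n) i) (fst (Xo n i')) (%c. xact n gm (tau n i (bact (Yo n) c))) y"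
  by (rule Tm_comp_cong[OF lact_Pi[OF g] tau_bact_Pi[OF o(2)] sL sL sX[OF o(2)] y eq])
 also have "... = xact (Suc n) gm (tau (Suc n) i y)"
  unfolding tau.simps xact_Suc[OF g tin]
  by (rule Tm_comp[OF tau_bact_Pi[OF o(1)] xP sL sX[OF o(1)] sX[OF o(2)] y, symmetric])
 finally show ?case .
qed

text \<open>Face \<open>0\<close> involves a structure map and is respected because
  \<open>tau\<close> is a homomorphism. A face of positive index is a free map induced by a lower
  face, so induction and functoriality of \<open>T\<close> apply. The argument for
  \<open>theta_face\<close> is the same.\<close>

lemma tau_face: "i : Obj I ==> k <= n ==> y : U (Yo (Suc n)) i ==> tau n i (yd n k i y) = xd n k i (tau (Suc n) i y)"
proof (induction n arbitrary: k y)
 case n: 0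
 thus ?case
 proof -
  note i = n(1)
  have y: "y : TO (L (Yo 0) i)" using n by (simp add: U_Yo_Suc)
  have tin: "tau (Suc 0) i y : TO (fst (Xo 0 i))" using tau_in[OF i n(3)] by (simp add: fst_Xo_Suc del: tau.simps)
  have "k = 0" using n by simp
  thus ?thesis using xd_0[OF i tin] yd_0[OF i y] by (simp add: Xo_0 Yo_0 U_def)
 qed
next
 case (Suc n)
 note i = Suc.prems(1)
 have y: "y : TO (L (Yo (Suc n)) i)" using Suc.prems by (simp add: U_Yo_Suc)
 have tin: "tau (Suc (Suc n)) i y : TO (fst (Xo (Suc n) i))" using tau_in[OF i Suc.prems(3)] by (simp only: fst_Xo_Suc)
 show ?case
 proof (cases k)
  case 0
  have bin: "Tm (L (Yo (Suc n)) i) (U (Yo (Suc n)) i) (bact (Yo (Suc n))) y : TO (fst (fob (Yo (Suc n)) i))"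
   using Tm_in[OF bactY sL sU[OF i] y] by (simp add: U_def)
  have "tau (Suc n) i (yd (Suc n) k i y) = st (Xo (Suc n) i) (Tm (U (Yo (Suc n)) i) (fst (Xo (Suc n) i)) (tau (Suc n) i)
    (Tm (L (Yo (Suc n)) i) (U (Yo (Suc n)) i) (bact (Yo (Suc n))) y))"
   unfolding 0 yd_0[OF i y] using ahom_st[OF tau_hom[OF i] bin] by (simp only: U_def)
  also have "Tm (U (Yo (Suc n)) i) (fst (Xo (Suc n) i)) (tau (Suc n) i) (Tm (L (Yo (Suc n)) i) (U (Yo (Suc n)) i) (bact (Yo (Suc n))) y)
   = tau (Suc (Suc n)) i y"
   unfolding tau.simps(2)[of "Suc n"]
   by (rule Tm_comp[OF bactY tau_Pi[OF i] sL sU[OF i] sX[OF i] y])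
  finally show ?thesis using xd_0[OF i tin] 0 by simp
 next
  case (Suc k')
  have k': "k' <= n" using Suc Suc.prems by simp
  note t = cface_DA[OF k']
  have xP: "xd n k' i : fst (Xo (Suc n) i) \<rightarrow> fst (Xo n i)" using ahom_Pi[OF xd_hom[OF i k']] .
  have eq: "tau n i (bact (Yo n) (lmap (cface GI A n k') c)) = xd n k' i (tau (Suc n) i (bact (Yo (Suc n)) c))"
   if c: "c : L (Yo (Suc n)) i" for c
   using Suc.IH[OF i k', of "bact (Yo (Suc n)) c"] bactY[of "Suc n" i] c by (auto simp: bact_lmap[OF t c] yd_def)
  have "tau (Suc n) i (yd (Suc n) k i y) = Tm (L (Yo (Suc n)) i) (fst (Xo n i)) (%c. xd n k' i (tau (Suc n) i (bact (Yo (Suc n)) c))) y"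
   unfolding Suc yd_Suc[OF i k' y]
   by (subst tau.simps(2), rule Tm_comp_cong[OF lmap_Pi[OF t] tau_bact_Pi[OF i] sL sL sX[OF i] y eq])
  also have "... = xd (Suc n) k i (tau (Suc (Suc n)) i y)"
   unfolding Suc xd_Suc[OF i k' tin] unfolding tau.simps(2)[of "Suc n"]
   by (rule Tm_comp[OF tau_bact_Pi[OF i] xP sL sX[OF i] sX[OF i] y, symmetric])
  finally show ?thesis .
 qed
qed

lemma yaug_Suc: "i : Obj I ==> k <= n ==> y : U (Yo (Suc n)) i ==> yaug (Suc n) i y = yaug n i (yd n k i y)"
 using GY.caug_cface[of A k n] A_diag tf_comp[OF cface_DA] unfolding yaug_def yd_def Obj_DA by metis

lemma xaug_Suc: "i : Obj I ==> k <= n ==> x : fst (Xo (Suc n) i) ==> xaug (Suc n) i x = xaug n i (xd n k i x)"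
 using GX.caug_cface[of "fob A i" k n] diag_ob[OF A_diag] afn_comp[OF cface_Alg] unfolding xaug_def xd_def Obj_Alg by metis

lemma yaug_0: "i : Obj I ==> y : U A i ==> yaug 0 i y = y"
 by (simp add: yaug_def tf_def DiagAlg_def U_def afn_Idn[unfolded Alg_def] Alg_def afn_def)

lemma xaug_0: "x : U A i ==> xaug 0 i x = x"
 by (simp add: xaug_def U_def afn_Idn)

lemma tau_aug: "i : Obj I ==> y : U (Yo n) i ==> xaug n i (tau n i y) = yaug n i y"
proof (induction n arbitrary: y)
 case 0
 thus ?case by (simp add: xaug_0 yaug_0 Yo_0)
next
 case (Suc n)
 note i = Suc.prems(1)
 show ?case
  using xaug_Suc[OF i, of 0 n "tau (Suc n) i y"] tau_in[OF Suc.prems] tau_face[OF i, of 0 n y] Suc.prems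
   yaug_Suc[OF i, of 0 n y] Suc.IH[OF i yd_in[OF i, of 0 n y]] by simp
qed

lemma theta_face: "i : Obj I ==> k <= n ==> x : fst (Xo (Suc n) i) ==> theta n i (xd n k i x) = yd n k i (theta (Suc n) i x)"
proof (induction n arbitrary: k x)
 case n: 0
 note i = n(1)
 have x: "x : TO (fst (Xo 0 i))" using n by (simp add: fst_Xo_Suc)
 have tin: "theta (Suc 0) i x : TO (L (Yo 0) i)" using theta_in[OF i n(3)] by (simp only: U_Yo_Suc[OF i])
 have "Tm (L (Yo 0) i) (U (Yo 0) i) (bact (Yo 0)) (theta (Suc 0) i x) = Tm (fst (Xo 0 i)) (U (Yo 0) i) (%x. x) x"
  unfolding theta.simps(2)
  by (rule Tm_comp_cong[OF theta_Pi[OF i] bactY sX[OF i] sL sU[OF i] x])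
   (use bact_ins[OF A_diag i] in \<open>simp add: Yo_0 Xo_0 U_def\<close>)
 also have "... = x" using Tm_id[OF sX[OF i] x] by (simp add: Yo_0 Xo_0 U_def)
 finally show ?case using n xd_0[OF i x] yd_0[OF i tin] by (simp add: Xo_0 Yo_0)
next
 case (Suc n)
 note i = Suc.prems(1)
 have x: "x : TO (fst (Xo (Suc n) i))" using Suc.prems by (simp only: fst_Xo_Suc)
 have tin: "theta (Suc (Suc n)) i x : TO (L (Yo (Suc n)) i)" using theta_in[OF i Suc.prems(3)] by (simp only: U_Yo_Suc[OF i])
 have thP: "theta (Suc n) i : fst (Xo (Suc n) i) \<rightarrow> U (Yo (Suc n)) i"
  using ahom_Pi[OF theta_hom[OF i]] by (simp only: U_def)
 show ?case
 proof (cases k)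
  case 0
  have "theta (Suc n) i (xd (Suc n) k i x) = st (fob (Yo (Suc n)) i) (Tm (fst (Xo (Suc n) i)) (U (Yo (Suc n)) i) (theta (Suc n) i) x)"
   unfolding 0 xd_0[OF i x] using ahom_st[OF theta_hom[OF i] x] by (simp only: U_def)
  also have "Tm (fst (Xo (Suc n) i)) (U (Yo (Suc n)) i) (theta (Suc n) i) x =
    Tm (L (Yo (Suc n)) i) (U (Yo (Suc n)) i) (bact (Yo (Suc n))) (theta (Suc (Suc n)) i x)"
   unfolding theta.simps(2)[of "Suc n"]
   by (rule Tm_comp_cong[OF theta_Pi[OF i] bactY sX[OF i] sL sU[OF i] x, symmetric])
    (simp only: bact_ins[OF Yo_diag i theta_in[OF i]])
  finally show ?thesis using yd_0[OF i tin] 0 by simp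
 next
  case (Suc k')
  have k': "k' <= n" using Suc Suc.prems by simp
  note t = cface_DA[OF k']
  have "theta (Suc n) i (xd (Suc n) k i x) = Tm (fst (Xo (Suc n) i)) (L (Yo n) i) (%x. code (Idn I i) (theta n i (xd n k' i x))) x"
   unfolding Suc xd_Suc[OF i k' x] theta.simps(2)[of n]
   by (rule Tm_comp[OF ahom_Pi[OF xd_hom[OF i k']] theta_Pi[OF i] sX[OF i] sX[OF i] sL x])
  also have "... = Tm (L (Yo (Suc n)) i) (L (Yo n) i) (lmap (cface GI A n k')) (theta (Suc (Suc n)) i x)"
   unfolding theta.simps(2)[of "Suc n"]
   by (rule Tm_comp_cong[OF theta_Pi[OF i] lmap_Pi[OF t] sX[OF i] sL sL x, symmetric])
    (simp only: lmap_ins[OF i] Suc.IH[OF i k'] yd_def)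
  also have "... = yd (Suc n) k i (theta (Suc (Suc n)) i x)"
   unfolding Suc by (rule yd_Suc[OF i k' tin, symmetric])
  finally show ?thesis .
 qed
qed

lemma theta_aug: "i : Obj I ==> x : fst (Xo n i) ==> yaug n i (theta n i x) = xaug n i x"
 using tau_aug[OF _ theta_in] tau_theta by metis

lemma hh_Pi_0: "i : Obj I ==> (%c. code (Idn I i) (eta (L (Yo n) i) c)) : L (Yo n) i \<rightarrow> L (Yo (Suc n)) i"
 using ins_in[of i _ "Yo (Suc n)"] eta_in[OF sL] by (auto simp: U_Yo_Suc)

lemma hh_hom: "i : Obj I ==> k <= n ==> ahom (fob (Yo (Suc n)) i) (fob (Yo (Suc (Suc n))) i) (hh n k i)"
proof (induction n k i rule: hh.induct)
 case (1 n i)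
 thus ?case using Tm_ahom[OF hh_Pi_0 sL sL] by (simp add: fob_Yo_Suc)
next
 case (2 n k i)
 have "(%c. code (Idn I i) (hh n k i (bact (Yo (Suc n)) c))) : L (Yo (Suc n)) i \<rightarrow> L (Yo (Suc (Suc n))) i"
  using ins_in[OF 2(2)] ahom_in[OF 2(1)[OF 2(2)]] 2(3) bactY[of "Suc n" i] by (auto simp: U_def)
 thus ?case using Tm_ahom[OF _ sL sL] by (simp add: fob_Yo_Suc[OF 2(2)])
qed simp

lemma hh_in: "i : Obj I ==> k <= n ==> y : U (Yo (Suc n)) i ==> hh n k i y : U (Yo (Suc (Suc n))) i"
 unfolding U_def by (rule ahom_in[OF hh_hom])

lemma hh_Pi: "i : Obj I ==> k <= n ==>
  (%c. code (Idn I i) (hh n k i (bact (Yo (Suc n)) c))) : L (Yo (Suc n)) i \<rightarrow> L (Yo (Suc (Suc n))) i"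
proof
 fix c assume i: "i : Obj I" and k: "k <= n" and "c : L (Yo (Suc n)) i"
 hence "bact (Yo (Suc n)) c : U (Yo (Suc n)) i" using bactY[of "Suc n" i] by auto
 thus "code (Idn I i) (hh n k i (bact (Yo (Suc n)) c)) : L (Yo (Suc (Suc n))) i"
  by (rule ins_in[OF i hh_in[OF i k]])
qed

section \<open>Faces of the homotopy operators\<close>

lemma hh_face_id:
 assumes i: "i : Obj I" and y: "y : U (Yo (Suc n)) i"
 shows "yd (Suc n) 0 i (hh n 0 i y) = y"
proof -
 have y': "y : TO (L (Yo n) i)" using y by (simp add: U_Yo_Suc[OF i])
 have e: "eta (L (Yo n) i) : L (Yo n) i \<rightarrow> TO (L (Yo n) i)" using eta_in[OF sL] by auto
 have hin: "hh n 0 i y : TO (L (Yo (Suc n)) i)" using hh_in[OF i _ y, of 0] by (simp only: U_Yo_Suc[OF i])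
 have "Tm (L (Yo (Suc n)) i) (U (Yo (Suc n)) i) (bact (Yo (Suc n))) (hh n 0 i y) = Tm (L (Yo n) i) (U (Yo (Suc n)) i) (eta (L (Yo n) i)) y"
  unfolding hh.simps
  by (rule Tm_comp_cong[OF hh_Pi_0[OF i] bactY sL sL sU[OF i] y'])
   (rule bact_ins[OF Yo_diag i], simp add: U_Yo_Suc[OF i] eta_in[OF sL])
 \<comment> \<open>Removing the new outer layer leaves \<open>mu\<close> after \<open>T eta\<close>,
   which the unit law of the monad cancels.\<close>
 thus ?thesis
  unfolding yd_0[OF i hin] using monad_laws(2)[OF sL y'] by (simp add: U_Yo_Suc[OF i] fob_Yo_Suc[OF i] free_st)
qed

lemma hh_face_Suc:
 assumes i: "i : Obj I" and k: "k <= n" and l: "l <= Suc n" and y: "y : U (Yo (Suc (Suc n))) i"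
 shows "yd (Suc (Suc n)) (Suc l) i (hh (Suc n) (Suc k) i y) = Tm (L (Yo (Suc n)) i) (L (Yo (Suc n)) i)
   (%c. code (Idn I i) (yd (Suc n) l i (hh n k i (bact (Yo (Suc n)) c)))) y"
proof -
 have y': "y : TO (L (Yo (Suc n)) i)" using y by (simp only: U_Yo_Suc[OF i])
 have "Suc k <= Suc n" using k by simp
 from hh_in[OF i this y] have hin: "hh (Suc n) (Suc k) i y : TO (L (Yo (Suc (Suc n))) i)"
  by (simp only: U_Yo_Suc[OF i])
 show ?thesis
  unfolding yd_Suc[OF i l hin] unfolding hh.simps
  by (rule Tm_comp_cong[OF hh_Pi[OF i k] lmap_Pi[OF cface_DA[OF l]] sL sL sL y'])
   (simp only: lmap_ins[OF i] yd_def)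
qed

lemma hh_face_0:
 assumes i: "i : Obj I" and l: "l <= n" and y: "y : U (Yo (Suc n)) i"
 shows "yd (Suc n) (Suc l) i (hh n 0 i y) = Tm (L (Yo n) i) (L (Yo n) i)
   (%c. code (Idn I i) (yd n l i (eta (L (Yo n) i) c))) y"
proof -
 have y': "y : TO (L (Yo n) i)" using y by (simp only: U_Yo_Suc[OF i])
 have hin: "hh n 0 i y : TO (L (Yo (Suc n)) i)" using hh_in[OF i _ y, of 0] by (simp only: U_Yo_Suc[OF i])
 show ?thesis
  unfolding yd_Suc[OF i l hin] unfolding hh.simps
  by (rule Tm_comp_cong[OF hh_Pi_0[OF i] lmap_Pi[OF cface_DA[OF l]] sL sL sL y'])
   (simp only: lmap_ins[OF i] yd_def)
qed

lemma yd_0_eta: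
 assumes i: "i : Obj I" and c: "c : L (Yo n) i"
 shows "yd n 0 i (eta (L (Yo n) i) c) = bact (Yo n) c"
proof -
 have "bact (Yo n) c : fst (fob (Yo n) i)" using bactY[of n i] c by (auto simp: U_def)
 thus ?thesis
  using yd_0[OF i eta_in[OF sL c]] eta_nat[OF bactY sL sU[OF i] c] algs_laws(1)[OF diag_ob[OF Yo_diag i]]
  by (simp add: U_def)
qed

lemma yd_Suc_eta:
 assumes i: "i : Obj I" and k: "k <= n" and c: "c : L (Yo (Suc n)) i"
 shows "yd (Suc n) (Suc k) i (eta (L (Yo (Suc n)) i) c) = eta (L (Yo n) i) (lmap (cface GI A n k) c)"
 using yd_Suc[OF i k eta_in[OF sL c]] eta_nat[OF lmap_Pi[OF cface_DA[OF k]] sL sL c] by simp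

lemma hh_0_yd_Suc:
 assumes i: "i : Obj I" and k: "k <= n" and y: "y : U (Yo (Suc (Suc n))) i"
 shows "hh n 0 i (yd (Suc n) (Suc k) i y) = Tm (L (Yo (Suc n)) i) (L (Yo (Suc n)) i)
   (%c. code (Idn I i) (eta (L (Yo n) i) (lmap (cface GI A n k) c))) y"
proof -
 have y': "y : TO (L (Yo (Suc n)) i)" using y by (simp only: U_Yo_Suc[OF i])
 show ?thesis
  unfolding yd_Suc[OF i k y'] hh.simps
  by (rule Tm_comp[OF lmap_Pi[OF cface_DA[OF k]] hh_Pi_0[OF i] sL sL sL y'])
qed

lemma hh_Suc_yd_Suc:
 assumes i: "i : Obj I" and k: "k <= n" and l: "l <= Suc n" and y: "y : U (Yo (Suc (Suc (Suc n)))) i"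
 shows "hh (Suc n) (Suc k) i (yd (Suc (Suc n)) (Suc l) i y) = Tm (L (Yo (Suc (Suc n))) i) (L (Yo (Suc (Suc n))) i)
   (%c. code (Idn I i) (hh n k i (yd (Suc n) l i (bact (Yo (Suc (Suc n))) c)))) y"
proof -
 have y': "y : TO (L (Yo (Suc (Suc n))) i)" using y by (simp only: U_Yo_Suc[OF i])
 show ?thesis
  unfolding yd_Suc[OF i l y'] hh.simps
  by (rule Tm_comp_cong[OF lmap_Pi[OF cface_DA[OF l]] hh_Pi[OF i k] sL sL sL y'])
   (simp only: bact_lmap[OF cface_DA[OF l]] yd_def)
qed

text \<open>Here all layers above the doubled one are normalised, and the last face sends a doubled
  generator \<open>c\<close> to the identity generator of \<open>bact c\<close> by
  \<open>yd_0_eta\<close>. What remains is \<open>theta\<close> after \<open>tau\<close>.\<close>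

lemma hh_face_last: "i : Obj I ==> y : U (Yo (Suc n)) i ==>
  yd (Suc n) (Suc n) i (hh n n i y) = theta (Suc n) i (tau (Suc n) i y)"
proof (induction n arbitrary: y)
 case 0
 note i = 0(1)
 have y': "y : TO (L (Yo 0) i)" using 0 by (simp only: U_Yo_Suc[OF i])
 have "theta (Suc 0) i (tau (Suc 0) i y) = Tm (L (Yo 0) i) (L (Yo 0) i) (%c. code (Idn I i) (theta 0 i (tau 0 i (bact (Yo 0) c)))) y"
  unfolding tau.simps(2) theta.simps(2)
  by (rule Tm_comp[OF tau_bact_Pi[OF i] theta_Pi[OF i] sL sX[OF i] sL y'])
 also have "... = yd (Suc 0) (Suc 0) i (hh 0 0 i y)"
  unfolding hh_face_0[OF i order_refl 0(2)]
  by (rule fun_cong[OF Tm_cong]) (simp add: yd_0_eta[OF i])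
 finally show ?case by simp
next
 case (Suc n)
 note i = Suc.prems(1)
 have y': "y : TO (L (Yo (Suc n)) i)" using Suc.prems by (simp only: U_Yo_Suc[OF i])
 have "theta (Suc (Suc n)) i (tau (Suc (Suc n)) i y) = Tm (L (Yo (Suc n)) i) (L (Yo (Suc n)) i)
   (%c. code (Idn I i) (theta (Suc n) i (tau (Suc n) i (bact (Yo (Suc n)) c)))) y"
  unfolding tau.simps(2)[of "Suc n"] theta.simps(2)[of "Suc n"]
  by (rule Tm_comp[OF tau_bact_Pi[OF i] theta_Pi[OF i] sL sX[OF i] sL y'])
 also have "... = yd (Suc (Suc n)) (Suc (Suc n)) i (hh (Suc n) (Suc n) i y)"
  unfolding hh_face_Suc[OF i order_refl order_refl Suc.prems(2)]
 proof (rule fun_cong[OF Tm_cong])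
  fix c assume "c : L (Yo (Suc n)) i"
  hence "bact (Yo (Suc n)) c : U (Yo (Suc n)) i" using bactY[of "Suc n" i] by auto
  thus "code (Idn I i) (theta (Suc n) i (tau (Suc n) i (bact (Yo (Suc n)) c))) =
    code (Idn I i) (yd (Suc n) (Suc n) i (hh n n i (bact (Yo (Suc n)) c)))"
   using Suc.IH[OF i] by (simp only:)
 qed
 finally show ?case by (simp only:)
qed

text \<open>Below \<open>k\<close> common layers both sides insert \<open>bact c\<close> with an
  identity arrow: on the left by \<open>hh_face_id\<close>, on the right by
  \<open>yd_0_eta\<close>.\<close>

lemma hh_face_mid: "i : Obj I ==> Suc k <= n ==> y : U (Yo (Suc n)) i ==>
  yd (Suc n) (Suc k) i (hh n (Suc k) i y) = yd (Suc n) (Suc k) i (hh n k i y)"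
proof (induction n arbitrary: k y)
 case (Suc n)
 note i = Suc.prems(1) and y = Suc.prems(3)
 have kn: "k <= n" using Suc.prems by simp
 have b: "bact (Yo (Suc n)) c : U (Yo (Suc n)) i" if "c : L (Yo (Suc n)) i" for c
  using bactY[of "Suc n" i] that by auto
 show ?case
 proof (cases k)
  case 0
  show ?thesis
   unfolding 0 hh_face_Suc[OF i le0 le0 y] hh_face_0[OF i le0 y]
   by (rule fun_cong[OF Tm_cong]) (simp only: hh_face_id[OF i b] yd_0_eta[OF i])
 next
  case (Suc k')
  have k': "Suc k' <= n" "k' <= n" "Suc k' <= Suc n" using kn Suc by auto
  show ?thesis
   unfolding Suc hh_face_Suc[OF i k'(1,3) y] hh_face_Suc[OF i k'(2,3) y]
   by (rule fun_cong[OF Tm_cong]) (simp only: Suc.IH[OF i k'(1) b])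
 qed
qed simp

text \<open>A face \<open>l < k\<close> removes one of the normalised layers, so \<open>k\<close>
  drops by one. For \<open>l = 0\<close> this rests on \<open>hh\<close> being a homomorphism, for
  larger \<open>l\<close> on induction under the outer layer.\<close>

lemma hh_face_lt: "i : Obj I ==> l < k ==> k <= Suc n ==> y : U (Yo (Suc (Suc n))) i ==>
  yd (Suc (Suc n)) l i (hh (Suc n) k i y) = hh n (k - 1) i (yd (Suc n) l i y)"
proof (induction n arbitrary: k l y)
 case (0 k l y)
 note i = 0(1) and y = 0(4)
 have kl: "k = Suc 0" "l = 0" using 0 by auto
 have y': "y : TO (L (Yo (Suc 0)) i)" using y by (simp only: U_Yo_Suc[OF i])
 have b: "bact (Yo (Suc 0)) c : U (Yo (Suc 0)) i" if "c : L (Yo (Suc 0)) i" for c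
  using bactY[of "Suc 0" i] that by auto
 have hin: "hh (Suc 0) (Suc 0) i y : TO (L (Yo (Suc (Suc 0))) i)"
  using hh_in[OF i order_refl y] by (simp only: U_Yo_Suc[OF i])
 have hP: "hh 0 0 i : U (Yo (Suc 0)) i \<rightarrow> U (Yo (Suc (Suc 0))) i" using hh_in[OF i le0] by auto
 have "Tm (L (Yo (Suc (Suc 0))) i) (U (Yo (Suc (Suc 0))) i) (bact (Yo (Suc (Suc 0)))) (hh (Suc 0) (Suc 0) i y) =
   Tm (L (Yo (Suc 0)) i) (U (Yo (Suc (Suc 0))) i) (%c. hh 0 0 i (bact (Yo (Suc 0)) c)) y"
  unfolding hh.simps(2)
  by (rule Tm_comp_cong[OF hh_Pi[OF i le0] bactY sL sL sU[OF i] y'])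
   (simp only: bact_ins[OF Yo_diag i hh_in[OF i le0 b]])
 also have "... = Tm (U (Yo (Suc 0)) i) (U (Yo (Suc (Suc 0))) i) (hh 0 0 i) (Tm (L (Yo (Suc 0)) i) (U (Yo (Suc 0)) i) (bact (Yo (Suc 0))) y)"
  by (rule Tm_comp[OF bactY hP sL sU[OF i] sU[OF i] y', symmetric])
 finally show ?case
  unfolding kl yd_0[OF i hin] yd_0[OF i y']
  using ahom_st[OF hh_hom[OF i le0], of "Tm (L (Yo (Suc 0)) i) (U (Yo (Suc 0)) i) (bact (Yo (Suc 0))) y" 0]
   Tm_in[OF bactY sL sU[OF i] y'] by (simp add: U_def)
next
 case (Suc n k l y)
 note i = Suc.prems(1) and y = Suc.prems(4)
 obtain k' where k': "k = Suc k'" "k' <= Suc n" using Suc.prems by (cases k) auto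
 have y': "y : TO (L (Yo (Suc (Suc n))) i)" using y by (simp only: U_Yo_Suc[OF i])
 have b: "bact (Yo (Suc (Suc n))) c : U (Yo (Suc (Suc n))) i" if "c : L (Yo (Suc (Suc n))) i" for c
  using bactY[of "Suc (Suc n)" i] that by auto
 show ?case
 proof (cases l)
  case 0
  have "Suc k' <= Suc (Suc n)" using k' by simp
  from hh_in[OF i this y] have hin: "hh (Suc (Suc n)) (Suc k') i y : TO (L (Yo (Suc (Suc (Suc n)))) i)"
   by (simp only: U_Yo_Suc[OF i])
  have hP: "hh (Suc n) k' i : U (Yo (Suc (Suc n))) i \<rightarrow> U (Yo (Suc (Suc (Suc n)))) i" using hh_in[OF i k'(2)] by auto
  have "Tm (L (Yo (Suc (Suc (Suc n)))) i) (U (Yo (Suc (Suc (Suc n)))) i) (bact (Yo (Suc (Suc (Suc n))))) (hh (Suc (Suc n)) (Suc k') i y) =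
    Tm (L (Yo (Suc (Suc n))) i) (U (Yo (Suc (Suc (Suc n)))) i) (%c. hh (Suc n) k' i (bact (Yo (Suc (Suc n))) c)) y"
   unfolding hh.simps(2)[of "Suc n"]
   by (rule Tm_comp_cong[OF hh_Pi[OF i k'(2)] bactY sL sL sU[OF i] y'])
    (simp only: bact_ins[OF Yo_diag i hh_in[OF i k'(2) b]])
  also have "... = Tm (U (Yo (Suc (Suc n))) i) (U (Yo (Suc (Suc (Suc n)))) i) (hh (Suc n) k' i)
    (Tm (L (Yo (Suc (Suc n))) i) (U (Yo (Suc (Suc n))) i) (bact (Yo (Suc (Suc n)))) y)"
   by (rule Tm_comp[OF bactY hP sL sU[OF i] sU[OF i] y', symmetric])
  finally show ?thesis
   unfolding 0 k'(1) yd_0[OF i hin] yd_0[OF i y']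
   using ahom_st[OF hh_hom[OF i k'(2)], of "Tm (L (Yo (Suc (Suc n))) i) (U (Yo (Suc (Suc n))) i) (bact (Yo (Suc (Suc n)))) y"]
    Tm_in[OF bactY sL sU[OF i] y'] by (simp add: U_def)
 next
  case (Suc l')
  obtain k'' where k'': "k' = Suc k''" "l' < k'" "k'' <= n" using Suc.prems Suc k' by (cases k') auto
  have l': "l' <= Suc n" "l' <= Suc (Suc n)" using k'' k' by auto
  have IH: "yd (Suc (Suc n)) l' i (hh (Suc n) k' i z) = hh n k'' i (yd (Suc n) l' i z)" if "z : U (Yo (Suc (Suc n))) i" for z
   using Suc.IH[OF i k''(2) k'(2) that] k'' by simp
  have "yd (Suc (Suc (Suc n))) (Suc l') i (hh (Suc (Suc n)) (Suc k') i y) = hh (Suc n) (Suc k'') i (yd (Suc (Suc n)) (Suc l') i y)"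
   unfolding hh_face_Suc[OF i k'(2) l'(2) y] hh_Suc_yd_Suc[OF i k''(3) l'(1) y]
   by (rule fun_cong[OF Tm_cong]) (simp only: IH[OF b])
  thus ?thesis using k' k'' Suc by simp
 qed
qed

text \<open>A face below the doubled layer passes through it, its index having been shifted by the
  doubling. At \<open>k = 0\<close> this is naturality of \<open>eta\<close>, in the form
  \<open>yd_Suc_eta\<close>.\<close>

lemma hh_face_gt: "i : Obj I ==> Suc k < l ==> l <= Suc (Suc n) ==> y : U (Yo (Suc (Suc n))) i ==>
  yd (Suc (Suc n)) l i (hh (Suc n) k i y) = hh n k i (yd (Suc n) (l - 1) i y)"
proof (induction n arbitrary: k l y)
 case (0 k l y)
 note i = 0(1) and y = 0(4)
 have kl: "k = 0" "l = Suc (Suc 0)" using 0 by auto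
 have "yd (Suc (Suc 0)) (Suc (Suc 0)) i (hh (Suc 0) 0 i y) = hh 0 0 i (yd (Suc 0) (Suc 0) i y)"
  unfolding hh_face_0[OF i order_refl y] hh_0_yd_Suc[OF i le0 y]
  by (rule fun_cong[OF Tm_cong]) (simp only: yd_Suc_eta[OF i le0])
 thus ?case using kl by simp
next
 case (Suc n k l y)
 note i = Suc.prems(1) and y = Suc.prems(4)
 obtain l' where l': "l = Suc (Suc l')" "l' <= Suc n" "Suc l' <= Suc (Suc n)"
  using Suc.prems by (cases l; cases "l - 1") auto
 have b: "bact (Yo (Suc (Suc n))) c : U (Yo (Suc (Suc n))) i" if "c : L (Yo (Suc (Suc n))) i" for c
  using bactY[of "Suc (Suc n)" i] that by auto
 show ?case
 proof (cases k)
  case 0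
  have "yd (Suc (Suc (Suc n))) (Suc (Suc l')) i (hh (Suc (Suc n)) 0 i y) = hh (Suc n) 0 i (yd (Suc (Suc n)) (Suc l') i y)"
   unfolding hh_face_0[OF i l'(3) y] hh_0_yd_Suc[OF i l'(2) y]
   by (rule fun_cong[OF Tm_cong]) (simp only: yd_Suc_eta[OF i l'(2)])
  thus ?thesis using 0 l' by simp
 next
  case (Suc k')
  have k': "Suc k' < Suc l'" "k' <= n" "k' <= Suc n" using Suc Suc.prems l' by auto
  have IH: "yd (Suc (Suc n)) (Suc l') i (hh (Suc n) k' i z) = hh n k' i (yd (Suc n) l' i z)" if "z : U (Yo (Suc (Suc n))) i" for z
   using Suc.IH[OF i k'(1) l'(3) that] by simp
  have "yd (Suc (Suc (Suc n))) (Suc (Suc l')) i (hh (Suc (Suc n)) (Suc k') i y) = hh (Suc n) (Suc k') i (yd (Suc (Suc n)) (Suc l') i y)"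
   unfolding hh_face_Suc[OF i k'(3) l'(3) y] hh_Suc_yd_Suc[OF i k'(2) l'(2) y]
   by (rule fun_cong[OF Tm_cong]) (simp only: IH[OF b])
  thus ?thesis using Suc l' by simp
 qed
qed

lemma hh_aug: "i : Obj I ==> k <= n ==> y : U (Yo (Suc n)) i ==> yaug (Suc (Suc n)) i (hh n k i y) = yaug (Suc n) i y"
proof (induction n arbitrary: k y)
 case 0
 thus ?case using yaug_Suc[OF 0(1) _ hh_in[OF 0(1) le0 0(3)], of 0] hh_face_id[OF 0(1) 0(3)] by simp
next
 case (Suc n)
 note i = Suc.prems(1) and y = Suc.prems(3)
 note h = yaug_Suc[OF i le0 hh_in[OF i Suc.prems(2) y]]
 show ?case
 proof (cases k)
  case 0
  thus ?thesis using h hh_face_id[OF i y] by simp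
 next
  case (Suc k')
  have k: "0 < k" "k' <= n" using Suc Suc.prems by auto
  have yin: "yd (Suc n) 0 i y : U (Yo (Suc n)) i" by (rule yd_in[OF i le0 y])
  show ?thesis
   using h hh_face_lt[OF i k(1) Suc.prems(2) y] Suc.IH[OF i k(2) yin] yaug_Suc[OF i le0 y] Suc by simp
 qed
qed

end

subsection \<open>Baues--Wirsching cochains with values in cohomology classes\<close>

lemma alt_sum_presents:
 assumes P: "presents S N f H" and y: "!!k. k : K ==> y k : S" and K: "finite K"
  and g: "!!k. k : K ==> g k = f (y k)"
 shows "alt_sum H K g = f (\<Sum>k\<in>K. alt k (y k))"
proof -
 interpret H: comm_group H by (rule presentsD(3)[OF P])
 have pow: "f x [^]\<^bsub>H\<^esub> ((-1) ^ k :: int) = f (alt k x)" if "x : S" for x k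
  using presentsD(5)[OF P that] presents_minus[OF P that]
  by (cases "even k") (simp_all add: alt_def H.int_pow_neg H.int_pow_1)
 have "finprod H (%k. g k [^]\<^bsub>H\<^esub> ((-1) ^ k :: int)) K = finprod H (%k. f (alt k (y k))) K"
  using g y pow presentsD(5)[OF P] subgp_alt[OF presentsD(1)[OF P]] by (intro H.finprod_cong') auto
 also have "... = f (\<Sum>k\<in>K. alt k (y k))"
  using K y
 proof (induction K)
  case empty
  thus ?case using presents_zero[OF P] by simp
 next
  case (insert k K)
  have s: "alt l (y l) : S" if "l : insert k K" for l using subgp_alt[OF presentsD(1)[OF P] insert(4)[OF that]] .
  have "(\<Sum>k\<in>K. alt k (y k)) : S" using s by (intro subgp_sum[OF presentsD(1)[OF P]]) auto
  moreover have "finprod H (%k. f (alt k (y k))) (insert k K) = f (alt k (y k)) \<otimes>\<^bsub>H\<^esub> finprod H (%k. f (alt k (y k))) K"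
   using insert(1,2) s presentsD(5)[OF P] by (intro H.finprod_insert) auto
  ultimately show ?case using insert presentsD(6)[OF P s] by simp
 qed
 finally show ?thesis by (simp add: alt_sum_def)
qed

lemma sum_apply: "(\<Sum>i\<in>S. f i) c = (\<Sum>i\<in>S. f i c)"
 for f :: "'a => 'b => 'c::ab_group_add"
 by (induction S rule: infinite_finite_induct) auto

lemma alt_apply: "alt n f c = alt n (f c)"
 for f :: "'b => 'c::ab_group_add"
 by (simp add: alt_def)

lemma comm_group_product_group:
 assumes "!!c. c : S ==> comm_group (G c)"
 shows "comm_group (product_group S G)"
proof -
 have g: "group (G c)" if "c : S" for c using assms[OF that] by (simp add: comm_group_def)
 interpret P: group "product_group S G" using g by (rule product_group)
 show ?thesis
  by (rule P.group_comm_groupI)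
   (auto simp: PiE_iff intro!: restrict_ext comm_monoid.m_comm[OF comm_group.axioms(1)[OF assms]])
qed

context resolution
begin

definition Zc where
 "Zc q al = {ph : Cc q al. dC q (Dom I al) ph = 0}"

definition Bc where
 "Bc q al = (case q of 0 => {0} | Suc r => dC r (Dom I al) ` Cc r al)"

lemma Lc_Zc:
 assumes al: "al : Hom I i j" and bt: "bt : Hom I j k" and ph: "ph : Zc q al"
 shows "Lc q bt al ph : Zc q (bt \<bullet> al)"
proof -
 note d = I.HomD[OF al] I.HomD[OF I.comp_Hom[OF bt al]]
 show ?thesis
  using Lc_Cc[OF al bt, of ph q] Lc_dC[OF al bt, of q ph] ph addmap.zero[OF Lc_add[OF al bt]] by (simp add: Zc_def d)
qed

lemma Rc_Zc:
 assumes al: "al : Hom I i j" and gm: "gm : Hom I i' i" and ph: "ph : Zc q al"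
 shows "Rc q gm ph : Zc q (al \<bullet> gm)"
proof -
 note d = I.HomD[OF al] I.HomD[OF I.comp_Hom[OF al gm]]
 show ?thesis
  using Rc_Cc[OF al gm, of ph q] Rc_dC[OF gm, of q ph] ph addmap.zero[OF Rc_add] by (simp add: Zc_def d)
qed

lemma Bc_Zc: "al : Hom I i j ==> Bc q al \<subseteq> Zc q al"
proof (cases q)
 case 0
 assume "al : Hom I i j"
 thus ?thesis using 0 subgp_zero[OF Cc_subgp] addmap.zero[OF dC_add] by (auto simp: Bc_def Zc_def)
next
 case (Suc r)
 assume a: "al : Hom I i j"
 hence "Dom I al = i" by (simp add: Hom_iff)
 thus ?thesis using Suc dC_Cc[OF a] dC_dC[OF I.Hom_Obj(1)[OF a]] by (auto simp: Bc_def Zc_def)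
qed

lemma src_Dom: "(i, as) : chains I p ==> Dom I (cc i as) = src i as"
 using chains_Hom by (simp add: Hom_iff)

text \<open>The vertical cohomology of a column is the product over its chains, because cocycles and
  coboundaries are decided chain by chain; representatives are chosen separately on each chain and
  set to \<open>0\<close> elsewhere.\<close>

lemma bw_presents:
 assumes P: "!!al. al : Arr I ==> presents (Zc q al) (Bc q al) (cl al) (fob D al)"
 shows "presents {f : chainD p q. dv p q f = 0} (case q of 0 => {0} | Suc r => dv p r ` chainD p r)
  (%f. \<lambda>(i, as)\<in>chains I p. cl (cc i as) (f (i, as))) (bw_complex I D p)"
  (is "presents ?Z ?B ?Tt _")
proof -
 have Pc: "presents (Zc q (cc i as)) (Bc q (cc i as)) (cl (cc i as)) (fob D (cc i as))"
  if "(i, as) : chains I p" for i as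
  using P chains_Hom[OF that] by (simp add: Hom_iff)
 have Z: "f (i, as) : Zc q (cc i as)" if f: "f : ?Z" and c: "(i, as) : chains I p" for f i as
 proof -
  have "dC q (src i as) (f (i, as)) = dv p q f (i, as)" using c by (simp add: dv_def)
  also have "... = 0" using f by simp
  finally show ?thesis using chainD_in[OF _ c, of f q] f by (simp add: Zc_def src_Dom[OF c])
 qed
 have ZI: "f : ?Z" if "!!i as. (i, as) : chains I p ==> f (i, as) : Zc q (cc i as)"
  "!!c. c \<notin> chains I p ==> f c = 0" for f
 proof
  have "f : chainD p q" using that by (intro chainDI) (auto simp: Zc_def)
  moreover have "dv p q f = 0" using that(1) src_Dom by (auto simp: dv_def fun_eq_iff Zc_def)
  ultimately show "f : chainD p q & dv p q f = 0" by blast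
 qed
 show ?thesis
  unfolding presents_def
 proof (intro conjI ballI)
  show "subgp ?Z"
   using chainD_subgp[of p q] addmap.zero[OF dv_add, of p q] addmap.diff[OF dv_add, of p q] by (auto simp: subgp_def)
  show "?B \<subseteq> ?Z"
   using addmap.zero[OF dv_add] subgp_zero[OF chainD_subgp] dv_D dv_dv by (auto split: nat.splits)
  show "comm_group (bw_complex I D p)"
   unfolding bw_complex_def using presentsD(3)[OF Pc] by (intro comm_group_product_group) auto
  show "?Tt ` ?Z = carrier (bw_complex I D p)"
  proof
   show "?Tt ` ?Z \<subseteq> carrier (bw_complex I D p)"
    using presentsD(5)[OF Pc Z] by (auto simp: bw_complex_def PiE_iff)
   show "carrier (bw_complex I D p) \<subseteq> ?Tt ` ?Z"
   proof
    fix g assume g: "g : carrier (bw_complex I D p)"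
    define f where "f c = (if c : chains I p then SOME ph. ph : Zc q (case_prod cc c) &
      g c = cl (case_prod cc c) ph else 0)" for c
    have f: "f (i, as) : Zc q (cc i as) & g (i, as) = cl (cc i as) (f (i, as))"
     if c: "(i, as) : chains I p" for i as
    proof -
     have "g (i, as) : carrier (fob D (cc i as))" using g c by (auto simp: bw_complex_def PiE_iff)
     hence "\<exists>ph. ph : Zc q (cc i as) & g (i, as) = cl (cc i as) ph"
      using presents_surj[OF Pc[OF c]] by metis
     from someI_ex[OF this] show ?thesis using c by (simp only: f_def if_True prod.case)
    qed
    have "f : ?Z" using f by (intro ZI) (auto simp: f_def)
    moreover have "g = ?Tt f"
     using g f by (auto simp: bw_complex_def PiE_iff extensional_def fun_eq_iff)
    ultimately show "g : ?Tt ` ?Z" by blast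
   qed
  qed
  show "?Tt (f + g) = ?Tt f \<otimes>\<^bsub>bw_complex I D p\<^esub> ?Tt g" if f: "f : ?Z" and g: "g : ?Z" for f g
   using presentsD(6)[OF Pc Z[OF f] Z[OF g]] by (auto simp: bw_complex_def intro!: restrict_ext)
  show "?Tt f = \<one>\<^bsub>bw_complex I D p\<^esub> \<longleftrightarrow> f : ?B" if f: "f : ?Z" for f
  proof -
   have "?Tt f = \<one>\<^bsub>bw_complex I D p\<^esub> \<longleftrightarrow> (\<forall>(i, as)\<in>chains I p. cl (cc i as) (f (i, as)) = \<one>\<^bsub>fob D (cc i as)\<^esub>)"
    by (auto simp: bw_complex_def restrict_def fun_eq_iff)
   also have "... \<longleftrightarrow> (\<forall>(i, as)\<in>chains I p. f (i, as) : Bc q (cc i as))"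
    using presentsD(7)[OF Pc Z[OF f]] by auto
   also have "... \<longleftrightarrow> f : ?B"
   proof (cases q)
    case 0
    thus ?thesis using f chainD_out[of f p q] by (auto simp: Bc_def fun_eq_iff)
   next
    case (Suc r)
    show ?thesis
    proof
     assume "f : ?B"
     then obtain g where g: "g : chainD p r" "f = dv p r g" using Suc by auto
     show "\<forall>(i, as)\<in>chains I p. f (i, as) : Bc q (cc i as)"
      using chainD_in[OF g(1)] src_Dom Suc by (auto simp: g(2) dv_def Bc_def)
    next
     assume B: "\<forall>(i, as)\<in>chains I p. f (i, as) : Bc q (cc i as)"
     define g where "g c = (if c : chains I p then SOME ph. ph : Cc r (case_prod cc c) &
      f c = dC r (case_prod src c) ph else 0)" for c
     have g: "g (i, as) : Cc r (cc i as) & f (i, as) = dC r (src i as) (g (i, as))"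
      if c: "(i, as) : chains I p" for i as
     proof -
      have "f (i, as) : Bc q (cc i as)" using B c by blast
      hence "\<exists>ph. ph : Cc r (cc i as) & f (i, as) = dC r (src i as) ph"
       using Suc src_Dom[OF c] by (auto simp: Bc_def)
      from someI_ex[OF this] show ?thesis using c by (simp only: g_def if_True prod.case)
     qed
     have "g : chainD p r" using g by (intro chainDI) (auto simp: g_def)
     moreover have "f = dv p r g"
      using g f chainD_out[of f p q] by (auto simp: dv_def fun_eq_iff)
     ultimately show "f : ?B" using Suc by auto
    qed
   qed
   finally show ?thesis .
  qed
 qed
qed

text \<open>Each term of the Baues--Wirsching coboundary is the class of the corresponding
  \<open>dterm\<close>: by \<open>l\<close> and \<open>r\<close> for the outer terms, while the
  inner terms change the chain but not its composite.\<close>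

lemma bw_diff_presents:
 assumes P: "!!al. al : Arr I ==> presents (Zc q al) (Bc q al) (cl al) (fob D al)"
  and l: "!!al bt i j k ph. al : Hom I i j ==> bt : Hom I j k ==> ph : Zc q al ==>
   ns_left I D bt al (cl al ph) = cl (bt \<bullet> al) (Lc q bt al ph)"
  and r: "!!al gm i j k ph. al : Hom I i j ==> gm : Hom I k i ==> ph : Zc q al ==>
   ns_right I D gm al (cl al ph) = cl (al \<bullet> gm) (Rc q gm ph)"
  and f: "f : chainD p q" "dv p q f = 0"
 shows "bw_diff I D p (\<lambda>(i, as)\<in>chains I p. cl (cc i as) (f (i, as))) =
  (\<lambda>(i, as)\<in>chains I (Suc p). cl (cc i as) (dh p q f (i, as)))"
 unfolding bw_diff_def
proof (rule restrict_ext, clarify)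
 let ?Tt = "\<lambda>(i, as)\<in>chains I p. cl (cc i as) (f (i, as))"
 fix i as assume c: "(i, as) : chains I (Suc p)"
 have fZ: "f (i, as) : Zc q (cc i as)" if c: "(i, as) : chains I p" for i as
 proof -
  have "dC q (src i as) (f (i, as)) = dv p q f (i, as)" using c by (simp add: dv_def)
  also have "... = 0" using f by simp
  finally show ?thesis using chainD_in[OF f(1) c] by (simp add: Zc_def src_Dom[OF c])
 qed
 obtain a as' where a: "as = a # as'" "a : Hom I (Dom I a) i" "(Dom I a, as') : chains I p"
  "cc (Dom I a) as' : Hom I (src (Dom I a) as') (Dom I a)"
  "cc i as = a \<bullet> cc (Dom I a) as'"
  using c by (rule chains_Suc)
 obtain bs b where b: "as = bs @ [b]" "b : Hom I (src i as) (src i bs)" "(i, bs) : chains I p"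
  "cc i bs : Hom I (src i bs) i" "cc i as = cc i bs \<bullet> b"
  using c by (rule chains_snoc)
 have h: "hd as = a" "tl as = as'" "last as = b" "butlast as = bs" using a(1) by (simp, simp) (simp_all add: b(1))
 have len: "length as = Suc p" using c by (simp add: chains_iff)
 have Pc: "presents (Zc q (cc i as)) (Bc q (cc i as)) (cl (cc i as)) (fob D (cc i as))"
  using P chains_Hom[OF c] by (simp add: Hom_iff)
 have t: "dterm p q j f i as : Zc q (cc i as) & bw_term I D p ?Tt i as j = cl (cc i as) (dterm p q j f i as)"
  if j: "j : {0..Suc p}" for j
 proof -
  consider "j = 0" | "j \<noteq> 0" "j <= p" | "j = Suc p" using j by fastforce
  thus ?thesis
  proof cases
   case 1
   thus ?thesis
    using Lc_Zc[OF a(4,2) fZ[OF a(3)]] l[OF a(4,2) fZ[OF a(3)]] a(3,5) by (simp add: dterm_def bw_term_def h)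
  next
   case 2
   have j1: "j - 1 < p" using 2 by simp
   have m: "take (j - 1) as @ (as ! (j - 1) \<bullet> as ! j) # drop (j + 1) as = mrg (j - 1) as"
    using 2 len mrg_take_drop[of "j - 1" as] by simp
   have "bw_term I D p ?Tt i as j = ?Tt (i, mrg (j - 1) as)"
    unfolding bw_term_def m using 2 by simp
   thus ?thesis
    using 2 fZ[OF chains_mrg(1)[OF c j1]] chains_mrg(1,2)[OF c j1] by (simp add: dterm_def)
  next
   case 3
   thus ?thesis
    using Rc_Zc[OF b(4,2) fZ[OF b(3)]] r[OF b(4,2) fZ[OF b(3)]] b(3,5) by (simp add: dterm_def bw_term_def h)
  qed
 qed
 have "alt_sum (fob D (cc i as)) {0..Suc p} (bw_term I D p ?Tt i as) =
  cl (cc i as) (\<Sum>j\<in>{0..Suc p}. alt j (dterm p q j f i as))"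
  using t by (intro alt_sum_presents[OF Pc]) auto
 also have "(\<Sum>j\<in>{0..Suc p}. alt j (dterm p q j f i as)) = dh p q f (i, as)"
  using c by (simp add: dh_def sum_apply alt_apply delta_def atLeast0AtMost del: sum.atMost_Suc)
 finally show "alt_sum (fob D (cc i as)) {0..Suc p} (bw_term I D p ?Tt i as) = cl (cc i as) (dh p q f (i, as))" .
qed

text \<open>The class map \<open>cl\<close> stays abstract, since the cohomology groups of the
  theorem are not literally those of this resolution; they are reached through a comparison of
  cochains.\<close>

lemma bw_second_page:
 assumes P: "!!al. al : Arr I ==> presents (Zc q al) (Bc q al) (cl al) (fob D al)"
  and l: "!!al bt i j k ph. al : Hom I i j ==> bt : Hom I j k ==> ph : Zc q al ==>
   ns_left I D bt al (cl al ph) = cl (bt \<bullet> al) (Lc q bt al ph)"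
  and r: "!!al gm i j k ph. al : Hom I i j ==> gm : Hom I k i ==> ph : Zc q al ==>
   ns_right I D gm al (cl al ph) = cl (al \<bullet> gm) (Rc q gm ph)"
 shows "\<exists>f. presents (DC.Z 2 (int p) (int p + int q)) (DC.B 2 (int p) (int p + int q)) f (bw_cohomology I D p)"
proof -
 let ?Tt' = "%p f. \<lambda>(i, as)\<in>chains I p. cl (cc i as) (f (i, as))"
 \<comment> \<open>A trivial group on the type of Baues--Wirsching cochains, for the negative
   columns that \<open>second_page\<close> also ranges over.\<close>
 have "\<exists>G. presents {0 :: 'i \<times> 'k list => 'u => 'u uab} {0} (%_. undefined :: 'i \<times> 'k list => 'a) G"
  by (rule presents_any) (auto simp: subgp_trivial)
 then obtain G0 :: "('i \<times> 'k list => 'a) monoid" where G0: "presents {0 :: 'i \<times> 'k list => 'u => 'u uab} {0} (%_. undefined :: 'i \<times> 'k list => 'a) G0"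
  by blast
 define C where "C p = (if p < 0 then G0 else bw_complex I D (nat p))" for p :: int
 define Tt where "Tt p = (if p < 0 then (%_. undefined) else ?Tt' (nat p))" for p :: int
 \<comment> \<open>Out of a negative column the differential is constantly the unit; its image in
   column \<open>0\<close> is the trivial group that \<open>coboundaries\<close> has in degree
   \<open>0\<close>.\<close>
 define de where "de p = (if p < 0 then (%_. \<one>\<^bsub>C (p + 1)\<^esub>) else bw_diff I D (nat p))" for p :: int
 have alt0: "alt n x = 0 \<longleftrightarrow> x = 0" for n and x :: "'i \<times> 'k list => 'u => 'u uab" by (simp add: alt_def)
 have CP: "presents {x : DD p (int q). DV p (int q) x = 0} (DV p (int q - 1) ` DD p (int q - 1)) (Tt p) (C p)" for p
 proof (cases "p < 0")
  case True
  hence "{x : DD p (int q). DV p (int q) x = 0} = {0}" "DV p (int q - 1) ` DD p (int q - 1) = {0}"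
   by (auto simp: DD_def DV_def)
  thus ?thesis using G0 True by (simp add: Tt_def C_def)
 next
  case False
  have Z: "{x : DD p (int q). DV p (int q) x = 0} = {f : chainD (nat p) q. dv (nat p) q f = 0}"
   using False by (auto simp: DD_def DV_def alt0)
  have B: "DV p (int q - 1) ` DD p (int q - 1) = (case q of 0 => {0} | Suc r => dv (nat p) r ` chainD (nat p) r)"
  proof (cases q)
   case 0
   thus ?thesis by (auto simp: DD_def DV_def)
  next
   case (Suc r)
   \<comment> \<open>The sign in \<open>DV\<close> does not affect images, because cochains are
     closed under negation.\<close>
   have "(%f. alt (nat p) (dv (nat p) r f)) ` chainD (nat p) r = dv (nat p) r ` chainD (nat p) r"
   proof
    show "(%f. alt (nat p) (dv (nat p) r f)) ` chainD (nat p) r \<subseteq> dv (nat p) r ` chainD (nat p) r"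
    proof (rule image_subsetI)
     fix f assume "f : chainD (nat p) r"
     from subgp_alt[OF chainD_subgp this]
     show "alt (nat p) (dv (nat p) r f) : dv (nat p) r ` chainD (nat p) r"
      unfolding addmap.alt[OF dv_add, symmetric] by (rule imageI)
    qed
    show "dv (nat p) r ` chainD (nat p) r \<subseteq> (%f. alt (nat p) (dv (nat p) r f)) ` chainD (nat p) r"
    proof
     fix y assume "y : dv (nat p) r ` chainD (nat p) r"
     then obtain f where f: "f : chainD (nat p) r" "y = dv (nat p) r f" by blast
     have "alt (nat p) (dv (nat p) r (alt (nat p) f)) = y"
      unfolding addmap.alt[OF dv_add] f(2) by (simp add: alt_def)
     thus "y : (%f. alt (nat p) (dv (nat p) r f)) ` chainD (nat p) r"
      using imageI[OF subgp_alt[OF chainD_subgp f(1)]] by metis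
    qed
   qed
   thus ?thesis using False Suc by (auto simp: DD_def DV_def[abs_def])
  qed
  show ?thesis unfolding Z B using bw_presents[OF P, of "nat p"] False by (simp add: Tt_def C_def)
 qed
 have "\<exists>f. presents (DC.Z 2 (int p) (int p + int q)) (DC.B 2 (int p) (int p + int q)) f
  (C (int p)\<lparr>carrier := kernel (C (int p)) (C (int p + 1)) (de (int p))\<rparr> Mod de (int p - 1) ` carrier (C (int p - 1)))"
 proof (rule DC.second_page[OF CP])
  fix p' x assume x: "x : DD p' (int q)" "DV p' (int q) x = 0"
  show "de p' (Tt p' x) = Tt (p' + 1) (DH p' (int q) x)"
  proof (cases "p' < 0")
   case True
   hence "DH p' (int q) x = 0" by (simp add: DH_def)
   thus ?thesis using presents_zero(1)[OF CP[of "p' + 1"]] True by (simp add: de_def)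
  next
   case False
   hence "x : chainD (nat p') q" "dv (nat p') q x = 0" using x by (auto simp: DD_def DV_def alt0)
   from bw_diff_presents[OF P l r this] show ?thesis
    using False by (simp add: de_def Tt_def DH_def nat_succ)
  qed
 qed
 moreover have "de (int p - 1) ` carrier (C (int p - 1)) = coboundaries (bw_complex I D) (bw_diff I D) p"
 proof (cases p)
  case 0
  have "carrier G0 \<noteq> {}" using presentsD(4)[OF G0] by auto
  thus ?thesis using 0 by (auto simp: de_def C_def coboundaries_def)
 next
  case (Suc r)
  thus ?thesis by (simp add: de_def C_def coboundaries_def)
 qed
 moreover have "C (int p) = bw_complex I D p" "C (int p + 1) = bw_complex I D (Suc p)" "de (int p) = bw_diff I D p"
  by (simp_all add: C_def de_def nat_succ)
 ultimately show ?thesis by (simp add: bw_cohomology_def cohomology_def)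
qed

end

subsection \<open>Comparison of the two cochain complexes\<close>

context comparison
begin

definition tauC where
 "tauC q i = pre (U (Yo (Suc q)) i) (tau (Suc q) i)"

definition thC where
 "thC q i = pre (fst (Xo (Suc q) i)) (theta (Suc q) i)"

definition hC where
 "hC q k i = pre (U (Yo (Suc q)) i) (hh q k i)"

lemma fstU: "fst (fob B i) = U B i"
 by (simp add: U_def)

lemma tauC_add: "addmap (tauC q i)" and thC_add: "addmap (thC q i)" and hC_add: "addmap (hC q k i)"
 unfolding tauC_def thC_def hC_def by (rule pre_add)+

lemma tauC_Cc:
 assumes al: "al : Hom I i j" and ph: "ph : RX.Cc q al"
 shows "tauC q i ph : RY.Cc q al"
proof -
 note i = I.Hom_Obj(1)[OF al]
 note d = I.HomD[OF al]
 show ?thesis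
  unfolding tauC_def RY.Cc_def d fstU[symmetric]
  by (rule pre_derv_cong[OF RX.base_over[OF al] tau_hom[OF i] diag_ob[OF Yo_diag i] _ ph[unfolded RX.Cc_def d]])
   (simp add: RX.base_def RY.base_def d tau_aug[OF i] fstU del: tau.simps)
qed

lemma thC_Cc:
 assumes al: "al : Hom I i j" and ph: "ph : RY.Cc q al"
 shows "thC q i ph : RX.Cc q al"
proof -
 note i = I.Hom_Obj(1)[OF al]
 note d = I.HomD[OF al]
 show ?thesis
  unfolding thC_def RX.Cc_def d
  by (rule pre_derv_cong[OF RY.base_over[OF al] theta_hom[OF i] Xo_alg[OF i] _ ph[unfolded RY.Cc_def d]])
   (simp add: RX.base_def RY.base_def d theta_aug[OF i] del: theta.simps)
qed

lemma hC_Cc: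
 assumes al: "al : Hom I i j" and k: "k <= q" and ph: "ph : RY.Cc (Suc q) al"
 shows "hC q k i ph : RY.Cc q al"
proof -
 note i = I.Hom_Obj(1)[OF al]
 note d = I.HomD[OF al]
 show ?thesis
  unfolding hC_def RY.Cc_def d fstU[symmetric]
  by (rule pre_derv_cong[OF RY.base_over[OF al] hh_hom[OF i k] diag_ob[OF Yo_diag i] _ ph[unfolded RY.Cc_def d]])
   (simp add: RY.base_def d hh_aug[OF i k] fstU)
qed

lemma thC_tauC:
 assumes al: "al : Hom I i j" and ph: "ph : RX.Cc q al"
 shows "thC q i (tauC q i ph) = ph"
proof -
 note i = I.Hom_Obj(1)[OF al]
 note d = I.HomD[OF al]
 have "thC q i (tauC q i ph) = pre (fst (Xo (Suc q) i)) (%x. tau (Suc q) i (theta (Suc q) i x)) ph"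
  unfolding thC_def tauC_def by (rule pre_pre) (rule theta_in[OF i])
 also have "... = pre (fst (Xo (Suc q) i)) (%x. x) ph"
  by (rule pre_cong) (rule tau_theta[OF i])
 also have "... = ph" using ph unfolding RX.Cc_def d by (rule pre_id)
 finally show ?thesis .
qed

lemma tauC_dC: "i : Obj I ==> tauC (Suc q) i (RX.dC q i ph) = RY.dC q i (tauC q i ph)"
 unfolding tauC_def RX.dC_def RY.dC_def RX.cof_def RY.cof_def fstU
 by (rule pre_alternating) (rule tau_in yd_in tau_face[symmetric]; assumption)+

lemma thC_dC: "i : Obj I ==> thC (Suc q) i (RY.dC q i ph) = RX.dC q i (thC q i ph)"
 unfolding thC_def RX.dC_def RY.dC_def RX.cof_def RY.cof_def fstU
 by (rule pre_alternating) (rule theta_in ahom_in[OF xd_hom] theta_face[symmetric]; assumption)+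

lemma thC_Lc:
 assumes al: "al : Hom I i j"
 shows "RX.Lc q bt al (thC q i ph) = thC q i (RY.Lc q bt al ph)"
proof -
 note i = I.Hom_Obj(1)[OF al]
 note d = I.HomD[OF al]
 have "RX.Lc q bt al (thC q i ph) = lft bt (%x. RY.base q al (theta (Suc q) i x)) (fst (Xo (Suc q) i)) (thC q i ph)"
  unfolding RX.Lc_def d by (rule lft_cong) (simp add: RX.base_def RY.base_def d theta_aug[OF i] del: theta.simps)
 also have "... = thC q i (RY.Lc q bt al ph)"
  unfolding thC_def RY.Lc_def d fstU by (rule lft_pre) (rule theta_in[OF i])
 finally show ?thesis .
qed

lemma tauC_Rc:
 assumes gm: "gm : Hom I i' i"
 shows "RY.Rc q gm (tauC q i ph) = tauC q i' (RX.Rc q gm ph)"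
proof -
 note o = I.Hom_Obj[OF gm]
 note d = I.HomD[OF gm]
 have "RY.Rc q gm (tauC q i ph) = pre (U (Yo (Suc q)) i') (%x. tau (Suc q) i (Bf (Yo (Suc q)) gm x)) ph"
  unfolding RY.Rc_def tauC_def d fstU by (rule pre_pre) (rule Bf_in[OF Yo_diag gm])
 also have "... = pre (U (Yo (Suc q)) i') (%x. xact (Suc q) gm (tau (Suc q) i' x)) ph"
  by (rule pre_cong) (rule tau_nat[OF gm])
 also have "... = tauC q i' (RX.Rc q gm ph)"
  unfolding RX.Rc_def tauC_def d by (rule pre_pre[symmetric]) (rule tau_in[OF o(1)])
 finally show ?thesis .
qed

text \<open>Pulling back along \<open>theta\<close> after \<open>tau\<close> is homotopic to the
  identity. On a cocycle the homotopy formula exhibits the difference as the coboundary of the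
  alternating sum of the \<open>hC n k i y\<close>.\<close>

lemma comparison_homotopy:
 assumes al: "al : Hom I i j" and y: "y : RY.Zc q al"
 shows "y - tauC q i (thC q i y) : RY.Bc q al"
proof -
 note i = I.Hom_Obj(1)[OF al]
 note d = I.HomD[OF al]
 have yC: "y : RY.Cc q al" and dy: "RY.dC q i y = 0" using y by (auto simp: RY.Zc_def d)
 have e: "tauC q i (thC q i y) = pre (U (Yo (Suc q)) i) (%x. theta (Suc q) i (tau (Suc q) i x)) y"
  unfolding tauC_def thC_def by (rule pre_pre) (rule tau_in[OF i])
 have idy: "pre (U (Yo (Suc q)) i) (%x. x) y = y"
  using pre_id yC unfolding RY.Cc_def d fstU[symmetric] by blast
 have hc: "hC q k i (RY.cof q l i y) = pre (U (Yo (Suc q)) i) (%x. yd (Suc q) l i (hh q k i x)) y" if "k <= q" for k l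
  unfolding hC_def RY.cof_def fstU by (rule pre_pre) (rule hh_in[OF i that])
 have h0: "hC q 0 i (RY.cof q 0 i y) = y"
 proof -
  have "hC q 0 i (RY.cof q 0 i y) = pre (U (Yo (Suc q)) i) (%x. x) y"
   unfolding hc[OF le0] by (rule pre_cong) (rule hh_face_id[OF i])
  thus ?thesis using idy by simp
 qed
 have hlast: "hC q q i (RY.cof q (Suc q) i y) = tauC q i (thC q i y)"
  unfolding hc[OF order_refl] e by (rule pre_cong) (rule hh_face_last[OF i])
 show ?thesis
 proof (cases q)
  case 0
  \<comment> \<open>In degree \<open>0\<close> there is no lower cochain group. The cocycle
    condition says that two cofaces agree, and \<open>hC 0 0\<close> sends them to \<open>y\<close>
    and to \<open>tauC (thC y)\<close>.\<close>
  have "RY.cof 0 0 i y - RY.cof 0 (Suc 0) i y = 0" using dy 0 by (simp add: RY.dC_def)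
  hence "hC 0 0 i (RY.cof 0 0 i y) = hC 0 0 i (RY.cof 0 (Suc 0) i y)" by simp
  thus ?thesis using h0 hlast 0 by (simp add: RY.Bc_def)
 next
  case (Suc n)
  let ?w = "\<Sum>k\<le>n. alt k (hC n k i y)"
  have ch: "RY.cof n l i (hC n k i y) = pre (U (Yo (Suc (Suc n))) i) (%x. hh n k i (yd (Suc n) l i x)) y" if "l <= Suc n" for k l
   unfolding hC_def RY.cof_def fstU by (rule pre_pre) (rule yd_in[OF i that])
  have "(\<Sum>k\<le>Suc n. alt k (hC (Suc n) k i (\<Sum>l\<le>Suc (Suc n). alt l (RY.cof (Suc n) l i y)))) +
    (\<Sum>l\<le>Suc n. alt l (RY.cof n l i (\<Sum>k\<le>n. alt k (hC n k i y)))) = y - tauC q i (thC q i y)"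
  proof (rule simplicial_homotopy[where ?D0.0 = "%l. RY.cof n l i" and ?s0.0 = "%k. hC n k i" and
    ?D1.0 = "%l. RY.cof (Suc n) l i" and ?s1.0 = "%k. hC (Suc n) k i"])
   show "hC (Suc n) 0 i (RY.cof (Suc n) 0 i y) = y" using h0 Suc by simp
   show "hC (Suc n) (Suc n) i (RY.cof (Suc n) (Suc (Suc n)) i y) = tauC q i (thC q i y)" using hlast Suc by simp
  next
   fix l k assume lk: "l < k" "k <= Suc n"
   have l: "l <= Suc n" using lk by simp
   show "hC (Suc n) k i (RY.cof (Suc n) l i y) = RY.cof n l i (hC n (k - 1) i y)"
    unfolding hc[unfolded Suc, OF lk(2)] ch[OF l] by (rule pre_cong) (rule hh_face_lt[OF i lk])
  next
   fix k assume k: "k < Suc n"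
   hence k': "Suc k <= Suc n" "k <= Suc n" by auto
   show "hC (Suc n) (Suc k) i (RY.cof (Suc n) (Suc k) i y) = hC (Suc n) k i (RY.cof (Suc n) (Suc k) i y)"
    unfolding hc[unfolded Suc, OF k'(1)] hc[unfolded Suc, OF k'(2)] by (rule pre_cong) (rule hh_face_mid[OF i k'(1)])
  next
   fix l k assume lk: "Suc k < l" "l <= Suc (Suc n)"
   hence k: "k <= Suc n" "l - 1 <= Suc n" by auto
   show "hC (Suc n) k i (RY.cof (Suc n) l i y) = RY.cof n (l - 1) i (hC n k i y)"
    unfolding hc[unfolded Suc, OF k(1)] ch[OF k(2)] by (rule pre_cong) (rule hh_face_gt[OF i lk])
  qed (rule RY.cof_add hC_add)+
  hence "RY.dC n i ?w = y - tauC q i (thC q i y)"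
   using dy unfolding Suc by (simp only: RY.dC_def[symmetric] addmap.zero[OF hC_add]) simp
  moreover have "?w : RY.Cc n al"
   using yC Suc by (intro subgp_sum[OF RY.Cc_subgp[OF al]] subgp_alt[OF RY.Cc_subgp[OF al]] hC_Cc[OF al]) auto
  ultimately show ?thesis using Suc by (auto simp: RY.Bc_def d image_iff intro!: bexI[of _ ?w])
 qed
qed

lemma thC_Zc: "al : Hom I i j ==> y : RY.Zc q al ==> thC q i y : RX.Zc q al"
 using thC_Cc[of al i j y q] thC_dC[of i q y] I.Hom_Obj(1)[of al i j] addmap.zero[OF thC_add]
 by (auto simp: RX.Zc_def RY.Zc_def Hom_iff)

lemma tauC_Zc: "al : Hom I i j ==> y : RX.Zc q al ==> tauC q i y : RY.Zc q al"
 using tauC_Cc[of al i j y q] tauC_dC[of i q y] I.Hom_Obj(1)[of al i j] addmap.zero[OF tauC_add]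
 by (auto simp: RX.Zc_def RY.Zc_def Hom_iff)

lemma thC_Bc:
 assumes al: "al : Hom I i j" and y: "y : RY.Bc q al"
 shows "thC q i y : RX.Bc q al"
proof (cases q)
 case 0
 thus ?thesis using y addmap.zero[OF thC_add] by (simp add: RY.Bc_def RX.Bc_def)
next
 case (Suc r)
 note d = I.HomD[OF al]
 then obtain w where "w : RY.Cc r al" "y = RY.dC r i w" using y Suc by (auto simp: RY.Bc_def)
 thus ?thesis
  using thC_dC[OF I.Hom_Obj(1)[OF al], of r w] thC_Cc[OF al] Suc d by (auto simp: RX.Bc_def)
qed

lemma tauC_Bc:
 assumes al: "al : Hom I i j" and y: "y : RX.Bc q al"
 shows "tauC q i y : RY.Bc q al"
proof (cases q)
 case 0
 thus ?thesis using y addmap.zero[OF tauC_add] by (simp add: RY.Bc_def RX.Bc_def)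
next
 case (Suc r)
 note d = I.HomD[OF al]
 then obtain w where "w : RX.Cc r al" "y = RX.dC r i w" using y Suc by (auto simp: RX.Bc_def)
 thus ?thesis
  using tauC_dC[OF I.Hom_Obj(1)[OF al], of r w] tauC_Cc[OF al] Suc d by (auto simp: RY.Bc_def)
qed

lemma Zc_subgp_Y: "al : Hom I i j ==> subgp (RY.Zc q al)"
 using RY.Cc_subgp[of al i j q] addmap.zero[OF RY.dC_add] addmap.diff[OF RY.dC_add]
 by (auto simp: subgp_def RY.Zc_def)

lemma Bc_subgp_Y: "al : Hom I i j ==> subgp (RY.Bc q al)"
proof (cases q)
 case 0
 thus ?thesis by (simp add: RY.Bc_def subgp_trivial)
next
 case (Suc r)
 assume "al : Hom I i j"
 note s = RY.Cc_subgp[OF this]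
 show ?thesis
  unfolding RY.Bc_def Suc subgp_def nat.case
 proof (intro conjI ballI)
  show "0 : RY.dC r (Dom I al) ` RY.Cc r al"
   using subgp_zero[OF s] addmap.zero[OF RY.dC_add] by (metis imageI)
  show "x - y : RY.dC r (Dom I al) ` RY.Cc r al" if "x : RY.dC r (Dom I al) ` RY.Cc r al" "y : RY.dC r (Dom I al) ` RY.Cc r al" for x y
   using that by (auto simp: addmap.diff[OF RY.dC_add, symmetric] intro!: imageI subgp_diff[OF s])
 qed
qed

text \<open>\<open>thC\<close> hits every cocycle because \<open>tauC\<close> is a section of it,
  and it detects coboundaries because \<open>tauC\<close> after \<open>thC\<close> is the identity
  up to coboundaries.\<close>

lemma presents_Y:
 assumes al: "al : Hom I i j" and P: "presents (RX.Zc q al) (RX.Bc q al) cl H"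
 shows "presents (RY.Zc q al) (RY.Bc q al) (%y. cl (thC q i y)) H"
 unfolding presents_def
proof (intro conjI ballI)
 note t = thC_Zc[OF al]
 show "subgp (RY.Zc q al)" by (rule Zc_subgp_Y[OF al])
 show "RY.Bc q al \<subseteq> RY.Zc q al" by (rule RY.Bc_Zc[OF al])
 show "comm_group H" by (rule presentsD(3)[OF P])
 show "(%y. cl (thC q i y)) ` RY.Zc q al = carrier H"
 proof
  show "(%y. cl (thC q i y)) ` RY.Zc q al \<subseteq> carrier H" using presentsD(5)[OF P t] by auto
  show "carrier H \<subseteq> (%y. cl (thC q i y)) ` RY.Zc q al"
  proof
   fix h assume "h : carrier H"
   then obtain x where x: "x : RX.Zc q al" "h = cl x" using presents_surj[OF P] by metis
   hence "thC q i (tauC q i x) = x" using thC_tauC[OF al] by (simp add: RX.Zc_def)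
   thus "h : (%y. cl (thC q i y)) ` RY.Zc q al" using x tauC_Zc[OF al x(1)] by force
  qed
 qed
 show "cl (thC q i (x + y)) = cl (thC q i x) \<otimes>\<^bsub>H\<^esub> cl (thC q i y)" if "x : RY.Zc q al" "y : RY.Zc q al" for x y
  using presentsD(6)[OF P t[OF that(1)] t[OF that(2)]] by (simp add: addmap.add[OF thC_add])
 show "cl (thC q i y) = \<one>\<^bsub>H\<^esub> \<longleftrightarrow> y : RY.Bc q al" if y: "y : RY.Zc q al" for y
 proof -
  have "thC q i y : RX.Bc q al \<longleftrightarrow> y : RY.Bc q al"
  proof
   assume "thC q i y : RX.Bc q al"
   from subgp_add[OF Bc_subgp_Y[OF al] comparison_homotopy[OF al y] tauC_Bc[OF al this]]
   show "y : RY.Bc q al" by simp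
  qed (rule thC_Bc[OF al])
  thus ?thesis using presentsD(7)[OF P t[OF y]] by simp
 qed
qed

text \<open>Although \<open>theta\<close> is not natural in \<open>I\<close>, it commutes with the right action up to coboundaries.\<close>

lemma thC_Rc:
 assumes al: "al : Hom I i j" and gm: "gm : Hom I i' i" and y: "y : RY.Zc q al"
 shows "RX.Rc q gm (thC q i y) - thC q i' (RY.Rc q gm y) : RX.Bc q (al \<bullet> gm)"
proof -
 note algm = I.comp_Hom[OF al gm]
 have x: "RX.Rc q gm (thC q i y) : RX.Cc q (al \<bullet> gm)"
  using RX.Rc_Zc[OF al gm thC_Zc[OF al y]] by (simp add: RX.Zc_def)
 \<comment> \<open>The difference of \<open>y\<close> and \<open>tauC (thC y)\<close> is a
   coboundary, and \<open>Rc\<close> and \<open>thC\<close> preserve coboundaries. Since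
   \<open>tauC\<close> commutes with \<open>Rc\<close> and \<open>thC\<close> cancels it, applying
   both maps yields the claim.\<close>
 have "RY.Rc q gm (y - tauC q i (thC q i y)) : RY.Bc q (al \<bullet> gm)"
 proof (cases q)
  case 0
  thus ?thesis using comparison_homotopy[OF al y] addmap.zero[OF RY.Rc_add] by (simp add: RY.Bc_def)
 next
  case (Suc r)
  note d = I.HomD[OF al] I.HomD[OF algm]
  obtain w where w: "w : RY.Cc r al" "y - tauC q i (thC q i y) = RY.dC r i w"
   using comparison_homotopy[OF al y] Suc d by (auto simp: RY.Bc_def)
  show ?thesis
   using RY.Rc_dC[OF gm, of r w] RY.Rc_Cc[OF al gm w(1)] w(2) d by (simp add: RY.Bc_def Suc)
 qed
 hence "thC q i' (RY.Rc q gm (tauC q i (thC q i y) - y)) : RX.Bc q (al \<bullet> gm)"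
  using thC_Bc[OF algm subgp_minus[OF Bc_subgp_Y[OF algm]]] addmap.minus[OF RY.Rc_add] by (metis minus_diff_eq)
 moreover have "thC q i' (RY.Rc q gm (tauC q i (thC q i y) - y)) = RX.Rc q gm (thC q i y) - thC q i' (RY.Rc q gm y)"
  unfolding addmap.diff[OF RY.Rc_add] addmap.diff[OF thC_add] tauC_Rc[OF gm] thC_tauC[OF algm x] ..
 ultimately show ?thesis by simp
qed

end

subsection \<open>Exactness of the rows\<close>

context comparison
begin

text \<open>The free generator of \<open>Yo (Suc q)\<close> at \<open>k\<close> with arrow
  \<open>gm : l \<rightarrow> k\<close> and element \<open>b\<close>. It is the transport along
  \<open>gm\<close> of the generator with identity arrow at \<open>l\<close>
  (\<open>Bf_ins\<close>).\<close>

abbreviation ins :: "nat => 'i => 'k => 'u => 'u" where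
 "ins q k gm b \<equiv> eta (L (Yo q) k) (code gm b)"

lemma ins_in: "gm : Hom I l k ==> b : U (Yo q) l ==> ins q k gm b : U (Yo (Suc q)) k"
 using eta_in[OF sL LI] I.Hom_Obj(2)[of gm l k] by (simp add: U_Yo_Suc)

lemma Bf_ins:
 assumes "gm : Hom I l k" "de : Hom I k m" "b : U (Yo q) l"
 shows "Bf (Yo (Suc q)) de (ins q k gm b) = ins q m (de \<bullet> gm) b"
 unfolding Yo_Suc using Bf_Gob[OF assms(2) eta_in[OF sL LI[OF assms(1,3)]]]
 by (simp add: eta_nat[OF lact_Pi[OF assms(2)] sL sL LI[OF assms(1,3)]] lact_code[OF assms(1)])

text \<open>A generator and the identity generator it is transported from have the same image in
  \<open>A(m)\<close>, once the arrow is absorbed into \<open>al\<close>. This puts the values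
  prescribed in \<open>row_contraction\<close> into the right fibres.\<close>

lemma base_ins:
 assumes "gm : Hom I l k" "al : Hom I k m" "b : U (Yo q) l"
 shows "RY.base q al (ins q k gm b) = RY.base q (al \<bullet> gm) (ins q l (Idn I l) b)"
proof -
 note o = I.Hom_Obj[OF assms(1)]
 note x = ins_in[OF I.Idn_Hom[OF o(1)] assms(3)]
 note d = I.HomD[OF assms(2)] I.HomD[OF I.comp_Hom[OF assms(2,1)]]
 have "ins q k gm b = Bf (Yo (Suc q)) gm (ins q l (Idn I l) b)"
  using Bf_ins[OF I.Idn_Hom[OF o(1)] assms(1,3)] I.comp_Idn(1)[OF assms(1)] by simp
 thus ?thesis
  using RY.aug_act[OF assms(1), of "ins q l (Idn I l) b" q] x RY.aug_in[OF o(1), of _ q] Bf_comp[OF A_diag assms(1,2)]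
  by (simp add: RY.base_def d fstU)
qed

text \<open>A generator at the source of the chain \<open>as\<close> carries an arrow
  \<open>gm\<close> that can be appended to \<open>as\<close>. The contracted cochain takes on it
  the value of \<open>f\<close> on the longer chain at the identity generator; freeness extends
  these values to a derivation.\<close>

lemma row_contraction:
 assumes f: "f : RY.chainD (Suc p) q"
 obtains h where "h : RY.chainD p q"
  "!!i as gm l b. (i, as) : chains I p ==> gm : Hom I l (src i as) ==> b : U (Yo q) l ==>
   h (i, as) (ins q (src i as) gm b) = f (i, as @ [gm]) (ins q l (Idn I l) b)"
proof -
 have ex: "\<exists>ph\<in>RY.Cc q (cc i as). \<forall>gm l b. gm : Hom I l (src i as) --> b : U (Yo q) l -->
   ph (ins q (src i as) gm b) = f (i, as @ [gm]) (ins q l (Idn I l) b)"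
  if c: "(i, as) : chains I p" for i as
 proof -
  define k where "k = src i as"
  note al = RY.chains_Hom[OF c, folded k_def]
  note k = I.Hom_Obj(1)[OF al]
  note d = I.HomD[OF al]
  have o: "over i (FA (L (Yo q) k)) (RY.base q (cc i as))"
   using RY.base_over[OF al, of q] fob_Yo_Suc[OF k] by simp
  \<comment> \<open>By \<open>base_ins\<close> the prescribed value lies in the fibre over the image
    of the generator \<open>s\<close>, as the free extension requires.\<close>
  have "\<exists>m\<in>carrier (fibg i (RY.base q (cc i as) (eta (L (Yo q) k) s))).
    f (i, as @ [fst (decode I s)]) (ins q (Dom I (fst (decode I s))) (Idn I (Dom I (fst (decode I s)))) (snd (decode I s))) =
    embed (fibg i (RY.base q (cc i as) (eta (L (Yo q) k) s))) m" if s: "s : L (Yo q) k" for s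
  proof -
   obtain gm l b where g: "gm : Hom I l k" "b : U (Yo q) l" "s = code gm b" "decode I s = (gm, b)" using s by (rule LE)
   note dg = I.HomD[OF g(1)]
   have c': "(i, as @ [gm]) : chains I (Suc p)"
    using c g(1) I.Hom_Obj(1)[OF g(1)] by (auto simp: chains_iff chain_append k_def Hom_iff)
   have cc: "cc i (as @ [gm]) = cc i as \<bullet> gm"
    using c c' by (intro chain_comp_snoc) (simp add: chains_iff)
   note d' = I.HomD[OF I.comp_Hom[OF al g(1)]]
   have "f (i, as @ [gm]) : derv i (fob (Yo (Suc q)) l) (RY.base q (cc i as \<bullet> gm))"
    using RY.chainD_in[OF f c'] unfolding cc RY.Cc_def d' .
   from derv_embed[OF this, unfolded fstU, OF ins_in[OF I.Idn_Hom[OF I.Hom_Obj(1)[OF g(1)]] g(2)]]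
   show ?thesis using base_ins[OF g(1) al g(2)] g(3,4) dg by simp
  qed
  then obtain m where m: "!!s. s : L (Yo q) k ==> m s : carrier (fibg i (RY.base q (cc i as) (eta (L (Yo q) k) s)))"
   "!!s. s : L (Yo q) k ==> f (i, as @ [fst (decode I s)]) (ins q (Dom I (fst (decode I s))) (Idn I (Dom I (fst (decode I s)))) (snd (decode I s))) =
    embed (fibg i (RY.base q (cc i as) (eta (L (Yo q) k) s))) (m s)"
   by metis
  obtain ph where ph: "ph : derv i (FA (L (Yo q) k)) (RY.base q (cc i as))"
   "!!s. s : L (Yo q) k ==> ph (eta (L (Yo q) k) s) = embed (fibg i (RY.base q (cc i as) (eta (L (Yo q) k) s))) (m s)"
   using derv_free_ext[OF sL o m(1)] by blast
  have "ph (ins q k gm b) = f (i, as @ [gm]) (ins q l (Idn I l) b)" if g: "gm : Hom I l k" "b : U (Yo q) l" for gm l b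
  proof -
   have "Dom I gm = l" using g(1) by (simp add: Hom_iff)
   thus ?thesis using ph(2)[OF LI[OF g]] m(2)[OF LI[OF g]] by (simp add: decode_Hom[OF g(1)])
  qed
  thus ?thesis
   using ph(1) unfolding RY.Cc_def d fob_Yo_Suc[OF k] k_def[symmetric] by blast
 qed
 define h where "h c = (if c : chains I p then SOME ph. ph : RY.Cc q (case_prod cc c) &
   (\<forall>gm l b. gm : Hom I l (case_prod src c) --> b : U (Yo q) l -->
    ph (ins q (case_prod src c) gm b) = f (fst c, snd c @ [gm]) (ins q l (Idn I l) b)) else 0)" for c
 have h: "h (i, as) : RY.Cc q (cc i as) & (\<forall>gm l b. gm : Hom I l (src i as) --> b : U (Yo q) l -->
   h (i, as) (ins q (src i as) gm b) = f (i, as @ [gm]) (ins q l (Idn I l) b))" if c: "(i, as) : chains I p" for i as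
  unfolding h_def prod.case fst_conv snd_conv if_P[OF c] by (rule someI_ex[OF ex[OF c, unfolded Bex_def]])
 show thesis
 proof (rule that)
  show "h : RY.chainD p q" using h by (intro RY.chainDI) (auto simp: h_def)
 qed (use h in blast)
qed

text \<open>Evaluate the cocycle condition for \<open>f\<close> on the chain
  \<open>as @ [gm]\<close> at the identity generator: all terms but the last make up
  \<open>dh h\<close> at the generator of \<open>gm\<close>, and the last is \<open>f\<close> itself
  up to sign.\<close>

lemma row_exact:
 assumes f: "f : RY.chainD (Suc p) q" and df: "RY.dh (Suc p) q f = 0"
 shows "\<exists>g\<in>RY.chainD p q. RY.dh p q g = f"
proof -
 obtain h where h: "h : RY.chainD p q" and hi: "!!i as gm l b. (i, as) : chains I p ==> gm : Hom I l (src i as) ==> b : U (Yo q) l ==>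
   h (i, as) (ins q (src i as) gm b) = f (i, as @ [gm]) (ins q l (Idn I l) b)"
  using row_contraction[OF f] by blast
 have dhv: "RY.dh n q g (i, as) y = (\<Sum>j\<le>Suc n. alt j (RY.dterm n q j g i as y))" if "(i, as) : chains I (Suc n)" for n g i as y
  using that by (simp add: RY.dh_def RY.delta_def sum_apply alt_apply del: sum.atMost_Suc)
 have "RY.dh p q h (i, as) = alt (Suc p) (f (i, as))" if c: "(i, as) : chains I (Suc p)" for i as
 proof -
  define k where "k = src i as"
  note al = RY.chains_Hom[OF c, folded k_def]
  note k = I.Hom_Obj(1)[OF al]
  note d = I.HomD[OF al]
  have o: "over i (FA (L (Yo q) k)) (RY.base q (cc i as))"
   using RY.base_over[OF al, of q] fob_Yo_Suc[OF k] by simp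
  have Cc: "RY.Cc q (cc i as) = derv i (FA (L (Yo q) k)) (RY.base q (cc i as))"
   unfolding RY.Cc_def d fob_Yo_Suc[OF k] ..
  obtain a as' where a: "as = a # as'" "a : Hom I (Dom I a) i" "(Dom I a, as') : chains I p"
   "cc (Dom I a) as' : Hom I (src (Dom I a) as') (Dom I a)" "src i as = src (Dom I a) as'"
   using c by (rule RY.chains_Suc)
  obtain bs bt where b: "as = bs @ [bt]" "bt : Hom I (src i as) (src i bs)" "(i, bs) : chains I p"
   using c by (rule RY.chains_snoc)
  have len: "length as = Suc p" "length bs = p" using c b(1) by (simp_all add: chains_iff)
  show ?thesis
  proof (rule derv_free_eqI[OF sL o])
   show "RY.dh p q h (i, as) : derv i (FA (L (Yo q) k)) (RY.base q (cc i as))"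
    using RY.chainD_in[OF RY.dh_D[OF h] c] unfolding Cc .
   show "alt (Suc p) (f (i, as)) : derv i (FA (L (Yo q) k)) (RY.base q (cc i as))"
    using subgp_alt[OF derv_subgp[OF o]] RY.chainD_in[OF f c] unfolding Cc by blast
   fix s assume "s : L (Yo q) k"
   then obtain gm l t where g: "gm : Hom I l k" "t : U (Yo q) l" "s = code gm t" by (rule LE)
   note l = I.Hom_Obj(1)[OF g(1)]
   note dg = I.HomD[OF g(1)]
   let ?x = "ins q l (Idn I l) t" and ?y = "ins q k gm t"
   have xi: "?x : U (Yo (Suc q)) l" and yi: "?y : U (Yo (Suc q)) k"
    using ins_in[OF I.Idn_Hom[OF l] g(2)] ins_in[OF g(1,2)] by auto
   have c': "(i, as @ [gm]) : chains I (Suc (Suc p))"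
    using c g(1) l by (auto simp: chains_iff chain_append k_def Hom_iff)
   \<comment> \<open>The case \<open>j = Suc p\<close> merges \<open>bt\<close> with the appended
     \<open>gm\<close>; it matches the last term for \<open>h\<close>, since the transition map
     along \<open>bt\<close> turns the arrow \<open>gm\<close> of the generator into the
     composite.\<close>
   have t: "RY.dterm (Suc p) q j f i (as @ [gm]) ?x = RY.dterm p q j h i as ?y" if j: "j <= Suc p" for j
   proof -
    consider "j = 0" | "j \<noteq> 0" "j <= p" | "j = Suc p" using j by fastforce
    thus ?thesis
    proof cases
     case 1
     have g': "gm : Hom I l (src (Dom I a) as')" using g(1) a(5) by (simp add: k_def)
     have c2: "is_chain I (Dom I a) (as' @ [gm])"
      using a(3) g' l by (auto simp: chains_iff chain_append Hom_iff)
     have "cc (Dom I a) (as' @ [gm]) = cc (Dom I a) as' \<bullet> gm"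
      by (rule chain_comp_snoc[OF c2])
     moreover have "Dom I (cc (Dom I a) as' \<bullet> gm) = l" "Dom I (cc (Dom I a) as') = k"
      using I.comp_Hom[OF a(4) g'] a(4,5) by (auto simp: Hom_iff k_def)
     ultimately show ?thesis
      using 1 base_ins[OF g' a(4) g(2)] hi[OF a(3) g' g(2)] a(5) xi yi
      by (simp add: RY.dterm_def a(1) RY.Lc_def lft_def fstU k_def)
    next
     case 2
     have "mrg (j - 1) (as @ [gm]) = mrg (j - 1) as @ [gm]" using 2 len by (intro mrg_snoc) auto
     moreover have "(i, mrg (j - 1) as) : chains I p" "src i (mrg (j - 1) as) = src i as"
      using RY.chains_mrg[OF c, of "j - 1"] 2 by auto
     ultimately show ?thesis
      using 2 hi[of i "mrg (j - 1) as" gm l t] g by (simp add: RY.dterm_def k_def)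
    next
     case 3
     have "mrg (length bs) (bs @ [bt, gm]) = bs @ [bt \<bullet> gm]" by (rule mrg_last)
     hence m: "mrg p (as @ [gm]) = bs @ [bt \<bullet> gm]" using len(2) b(1) by simp
     note bt = b(2)[folded k_def]
     have "Dom I bt = k" using bt by (simp add: Hom_iff)
     hence "RY.Rc q bt (h (i, bs)) ?y = h (i, bs) (ins q (src i bs) (bt \<bullet> gm) t)"
      using yi Bf_ins[OF g(1) bt g(2)] by (simp add: RY.Rc_def pre_def fstU)
     also have "... = f (i, bs @ [bt \<bullet> gm]) ?x"
      by (rule hi[OF b(3) I.comp_Hom[OF bt g(1)] g(2)])
     finally show ?thesis using 3 m b(1) by (simp add: RY.dterm_def)
    qed
   qed
   \<comment> \<open>Removing \<open>gm\<close> acts by the transition map along \<open>gm\<close>,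
     which carries the identity generator to the generator of \<open>gm\<close>.\<close>
   have last: "RY.dterm (Suc p) q (Suc (Suc p)) f i (as @ [gm]) ?x = f (i, as) ?y"
    using xi dg Bf_ins[OF I.Idn_Hom[OF l] g(1,2)] I.comp_Idn(1)[OF g(1)]
    by (simp add: RY.dterm_def RY.Rc_def pre_def fstU)
   have "0 = RY.dh (Suc p) q f (i, as @ [gm]) ?x" by (simp add: df)
   also have "... = (\<Sum>j\<le>Suc p. alt j (RY.dterm (Suc p) q j f i (as @ [gm]) ?x)) + alt (Suc (Suc p)) (f (i, as) ?y)"
    unfolding dhv[OF c'] sum.atMost_Suc[of _ "Suc p"] last ..
   also have "(\<Sum>j\<le>Suc p. alt j (RY.dterm (Suc p) q j f i (as @ [gm]) ?x)) = RY.dh p q h (i, as) ?y"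
    unfolding dhv[OF c] by (rule sum.cong) (auto simp: t)
   finally show "RY.dh p q h (i, as) (eta (L (Yo q) k) s) = alt (Suc p) (f (i, as)) (eta (L (Yo q) k) s)"
    by (simp add: alt_def g(3) eq_neg_iff_add_eq_0 split: if_splits)
  qed
 qed
 \<comment> \<open>The sign \<open>(-1)^(p + 1)\<close> is moved into the preimage.\<close>
 hence "RY.dh p q (alt (Suc p) h) (i, as) = alt (Suc p) (alt (Suc p) (f (i, as)))" if "(i, as) : chains I (Suc p)" for i as
  unfolding addmap.alt[OF RY.dh_add] alt_apply[of _ _ "(i, as)"] using that by metis
 hence "RY.dh p q (alt (Suc p) h) (i, as) = f (i, as)" if "(i, as) : chains I (Suc p)" for i as
  using that by (cases "even p") (simp_all add: alt_def)
 moreover have "RY.dh p q (alt (Suc p) h) (i, as) = f (i, as)" if "(i, as) \<notin> chains I (Suc p)" for i as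
  using that RY.chainD_out[OF f] RY.chainD_out[OF RY.dh_D[OF subgp_alt[OF RY.chainD_subgp h]]] by metis
 ultimately have "RY.dh p q (alt (Suc p) h) = f" by (intro ext[of "RY.dh p q (alt (Suc p) h)"]) (metis surj_pair)
 thus ?thesis using subgp_alt[OF RY.chainD_subgp h] by blast
qed

lemma DC_exact:
 assumes p: "0 < p" and x: "x : RY.DD p q" and d: "RY.DH p q x = 0"
 shows "\<exists>y\<in>RY.DD (p - 1) q. RY.DH (p - 1) q y = x"
proof (cases "q < 0")
 case True
 thus ?thesis using x by (auto simp: RY.DD_def RY.DH_def)
next
 case False
 obtain n where n: "nat p = Suc n" "nat (p - 1) = n" using p by (cases "nat p") auto
 thus ?thesis
  using row_exact[of x n "nat q"] x d p False by (auto simp: RY.DD_def RY.DH_def)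
qed

end

subsection \<open>Pullback of group objects\<close>

text \<open>An injective map onto a subgroup that turns multiplication into addition forces the
  axioms of a commutative group on \<open>H\<close>. The groups of derivations of the two cohomology
  theories obtain their group laws in this way.\<close>

lemma presents_embedding:
 fixes e :: "'h => 'a::ab_group_add"
 assumes S: "subgp S" and e: "e ` carrier H = S" "inj_on e (carrier H)"
  and m: "!!x y. x : carrier H ==> y : carrier H ==> x \<otimes>\<^bsub>H\<^esub> y : carrier H & e (x \<otimes>\<^bsub>H\<^esub> y) = e x + e y"
  and o: "\<one>\<^bsub>H\<^esub> : carrier H" "e \<one>\<^bsub>H\<^esub> = 0"
 shows "presents S {0} (inv_into (carrier H) e) H"
proof -
 let ?i = "inv_into (carrier H) e"
 have i: "?i x : carrier H" "e (?i x) = x" if "x : S" for x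
  using that e(1) by (auto simp: inv_into_into f_inv_into_f)
 have eq: "x = y" if "x : carrier H" "y : carrier H" "e x = e y" for x y
  using e(2) that by (auto simp: inj_on_def)
 have H: "comm_group H"
 proof (rule comm_groupI)
  fix x y z assume xyz: "x : carrier H" "y : carrier H" "z : carrier H"
  show "x \<otimes>\<^bsub>H\<^esub> y : carrier H" using m xyz by blast
  show "x \<otimes>\<^bsub>H\<^esub> y \<otimes>\<^bsub>H\<^esub> z = x \<otimes>\<^bsub>H\<^esub> (y \<otimes>\<^bsub>H\<^esub> z)" using m xyz by (intro eq) (auto simp: add.assoc)
  show "x \<otimes>\<^bsub>H\<^esub> y = y \<otimes>\<^bsub>H\<^esub> x" using m xyz by (intro eq) (auto simp: add.commute)
  show "\<one>\<^bsub>H\<^esub> \<otimes>\<^bsub>H\<^esub> x = x" using m o xyz by (intro eq) auto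
  have "- e x : S" using subgp_minus[OF S] e(1) xyz(1) by blast
  thus "\<exists>y\<in>carrier H. y \<otimes>\<^bsub>H\<^esub> x = \<one>\<^bsub>H\<^esub>"
   using m o xyz i by (intro bexI[of _ "?i (- e x)"] eq) auto
 next
  show "\<one>\<^bsub>H\<^esub> : carrier H" by fact
 qed
 show ?thesis
  unfolding presents_def
 proof (intro conjI ballI)
  show "{0} \<subseteq> S" using subgp_zero[OF S] by simp
  show "?i ` S = carrier H" using e by (metis inv_into_image_cancel subset_refl)
  show "?i (x + y) = ?i x \<otimes>\<^bsub>H\<^esub> ?i y" if "x : S" "y : S" for x y
   using m i[OF that(1)] i[OF that(2)] i[OF subgp_add[OF S that]] by (intro eq) auto
  show "?i x = \<one>\<^bsub>H\<^esub> \<longleftrightarrow> x : {0}" if "x : S" for x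
   using i[OF that] o eq by auto
 qed (use S H in auto)
qed

context category
begin

text \<open>Transposition for the adjunction between composition with \<open>f\<close> and pullback
  along \<open>f\<close>: an arrow over \<open>X\<close> into the pullback of \<open>q\<close>
  becomes an arrow over \<open>Y\<close> into \<open>q\<close>. \<open>ptr_inj\<close> and
  \<open>ptr_lift\<close> make it bijective.\<close>

definition ptr :: "'m => 'm => 'm \<times> 'm \<times> 'm => 'm \<times> 'm \<times> 'm" where
 "ptr f q a = (f \<bullet> fst a, snd (pullback C f q) \<bullet> fst (snd a), q)"

context
 fixes f X Y
 assumes f: "f : Hom C X Y"
  and pb: "\<forall>q\<in>Obj (slice C Y). is_pullback C f q (fst (pullback C f q)) (snd (pullback C f q))"
begin

abbreviation "Pb q \<equiv> fst (pullback C f q)"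
abbreviation "Pr q \<equiv> snd (pullback C f q)"

lemma pb_Hom:
 assumes "q : Obj (slice C Y)"
 shows "Pb q : Hom C (Dom C (Pb q)) X" "Pr q : Hom C (Dom C (Pb q)) (Dom C q)" "f \<bullet> Pb q = q \<bullet> Pr q"
 using bspec[OF pb assms] f by (auto simp: is_pullback_def Hom_iff)

lemma pb_ex1:
 assumes q: "q : Obj (slice C Y)" and h: "h : Hom C z X" and k: "k : Hom C z (Dom C q)" and e: "f \<bullet> h = q \<bullet> k"
 shows "\<exists>!u. u : Hom C z (Dom C (Pb q)) & Pb q \<bullet> u = h & Pr q \<bullet> u = k"
 using bspec[OF pb q] f h k e Hom_Obj(1)[OF h] unfolding is_pullback_def by (auto simp: Hom_iff)

lemma pb_lift:
 assumes q: "q : Obj (slice C Y)" and h: "h : Hom C z X" and k: "k : Hom C z (Dom C q)" and e: "f \<bullet> h = q \<bullet> k"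
 shows "pb_lift C f q h k : Hom C z (Dom C (Pb q))" "Pb q \<bullet> pb_lift C f q h k = h" "Pr q \<bullet> pb_lift C f q h k = k"
proof -
 have "pb_lift C f q h k = (THE u. u : Hom C z (Dom C (Pb q)) & Pb q \<bullet> u = h & Pr q \<bullet> u = k)"
  using h by (simp add: pb_lift_def case_prod_beta Hom_iff)
 with theI'[OF pb_ex1[OF assms]]
 show "pb_lift C f q h k : Hom C z (Dom C (Pb q))" "Pb q \<bullet> pb_lift C f q h k = h" "Pr q \<bullet> pb_lift C f q h k = k"
  by auto
qed

lemma Pb_Obj: "q : Obj (slice C Y) ==> Pb q : Obj (slice C X)"
 using pb_Hom(1)[of q] by (simp add: Hom_iff)

lemma slice_HomD:
 assumes "a : Hom (slice C W) z q"
 shows "a = (z, fst (snd a), q)" "z : Hom C (Dom C z) W" "q : Hom C (Dom C q) W"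
  "fst (snd a) : Hom C (Dom C z) (Dom C q)" "q \<bullet> fst (snd a) = z"
 using assms unfolding slice_Hom by (auto simp: Hom_iff)

lemma ptr_Hom:
 assumes q: "q : Obj (slice C Y)" and a: "a : Hom (slice C X) z (Pb q)"
 shows "ptr f q a : Hom (slice C Y) (f \<bullet> z) q"
proof -
 note a = slice_HomD[OF a]
 have qH: "q : Hom C (Dom C q) Y" using q by (simp add: Hom_iff)
 have fa: "fst a = z" using a(1) by (metis fst_conv)
 have "q \<bullet> (Pr q \<bullet> fst (snd a)) = f \<bullet> z"
  using pb_Hom(3)[OF q] comp_assoc[OF a(4) pb_Hom(2)[OF q] qH] comp_assoc[OF a(4) pb_Hom(1)[OF q] f] a(5) by simp
 thus ?thesis
  using qH comp_Hom[OF f a(2)] comp_Hom[OF pb_Hom(2)[OF q] a(4)] unfolding ptr_def slice_Hom fa by (auto simp: Hom_iff)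
qed

lemma ptr_inj:
 assumes q: "q : Obj (slice C Y)" and a: "a : Hom (slice C X) z (Pb q)" and b: "b : Hom (slice C X) z (Pb q)"
  and e: "ptr f q a = ptr f q b"
 shows "a = b"
proof -
 note a = slice_HomD[OF a] and b = slice_HomD[OF b]
 note k = comp_Hom[OF pb_Hom(2)[OF q] a(4)]
 have "f \<bullet> z = q \<bullet> (Pr q \<bullet> fst (snd a))"
  using ptr_Hom[OF q \<open>a : _\<close>] by (auto simp: ptr_def slice_Hom)
 from pb_ex1[OF q a(2) k this] have "fst (snd a) = fst (snd b)"
  using a b e by (auto simp: ptr_def)
 thus ?thesis using a(1) b(1) by metis
qed

lemma ptr_lift:
 assumes q: "q : Obj (slice C Y)" and z: "z : Obj (slice C X)" and b: "(f \<bullet> z, k, q) : Hom (slice C Y) (f \<bullet> z) q"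
 shows "(z, pb_lift C f q z k, Pb q) : Hom (slice C X) z (Pb q)" "ptr f q (z, pb_lift C f q z k, Pb q) = (f \<bullet> z, k, q)"
proof -
 have z': "z : Hom C (Dom C z) X" using z by (simp add: Hom_iff)
 have "Dom C (f \<bullet> z) = Dom C z" using comp_Hom[OF f z'] by (simp add: Hom_iff)
 hence "k : Hom C (Dom C z) (Dom C q)" "f \<bullet> z = q \<bullet> k" using slice_HomD[OF b] by auto
 from pb_lift[OF q z' this]
 show "(z, pb_lift C f q z k, Pb q) : Hom (slice C X) z (Pb q)" "ptr f q (z, pb_lift C f q z k, Pb q) = (f \<bullet> z, k, q)"
  using z Pb_Obj[OF q] by (auto simp: slice_Hom ptr_def)
qed

lemma ptr_far:
 assumes t: "t : Hom (slice C Y) q q'" and a: "a : Hom (slice C X) z (Pb q)"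
 shows "far (pullback_functor C f) t : Hom (slice C X) (Pb q) (Pb q')"
  "ptr f q' (far (pullback_functor C f) t \<bullet>\<^bsub>slice C X\<^esub> a) = t \<bullet>\<^bsub>slice C Y\<^esub> ptr f q a"
proof -
 have q: "q : Obj (slice C Y)" "q' : Obj (slice C Y)" using t by (auto simp: slice_Hom)
 obtain u where u: "t = (q, u, q')" "u : Hom C (Dom C q) (Dom C q')" "q' \<bullet> u = q" using t by (auto simp: slice_Hom)
 note a' = slice_HomD[OF a]
 note r = pb_Hom[OF q(1)]
 have q'H: "q' : Hom C (Dom C q') Y" using q by (simp add: Hom_iff)
 have "f \<bullet> Pb q = q' \<bullet> (u \<bullet> Pr q)" using r(3) comp_assoc[OF r(2) u(2) q'H] u(3) by simp
 note l = pb_lift[OF q(2) r(1) comp_Hom[OF u(2) r(2)] this]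
 have F: "far (pullback_functor C f) t = (Pb q, pb_lift C f q' (Pb q) (u \<bullet> Pr q), Pb q')"
  by (simp add: pullback_functor_def u(1))
 show "far (pullback_functor C f) t : Hom (slice C X) (Pb q) (Pb q')"
  unfolding F using l Pb_Obj[OF q(1)] Pb_Obj[OF q(2)] by (auto simp: slice_Hom)
 have "Pr q' \<bullet> (pb_lift C f q' (Pb q) (u \<bullet> Pr q) \<bullet> fst (snd a)) = u \<bullet> (Pr q \<bullet> fst (snd a))"
  using comp_assoc[OF a'(4) l(1) pb_Hom(2)[OF q(2)]] comp_assoc[OF a'(4) r(2) u(2)] l(3) by simp
 thus "ptr f q' (far (pullback_functor C f) t \<bullet>\<^bsub>slice C X\<^esub> a) = t \<bullet>\<^bsub>slice C Y\<^esub> ptr f q a"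
  unfolding F using u(1) by (simp add: ptr_def)
qed

text \<open>Pullback preserves the product, as is seen by transposing pairings; hence addition in
  the pulled-back module transposes to addition in \<open>N\<close>.\<close>

lemma ptr_plus:
 assumes N: "is_product (slice C Y) (gob N) (gob N) (gpr1 N) (gpr2 N)"
   "gadd N : Hom (slice C Y) (Dom (slice C Y) (gpr1 N)) (gob N)"
  and a: "a : Hom (slice C X) z (Pb (gob N))" and b: "b : Hom (slice C X) z (Pb (gob N))"
 shows "plus_arr (slice C X) (pullback_module C f N) a b : Hom (slice C X) z (Pb (gob N))"
  "ptr f (gob N) (plus_arr (slice C X) (pullback_module C f N) a b) = plus_arr (slice C Y) N (ptr f (gob N) a) (ptr f (gob N) b)"
proof -
 interpret X: category "slice C X" using category_slice by (simp add: category_def)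
 interpret Y: category "slice C Y" using category_slice by (simp add: category_def)
 define Q where "Q = Dom (slice C Y) (gpr1 N)"
 have g: "gpr1 N : Hom (slice C Y) Q (gob N)" "gpr2 N : Hom (slice C Y) Q (gob N)"
  using N(1) by (auto simp: is_product_def Q_def)
 have q: "gob N : Obj (slice C Y)" "Q : Obj (slice C Y)" using Y.Hom_Obj[OF g(1)] by auto
 note pa = ptr_Hom[OF q(1) a] and pb' = ptr_Hom[OF q(1) b]
 let ?N = "pullback_module C f N" and ?P = "%u. u : Hom (slice C Y) (f \<bullet> z) Q &
  gpr1 N \<bullet>\<^bsub>slice C Y\<^esub> u = ptr f (gob N) a & gpr2 N \<bullet>\<^bsub>slice C Y\<^esub> u = ptr f (gob N) b"
 have ex1: "\<exists>!u. ?P u"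
  using N(1) Y.Hom_Obj(1)[OF pa] pa pb' unfolding is_product_def Q_def by blast
 let ?w = "pairing (slice C Y) N (ptr f (gob N) a) (ptr f (gob N) b)"
 have "Dom (slice C Y) (ptr f (gob N) a) = f \<bullet> z" using pa by (simp add: Hom_iff)
 hence "?w = (THE u. ?P u)"
  by (simp only: pairing_def Q_def)
 hence w: "?P ?w"
  using theI'[OF ex1] by simp
 have wz: "?w = (f \<bullet> z, fst (snd ?w), Q)" using w slice_HomD(1) by blast
 have z: "z : Obj (slice C X)" using a by (auto simp: slice_Hom)
 \<comment> \<open>The arrow whose transpose is the pairing over \<open>Y\<close>; it turns out to
   be the pairing over \<open>X\<close>.\<close>
 define v where "v = (z, pb_lift C f Q z (fst (snd ?w)), Pb Q)"
 have v: "v : Hom (slice C X) z (Pb Q)" "ptr f Q v = ?w"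
  using ptr_lift[OF q(2) z] w wz unfolding v_def by metis+
 note F1 = ptr_far[OF g(1) v(1)] and F2 = ptr_far[OF g(2) v(1)] and F3 = ptr_far[OF N(2)[folded Q_def] v(1)]
 have gp: "gpr1 ?N = far (pullback_functor C f) (gpr1 N)" "gpr2 ?N = far (pullback_functor C f) (gpr2 N)"
  "gadd ?N = far (pullback_functor C f) (gadd N)"
  by (simp_all add: pullback_module_def map_grp_obj_def)
 have Da: "Dom (slice C X) a = z" "Dom (slice C X) (gpr1 ?N) = Pb Q" using a F1(1) by (auto simp: Hom_iff gp)
 have va: "gpr1 ?N \<bullet>\<^bsub>slice C X\<^esub> v = a"
  using ptr_inj[OF q(1) X.comp_Hom[OF F1(1) v(1)] a] F1(2) v(2) w unfolding gp by metis
 have vb: "gpr2 ?N \<bullet>\<^bsub>slice C X\<^esub> v = b"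
  using ptr_inj[OF q(1) X.comp_Hom[OF F2(1) v(1)] b] F2(2) v(2) w unfolding gp by metis
 have vP: "pairing (slice C X) ?N a b = v"
  unfolding pairing_def Da
 proof (rule the_equality)
  fix u assume u: "u : Hom (slice C X) z (Pb Q) & gpr1 ?N \<bullet>\<^bsub>slice C X\<^esub> u = a & gpr2 ?N \<bullet>\<^bsub>slice C X\<^esub> u = b"
  hence u': "u : Hom (slice C X) z (Pb Q)" by blast
  have "?P (ptr f Q u)"
   using ptr_Hom[OF q(2) u'] ptr_far(2)[OF g(1) u'] ptr_far(2)[OF g(2) u'] u unfolding gp by metis
  hence "ptr f Q u = ptr f Q v" using ex1 w v(2) by metis
  thus "u = v" by (rule ptr_inj[OF q(2) u' v(1)])
 qed (use v(1) va vb in blast)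
 show "plus_arr (slice C X) ?N a b : Hom (slice C X) z (Pb (gob N))"
  unfolding plus_arr_def vP gp by (rule X.comp_Hom[OF F3(1) v(1)])
 show "ptr f (gob N) (plus_arr (slice C X) ?N a b) = plus_arr (slice C Y) N (ptr f (gob N) a) (ptr f (gob N) b)"
  unfolding plus_arr_def vP gp F3(2) v(2) ..
qed

lemma ptr_one:
 assumes N: "is_terminal (slice C Y) (gone N)" "gzero N : Hom (slice C Y) (gone N) (gob N)" and z: "z : Obj (slice C X)"
 shows "gzero (pullback_module C f N) \<bullet>\<^bsub>slice C X\<^esub> to_one (slice C X) (pullback_module C f N) z : Hom (slice C X) z (Pb (gob N))"
  "ptr f (gob N) (gzero (pullback_module C f N) \<bullet>\<^bsub>slice C X\<^esub> to_one (slice C X) (pullback_module C f N) z) =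
   gzero N \<bullet>\<^bsub>slice C Y\<^esub> to_one (slice C Y) N (f \<bullet> z)"
proof -
 interpret X: category "slice C X" using category_slice by (simp add: category_def)
 interpret Y: category "slice C Y" using category_slice by (simp add: category_def)
 let ?N = "pullback_module C f N"
 have q: "gone N : Obj (slice C Y)" using N(1) by (auto simp: is_terminal_def)
 have gp: "gone ?N = Pb (gone N)" "gzero ?N = far (pullback_functor C f) (gzero N)"
  by (simp_all add: pullback_module_def map_grp_obj_def pullback_functor_def)
 have fz: "f \<bullet> z : Obj (slice C Y)" using comp_Hom[OF f, of z "Dom C z"] z by (auto simp: Hom_iff)
 have ex1: "\<exists>!u. u : Hom (slice C Y) (f \<bullet> z) (gone N)" using N(1) fz unfolding is_terminal_def by blast
 have w: "to_one (slice C Y) N (f \<bullet> z) : Hom (slice C Y) (f \<bullet> z) (gone N)" (is "?w : _")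
  unfolding to_one_def by (rule theI'[OF ex1])
 have wz: "?w = (f \<bullet> z, fst (snd ?w), gone N)" using w slice_HomD(1) by blast
 define v where "v = (z, pb_lift C f (gone N) z (fst (snd ?w)), Pb (gone N))"
 have v: "v : Hom (slice C X) z (Pb (gone N))" "ptr f (gone N) v = ?w"
  using ptr_lift[OF q z] w wz unfolding v_def by metis+
 have "to_one (slice C X) ?N z = v"
  unfolding to_one_def gp
 proof (rule the_equality)
  fix u assume u: "u : Hom (slice C X) z (Pb (gone N))"
  thus "u = v" using ptr_Hom[OF q u] ex1 w v by (intro ptr_inj[OF q u v(1)]) metis
 qed (rule v(1))
 thus "gzero ?N \<bullet>\<^bsub>slice C X\<^esub> to_one (slice C X) ?N z : Hom (slice C X) z (Pb (gob N))"
  "ptr f (gob N) (gzero ?N \<bullet>\<^bsub>slice C X\<^esub> to_one (slice C X) ?N z) = gzero N \<bullet>\<^bsub>slice C Y\<^esub> ?w"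
  using X.comp_Hom[OF ptr_far(1)[OF N(2) v(1)] v(1)] ptr_far(2)[OF N(2) v(1)] v(2) unfolding gp by simp_all
qed

end

end

subsection \<open>Derivations into restricted modules\<close>

context module_setup
begin

abbreviation SA :: "'i => ('u alg_hom, 'u alg_hom \<times> 'u alg_hom \<times> 'u alg_hom) cat" where
 "SA j \<equiv> slice (Alg T) (fob A j)"

lemma SA_Hom:
 "b : Hom (SA j) c d \<longleftrightarrow> b = (c, fst (snd b), d) & c : HA (fst c) (fob A j) & d : HA (fst d) (fob A j) &
  fst (snd b) : HA (fst c) (fst d) & (\<forall>x\<in>fst (fst c). afn d (afn (fst (snd b)) x) = afn c x)"
 (is "?L \<longleftrightarrow> ?R")
proof
 assume L: ?L
 hence R: "b = (c, fst (snd b), d)" "c : HA (fst c) (fob A j)" "d : HA (fst d) (fob A j)"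
  "fst (snd b) : HA (fst c) (fst d)" "d \<cdot> fst (snd b) = c"
  unfolding slice_Hom by (auto simp: Hom_iff)
 thus ?R using afn_comp[OF R(4)] by metis
next
 assume R: ?R
 hence h: "c : HA (fst c) (fob A j)" "d : HA (fst d) (fob A j)" "fst (snd b) : HA (fst c) (fst d)"
  by blast+
 have e: "d \<cdot> fst (snd b) = c"
  using R by (intro Alg_arr_eqI[OF Alg.comp_Hom[OF h(2,3)] h(1)]) (simp add: afn_comp[OF h(3)])
 obtain u where u: "b = (c, u, d)" "fst (snd b) = u" using R by metis
 show ?L using h e unfolding u(2) unfolding u(1) slice_Hom by (simp add: Hom_iff)
qed

lemma at_Obj: "p : Obj SL ==> j : Obj I ==> component p j : HA (fob (fst p) j) (fob A j)"
 unfolding Obj_SL by (rule DA_HomD(6))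

lemma fst_at: "p : Obj SL ==> j : Obj I ==> fst (component p j) = fob (fst p) j"
 using at_Obj[of p j] by (simp add: Hom_iff)

lemma at_ar:
 assumes t: "t : Hom SL p q" and j: "j : Obj I"
 shows "far (eval_slice j) t : Hom (SA j) (component p j) (component q j)"
  "afn (fst (snd (far (eval_slice j) t))) = sf t j" "fst (far (eval_slice j) t) = component p j"
proof -
 note o = SL.Hom_Obj[OF t]
 have e: "far (eval_slice j) t = (component p j, component (fst (snd t)) j, component q j)"
  by (subst SL_HomD(1)[OF t]) (simp add: eval_slice_def)
 show "far (eval_slice j) t : Hom (SA j) (component p j) (component q j)"
  unfolding SA_Hom e fst_at[OF o(1) j] fst_at[OF o(2) j]
  using at_Obj[OF o(1) j] at_Obj[OF o(2) j] DA_HomD(6)[OF SL_HomD(4)[OF t] j] sf_over[OF t j]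
  by (simp add: sf_def tf_def U_def)
 show "afn (fst (snd (far (eval_slice j) t))) = sf t j" "fst (far (eval_slice j) t) = component p j"
  by (simp_all add: e sf_def tf_def)
qed

lemma module_at_simps:
 "gob (module_at M j) = component (gob M) j" "gone (module_at M j) = component (gone M) j"
 "gpr1 (module_at M j) = far (eval_slice j) (gpr1 M)" "gpr2 (module_at M j) = far (eval_slice j) (gpr2 M)"
 "gadd (module_at M j) = far (eval_slice j) (gadd M)" "gzero (module_at M j) = far (eval_slice j) (gzero M)"
 by (simp_all add: module_at_def map_grp_obj_def eval_slice_def)

lemma SA_comp: "b : Hom (SA j) c d ==> x : fst (fst c) ==>
  afn (fst (snd (b' \<bullet>\<^bsub>SA j\<^esub> b))) x = afn (fst (snd b')) (afn (fst (snd b)) x)"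
 using afn_comp[of "fst (snd b)" "fst c" "fst d" x] by (simp add: SA_Hom)

lemma SA_eqI:
 assumes "b : Hom (SA j) c d" "b' : Hom (SA j) c d" "!!x. x : fst (fst c) ==> afn (fst (snd b)) x = afn (fst (snd b')) x"
 shows "b = b'"
 using assms Alg_arr_eqI[of "fst (snd b)" "fst c" "fst d" "fst (snd b')"] unfolding SA_Hom by metis

lemma at_mob: "j : Obj I ==> component (gob M) j : HA (fob Mob j) (fob A j)"
 "j : Obj I ==> fst (component (gob M) j) = fob Mob j" "afn (component (gob M) j) = pim j"
 unfolding Mob_def pim_def tf_def using at_Obj[OF gob(1)] fst_at[OF gob(1)] by auto

lemma at_HomI:
 assumes p: "p : Obj SL" and j: "j : Obj I" and c: "c : HA B (fob A j)" and w: "ahom B (fob (fst p) j) w"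
  and o: "!!x. x : fst B ==> tf p j (w x) = afn c x"
 shows "(c, mkarr B (fob (fst p) j) w, component p j) : Hom (SA j) c (component p j)"
proof -
 have B: "B : algs" "fst c = B" using Alg_HomD(2)[OF c] c by (auto simp: Hom_iff)
 have P: "fob (fst p) j : algs" using at_Obj[OF p j] by (rule Alg_HomD(2))
 show ?thesis
  unfolding SA_Hom fst_at[OF p j] B(2)
  using c at_Obj[OF p j] mkarr_Hom[OF B(1) P w] o by (simp add: tf_def afn_mkarr B(2))
qed

lemma at_Hom_mob:
 assumes j: "j : Obj I" and f: "f : Hom (SA j) c (component (gob M) j)"
 shows "ahom (fst c) (fob Mob j) (afn (fst (snd f)))" "x : fst (fst c) ==> pim j (afn (fst (snd f)) x) = afn c x"
  "fst c : algs" "c : HA (fst c) (fob A j)"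
 using f Alg_HomD(2,4) unfolding SA_Hom at_mob(2)[OF j] at_mob(3) by blast+

text \<open>Evaluation at \<open>j\<close> preserves the product: \<open>pair_lift\<close> supplies
  pairings out of every algebra over \<open>A(j)\<close>, and \<open>pair_inj\<close> their
  uniqueness. The addition of \<open>M(j)\<close> is thereby the fibrewise one.\<close>

lemma at_product_plus:
 assumes j: "j : Obj I"
 shows "is_product (SA j) (component (gob M) j) (component (gob M) j) (gpr1 (module_at M j)) (gpr2 (module_at M j))"
  and "f : Hom (SA j) c (component (gob M) j) ==> g : Hom (SA j) c (component (gob M) j) ==> x : fst (fst c) ==>
   afn (fst (snd (plus_arr (SA j) (module_at M j) f g))) x = afn (fst (snd f)) x \<otimes>\<^bsub>fibg j (afn c x)\<^esub> afn (fst (snd g)) x"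
proof -
 interpret S: category "SA j" using Alg.category_slice by (simp add: category_def)
 let ?N = "module_at M j"
 note g1 = at_ar[OF gpr(1) j] and g2 = at_ar[OF gpr(2) j]
 have D: "Dom (SA j) (gpr1 ?N) = component Pob j" by (simp add: module_at_simps g1(3))
 have main: "\<exists>!u. u : Hom (SA j) c (component Pob j) & gpr1 ?N \<bullet>\<^bsub>SA j\<^esub> u = f & gpr2 ?N \<bullet>\<^bsub>SA j\<^esub> u = g" (is ?E1)
  "!!x u. u : Hom (SA j) c (component Pob j) ==> gpr1 ?N \<bullet>\<^bsub>SA j\<^esub> u = f ==> gpr2 ?N \<bullet>\<^bsub>SA j\<^esub> u = g ==> x : fst (fst c) ==>
   afn (fst (snd (gadd ?N \<bullet>\<^bsub>SA j\<^esub> u))) x = afn (fst (snd f)) x \<otimes>\<^bsub>fibg j (afn c x)\<^esub> afn (fst (snd g)) x"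
  if f: "f : Hom (SA j) c (component (gob M) j)" and g: "g : Hom (SA j) c (component (gob M) j)" for c f g
 proof -
  note f' = at_Hom_mob[OF j f] and g' = at_Hom_mob[OF j g]
  obtain w where w: "ahom (fst c) (fob (fst Pob) j) w" "!!x. x : fst (fst c) ==> sf (gpr1 M) j (w x) = afn (fst (snd f)) x &
    sf (gpr2 M) j (w x) = afn (fst (snd g)) x & sf (gadd M) j (w x) = afn (fst (snd f)) x \<otimes>\<^bsub>fibg j (afn c x)\<^esub> afn (fst (snd g)) x"
   using pair_lift[OF f'(3) j f'(1) g'(1) f'(2) g'(2)] by blast
  let ?u = "(c, mkarr (fst c) (fob (fst Pob) j) w, component Pob j)"
  have wi: "w x : U (fst Pob) j" if "x : fst (fst c)" for x using ahom_in[OF w(1) that] by (simp add: U_def)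
  have u: "?u : Hom (SA j) c (component Pob j)"
  proof (rule at_HomI[OF Pob(1) j f'(4) w(1)])
   fix x assume x: "x : fst (fst c)"
   show "tf Pob j (w x) = afn c x"
    using sf_over[OF gpr(1) j wi[OF x]] w(2)[OF x] f'(2)[OF x] by (simp add: pim_def)
  qed
  have uw: "afn (fst (snd ?u)) x = w x" if "x : fst (fst c)" for x using that by (simp add: afn_mkarr)
  have u1: "gpr1 ?N \<bullet>\<^bsub>SA j\<^esub> ?u = f"
   unfolding module_at_simps
   by (rule SA_eqI[OF S.comp_Hom[OF g1(1) u] f]) (use w(2) in \<open>simp only: SA_comp[OF u] uw g1(2)\<close>)
  have u2: "gpr2 ?N \<bullet>\<^bsub>SA j\<^esub> ?u = g"
   unfolding module_at_simps
   by (rule SA_eqI[OF S.comp_Hom[OF g2(1) u] g]) (use w(2) in \<open>simp only: SA_comp[OF u] uw g2(2)\<close>)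
  have uniq: "v = ?u" if v: "v : Hom (SA j) c (component Pob j)" "gpr1 ?N \<bullet>\<^bsub>SA j\<^esub> v = f" "gpr2 ?N \<bullet>\<^bsub>SA j\<^esub> v = g" for v
  proof (rule SA_eqI[OF v(1) u])
   fix x assume x: "x : fst (fst c)"
   have vi: "afn (fst (snd v)) x : U (fst Pob) j"
    using v(1) x Alg_HomD(5) unfolding SA_Hom fst_at[OF Pob(1) j] U_def by blast
   have "sf (gpr1 M) j (afn (fst (snd v)) x) = afn (fst (snd f)) x" "sf (gpr2 M) j (afn (fst (snd v)) x) = afn (fst (snd g)) x"
    using SA_comp[OF v(1) x, of "gpr1 ?N", unfolded v(2)] SA_comp[OF v(1) x, of "gpr2 ?N", unfolded v(3)]
    unfolding module_at_simps g1(2) g2(2) by simp_all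
   thus "afn (fst (snd v)) x = afn (fst (snd ?u)) x"
    unfolding uw[OF x] using w(2)[OF x] by (intro pair_inj[OF j vi wi[OF x]]) auto
  qed
  show ?E1 using u u1 u2 uniq by blast
  show "afn (fst (snd (gadd ?N \<bullet>\<^bsub>SA j\<^esub> v))) x = afn (fst (snd f)) x \<otimes>\<^bsub>fibg j (afn c x)\<^esub> afn (fst (snd g)) x"
   if v: "v : Hom (SA j) c (component Pob j)" "gpr1 ?N \<bullet>\<^bsub>SA j\<^esub> v = f" "gpr2 ?N \<bullet>\<^bsub>SA j\<^esub> v = g" and x: "x : fst (fst c)" for x v
   unfolding uniq[OF v] SA_comp[OF u x] uw[OF x] using w(2)[OF x] by (simp add: module_at_simps at_ar(2)[OF gadd j])
 qed
 show "is_product (SA j) (component (gob M) j) (component (gob M) j) (gpr1 (module_at M j)) (gpr2 (module_at M j))"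
  unfolding is_product_def D using main(1) g1(1) g2(1) unfolding module_at_simps by blast
 assume f: "f : Hom (SA j) c (component (gob M) j)" and g: "g : Hom (SA j) c (component (gob M) j)" and x: "x : fst (fst c)"
 have "Dom (SA j) f = c" using f by (simp add: Hom_iff)
 hence "pairing (SA j) ?N f g = (THE u. u : Hom (SA j) c (component Pob j) & gpr1 ?N \<bullet>\<^bsub>SA j\<^esub> u = f & gpr2 ?N \<bullet>\<^bsub>SA j\<^esub> u = g)"
  unfolding pairing_def D by simp
 hence "pairing (SA j) ?N f g : Hom (SA j) c (component Pob j) & gpr1 ?N \<bullet>\<^bsub>SA j\<^esub> pairing (SA j) ?N f g = f &
   gpr2 ?N \<bullet>\<^bsub>SA j\<^esub> pairing (SA j) ?N f g = g"
  using theI'[OF main(1)[OF f g]] by simp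
 thus "afn (fst (snd (plus_arr (SA j) (module_at M j) f g))) x = afn (fst (snd f)) x \<otimes>\<^bsub>fibg j (afn c x)\<^esub> afn (fst (snd g)) x"
  unfolding plus_arr_def using main(2)[OF f g _ _ _ x] by blast
qed

lemma at_terminal_zero:
 assumes j: "j : Obj I"
 shows "is_terminal (SA j) (gone (module_at M j))"
  and "c : Obj (SA j) ==> x : fst (fst c) ==>
   afn (fst (snd (gzero (module_at M j) \<bullet>\<^bsub>SA j\<^esub> to_one (SA j) (module_at M j) c))) x = \<one>\<^bsub>fibg j (afn c x)\<^esub>"
proof -
 let ?N = "module_at M j"
 have main: "\<exists>!u. u : Hom (SA j) c (component (gone M) j)" (is ?E1)
  "!!x u. u : Hom (SA j) c (component (gone M) j) ==> x : fst (fst c) ==>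
   afn (fst (snd (gzero ?N \<bullet>\<^bsub>SA j\<^esub> u))) x = \<one>\<^bsub>fibg j (afn c x)\<^esub>" if c: "c : Obj (SA j)" for c
 proof -
  have c': "c : HA (fst c) (fob A j)" using c by (simp add: Hom_iff)
  obtain w where w: "ahom (fst c) (fob (fst (gone M)) j) w"
   "!!x. x : fst (fst c) ==> tf (gone M) j (w x) = afn c x & sf (gzero M) j (w x) = \<one>\<^bsub>fibg j (afn c x)\<^esub>"
   using zero_lift[OF Alg_HomD(2)[OF c'] j Alg_HomD(4)[OF c']] by blast
  let ?u = "(c, mkarr (fst c) (fob (fst (gone M)) j) w, component (gone M) j)"
  have u: "?u : Hom (SA j) c (component (gone M) j)"
   using w by (intro at_HomI[OF gone_Obj(1) j c' w(1)]) blast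
  have uw: "afn (fst (snd ?u)) x = w x" if "x : fst (fst c)" for x using that by (simp add: afn_mkarr)
  have uniq: "v = ?u" if v: "v : Hom (SA j) c (component (gone M) j)" for v
  proof (rule SA_eqI[OF v u])
   fix x assume x: "x : fst (fst c)"
   have vi: "afn (fst (snd v)) x : U (fst (gone M)) j"
    using v x Alg_HomD(5) unfolding SA_Hom fst_at[OF gone_Obj(1) j] U_def by blast
   have "tf (gone M) j (afn (fst (snd v)) x) = afn c x" using v x unfolding SA_Hom tf_def by blast
   thus "afn (fst (snd v)) x = afn (fst (snd ?u)) x"
    unfolding uw[OF x] using w(2)[OF x] ahom_in[OF w(1) x] by (intro gone_inj[OF j vi]) (auto simp: U_def)
  qed
  show ?E1 using u uniq by blast
  show "afn (fst (snd (gzero ?N \<bullet>\<^bsub>SA j\<^esub> v))) x = \<one>\<^bsub>fibg j (afn c x)\<^esub>"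
   if v: "v : Hom (SA j) c (component (gone M) j)" and x: "x : fst (fst c)" for x v
   unfolding uniq[OF v] SA_comp[OF u x] uw[OF x] using w(2)[OF x] by (simp add: module_at_simps at_ar(2)[OF MA.gzero j])
 qed
 show "is_terminal (SA j) (gone ?N)"
  unfolding is_terminal_def module_at_simps using main(1) at_Obj[OF gone_Obj(1) j] by (auto simp: Hom_iff)
 assume c: "c : Obj (SA j)" and x: "x : fst (fst c)"
 have "to_one (SA j) ?N c : Hom (SA j) c (component (gone M) j)"
  unfolding to_one_def module_at_simps by (rule theI'[OF main(1)[OF c]])
 thus "afn (fst (snd (gzero ?N \<bullet>\<^bsub>SA j\<^esub> to_one (SA j) ?N c))) x = \<one>\<^bsub>fibg j (afn c x)\<^esub>"
  using main(2)[OF c _ x] by blast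
qed

end

text \<open>Applied to complexes whose terms are embedded as subgroups, so that every denominator is
  zero and cohomology is cocycles modulo coboundaries in the additive type.\<close>

lemma cohomology_presents:
 fixes de :: "nat => 'a => 'a::ab_group_add"
 assumes P: "!!n. presents (S n) {0} (f n) (K n)" and a: "!!n. addmap (de n)"
  and in_S: "!!n x. x : S n ==> de n x : S (Suc n)"
  and sq: "!!n x. x : S n ==> de (Suc n) (de n x) = 0"
  and d: "!!n x. x : S n ==> d n (f n x) = f (Suc n) (de n x)"
 shows "presents {x : S n. de n x = 0} (case n of 0 => {0} | Suc m => de m ` S m)
   (%x. coboundaries K d n #>\<^bsub>K n\<^esub> f n x) (cohomology K d n)"
  and "coboundaries K d n = f n ` (case n of 0 => {0} | Suc m => de m ` S m)"
proof -
 have r: "B #>\<^bsub>K n\<lparr>carrier := X\<rparr>\<^esub> y = B #>\<^bsub>K n\<^esub> y" for B X y n by (simp add: r_coset_def)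
 show "coboundaries K d n = f n ` (case n of 0 => {0} | Suc m => de m ` S m)"
 proof (cases n)
  case 0
  thus ?thesis using presents_zero(1)[OF P] by (simp add: coboundaries_def)
 next
  case (Suc m)
  have "d m ` f m ` S m = f (Suc m) ` de m ` S m" using d by force
  thus ?thesis using Suc presentsD(4)[OF P, of m] by (simp add: coboundaries_def)
 qed
 show "presents {x : S n. de n x = 0} (case n of 0 => {0} | Suc m => de m ` S m)
   (%x. coboundaries K d n #>\<^bsub>K n\<^esub> f n x) (cohomology K d n)"
 proof (cases n)
  case 0
  \<comment> \<open>A trivial group in degree \<open>-1\<close>, so that degree \<open>0\<close>
    also fits \<open>presents_homology\<close>.\<close>
  have "\<exists>G. presents {0 :: 'a} {0} (%_. undefined :: 'b) G" by (rule presents_any) (auto simp: subgp_trivial)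
  then obtain G :: "'b monoid" where G: "presents {0 :: 'a} {0} (%_. undefined) G" by blast
  have "carrier G \<noteq> {}" using presentsD(4)[OF G] by auto
  hence "(%_. \<one>\<^bsub>K 0\<^esub>) ` carrier G = coboundaries K d 0" by (auto simp: coboundaries_def)
  moreover have "addmap (%x :: 'a. 0 :: 'a)" by unfold_locales simp
  ultimately show ?thesis
   using presents_homology[OF G P[of 0] P[of 1], of "%_. 0" "de 0" "%_. \<one>\<^bsub>K 0\<^esub>" "d 0"] a[of 0] in_S[of _ 0] d[of _ 0]
    addmap.zero[OF a] presents_zero(1)[OF P] subgp_zero[OF presentsD(1)[OF P]] 0
   by (simp add: cohomology_def r)
 next
  case (Suc m)
  have e: "{n + de m x |n x. n : {0} & x : S m} = de m ` S m" by auto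
  have e': "{x : S (Suc m). de (Suc m) x : {0}} = {x : S (Suc m). de (Suc m) x = 0}" by auto
  have "presents {x : S (Suc m). de (Suc m) x : {0}} {n + de m x |n x. n : {0} & x : S m}
   (%x. d m ` carrier (K m) #>\<^bsub>K (Suc m)\<lparr>carrier := kernel (K (Suc m)) (K (Suc (Suc m))) (d (Suc m))\<rparr>\<^esub> f (Suc m) x)
   (K (Suc m)\<lparr>carrier := kernel (K (Suc m)) (K (Suc (Suc m))) (d (Suc m))\<rparr> Mod d m ` carrier (K m))"
   by (rule presents_homology[OF P P P a a]) (auto intro: in_S simp: sq d addmap.zero[OF a])
  thus ?thesis unfolding e e' r by (simp add: Suc cohomology_def coboundaries_def)
 qed
qed

lemma cohomology_map_presents:
 assumes P: "presents S N0 f H" and P': "presents S' N0' f' H'" and N: "N \<subseteq> S" "subgp N" and N': "N' \<subseteq> S'" "subgp N'"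
  and ph: "addmap ph" "ph ` S \<subseteq> S'" "ph ` N \<subseteq> N'" and h: "!!x. x : S ==> h (f x) = f' (ph x)" and x: "x : S"
 shows "(f' ` N') <#>\<^bsub>H'\<^esub> (h ` (f ` N #>\<^bsub>H\<^esub> f x)) = f' ` N' #>\<^bsub>H'\<^esub> f' (ph x)"
proof -
 have fx: "ph x : S'" using ph(2) x by blast
 have "h ` (f ` N #>\<^bsub>H\<^esub> f x) = (%y. f' (ph y + ph x)) ` N"
 proof -
  have "f y \<otimes>\<^bsub>H\<^esub> f x = f (y + x)" "h (f (y + x)) = f' (ph y + ph x)" if "y : N" for y
   using presentsD(6)[OF P _ x] h[OF subgp_add[OF presentsD(1)[OF P] _ x]] addmap.add[OF ph(1)] N(1) that by auto
  thus ?thesis by (auto simp: r_coset_def image_iff)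
 qed
 hence "(f' ` N') <#>\<^bsub>H'\<^esub> (h ` (f ` N #>\<^bsub>H\<^esub> f x)) = (\<Union>y'\<in>N'. \<Union>y\<in>N. {f' (y' + (ph y + ph x))})"
  using presentsD(6)[OF P'] N'(1) ph(2) N(1) fx subgp_add[OF presentsD(1)[OF P']]
  by (auto simp: set_mult_def subset_iff image_subset_iff)
 also have "... = (\<Union>y'\<in>N'. {f' (y' + ph x)})"
 proof
  show "(\<Union>y'\<in>N'. \<Union>y\<in>N. {f' (y' + (ph y + ph x))}) \<subseteq> (\<Union>y'\<in>N'. {f' (y' + ph x)})"
   using subgp_add[OF N'(2)] ph(3) by (force simp: add.assoc[symmetric])
  show "(\<Union>y'\<in>N'. {f' (y' + ph x)}) \<subseteq> (\<Union>y'\<in>N'. \<Union>y\<in>N. {f' (y' + (ph y + ph x))})"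
   using subgp_zero[OF N(2)] addmap.zero[OF ph(1)] by force
 qed
 also have "... = f' ` N' #>\<^bsub>H'\<^esub> f' (ph x)"
  using presentsD(6)[OF P' _ fx] N'(1) by (simp add: r_coset_def subset_iff cong: SUP_cong)
 finally show ?thesis .
qed

section \<open>Derivations into restricted modules as functions into the fibres of
  \<open>M(j)\<close>\<close>

context module_setup
begin

abbreviation Rm :: "'k => 'u alg_hom module_obj" where
 "Rm al \<equiv> restricted_module I (Alg T) A M al"

definition tr where
 "tr al = Alg.ptr (far A al) (component (gob M) (Cod I al))"

text \<open>The transpose of \<open>a\<close> along the pullback, read as a function into fibres. It
  makes derivations into a restricted module the same data as the cochains of the double
  complex.\<close>

definition dere where
 "dere al a = demb (Cod I al) (fst (fst (fst a))) (%x. Bf A al (afn (fst a) x)) (afn (fst (snd (tr al a))))"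

lemma restrict_pullback:
 assumes al: "al : Hom I i j"
 shows "\<forall>q\<in>Obj (SA j). is_pullback (Alg T) (far A al) q (fst (pullback (Alg T) (far A al) q)) (snd (pullback (Alg T) (far A al) q))"
 by (intro ballI pullback_pullback[OF diag_ar[OF A_diag al], of _ "fst _"]) (auto simp: Hom_iff)

lemma mob_Obj: "j : Obj I ==> component (gob M) j : Obj (SA j)"
 using at_mob(1)[of j] by (auto simp: Hom_iff)

lemma Rm_eq:
 assumes al: "al : Hom I i j"
 shows "Rm al = pullback_module (Alg T) (far A al) (module_at M j)"
  "gob (Rm al) = fst (pullback (Alg T) (far A al) (component (gob M) j))"
 using al by (simp_all add: restricted_module_def pullback_module_def map_grp_obj_def pullback_functor_def module_at_simps Hom_iff)

lemma Der_carrier: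
 "al : Hom I i j ==> carrier (Der (Alg T) (fob A i) c (Rm al)) = Hom (SA i) c (fst (pullback (Alg T) (far A al) (component (gob M) j)))"
 by (simp add: Der_def hom_grp_def Rm_eq(2))

context
 fixes al i j
 assumes al: "al : Hom I i j"
begin

lemmas transpose = diag_ar[OF A_diag al] restrict_pullback[OF al]

lemma j_Obj: "j : Obj I"
 by (rule I.Hom_Obj(2)[OF al])

lemma tr_eq: "tr al a = Alg.ptr (far A al) (component (gob M) j) a"
 using al by (simp add: tr_def Hom_iff)

lemma far_comp:
 assumes "c : HA z (fob A i)"
 shows "fst (far A al \<cdot> c) = z" "x : fst z ==> afn (far A al \<cdot> c) x = Bf A al (afn c x)"
 using Alg.comp_Hom[OF transpose(1) assms] afn_comp[OF assms] by (auto simp: Hom_iff Bf_def)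

lemma der_over: "c : HA z (fob A i) ==> over j z (%x. Bf A al (afn c x))"
 unfolding over_def
 using j_Obj Alg_HomD[of c z "fob A i"] Bf_ahom[OF A_diag al] diag_ob[OF A_diag j_Obj] by (blast intro: ahom_comp)

lemma dere:
 assumes c: "c : HA z (fob A i)" and a: "a : carrier (Der (Alg T) (fob A i) c (Rm al))"
 shows "dere al a = demb j (fst z) (%x. Bf A al (afn c x)) (afn (fst (snd (tr al a))))"
  "dfun j z (%x. Bf A al (afn c x)) (afn (fst (snd (tr al a))))"
  "tr al a : Hom (SA j) (far A al \<cdot> c) (component (gob M) j)"
proof -
 have "fst a = c" "fst c = z" using a c unfolding Der_carrier[OF al] by (auto simp: Hom_iff)
 thus "dere al a = demb j (fst z) (%x. Bf A al (afn c x)) (afn (fst (snd (tr al a))))"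
  using al by (simp add: dere_def Hom_iff)
 show t: "tr al a : Hom (SA j) (far A al \<cdot> c) (component (gob M) j)"
  unfolding tr_eq by (rule Alg.ptr_Hom[OF transpose mob_Obj[OF j_Obj] a[unfolded Der_carrier[OF al]]])
 show "dfun j z (%x. Bf A al (afn c x)) (afn (fst (snd (tr al a))))"
  using at_Hom_mob(1,2)[OF j_Obj t] far_comp[OF c] by (simp add: dfun_def)
qed

lemma dere_ex:
 assumes c: "c : HA z (fob A i)" and w: "dfun j z (%x. Bf A al (afn c x)) w"
 shows "\<exists>a\<in>carrier (Der (Alg T) (fob A i) c (Rm al)). dere al a = demb j (fst z) (%x. Bf A al (afn c x)) w"
proof -
 let ?k = "mkarr z (fob Mob j) w" and ?q = "component (gob M) j"
 have b: "(far A al \<cdot> c, ?k, ?q) : Hom (SA j) (far A al \<cdot> c) ?q"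
  using w far_comp[OF c] unfolding Mob_def
  by (intro at_HomI[OF gob(1) j_Obj Alg.comp_Hom[OF transpose(1) c]]) (auto simp: dfun_def Mob_def pim_def)
 have "c : Obj (SA i)" using c by (simp add: Hom_iff)
 note l = Alg.ptr_lift[OF transpose mob_Obj[OF j_Obj] this b]
 from dere(1)[OF c, unfolded Der_carrier[OF al], OF l(1)]
 show ?thesis
  using l unfolding Der_carrier[OF al] tr_eq l(2)
  by (intro bexI[OF _ l(1)]) (auto intro!: demb_cong simp: afn_mkarr)
qed

text \<open>\<open>dere\<close> is injective because transposition and \<open>demb\<close> are, and
  additive because addition in the pullback transposes to fibre multiplication.\<close>

lemma presents_Der:
 assumes c: "c : HA z (fob A i)"
 shows "presents (derv j z (%x. Bf A al (afn c x))) {0} (inv_into (carrier (Der (Alg T) (fob A i) c (Rm al))) (dere al))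
  (Der (Alg T) (fob A i) c (Rm al))"
proof (rule presents_embedding)
 let ?D = "Der (Alg T) (fob A i) c (Rm al)"
 note o = der_over[OF c]
 have c': "c : Obj (SA i)" using c by (simp add: Hom_iff)
 have fz: "fst (fst (far A al \<cdot> c)) = fst z" using far_comp(1)[OF c] by simp
 show "subgp (derv j z (%x. Bf A al (afn c x)))" by (rule derv_subgp[OF o])
 show "dere al ` carrier ?D = derv j z (%x. Bf A al (afn c x))"
 proof
  show "dere al ` carrier ?D \<subseteq> derv j z (%x. Bf A al (afn c x))" using dere[OF c] by (auto simp: derv_def)
  show "derv j z (%x. Bf A al (afn c x)) \<subseteq> dere al ` carrier ?D"
  proof
   fix ph assume "ph : derv j z (%x. Bf A al (afn c x))"
   then obtain w where w: "ph = demb j (fst z) (%x. Bf A al (afn c x)) w" "dfun j z (%x. Bf A al (afn c x)) w"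
    unfolding derv_def by blast
   thus "ph : dere al ` carrier ?D" using dere_ex[OF c w(2)] by (metis imageI)
  qed
 qed
 show "inj_on (dere al) (carrier ?D)"
 proof
  fix a b assume a: "a : carrier ?D" and b: "b : carrier ?D" and e: "dere al a = dere al b"
  have "tr al a = tr al b"
   using demb_inj[OF o dere(2)[OF c a] dere(2)[OF c b]] e dere(1)[OF c a] dere(1)[OF c b]
   by (intro SA_eqI[OF dere(3)[OF c a] dere(3)[OF c b]]) (simp add: fz)
  note e' = this[unfolded tr_eq]
  show "a = b"
   by (rule Alg.ptr_inj[OF transpose mob_Obj[OF j_Obj] a[unfolded Der_carrier[OF al]] b[unfolded Der_carrier[OF al]] e'])
 qed
 have ga: "gadd (module_at M j) : Hom (SA j) (Dom (SA j) (gpr1 (module_at M j))) (gob (module_at M j))"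
  using at_ar(1)[OF gadd j_Obj] at_ar(3)[OF gpr(1) j_Obj] by (simp add: module_at_simps)
 have gz: "gzero (module_at M j) : Hom (SA j) (gone (module_at M j)) (gob (module_at M j))"
  using at_ar(1)[OF MA.gzero j_Obj] by (simp add: module_at_simps)
 have prod: "is_product (SA j) (gob (module_at M j)) (gob (module_at M j)) (gpr1 (module_at M j)) (gpr2 (module_at M j))"
  using at_product_plus(1)[OF j_Obj] by (simp add: module_at_simps)
 show "a \<otimes>\<^bsub>?D\<^esub> b : carrier ?D & dere al (a \<otimes>\<^bsub>?D\<^esub> b) = dere al a + dere al b"
  if a: "a : carrier ?D" and b: "b : carrier ?D" for a b
 proof -
  have m: "a \<otimes>\<^bsub>?D\<^esub> b = plus_arr (SA i) (pullback_module (Alg T) (far A al) (module_at M j)) a b"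
   by (simp add: Der_def hom_grp_def Rm_eq(1)[OF al])
  note p = Alg.ptr_plus[OF transpose prod ga, unfolded module_at_simps, OF a[unfolded Der_carrier[OF al]] b[unfolded Der_carrier[OF al]], folded m]
  have ab: "a \<otimes>\<^bsub>?D\<^esub> b : carrier ?D" using p(1) unfolding Der_carrier[OF al] .
  have "afn (fst (snd (tr al (a \<otimes>\<^bsub>?D\<^esub> b)))) x = afn (fst (snd (tr al a))) x \<otimes>\<^bsub>fibg j (Bf A al (afn c x))\<^esub> afn (fst (snd (tr al b))) x"
   if "x : fst z" for x
   using at_product_plus(2)[OF j_Obj dere(3)[OF c a] dere(3)[OF c b], of x] that far_comp(2)[OF c that] p(2)
   unfolding tr_eq fz by simp
  hence "dere al (a \<otimes>\<^bsub>?D\<^esub> b) = dere al a + dere al b"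
   unfolding dere(1)[OF c ab] dere(1)[OF c a] dere(1)[OF c b] dfun_add(2)[OF o dere(2)[OF c a] dere(2)[OF c b], symmetric]
   by (intro demb_cong) auto
  thus ?thesis using ab by blast
 qed
 have o1: "\<one>\<^bsub>?D\<^esub> = gzero (pullback_module (Alg T) (far A al) (module_at M j)) \<bullet>\<^bsub>SA i\<^esub>
   to_one (SA i) (pullback_module (Alg T) (far A al) (module_at M j)) c"
  by (simp only: Der_def hom_grp_def Rm_eq(1)[OF al] monoid.simps)
 note p = Alg.ptr_one[OF transpose at_terminal_zero(1)[OF j_Obj] gz c', folded o1, unfolded module_at_simps(1)]
 show one: "\<one>\<^bsub>?D\<^esub> : carrier ?D" using p(1) unfolding Der_carrier[OF al] .
 have "afn (fst (snd (tr al \<one>\<^bsub>?D\<^esub>))) x = \<one>\<^bsub>fibg j (Bf A al (afn c x))\<^esub>" if "x : fst z" for x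
  using at_terminal_zero(2)[OF j_Obj, of "far A al \<cdot> c" x] Alg.comp_Hom[OF transpose(1) c] far_comp(2)[OF c that] that
  unfolding tr_eq p(2) fz by (simp add: Hom_iff)
 thus "dere al \<one>\<^bsub>?D\<^esub> = 0"
  unfolding dere(1)[OF c one] dfun_zero(2)[OF o, symmetric] by (intro demb_cong) auto
qed

lemma dere_comp:
 assumes c: "c : HA z (fob A i)" and g: "g : HA z' z" and c': "c' = c \<cdot> g"
  and a: "a : carrier (Der (Alg T) (fob A i) c (Rm al))"
 shows "a \<bullet>\<^bsub>SA i\<^esub> (c', g, c) : carrier (Der (Alg T) (fob A i) c' (Rm al))"
  "dere al (a \<bullet>\<^bsub>SA i\<^esub> (c', g, c)) = pre (fst z') (afn g) (dere al a)"
proof -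
 interpret S: category "SA i" using Alg.category_slice by (simp add: category_def)
 have c'H: "c' : HA z' (fob A i)" unfolding c' by (rule Alg.comp_Hom[OF c g])
 have a': "a : Hom (SA i) c (fst (pullback (Alg T) (far A al) (component (gob M) j)))" using a unfolding Der_carrier[OF al] .
 have "(c', g, c) : Hom (SA i) c' c" using c c'H g c' unfolding slice_Hom by (auto simp: Hom_iff)
 thus in_D: "a \<bullet>\<^bsub>SA i\<^esub> (c', g, c) : carrier (Der (Alg T) (fob A i) c' (Rm al))"
  unfolding Der_carrier[OF al] by (rule S.comp_Hom[OF a'])
 have u: "fst (snd a) : HA z (fst (fst (pullback (Alg T) (far A al) (component (gob M) j))))"
  using a' c unfolding slice_Hom by (auto simp: Hom_iff)
 note r = Alg.pb_Hom(2)[OF transpose mob_Obj[OF j_Obj]]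
 have "fst (snd (tr al (a \<bullet>\<^bsub>SA i\<^esub> (c', g, c)))) = fst (snd (tr al a)) \<cdot> g"
  using Alg.comp_assoc[OF g u, of _ "fst (component (gob M) j)"] r by (simp add: tr_eq Alg.ptr_def)
 hence t: "afn (fst (snd (tr al (a \<bullet>\<^bsub>SA i\<^esub> (c', g, c))))) x = afn (fst (snd (tr al a))) (afn g x)" if "x : fst z'" for x
  using afn_comp[OF g that] by simp
 have "dere al (a \<bullet>\<^bsub>SA i\<^esub> (c', g, c)) = demb j (fst z') (%x. Bf A al (afn c (afn g x))) (%x. afn (fst (snd (tr al a))) (afn g x))"
  unfolding dere(1)[OF c'H in_D] by (rule demb_cong) (use t afn_comp[OF g] c' in auto)
 also have "... = pre (fst z') (afn g) (dere al a)"
  unfolding dere(1)[OF c a] using Alg_HomD(5)[OF g] by (auto simp: pre_def demb_def)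
 finally show "dere al (a \<bullet>\<^bsub>SA i\<^esub> (c', g, c)) = pre (fst z') (afn g) (dere al a)" .
qed

end

end

subsection \<open>The natural system of cohomology groups\<close>

context comparison
begin

abbreviation KX where "KX al \<equiv> cm_complex (Alg T) GA (fob A (Dom I al)) (Rm al)"
abbreviation DX where "DX al \<equiv> cm_diff (Alg T) GA (fob A (Dom I al)) (Rm al)"
abbreviation fX where "fX al n \<equiv> inv_into (carrier (KX al n)) (dere al)"
abbreviation HX where "HX q \<equiv> cohomology_system I (Alg T) GA A M q"

definition clX where "clX q al x = coboundaries (KX al) (DX al) q #>\<^bsub>KX al q\<^esub> fX al q x"

lemma KX_eq: "al : Hom I i j ==> KX al n = Der (Alg T) (fob A i) (caug (Alg T) GA (fob A i) (Suc n)) (Rm al)"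
 by (simp add: cm_complex_def Hom_iff)

lemma X_Cc: "al : Hom I i j ==> RX.Cc n al = derv j (Xo (Suc n) i) (%x. Bf A al (afn (caug (Alg T) GA (fob A i) (Suc n)) x))"
 by (simp add: RX.Cc_def RX.base_def[abs_def] xaug_def Hom_iff del: caug.simps)

lemma KX_presents:
 assumes al: "al : Hom I i j"
 shows "presents (RX.Cc n al) {0} (fX al n) (KX al n)"
 unfolding X_Cc[OF al] KX_eq[OF al] by (rule presents_Der[OF al caug_Alg[OF I.Hom_Obj(1)[OF al]]])

lemma fX:
 assumes al: "al : Hom I i j" and x: "x : RX.Cc n al"
 shows "fX al n x : carrier (KX al n)" "dere al (fX al n x) = x"
proof -
 obtain w where w: "x = demb j (fst (Xo (Suc n) i)) (%x. Bf A al (afn (caug (Alg T) GA (fob A i) (Suc n)) x)) w"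
  "dfun j (Xo (Suc n) i) (%x. Bf A al (afn (caug (Alg T) GA (fob A i) (Suc n)) x)) w"
  using x unfolding X_Cc[OF al] derv_def by blast
 have "x : dere al ` carrier (KX al n)"
  using dere_ex[OF al caug_Alg[OF I.Hom_Obj(1)[OF al]] w(2)] unfolding KX_eq[OF al] w(1) by (metis imageI)
 thus "fX al n x : carrier (KX al n)" "dere al (fX al n x) = x" by (auto intro: inv_into_into f_inv_into_f)
qed

lemma fX_dere:
 assumes al: "al : Hom I i j" and a: "a : carrier (KX al n)"
 shows "fX al n (dere al a) = a"
proof -
 obtain x where x: "x : RX.Cc n al" "a = fX al n x" using presents_surj[OF KX_presents[OF al] a] by blast
 thus ?thesis using fX(2)[OF al x(1)] by metis
qed

lemma DX_fX:
 assumes al: "al : Hom I i j" and x: "x : RX.Cc n al"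
 shows "DX al n (fX al n x) = fX al (Suc n) (RX.dC n i x)"
proof -
 note i = I.Hom_Obj(1)[OF al]
 note d = I.HomD[OF al]
 let ?c = "caug (Alg T) GA (fob A i)" and ?g = "cface GA (fob A i) (Suc n)"
 let ?t = "%k. fX al n x \<bullet>\<^bsub>SA i\<^esub> (?c (Suc (Suc n)), ?g k, ?c (Suc n))"
 have t: "?t k = fX al (Suc n) (RX.cof n k i x)" if k: "k <= Suc n" for k
 proof -
  have c': "?c (Suc (Suc n)) = ?c (Suc n) \<cdot> ?g k"
   using GX.caug_cface[of "fob A i" k "Suc n"] k diag_ob[OF A_diag i] by simp
  note D = dere_comp[OF al caug_Alg[OF i] cface_Alg[OF i k] c' fX(1)[OF al x, unfolded KX_eq[OF al]], folded KX_eq[OF al]]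
  have "dere al (?t k) = RX.cof n k i x"
   unfolding D(2) fX(2)[OF al x] RX.cof_def by (simp add: xd_def)
  thus ?thesis using fX_dere[OF al D(1)] by simp
 qed
 have "DX al n (fX al n x) = alt_sum (KX al (Suc n)) {0..Suc n} ?t"
  unfolding cm_diff_def d ..
 also have "... = fX al (Suc n) (\<Sum>k\<in>{0..Suc n}. alt k (RX.cof n k i x))"
 proof (rule alt_sum_presents[OF KX_presents[OF al]])
  fix k assume "k : {0..Suc n}"
  hence k: "k <= Suc n" by simp
  show "RX.cof n k i x : RX.Cc (Suc n) al" "?t k = fX al (Suc n) (RX.cof n k i x)"
   by (rule RX.cof_Cc[OF al k x], rule t[OF k])
 qed simp
 finally show ?thesis by (simp add: RX.dC_def atLeast0AtMost del: sum.atMost_Suc)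
qed

lemma clX_presents:
 assumes al: "al : Hom I i j"
 shows "presents (RX.Zc q al) (RX.Bc q al) (clX q al) (fob (HX q) al)"
  and "coboundaries (KX al) (DX al) q = fX al q ` RX.Bc q al"
proof -
 note d = I.HomD[OF al]
 note C = cohomology_presents[where S = "%n. RX.Cc n al" and de = "%n. RX.dC n i" and K = "KX al" and d = "DX al" and n = q,
  OF KX_presents[OF al] RX.dC_add RX.dC_Cc[OF al] RX.dC_dC[OF I.Hom_Obj(1)[OF al]] DX_fX[OF al]]
 show "presents (RX.Zc q al) (RX.Bc q al) (clX q al) (fob (HX q) al)"
  unfolding RX.Zc_def RX.Bc_def using C(1) unfolding clX_def[abs_def] d
  by (simp add: cohomology_system_def cm_cohomology_def d)
 show "coboundaries (KX al) (DX al) q = fX al q ` RX.Bc q al"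
  using C(2) unfolding RX.Bc_def d .
qed

text \<open>A lift to a pullback is determined by its composite with the projection to
  \<open>M(j')\<close>, and this composite is what \<open>dere\<close> records. So the map of the
  natural system becomes \<open>Rc\<close> after \<open>Lc\<close>.\<close>

lemma der_map_fX:
 assumes al: "al : Hom I i j" and bt: "bt : Hom I j j'" and gm: "gm : Hom I i' i" and x: "x : RX.Cc n al"
 shows "der_map I (Alg T) GA A M n al bt gm (fX al n x) = fX (bt \<bullet> al \<bullet> gm) n (RX.Rc n gm (RX.Lc n bt al x))"
proof -
 define al' where "al' = bt \<bullet> al \<bullet> gm"
 note btal = I.comp_Hom[OF bt al]
 note al' = I.comp_Hom[OF btal gm, folded al'_def]
 note o = I.Hom_Obj[OF al] I.Hom_Obj[OF al']
 note d = I.HomD[OF al] I.HomD[OF al'] I.HomD[OF gm]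
 let ?c = "%i. caug (Alg T) GA (fob A i) (Suc n)" and ?q = "%j. component (gob M) j"
 define a where "a = fX al n x"
 have a: "a : carrier (Der (Alg T) (fob A i) (?c i) (Rm al))" "dere al a = x"
  using fX[OF al x] unfolding KX_eq[OF al] a_def by auto
 note D = dere[OF al caug_Alg[OF o(1)] a(1)]
 define r where "r = snd (pullback (Alg T) (far A al) (?q j))"
 define t where "t = fst (snd (tr al a))"
 define u where "u = fst (snd a)"
 have aH: "a : Hom (SA i) (?c i) (fst (pullback (Alg T) (far A al) (?q j)))" using a(1) unfolding Der_carrier[OF al] .
 have a_eq: "a = (?c i, u, fst (pullback (Alg T) (far A al) (?q j)))" using aH unfolding SA_Hom u_def by blast
 have c: "fst (?c i) = Xo (Suc n) i" "fst (?c i') = Xo (Suc n) i'"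
  using caug_Alg[OF o(1), of "Suc n"] caug_Alg[OF o(3), of "Suc n"] by (auto simp: Hom_iff)
 have u: "u : HA (Xo (Suc n) i) (fst (fst (pullback (Alg T) (far A al) (?q j))))"
  using aH unfolding SA_Hom u_def c by blast
 have r: "r : HA (fst (fst (pullback (Alg T) (far A al) (?q j)))) (fob Mob j)"
  using Alg.pb_Hom(2)[OF diag_ar[OF A_diag al] restrict_pullback[OF al] mob_Obj[OF o(2)]] at_mob(2)[OF o(2)] by (simp add: r_def)
 have t: "t = r \<cdot> u" by (simp add: t_def tr_def d Alg.ptr_def r_def u_def)
 have tH: "t : HA (Xo (Suc n) i) (fob Mob j)" unfolding t by (rule Alg.comp_Hom[OF r u])
 note Mbt = diag_ar[OF Mob_diag bt] and g = cpow_ar_Alg[OF gm, of "Suc n"]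
 \<comment> \<open>The composite that \<open>der_map\<close> lifts to the new pullback; fact
   \<open>b\<close> below shows that it lies over \<open>A(j')\<close>, so that the lift
   exists.\<close>
 define k where "k = far Mob bt \<cdot> r \<cdot> u \<cdot> cpow_ar GA (Suc n) (far A gm)"
 have k: "k = far Mob bt \<cdot> t \<cdot> cpow_ar GA (Suc n) (far A gm)"
  unfolding k_def t using Alg.comp_assoc[OF u r Mbt] by simp
 have kH: "k : HA (Xo (Suc n) i') (fob Mob j')"
  unfolding k by (intro Alg.comp_Hom[OF Alg.comp_Hom[OF Mbt tH] g])
 have ka: "afn k y = Bf Mob bt (afn t (xact (Suc n) gm y))" if "y : fst (Xo (Suc n) i')" for y
  using afn_comp[OF g that] afn_comp[OF tH Alg_HomD(5)[OF g that]] unfolding k xact_def Bf_def by simp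
 have base: "Bf A bt (RX.base n al (xact (Suc n) gm y)) = Bf A al' (xaug (Suc n) i' y)" if y: "y : fst (Xo (Suc n) i')" for y
 proof -
  have z: "xaug (Suc n) i' y : U A i'" by (rule RX.aug_in[OF o(3) y])
  note gz = Bf_in[OF A_diag gm z]
  show ?thesis
   using RX.aug_act[OF gm y] Bf_comp[OF A_diag gm btal z] Bf_comp[OF A_diag al bt gz] by (simp add: RX.base_def d al'_def)
 qed
 have tp: "pim j (afn t y) = RX.base n al y" if "y : fst (Xo (Suc n) i)" for y
  using D(2) that by (simp add: dfun_def t_def RX.base_def d xaug_def)
 have cA: "far A al' \<cdot> ?c i' : HA (Xo (Suc n) i') (fob A j')"
  by (rule Alg.comp_Hom[OF diag_ar[OF A_diag al'] caug_Alg[OF o(3)]])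
 have b: "(far A al' \<cdot> ?c i', k, ?q j') : Hom (SA j') (far A al' \<cdot> ?c i') (?q j')"
  unfolding SA_Hom at_mob(2)[OF o(4)] at_mob(3) far_comp(1)[OF al' caug_Alg[OF o(3)]]
 proof (intro conjI ballI)
  fix y assume y: "y : fst (Xo (Suc n) i')"
  have "afn t (xact (Suc n) gm y) : U Mob j" using Alg_HomD(5)[OF tH xact_in[OF gm y]] by (simp add: U_def)
  thus "pim j' (afn (fst (snd (far A al' \<cdot> ?c i', k, ?q j'))) y) = afn (far A al' \<cdot> ?c i') y"
   using ka[OF y] pim_nat[OF bt] tp[OF xact_in[OF gm y]] base[OF y] far_comp(2)[OF al' caug_Alg[OF o(3)] y]
   by (simp add: xaug_def)
 qed (use kH cA at_mob(1)[OF o(4)] in auto)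
 have "?c i' : Obj (SA i')" using caug_Alg[OF o(3), of "Suc n"] by (simp add: Hom_iff)
 note l = Alg.ptr_lift[OF diag_ar[OF A_diag al'] restrict_pullback[OF al'] mob_Obj[OF o(4)] this b]
 define e where "e = (?c i', pb_lift (Alg T) (far A al') (?q j') (?c i') k, fst (pullback (Alg T) (far A al') (?q j')))"
 have em: "der_map I (Alg T) GA A M n al bt gm a = e"
  unfolding der_map_def a_eq prod.case Let_def al'_def[symmetric] d module_at_simps Rm_eq(2)[OF al'] r_def[symmetric] Mob_def[symmetric]
   k_def[symmetric] e_def ..
 have eD: "e : carrier (Der (Alg T) (fob A i') (?c i') (Rm al'))" using l(1) unfolding Der_carrier[OF al'] e_def .
 have te: "fst (snd (tr al' e)) = k" using l(2) by (simp add: tr_def d e_def)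
 have oal: "over j (Xo (Suc n) i) (RX.base n al)" by (rule RX.base_over[OF al])
 have bx: "(%x. Bf A al (afn (?c i) x)) = RX.base n al" by (simp add: RX.base_def[abs_def] xaug_def d)
 have x_eq: "x = demb j (fst (Xo (Suc n) i)) (RX.base n al) (afn t)" and tw: "dfun j (Xo (Suc n) i) (RX.base n al) (afn t)"
  using D(1,2) a(2) unfolding bx t_def by auto
 have "RX.Rc n gm (RX.Lc n bt al x) = pre (fst (Xo (Suc n) i')) (xact (Suc n) gm)
   (demb j' (fst (Xo (Suc n) i)) (%x. Bf A bt (RX.base n al x)) (%x. Bf Mob bt (afn t x)))"
  unfolding RX.Rc_def RX.Lc_def d x_eq lft_demb(1)[OF bt oal tw] ..
 also have "... = demb j' (fst (Xo (Suc n) i')) (%x. Bf A al' (afn (?c i') x)) (afn k)"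
  using xact_in[OF gm] ka base by (auto simp: pre_def demb_def xaug_def)
 also have "... = dere al' e" unfolding dere(1)[OF al' caug_Alg[OF o(3)] eD] te ..
 finally have "fX al' n (RX.Rc n gm (RX.Lc n bt al x)) = e"
  using fX_dere[OF al', of e n] eD unfolding KX_eq[OF al'] by simp
 thus ?thesis using em by (simp add: a_def al'_def)
qed

lemma HX_far:
 assumes al: "al : Hom I i j" and bt: "bt : Hom I j j'" and gm: "gm : Hom I i' i" and x: "x : RX.Zc q al"
 shows "fst (snd (far (HX q) (al, (bt, gm), bt \<bullet> al \<bullet> gm))) (clX q al x) = clX q (bt \<bullet> al \<bullet> gm) (RX.Rc q gm (RX.Lc q bt al x))"
  "RX.Rc q gm (RX.Lc q bt al x) : RX.Zc q (bt \<bullet> al \<bullet> gm)"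
proof -
 define al' where "al' = bt \<bullet> al \<bullet> gm"
 note btal = I.comp_Hom[OF bt al]
 note al' = I.comp_Hom[OF btal gm, folded al'_def]
 note d = I.HomD[OF al] I.HomD[OF btal] I.HomD[OF al']
 let ?ph = "%x. RX.Rc q gm (RX.Lc q bt al x)"
 have ph: "addmap ?ph"
  by unfold_locales (simp add: addmap.add[OF RX.Lc_add[OF al bt]] addmap.add[OF RX.Rc_add])
 have phC: "RX.Rc r gm (RX.Lc r bt al x) : RX.Cc r al'" if "x : RX.Cc r al" for x r
  unfolding al'_def by (rule RX.Rc_Cc[OF btal gm RX.Lc_Cc[OF al bt that]])
 have phB: "?ph ` RX.Bc q al \<subseteq> RX.Bc q al'"
 proof (cases q)
  case 0
  thus ?thesis using addmap.zero[OF ph] by (auto simp: RX.Bc_def)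
 next
  case (Suc r)
  thus ?thesis
   using phC[of _ r] by (auto simp: RX.Bc_def d RX.Lc_dC[OF al bt] RX.Rc_dC[OF gm])
 qed
 have Z: "RX.Zc q al \<subseteq> RX.Cc q al" "RX.Bc q al \<subseteq> RX.Cc q al" "RX.Bc q al' \<subseteq> RX.Cc q al'"
  using RX.Bc_Zc[OF al] RX.Bc_Zc[OF al'] by (auto simp: RX.Zc_def)
 note P = clX_presents[OF al] and P' = clX_presents[OF al']
 have xC: "x : RX.Cc q al" using x Z by blast
 have "cohomology_map (KX al') (DX al') q (der_map I (Alg T) GA A M q al bt gm) (clX q al x) = clX q al' (?ph x)"
  unfolding cohomology_map_def clX_def P(2) P'(2)
 proof (rule cohomology_map_presents[OF KX_presents[OF al] KX_presents[OF al'] Z(2) presents_subgp[OF P(1)] Z(3) presents_subgp[OF P'(1)] ph _ phB _ xC])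
  show "?ph ` RX.Cc q al \<subseteq> RX.Cc q al'" using phC by blast
  show "der_map I (Alg T) GA A M q al bt gm (fX al q x) = fX al' q (?ph x)" if "x : RX.Cc q al" for x
   unfolding al'_def by (rule der_map_fX[OF al bt gm that])
 qed
 thus "fst (snd (far (HX q) (al, (bt, gm), bt \<bullet> al \<bullet> gm))) (clX q al x) = clX q (bt \<bullet> al \<bullet> gm) (?ph x)"
  using presentsD(5)[OF P(1) x] by (simp add: cohomology_system_def al'_def[symmetric])
 show "?ph x : RX.Zc q (bt \<bullet> al \<bullet> gm)"
  by (rule RX.Rc_Zc[OF btal gm RX.Lc_Zc[OF al bt x]])
qed

text \<open>Needed for the identity law of the natural system; the axioms of
  \<open>resolution\<close> speak of composites only.\<close>

lemma xact_Idn: "i : Obj I ==> x : fst (Xo n i) ==> xact n (Idn I i) x = x"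
proof (induction n arbitrary: x)
 case 0
 thus ?case using Bf_Idn[OF A_diag, of i x] by (simp add: xact_def cpow_ar_def Bf_def Xo_0 U_def)
next
 case (Suc n)
 have "Tm (fst (Xo n i)) (fst (Xo n i)) (xact n (Idn I i)) = Tm (fst (Xo n i)) (fst (Xo n i)) (%x. x)"
  by (rule Tm_cong) (rule Suc.IH[OF Suc.prems(1)])
 thus ?case
  using Suc.prems xact_Suc[OF I.Idn_Hom[OF Suc.prems(1)], of x n] Tm_id[OF sX[OF Suc.prems(1)], of x n] by (simp add: fst_Xo_Suc)
qed

lemma X_Idn:
 assumes al: "al : Hom I i j" and x: "x : RX.Cc q al"
 shows "RX.Rc q (Idn I i) x = x" "RX.Lc q (Idn I j) al x = x"
proof -
 note o = I.Hom_Obj[OF al]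
 note d = I.HomD[OF al] I.HomD[OF I.Idn_Hom[OF o(1)]]
 have "RX.Rc q (Idn I i) x = pre (fst (Xo (Suc q) i)) (%x. x) x"
  unfolding RX.Rc_def d by (rule pre_cong) (rule xact_Idn[OF o(1)])
 also have "... = x" using x unfolding RX.Cc_def d by (rule pre_id)
 finally show "RX.Rc q (Idn I i) x = x" .
 show "RX.Lc q (Idn I j) al x = x"
  unfolding RX.Lc_def d using x unfolding RX.Cc_def d by (rule lft_id[OF RX.base_over[OF al]])
qed

lemma HX_far_parts:
 "fst (far (HX q) (al, b, al')) = fob (HX q) al" "snd (snd (far (HX q) (al, b, al'))) = fob (HX q) al'"
 "fst (snd (far (HX q) (al, b, al'))) : extensional (carrier (fob (HX q) al))"
 by (cases b; simp add: cohomology_system_def)+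

text \<open>Classes are represented by cocycles, on which the maps are \<open>Rc\<close> after
  \<open>Lc\<close>. The functor laws reduce to \<open>Lc_Lc\<close>, \<open>Rc_Rc\<close>,
  \<open>Lc_Rc\<close> and \<open>X_Idn\<close>.\<close>

theorem natural_system: "is_natural_system I (HX q)"
 unfolding is_natural_system_def is_functor_def
proof (intro conjI ballI impI)
 note PA = clX_presents(1)[OF I.Arr_Hom]
 have cg: "comm_group (fob (HX q) al)" if "al : Arr I" for al
  by (rule presentsD(3)[OF PA[OF that]])
 fix f assume "f : Obj (fact_cat I)"
 hence f: "f : Arr I" by (simp add: fact_cat_def)
 show "fob (HX q) f : Obj ab_cat" using cg[OF f] by (simp add: ab_cat_def)
 define i j where "i = Dom I f" and "j = Cod I f"
 have fH: "f : Hom I i j" using I.Arr_Hom[OF f] by (simp add: i_def j_def)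
 note o = I.Hom_Obj[OF fH]
 have ff: "Idn I j \<bullet> f \<bullet> Idn I i = f" using I.comp_Idn[OF fH] by simp
 let ?F = "far (HX q) (f, (Idn I j, Idn I i), f)"
 have "fst (snd ?F) = (\<lambda>x\<in>carrier (fob (HX q) f). x)"
 proof (rule extensionalityI[OF HX_far_parts(3)])
  fix S assume S: "S : carrier (fob (HX q) f)"
  obtain x where x: "x : RX.Zc q f" "S = clX q f x" using presents_surj[OF PA[OF f] S] by blast
  have xC: "x : RX.Cc q f" using x(1) by (simp add: RX.Zc_def)
  show "fst (snd ?F) S = (\<lambda>x\<in>carrier (fob (HX q) f). x) S"
   using HX_far(1)[OF fH I.Idn_Hom[OF o(2)] I.Idn_Hom[OF o(1)] x(1)] X_Idn[OF fH xC] S unfolding ff x(2) by simp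
 qed simp
 hence "?F = (fob (HX q) f, \<lambda>x\<in>carrier (fob (HX q) f). x, fob (HX q) f)"
  using HX_far_parts(1,2)[of q f "(Idn I j, Idn I i)" f] by (metis prod.collapse)
 thus "far (HX q) (Idn (fact_cat I) f) = Idn ab_cat (fob (HX q) f)"
  by (simp add: fact_cat_def ab_cat_def i_def j_def)
next
 note PA = clX_presents(1)
 fix f assume f: "f : Arr (fact_cat I)"
 then obtain al bt gm i j j' i' where fe: "f = (al, (bt, gm), bt \<bullet> al \<bullet> gm)" and
  h: "al : Hom I i j" "bt : Hom I j j'" "gm : Hom I i' i"
  by (auto simp: fact_cat_def Hom_iff)
 let ?al' = "bt \<bullet> al \<bullet> gm"
 note btal = I.comp_Hom[OF h(2,1)]
 note h' = I.comp_Hom[OF btal h(3)]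
 have "fst (snd (far (HX q) f)) : hom (fob (HX q) al) (fob (HX q) ?al')"
 proof (rule homI)
  fix S assume "S : carrier (fob (HX q) al)"
  then obtain x where x: "x : RX.Zc q al" "S = clX q al x" using presents_surj[OF PA[OF h(1)]] by blast
  show "fst (snd (far (HX q) f)) S : carrier (fob (HX q) ?al')"
   unfolding fe x(2) HX_far(1)[OF h x(1)] by (rule presentsD(5)[OF PA[OF h'] HX_far(2)[OF h x(1)]])
  fix S' assume "S' : carrier (fob (HX q) al)"
  then obtain x' where x': "x' : RX.Zc q al" "S' = clX q al x'" using presents_surj[OF PA[OF h(1)]] by blast
  show "fst (snd (far (HX q) f)) (S \<otimes>\<^bsub>fob (HX q) al\<^esub> S') =
   fst (snd (far (HX q) f)) S \<otimes>\<^bsub>fob (HX q) ?al'\<^esub> fst (snd (far (HX q) f)) S'"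
   unfolding fe x(2) x'(2) presentsD(6)[OF PA[OF h(1)] x(1) x'(1), symmetric] HX_far(1)[OF h x(1)] HX_far(1)[OF h x'(1)]
    HX_far(1)[OF h subgp_add[OF presentsD(1)[OF PA[OF h(1)]] x(1) x'(1)]]
    presentsD(6)[OF PA[OF h'] HX_far(2)[OF h x(1)] HX_far(2)[OF h x'(1)], symmetric]
    addmap.add[OF RX.Lc_add[OF h(1,2)]] addmap.add[OF RX.Rc_add] ..
 qed
 thus "far (HX q) f : Hom ab_cat (fob (HX q) (Dom (fact_cat I) f)) (fob (HX q) (Cod (fact_cat I) f))"
  using HX_far_parts[of q al "(bt, gm)" ?al'] presentsD(3)[OF PA[OF h(1)]] presentsD(3)[OF PA[OF h']]
  by (cases "far (HX q) f") (auto simp: ab_cat_def Hom_iff fact_cat_def fe)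
 fix g assume "g : Arr (fact_cat I)" "Cod (fact_cat I) f = Dom (fact_cat I) g"
 then obtain bt' gm' k' k where ge: "g = (?al', (bt', gm'), bt' \<bullet> ?al' \<bullet> gm')" and
  g: "bt' : Hom I j' k'" "gm' : Hom I k i'"
  using h' by (auto simp: fact_cat_def Hom_iff fe)
 have btbt: "bt' \<bullet> bt : Hom I j k'" and gmgm: "gm \<bullet> gm' : Hom I k i"
  using I.comp_Hom[OF g(1) h(2)] I.comp_Hom[OF h(3) g(2)] by auto
 have e: "bt' \<bullet> ?al' \<bullet> gm' = bt' \<bullet> bt \<bullet> al \<bullet> (gm \<bullet> gm')"
  using I.comp_assoc[OF g(2) h' g(1)] I.comp_assoc[OF g(2) h(3) btal] I.comp_assoc[OF h(1,2) g(1)]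
   I.comp_assoc[OF gmgm btal g(1)] by simp
 let ?G = "far (HX q) (al, (bt' \<bullet> bt, gm \<bullet> gm'), bt' \<bullet> ?al' \<bullet> gm')"
 have "fst (snd ?G) = compose (carrier (fob (HX q) al)) (fst (snd (far (HX q) g))) (fst (snd (far (HX q) f)))"
 proof (rule extensionalityI[OF HX_far_parts(3)])
  fix S assume S: "S : carrier (fob (HX q) al)"
  then obtain x where x: "x : RX.Zc q al" "S = clX q al x" using presents_surj[OF PA[OF h(1)]] by blast
  have "fst (snd ?G) S = clX q (bt' \<bullet> ?al' \<bullet> gm') (RX.Rc q (gm \<bullet> gm') (RX.Lc q (bt' \<bullet> bt) al x))"
   unfolding x(2) e by (rule HX_far(1)[OF h(1) btbt gmgm x(1)])
  also have "RX.Rc q (gm \<bullet> gm') (RX.Lc q (bt' \<bullet> bt) al x) = RX.Rc q gm' (RX.Lc q bt' ?al' (RX.Rc q gm (RX.Lc q bt al x)))"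
   using RX.Rc_Rc[OF h(3) g(2)] RX.Lc_Lc[OF h(1,2) g(1)] RX.Lc_Rc[OF btal g(1) h(3)] by simp
  finally show "fst (snd ?G) S = compose (carrier (fob (HX q) al)) (fst (snd (far (HX q) g))) (fst (snd (far (HX q) f))) S"
   using S unfolding fe ge by (simp add: compose_def x(2) HX_far(1)[OF h x(1)] HX_far(1)[OF h' g HX_far(2)[OF h x(1)]])
 qed (simp add: compose_def)
 thus "far (HX q) (g \<bullet>\<^bsub>fact_cat I\<^esub> f) = far (HX q) g \<bullet>\<^bsub>ab_cat\<^esub> far (HX q) f"
  using HX_far_parts[of q al "(bt' \<bullet> bt, gm \<bullet> gm')" "bt' \<bullet> ?al' \<bullet> gm'"] HX_far_parts[of q al "(bt, gm)" ?al']
   HX_far_parts[of q ?al' "(bt', gm')" "bt' \<bullet> ?al' \<bullet> gm'"]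
  by (cases ?G) (simp add: fact_cat_def ab_cat_def fe ge)
qed

text \<open>A cocycle on \<open>Y\<close> is read as a class of the levelwise resolution through
  \<open>thC\<close>. This commutes with \<open>Lc\<close> strictly and with \<open>Rc\<close> up to
  coboundaries, so the induced classes agree.\<close>

lemma Y_second_page:
 "\<exists>f. presents (RY.DC.Z 2 (int p) (int p + int q)) (RY.DC.B 2 (int p) (int p + int q)) f (bw_cohomology I (HX q) p)"
proof (rule RY.bw_second_page[where cl = "%al y. clX q al (thC q (Dom I al) y)"])
 fix al assume "al : Arr I"
 note al = I.Arr_Hom[OF this]
 show "presents (RY.Zc q al) (RY.Bc q al) (%y. clX q al (thC q (Dom I al) y)) (fob (HX q) al)"
  by (rule presents_Y[OF al clX_presents(1)[OF al]])
next
 fix al bt i j k ph assume al: "al : Hom I i j" and bt: "bt : Hom I j k" and ph: "ph : RY.Zc q al"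
 note btal = I.comp_Hom[OF bt al] and i = I.Hom_Obj(1)[OF al]
 note d = I.HomD[OF al] I.HomD[OF btal]
 note t = thC_Zc[OF al ph]
 have "RX.Lc q bt al (thC q i ph) : RX.Cc q (bt \<bullet> al)" using RX.Lc_Zc[OF al bt t] by (simp add: RX.Zc_def)
 thus "ns_left I (HX q) bt al (clX q al (thC q (Dom I al) ph)) = clX q (bt \<bullet> al) (thC q (Dom I (bt \<bullet> al)) (RY.Lc q bt al ph))"
  using HX_far(1)[OF al bt I.Idn_Hom[OF i] t] I.comp_Idn(1)[OF btal] X_Idn(1)[OF btal] thC_Lc[OF al, of q bt ph]
  by (simp add: ns_left_def d)
next
 fix al gm i j k ph assume al: "al : Hom I i j" and gm: "gm : Hom I k i" and ph: "ph : RY.Zc q al"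
 note algm = I.comp_Hom[OF al gm] and j = I.Hom_Obj(2)[OF al]
 note d = I.HomD[OF al] I.HomD[OF algm]
 note t = thC_Zc[OF al ph]
 have "thC q i ph : RX.Cc q al" using t by (simp add: RX.Zc_def)
 hence "ns_right I (HX q) gm al (clX q al (thC q (Dom I al) ph)) = clX q (al \<bullet> gm) (RX.Rc q gm (thC q i ph))"
  using HX_far(1)[OF al I.Idn_Hom[OF j] gm t] I.comp_Idn(2)[OF al] X_Idn(2)[OF al]
  by (simp add: ns_right_def d)
 also have "... = clX q (al \<bullet> gm) (thC q k (RY.Rc q gm ph))"
  using presents_eq[OF clX_presents(1)[OF algm] RX.Rc_Zc[OF al gm t] thC_Zc[OF algm RY.Rc_Zc[OF al gm ph]]] thC_Rc[OF al gm ph] by simp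
 finally show "ns_right I (HX q) gm al (clX q al (thC q (Dom I al) ph)) = clX q (al \<bullet> gm) (thC q (Dom I (al \<bullet> gm)) (RY.Rc q gm ph))"
  by (simp add: d)
qed

end

subsection \<open>Cohomology of the diagram\<close>

lemma sum_alt_apply: "(\<Sum>k\<in>K. alt k (f k)) c = (\<Sum>k\<in>K. alt k (f k c))"
 for f :: "nat => 'b => 'c::ab_group_add"
 by (simp only: sum_apply alt_apply)

context comparison
begin

abbreviation KP where "KP \<equiv> cm_complex DA GI A M"
abbreviation cP where "cP n \<equiv> caug DA GI A (Suc n)"

definition derP where
 "derP n f = (%(i, as). if (i, as) : chains I 0 then demb i (U (Yo (Suc n)) i) (yaug (Suc n) i) (sf f i) else 0)"

definition SP where "SP n = {x : RY.chainD 0 n. RY.dh 0 n x = 0}"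

lemma chains_0: "(i, as) : chains I 0 \<longleftrightarrow> as = [] & i : Obj I"
 by (auto simp: chains_iff)

lemma cP: "cP n : Obj SL" "fst (cP n) = Yo (Suc n)" "tf (cP n) = yaug (Suc n)"
 using caug_DA[of "Suc n"] DA_HomD(3)[OF caug_DA[of "Suc n"]] unfolding Obj_SL
 by (auto simp: yaug_def[abs_def] simp del: caug.simps)

lemma KP_carrier: "carrier (KP n) = Hom SL (cP n) (gob M)"
 by (simp add: cm_complex_def Der_def hom_grp_def)

lemma Y_Cc:
 assumes i: "i : Obj I"
 shows "RY.Cc n (Idn I i) = derv i (fob (Yo (Suc n)) i) (yaug (Suc n) i)"
  and "over i (fob (Yo (Suc n)) i) (yaug (Suc n) i)"
proof -
 note d = I.HomD[OF I.Idn_Hom[OF i]]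
 show "RY.Cc n (Idn I i) = derv i (fob (Yo (Suc n)) i) (yaug (Suc n) i)"
  unfolding RY.Cc_def d by (rule derv_cong) (simp add: RY.base_def d Bf_Idn[OF A_diag i RY.aug_in[OF i]])
 show "over i (fob (Yo (Suc n)) i) (yaug (Suc n) i)"
  using i diag_ob[OF Yo_diag i] RY.aug_hom[OF i] by (simp add: over_def)
qed

text \<open>On a chain \<open>[gm]\<close> the horizontal coboundary is the difference of the two
  sides of the naturality square, and embeddings of one fibre are injective. So the kernel of a row
  in column \<open>0\<close> consists of the natural families, that is, of derivations on
  \<open>Y\<close>.\<close>

lemma SP_iff:
 assumes w: "!!i. i : Obj I ==> dfun i (fob (Yo (Suc n)) i) (yaug (Suc n) i) (w i)"
 shows "(%(i, as). if (i, as) : chains I 0 then demb i (U (Yo (Suc n)) i) (yaug (Suc n) i) (w i) else 0) : SP n \<longleftrightarrow>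
  (\<forall>i k gm x. gm : Hom I k i --> x : U (Yo (Suc n)) k --> w i (Bf (Yo (Suc n)) gm x) = Bf Mob gm (w k x))"
  (is "?x : _ \<longleftrightarrow> ?R")
proof -
 let ?Y = "Yo (Suc n)"
 have xD: "?x : RY.chainD 0 n"
 proof (rule RY.chainDI)
  fix i as assume "(i, as) : chains I 0"
  thus "?x (i, as) : RY.Cc n (cc i as)"
   using Y_Cc(1)[of i n] w[of i] unfolding derv_def fstU by (auto simp: chains_0)
 qed auto
 have dh: "RY.dh 0 n ?x (i, [gm]) = demb i (U ?Y k) (%x. Bf A gm (yaug (Suc n) k x)) (%x. Bf Mob gm (w k x)) -
   demb i (U ?Y k) (%x. Bf A gm (yaug (Suc n) k x)) (%x. w i (Bf ?Y gm x))" if gm: "gm : Hom I k i" for gm k i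
 proof -
  note o = I.Hom_Obj[OF gm]
  have d: "Dom I gm = k" "Cod I gm = i" "gm : Arr I" "Dom I (Idn I k) = k" using gm I.Idn_Hom[OF o(1)] by (auto simp: Hom_iff)
  have c: "(i, [gm]) : chains I (Suc 0)" "(k, []) : chains I 0" "(i, []) : chains I 0" using o d by (auto simp: chains_iff)
  have "RY.dh 0 n z (i, [gm]) = RY.Lc n gm (Idn I k) (z (k, [])) - RY.Rc n gm (z (i, []))" for z
   using c(1) by (simp add: RY.dh_def sum_apply alt_apply RY.delta_def RY.dterm_def d)
  hence "RY.dh 0 n ?x (i, [gm]) = RY.Lc n gm (Idn I k) (?x (k, [])) - RY.Rc n gm (?x (i, []))" .
  also have "RY.Lc n gm (Idn I k) (?x (k, [])) = demb i (U ?Y k) (%x. Bf A gm (yaug (Suc n) k x)) (%x. Bf Mob gm (w k x))"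
  proof -
   have "RY.Lc n gm (Idn I k) (?x (k, [])) = lft gm (yaug (Suc n) k) (fst (fob ?Y k)) (?x (k, []))"
    unfolding RY.Lc_def d by (rule lft_cong) (simp add: RY.base_def d Bf_Idn[OF A_diag o(1) RY.aug_in[OF o(1)]])
   thus ?thesis using lft_demb(1)[OF gm Y_Cc(2)[OF o(1)] w[OF o(1)]] c(2) by (simp add: fstU)
  qed
  also have "RY.Rc n gm (?x (i, [])) = demb i (U ?Y k) (%x. Bf A gm (yaug (Suc n) k x)) (%x. w i (Bf ?Y gm x))"
   unfolding RY.Rc_def d fstU using c(3) Bf_in[OF Yo_diag gm] RY.aug_act[OF gm, of _ n]
   by (auto simp: pre_def demb_def fstU)
  finally show ?thesis .
 qed
 have "?x : SP n \<longleftrightarrow> (\<forall>i k gm. gm : Hom I k i --> RY.dh 0 n ?x (i, [gm]) = 0)"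
 proof
  assume "?x : SP n"
  hence "RY.dh 0 n ?x = 0" by (simp add: SP_def)
  thus "\<forall>i k gm. gm : Hom I k i --> RY.dh 0 n ?x (i, [gm]) = 0" by simp
 next
  assume R: "\<forall>i k gm. gm : Hom I k i --> RY.dh 0 n ?x (i, [gm]) = 0"
  have "RY.dh 0 n ?x (i, as) = 0" for i as
  proof (cases "(i, as) : chains I (Suc 0)")
   case True
   then obtain gm where "as = [gm]" "gm : Hom I (Dom I gm) i" by (auto simp: chains_iff length_Suc_conv Hom_iff)
   thus ?thesis using R by blast
  qed (rule RY.chainD_out[OF RY.dh_D[OF xD]])
  hence "RY.dh 0 n ?x = 0" by (auto simp: fun_eq_iff)
  thus "?x : SP n" using xD by (simp add: SP_def)
 qed
 also have "... \<longleftrightarrow> ?R"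
 proof -
  have "RY.dh 0 n ?x (i, [gm]) = 0 \<longleftrightarrow> (\<forall>x\<in>U ?Y k. w i (Bf ?Y gm x) = Bf Mob gm (w k x))" if gm: "gm : Hom I k i" for i k gm
  proof -
   note o = I.Hom_Obj[OF gm]
   note l = lft_demb(2)[OF gm Y_Cc(2)[OF o(1)] w[OF o(1)]]
   have ov: "over i (fob ?Y k) (%x. Bf A gm (yaug (Suc n) k x))"
    using Y_Cc(2)[OF o(1)] Bf_ahom[OF A_diag gm] ahom_comp diag_ob[OF A_diag] o unfolding over_def by blast
   have w': "w i (Bf ?Y gm x) : carrier (fibg i (Bf A gm (yaug (Suc n) k x)))" if x: "x : U ?Y k" for x
    using dfun_fib[OF w[OF o(2)], unfolded fstU, OF Bf_in[OF Yo_diag gm x]] RY.aug_act[OF gm, of x n] x by (simp add: fstU)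
   show ?thesis
    unfolding dh[OF gm] right_minus_eq
    using embed_inj[OF over_fibg[OF ov] dfun_fib[OF l] w', unfolded fstU] by (auto simp: demb_def fun_eq_iff)
  qed
  thus ?thesis by blast
 qed
 finally show ?thesis .
qed

lemma derP_dfun:
 assumes f: "f : carrier (KP n)" and i: "i : Obj I"
 shows "dfun i (fob (Yo (Suc n)) i) (yaug (Suc n) i) (sf f i)"
 using f sf_ahom[OF _ i, of f "cP n" "gob M"] sf_over[OF _ i, of f "cP n" "gob M"]
 unfolding KP_carrier cP by (auto simp: dfun_def Mob_def pim_def fstU)

text \<open>A family of homomorphisms into the \<open>M(i)\<close> over the augmentation is an arrow
  of the slice when it is natural, which \<open>SP_iff\<close> expresses. Additivity is the
  comparison of the addition in the slice with fibre multiplication.\<close>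

lemma KP_presents: "presents (SP n) {0} (inv_into (carrier (KP n)) (derP n)) (KP n)" (is ?P)
 and derP_image: "derP n ` carrier (KP n) = SP n"
 and derP_inj: "inj_on (derP n) (carrier (KP n))"
proof -
 let ?Y = "Yo (Suc n)"
 show im: "derP n ` carrier (KP n) = SP n"
 proof
  show "derP n ` carrier (KP n) \<subseteq> SP n"
  proof (rule image_subsetI)
   fix f assume f: "f : carrier (KP n)"
   thus "derP n f : SP n"
    unfolding derP_def using SP_iff[OF derP_dfun[OF f]] sf_nat[of f "cP n" "gob M"]
    unfolding KP_carrier cP Mob_def[symmetric] by blast
  qed
  show "SP n \<subseteq> derP n ` carrier (KP n)"
  proof
   fix x assume x: "x : SP n"
   hence xD: "x : RY.chainD 0 n" by (simp add: SP_def)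
   have "\<exists>w. dfun i (fob ?Y i) (yaug (Suc n) i) w & x (i, []) = demb i (U ?Y i) (yaug (Suc n) i) w" if i: "i : Obj I" for i
    using RY.chainD_in[OF xD, of i "[]"] i Y_Cc(1)[OF i, of n] unfolding derv_def fstU by (auto simp: chains_0)
   then obtain w where w: "!!i. i : Obj I ==> dfun i (fob ?Y i) (yaug (Suc n) i) (w i)"
    "!!i. i : Obj I ==> x (i, []) = demb i (U ?Y i) (yaug (Suc n) i) (w i)" by metis
   have x_eq: "x = (%(i, as). if (i, as) : chains I 0 then demb i (U ?Y i) (yaug (Suc n) i) (w i) else 0)"
    using w(2) RY.chainD_out[OF xD] by (intro ext) (auto simp: chains_0)
   have nat: "gm : Hom I k i ==> y : U ?Y k ==> w i (Bf ?Y gm y) = Bf Mob gm (w k y)" for i k gm y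
    using x SP_iff[OF w(1)] unfolding x_eq by blast
   let ?t = "mk_nt ?Y Mob w"
   have t: "?t : Hom DA ?Y Mob"
    by (rule mk_nt_Hom[OF Yo_diag Mob_diag _ nat]) (use w(1) in \<open>auto simp: dfun_def\<close>)
   have "gob M \<bullet>\<^bsub>DA\<^esub> ?t = cP n"
   proof (rule DA_eqI[OF DA.comp_Hom[OF gob(2) t] caug_DA])
    show "tf (gob M \<bullet>\<^bsub>DA\<^esub> ?t) j y = tf (cP n) j y" if "j : Obj I" "y : U ?Y j" for j y
     using tf_comp[OF t that, of "gob M"] tf_mk_nt[OF that, of Mob w] w(1)[OF that(1)] that(2)
     unfolding cP by (simp add: dfun_def pim_def fstU)
   qed
   hence f: "(cP n, ?t, gob M) : carrier (KP n)"
    unfolding KP_carrier slice_Hom using t caug_DA[of "Suc n"] gob(2) cP(2) by (auto simp: Hom_iff Mob_def simp del: caug.simps)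
   have "derP n (cP n, ?t, gob M) = x"
    unfolding derP_def x_eq by (intro ext) (auto simp: sf_def chains_0 tf_mk_nt intro!: fun_cong[OF demb_cong])
   thus "x : derP n ` carrier (KP n)" using f by (metis imageI)
  qed
 qed
 show inj: "inj_on (derP n) (carrier (KP n))"
 proof
  fix f g assume f: "f : carrier (KP n)" and g: "g : carrier (KP n)" and e: "derP n f = derP n g"
  note f' = SL_HomD[OF f[unfolded KP_carrier]] and g' = SL_HomD[OF g[unfolded KP_carrier]]
  have "fst (snd f) = fst (snd g)"
  proof (rule DA_eqI[OF f'(4) g'(4)])
   fix j y assume j: "j : Obj I" and y: "y : U (fst (cP n)) j"
   have "demb j (U ?Y j) (yaug (Suc n) j) (sf f j) = demb j (U ?Y j) (yaug (Suc n) j) (sf g j)"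
    using fun_cong[OF e, of "(j, [])"] j by (simp add: derP_def chains_0)
   thus "tf (fst (snd f)) j y = tf (fst (snd g)) j y"
    using demb_inj[OF Y_Cc(2)[OF j] derP_dfun[OF f j] derP_dfun[OF g j]] y unfolding fstU cP sf_def by blast
  qed
  thus "f = g" using f'(1) g'(1) by metis
 qed
 show ?P
 proof (rule presents_embedding[OF _ im inj])
  show "subgp (SP n)"
   using RY.chainD_subgp[of 0 n] addmap.zero[OF RY.dh_add] addmap.diff[OF RY.dh_add] by (auto simp: SP_def subgp_def)
  have ml: "f \<otimes>\<^bsub>KP n\<^esub> g = plus_arr SL M f g" "\<one>\<^bsub>KP n\<^esub> = gzero M \<bullet>\<^bsub>SL\<^esub> to_one SL M (cP n)" for f g
   by (simp_all add: cm_complex_def Der_def hom_grp_def)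
  have in_A: "yaug (Suc n) i x : U A i" if "i : Obj I" "x : U ?Y i" for i x
   using RY.aug_in[OF that(1)] that(2) by (simp add: fstU)
  show "f \<otimes>\<^bsub>KP n\<^esub> g : carrier (KP n) & derP n (f \<otimes>\<^bsub>KP n\<^esub> g) = derP n f + derP n g"
   if f: "f : carrier (KP n)" and g: "g : carrier (KP n)" for f g
  proof -
   note fH = f[unfolded KP_carrier] and gH = g[unfolded KP_carrier]
   note p = MA.plus_Hom[OF fH gH]
   \<comment> \<open>Equality of elements is tested on generalized points: \<open>fibg_mult\<close>
     rewrites the fibre product as a sum of points, and addition commutes with composition.\<close>
   have "sf (plus_arr SL M f g) i x = sf f i x \<otimes>\<^bsub>fibg i (yaug (Suc n) i x)\<^esub> sf g i x" if i: "i : Obj I" and x: "x : U ?Y i" for i x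
   proof (rule pt_inj[OF _ gob(1) i])
    have x': "x : U (fst (cP n)) i" using x unfolding cP(2) .
    note m = dfun_fib[OF derP_dfun[OF f i], unfolded fstU, OF x] dfun_fib[OF derP_dfun[OF g i], unfolded fstU, OF x]
    note fm = fibg_mult[OF i in_A[OF i x] m]
    show "pt (gob M) i (sf (plus_arr SL M f g) i x) = pt (gob M) i (sf f i x \<otimes>\<^bsub>fibg i (yaug (Suc n) i x)\<^esub> sf g i x)"
     unfolding fm(2) pt_comp[OF p i x', symmetric] pt_comp[OF fH i x', symmetric] pt_comp[OF gH i x', symmetric]
     by (rule MA.plus_comp[OF fH gH pt_Hom(1)[OF cP(1) i x']])
    show "sf (plus_arr SL M f g) i x : U (fst (gob M)) i" by (rule sf_in[OF p i x'])
    show "sf f i x \<otimes>\<^bsub>fibg i (yaug (Suc n) i x)\<^esub> sf g i x : U (fst (gob M)) i"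
     using fm(1) by (simp add: fibg_carrier Mob_def)
   qed
   hence "demb i (U ?Y i) (yaug (Suc n) i) (sf (plus_arr SL M f g) i) =
     demb i (U ?Y i) (yaug (Suc n) i) (sf f i) + demb i (U ?Y i) (yaug (Suc n) i) (sf g i)" if i: "i : Obj I" for i
    unfolding dfun_add(2)[OF Y_Cc(2)[OF i] derP_dfun[OF f i] derP_dfun[OF g i], unfolded fstU, symmetric]
    using i by (intro demb_cong) auto
   hence "derP n (plus_arr SL M f g) = derP n f + derP n g"
    by (intro ext) (auto simp: derP_def chains_0)
   thus ?thesis using p unfolding ml(1) KP_carrier by blast
  qed
  have oH: "\<one>\<^bsub>KP n\<^esub> : Hom SL (cP n) (gob M)" unfolding ml(2) by (rule SL.comp_Hom[OF MA.gzero MA.to_one[OF cP(1)]])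
  thus "\<one>\<^bsub>KP n\<^esub> : carrier (KP n)" unfolding KP_carrier .
  have "sf \<one>\<^bsub>KP n\<^esub> i x = \<one>\<^bsub>fibg i (yaug (Suc n) i x)\<^esub>" if i: "i : Obj I" and x: "x : U ?Y i" for i x
  proof (rule pt_inj[OF _ gob(1) i])
   have x': "x : U (fst (cP n)) i" using x unfolding cP(2) .
   note fo = fibg_one[OF i in_A[OF i x]]
   show "pt (gob M) i (sf \<one>\<^bsub>KP n\<^esub> i x) = pt (gob M) i \<one>\<^bsub>fibg i (yaug (Suc n) i x)\<^esub>"
    unfolding fo(2) pt_comp[OF oH i x', symmetric] unfolding ml(2)
    using MA.zero_comp[OF pt_Hom(1)[OF cP(1) i x']] unfolding cP(3) .
   show "sf \<one>\<^bsub>KP n\<^esub> i x : U (fst (gob M)) i" by (rule sf_in[OF oH i x'])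
   show "\<one>\<^bsub>fibg i (yaug (Suc n) i x)\<^esub> : U (fst (gob M)) i" using fo(1) by (simp add: fibg_carrier Mob_def)
  qed
  hence "demb i (U ?Y i) (yaug (Suc n) i) (sf \<one>\<^bsub>KP n\<^esub> i) = demb i (U ?Y i) (yaug (Suc n) i) (%x. \<one>\<^bsub>fibg i (yaug (Suc n) i x)\<^esub>)"
   if "i : Obj I" for i using that by (intro demb_cong) auto
  hence "demb i (U ?Y i) (yaug (Suc n) i) (sf \<one>\<^bsub>KP n\<^esub> i) = 0" if i: "i : Obj I" for i
   using dfun_zero(2)[OF Y_Cc(2)[OF i, of n]] i by (simp add: fstU)
  thus "derP n \<one>\<^bsub>KP n\<^esub> = 0" by (intro ext) (auto simp: derP_def chains_0)
 qed
qed

text \<open>Precomposition with a face of \<open>Y\<close> is the coface \<open>cof\<close> at every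
  object, so the alternating sum is the vertical differential of column \<open>0\<close>.\<close>

lemma KP_diff:
 assumes x: "x : SP n"
 shows "cm_diff DA GI A M n (inv_into (carrier (KP n)) (derP n) x) = inv_into (carrier (KP (Suc n))) (derP (Suc n)) (RY.dv 0 n x)"
  and "RY.dv 0 n x : SP (Suc n)"
proof -
 define a where "a = inv_into (carrier (KP n)) (derP n) x"
 have a: "a : carrier (KP n)" "derP n a = x"
  using x derP_image[of n] by (auto simp: a_def inv_into_into f_inv_into_f)
 note aH = a(1)[unfolded KP_carrier]
 let ?w = "%k. (cP (Suc n), cface GI A (Suc n) k, cP n)"
 define y where "y k = derP (Suc n) (a \<bullet>\<^bsub>SL\<^esub> ?w k)" for k
 have wH: "?w k : Hom SL (cP (Suc n)) (cP n)" if k: "k <= Suc n" for k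
 proof -
  have "cP (Suc n) = cP n \<bullet>\<^bsub>DA\<^esub> cface GI A (Suc n) k"
   using GY.caug_cface[of A k "Suc n"] k A_diag by simp
  thus ?thesis
   using cface_DA[OF k] caug_DA[of "Suc n"] caug_DA[of "Suc (Suc n)"] unfolding slice_Hom
   by (auto simp: Hom_iff simp del: caug.simps)
 qed
 have c: "a \<bullet>\<^bsub>SL\<^esub> ?w k : carrier (KP (Suc n))" if k: "k <= Suc n" for k
  unfolding KP_carrier by (rule SL.comp_Hom[OF aH wH[OF k]])
 have yS: "y k : SP (Suc n)" if "k <= Suc n" for k
  unfolding y_def derP_image[symmetric] using c[OF that] by blast
 have yv: "y k (i, as) = (if (i, as) : chains I 0 then RY.cof n k i (x (i, as)) else 0)" if k: "k <= Suc n" for k i as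
 proof (cases "(i, as) : chains I 0")
  case True
  hence i: "i : Obj I" "as = []" by (auto simp: chains_0)
  have s: "sf (a \<bullet>\<^bsub>SL\<^esub> ?w k) i z = sf a i (yd (Suc n) k i z)" if z: "z : U (Yo (Suc (Suc n))) i" for z
  proof -
   have z': "z : U (fst (cP (Suc n))) i" using z unfolding cP(2) .
   show ?thesis unfolding sf_comp[OF wH[OF k] aH i(1) z'] by (simp only: sf_def yd_def fst_conv snd_conv)
  qed
  have "y k (i, as) = demb i (U (Yo (Suc (Suc n))) i) (%z. yaug (Suc n) i (yd (Suc n) k i z)) (%z. sf a i (yd (Suc n) k i z))"
   unfolding y_def derP_def prod.case if_P[OF True] by (rule demb_cong, erule yaug_Suc[OF i(1) k], erule s)
  also have "... = RY.cof n k i (x (i, as))"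
   unfolding a(2)[symmetric] derP_def prod.case if_P[OF True] RY.cof_def fstU
   using yd_in[OF i(1) k] by (auto simp: pre_def demb_def)
  finally show ?thesis using True by simp
 qed (simp add: y_def derP_def)
 have dv: "RY.dv 0 n x = (\<Sum>k\<in>{0..Suc n}. alt k (y k))"
 proof (rule ext, clarify)
  fix i as
  show "RY.dv 0 n x (i, as) = (\<Sum>k\<in>{0..Suc n}. alt k (y k)) (i, as)"
  proof (cases "(i, as) : chains I 0")
   case True
   thus ?thesis
    using yv[of _ i as] by (auto simp: RY.dv_def RY.dC_def sum_apply alt_apply atLeast0AtMost chains_0 simp del: sum.atMost_Suc intro!: sum.cong)
  next
   case False
   hence "alt k (y k (i, as)) = 0" if "k : {0..Suc n}" for k
    using yv[of k i as] that by (simp add: alt_def)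
   hence "(\<Sum>k\<in>{0..Suc n}. alt k (y k)) (i, as) = 0"
    unfolding sum_alt_apply[of y "{0..Suc n}" "(i, as)"] by (intro sum.neutral) blast
   thus ?thesis using False by (simp add: RY.dv_def)
  qed
 qed
 show "RY.dv 0 n x : SP (Suc n)"
  unfolding dv using yS subgp_alt[OF presentsD(1)[OF KP_presents]] by (intro subgp_sum[OF presentsD(1)[OF KP_presents]]) auto
 have "cm_diff DA GI A M n a = alt_sum (KP (Suc n)) {0..Suc n} (%k. a \<bullet>\<^bsub>SL\<^esub> ?w k)"
  unfolding cm_diff_def ..
 also have "... = inv_into (carrier (KP (Suc n))) (derP (Suc n)) (\<Sum>k\<in>{0..Suc n}. alt k (y k))"
 proof (rule alt_sum_presents[OF KP_presents])
  fix k assume "k : {0..Suc n}"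
  hence k: "k <= Suc n" by simp
  show "y k : SP (Suc n)" by (rule yS[OF k])
  show "a \<bullet>\<^bsub>SL\<^esub> ?w k = inv_into (carrier (KP (Suc n))) (derP (Suc n)) (y k)"
   unfolding y_def by (rule inv_into_f_f[OF derP_inj c[OF k], symmetric])
 qed simp
 finally show "cm_diff DA GI A M n (inv_into (carrier (KP n)) (derP n) x) = inv_into (carrier (KP (Suc n))) (derP (Suc n)) (RY.dv 0 n x)"
  unfolding dv a_def .
qed

lemma total_presents:
 "\<exists>f. presents {x : RY.DC.TF 0 (int n). RY.DC.Td (int n) x = 0} (RY.DC.Td (int n - 1) ` RY.DC.TF 0 (int n - 1)) f
  (cm_cohomology DA GI A M n)"
proof (rule RY.DC.total_cohomology[OF DC_exact])
 have C: "presents {x : SP n. RY.dv 0 n x = 0} (case n of 0 => {0} | Suc m => RY.dv 0 m ` SP m)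
   (%x. coboundaries KP (cm_diff DA GI A M) n #>\<^bsub>KP n\<^esub> inv_into (carrier (KP n)) (derP n) x) (cm_cohomology DA GI A M n)"
  unfolding cm_cohomology_def
  by (rule cohomology_presents(1)[where de = "RY.dv 0" and S = SP, OF KP_presents RY.dv_add KP_diff(2) RY.dv_dv KP_diff(1)])
 have Z: "{x : RY.DD 0 (int n). RY.DH 0 (int n) x = 0 & RY.DV 0 (int n) x = 0} = {x : SP n. RY.dv 0 n x = 0}"
  by (auto simp: RY.DD_def RY.DH_def RY.DV_def SP_def alt_def)
 have B: "RY.DV 0 (int n - 1) ` {x : RY.DD 0 (int n - 1). RY.DH 0 (int n - 1) x = 0} = (case n of 0 => {0} | Suc m => RY.dv 0 m ` SP m)"
  by (cases n) (auto simp: RY.DD_def RY.DH_def RY.DV_def SP_def alt_def)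
 show "presents {x : RY.DD 0 (int n). RY.DH 0 (int n) x = 0 & RY.DV 0 (int n) x = 0}
   (RY.DV 0 (int n - 1) ` {x : RY.DD 0 (int n - 1). RY.DH 0 (int n - 1) x = 0})
   (%x. coboundaries KP (cm_diff DA GI A M) n #>\<^bsub>KP n\<^esub> inv_into (carrier (KP n)) (derP n) x) (cm_cohomology DA GI A M n)"
  using C unfolding Z B .
qed

lemma spectral_sequence:
 "\<exists>E d. first_quadrant_ss E d & (\<forall>p q. E 2 (int p) (int q) = bw_cohomology I (HX q) p) & ss_converges E (cm_cohomology DA GI A M)"
proof -
 \<comment> \<open>Outside the first quadrant the subquotient is zero, and a trivial group on the
   type of Baues--Wirsching cohomology is taken.\<close>
 have "\<exists>G. \<exists>f. presents (RY.DC.Z 2 p (p + q)) (RY.DC.B 2 p (p + q)) f G &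
   (0 <= p & 0 <= q --> G = bw_cohomology I (HX (nat q)) (nat p))" for p q :: int
 proof (cases "0 <= p & 0 <= q")
  case True
  thus ?thesis using Y_second_page[of "nat p" "nat q"] by auto
 next
  case False
  have z: "RY.DC.Z 2 p (p + q) \<subseteq> RY.DC.B 2 p (p + q)" using False by (intro RY.DC.Z_trivial) auto
  have "\<exists>G. presents (RY.DC.Z 2 p (p + q)) (RY.DC.B 2 p (p + q))
    (%_. undefined :: ('i \<times> 'k list => ('u alg_hom \<times> 'u alg_hom \<times> 'u alg_hom) set) set) G"
   using subgp_diff[OF RY.DC.Z_subgp] z by (intro presents_any[OF RY.DC.Z_subgp RY.DC.B_subgp RY.DC.B_sub_Z]) auto
  thus ?thesis using False by blast
 qed
 then obtain E2 where E2: "!!p q. \<exists>f. presents (RY.DC.Z 2 p (p + q)) (RY.DC.B 2 p (p + q)) f (E2 p q)"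
  "!!p q. 0 <= p ==> 0 <= q ==> E2 p q = bw_cohomology I (HX (nat q)) (nat p)" by metis
 from RY.DC.spectral_sequence_exists[OF E2(1) total_presents]
 obtain E d where E: "first_quadrant_ss E d" "!!p q. E 2 p q = E2 p q" "ss_converges E (cm_cohomology DA GI A M)" by blast
 have "E 2 (int p) (int q) = bw_cohomology I (HX q) p" for p q using E(2) E2(2)[of "int p" "int q"] by simp
 thus ?thesis using E by blast
qed

end

theorem theorem6p9:
  fixes T :: "('u set, 'u smap) monad"
    and I :: "('i, 'k) cat"
    and A :: "('i, 'k, 'u) alg_diagram"
    and M :: "('i, 'k, 'u) alg_diagram_hom module_obj"
  assumes "regular_universe TYPE('u)"
    and "is_monad set_cat T"
    and "small_category TYPE('u) I"
    and "A \<in> Obj (DiagAlg I T)"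
    and "is_module (DiagAlg I T) A M"
  shows "(\<forall>q. is_natural_system I (cohomology_system I (Alg T) (free_comonad T) A M q)) \<and>
    (\<exists>E d. first_quadrant_ss E d \<and>
       (\<forall>p q. E 2 (int p) (int q) =
          bw_cohomology I (cohomology_system I (Alg T) (free_comonad T) A M q) p) \<and>
       ss_converges E (cm_cohomology (DiagAlg I T) (diag_comonad I T) A M))"
proof -
 interpret comparison T I A M
  by unfold_locales (fact assms)+
 show ?thesis using natural_system spectral_sequence by blast
qed

end
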